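(* Let $Y$ be a 1-ended simply connected locally finite CW complex. Assume that for each non-empty compact subset $C_0$ of $Y$ there is an infinite finitely generated group $J$ (which may depend on $C_0$) acting as cell preserving covering transformations on $Y$, so that (a) $J$ is semistable at $\infty$ in $Y$ with respect to $C_0$, and (b) $J$ is co-semistable at $\infty$ in $Y$ with respect to $C_0$. Then $Y$ has semistable fundamental group at $\infty$.
   Context: $Y$ has semistable fundamental group at $\infty$ if any two proper rays $[0,\infty)\to Y$ are properly homotopic. For $A\subseteq Y$, $J\cdot A=\bigcup_{j\in J}j(A)$. "Cell preserving" means the action permutes the cells of a locally finite cell structure on $Y$. An edge path ray is a ray that is an infinite concatenation of edges. Fix a base vertex $\ast$ of $Y$. For a finite generating set $J^0$ of $J$ let $\Lambda(J,J^0)$ be the Cayley graph, and let $z:(\Lambda(J,J^0),1)\to (Y,\ast)$ be a $J$-equivariant map sending each edge to an edge path of length at most some constant $K(J^0)$. Semistability in $Y$: for a compact $C_0\subset Y$, $J$ is semistable at $\infty$ in $Y$ with respect to $C_0$ if there exist a compact set $C$ in $Y$ and some (equivalently any) finite generating set $J^0$ for $J$ such that for any third compact set $D$ and any proper edge path rays $r$ and $s$ in $\Lambda(J,J^0)$ which are based at the same vertex $v$ and are such that $z(r)$ and $z(s)$ have image in $Y-C$, there is a path $\delta$ in $Y-D$ connecting a point of $z(r)$ to a point of $z(s)$ such that the loop determined by $\delta$ and the initial segments of $z(r)$ and $z(s)$ is homotopically trivial in $Y-C_0$. (The definition is independent of $J^0$ and $\ast$, although $C$ may change.) Co-semistability in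 $Y$: a subset $A$ of $Y$ is $J$-bounded if $A\subset J\cdot D$ for some compact $D\subset Y$, and $J$-unbounded otherwise. A proper ray $r$ in $Y$ is $J$-bounded if its image is a $J$-bounded set. Let $C_0\subset Y$ be non-empty compact and $C$ a finite subcomplex of $Y$ containing $C_0$. For a $J$-unbounded component $U$ of $Y-J\cdot C$ and a $J$-bounded proper ray $r$ with image in $U$, $J$ is co-semistable at $\infty$ in $U$ with respect to $r$ and $C_0$ if for any compact set $D$ and any loop $\alpha:[0,1]\to U$ with $\alpha(0)=\alpha(1)=r(0)$ there are $n\ge 0$ and a homotopy $H:[0,1]\times[0,n]\to Y-C_0$ such that $H(t,0)=\alpha(t)$ for all $t\in[0,1]$, $H(0,s)=H(1,s)=r(s)$ for all $s\in[0,n]$, and $H(t,n)\in Y-D$ for all $t\in[0,1]$. $J$ is co-semistable at $\infty$ in $Y$ with respect to $C_0$ if there is a finite subcomplex $C\supseteq C_0$ such that $J$ is co-semistable at $\infty$ in $U$ with respect to $r$ and $C_0$ for each $J$-unbounded component $U$ of $Y-J\cdot C$ and each proper $J$-bounded ray $r$ in $U$. *)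

theory Defs
  imports
    "HOL-Analysis.Analysis"
    "HOL-Algebra.Group_Action"
    "HOL-Algebra.Generated_Groups"
begin

definition closed_disc :: "nat \<Rightarrow> (nat \<Rightarrow> real) topology" where
  "closed_disc n = subtopology (Euclidean_space n) {x. (\<Sum>i<n. (x i)\<^sup>2) \<le> 1}"

definition open_disc :: "nat \<Rightarrow> (nat \<Rightarrow> real) topology" where
  "open_disc n = subtopology (Euclidean_space n) {x. (\<Sum>i<n. (x i)\<^sup>2) < 1}"

text \<open>
  A cell structure is given as \<open>E :: nat \<Rightarrow> 'a set set\<close>, where \<open>E n\<close> is the set of \<^emph>\<open>open\<close> \<open>n\<close>-cells;
  the \<open>0\<close>-cells are the singletons of vertices.
\<close>

definition cells :: "(nat \<Rightarrow> 'a set set) \<Rightarrow> 'a set set" where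
  "cells E = (\<Union>n. E n)"

definition characteristic_map ::
    "'a::t2_space set \<Rightarrow> (nat \<Rightarrow> 'a set set) \<Rightarrow> nat \<Rightarrow> 'a set \<Rightarrow> ((nat \<Rightarrow> real) \<Rightarrow> 'a) \<Rightarrow> bool" where
  "characteristic_map Y E n e \<Phi> \<longleftrightarrow>
     continuous_map (closed_disc n) (top_of_set Y) \<Phi> \<and>
     homeomorphic_map (open_disc n) (top_of_set e) \<Phi> \<and>
     (\<exists>F. finite F \<and> F \<subseteq> (\<Union>m<n. E m) \<and>
          \<Phi> ` (topspace (closed_disc n) - topspace (open_disc n)) \<subseteq> \<Union>F)"

text \<open>
  The Hausdorff axiom is supplied by the type class. By the existence of characteristic maps,
  the closure of a cell in the ambient type is compact and contained in \<open>Y\<close>, so it coincides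
  with the closure relative to \<open>Y\<close>.
\<close>

definition CW_structure :: "'a::t2_space set \<Rightarrow> (nat \<Rightarrow> 'a set set) \<Rightarrow> bool" where
  "CW_structure Y E \<longleftrightarrow>
     \<Union>(cells E) = Y \<and>
     (\<forall>m n. \<forall>e\<in>E m. \<forall>f\<in>E n. (m, e) \<noteq> (n, f) \<longrightarrow> e \<inter> f = {}) \<and>
     (\<forall>n. \<forall>e\<in>E n. \<exists>\<Phi>. characteristic_map Y E n e \<Phi>) \<and>
     (\<forall>A\<subseteq>Y. (\<forall>e\<in>cells E. closedin (top_of_set Y) (A \<inter> closure e)) \<longrightarrow> closedin (top_of_set Y) A)"

definition locally_finite_CW_structure :: "'a::t2_space set \<Rightarrow> (nat \<Rightarrow> 'a set set) \<Rightarrow> bool" where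
  "locally_finite_CW_structure Y E \<longleftrightarrow>
     CW_structure Y E \<and>
     (\<forall>y\<in>Y. \<exists>U. openin (top_of_set Y) U \<and> y \<in> U \<and> finite {e \<in> cells E. e \<inter> U \<noteq> {}})"

definition locally_finite_CW_complex :: "'a::t2_space set \<Rightarrow> bool" where
  "locally_finite_CW_complex Y \<longleftrightarrow> (\<exists>E. locally_finite_CW_structure Y E)"

definition finite_subcomplex :: "(nat \<Rightarrow> 'a::t2_space set set) \<Rightarrow> 'a set \<Rightarrow> bool" where
  "finite_subcomplex E C \<longleftrightarrow>
     (\<exists>F. finite F \<and> F \<subseteq> cells E \<and> C = \<Union>F \<and> (\<forall>e\<in>F. closure e \<subseteq> C))"

definition vertices :: "(nat \<Rightarrow> 'a set set) \<Rightarrow> 'a set" where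
  "vertices E = \<Union>(E 0)"

definition edge_traversal :: "(nat \<Rightarrow> 'a::t2_space set set) \<Rightarrow> (real \<Rightarrow> 'a) \<Rightarrow> bool" where
  "edge_traversal E p \<longleftrightarrow>
     path p \<and> pathstart p \<in> vertices E \<and> pathfinish p \<in> vertices E \<and>
     (\<exists>e\<in>E 1. homeomorphic_map (top_of_set {0<..<1}) (top_of_set e) p)"

inductive edge_path :: "(nat \<Rightarrow> 'a::t2_space set set) \<Rightarrow> nat \<Rightarrow> (real \<Rightarrow> 'a) \<Rightarrow> bool"
  for E where
  trivial: "v \<in> vertices E \<Longrightarrow> edge_path E 0 (\<lambda>t. v)"
| edge: "edge_traversal E p \<Longrightarrow> edge_path E 1 p"
| join: "edge_path E k p \<Longrightarrow> edge_path E l q \<Longrightarrow> pathfinish p = pathstart q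
         \<Longrightarrow> edge_path E (k + l) (p +++ q)"

text \<open>
  Proper maps are continuous maps that are proper in the sense of \<^const>\<open>proper_map\<close>
  (closed with compact fibres). As a locally finite CW complex is locally compact and Hausdorff,
  for continuous maps into it this says that preimages of compact sets are compact.
\<close>

definition proper_ray :: "'a::t2_space set \<Rightarrow> (real \<Rightarrow> 'a) \<Rightarrow> bool" where
  "proper_ray Y r \<longleftrightarrow>
     continuous_map (top_of_set {0..}) (top_of_set Y) r \<and>
     proper_map (top_of_set {0..}) (top_of_set Y) r"

definition properly_homotopic_rays ::
    "'a::t2_space set \<Rightarrow> (real \<Rightarrow> 'a) \<Rightarrow> (real \<Rightarrow> 'a) \<Rightarrow> bool" where
  "properly_homotopic_rays Y r s \<longleftrightarrow>
     (\<exists>H :: real \<times> real \<Rightarrow> 'a.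
        continuous_map (top_of_set ({0..} \<times> {0..1})) (top_of_set Y) H \<and>
        proper_map (top_of_set ({0..} \<times> {0..1})) (top_of_set Y) H \<and>
        (\<forall>t\<ge>0. H (t, 0) = r t \<and> H (t, 1) = s t))"

definition semistable_fundamental_group_at_infinity :: "'a::t2_space set \<Rightarrow> bool" where
  "semistable_fundamental_group_at_infinity Y \<longleftrightarrow>
     (\<forall>r s. proper_ray Y r \<and> proper_ray Y s \<longrightarrow> properly_homotopic_rays Y r s)"

definition one_ended :: "'a::t2_space set \<Rightarrow> bool" where
  "one_ended Y \<longleftrightarrow>
     (\<forall>C. compact C \<and> C \<subseteq> Y \<longrightarrow>
        (\<exists>!U. U \<in> components (Y - C) \<and> \<not> (\<exists>K. compact K \<and> K \<subseteq> Y \<and> U \<subseteq> K)))"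

definition finite_generating_set :: "('g, 'm) monoid_scheme \<Rightarrow> 'g set \<Rightarrow> bool" where
  "finite_generating_set J S \<longleftrightarrow> finite S \<and> S \<subseteq> carrier J \<and> generate J S = carrier J"

definition infinite_fg_group :: "('g, 'm) monoid_scheme \<Rightarrow> bool" where
  "infinite_fg_group J \<longleftrightarrow>
     group J \<and> infinite (carrier J) \<and> (\<exists>S. finite_generating_set J S)"

text \<open>
  The last clause is the usual covering space action condition: the orbit projection is a covering
  map, and \<open>J\<close> acts faithfully as a group of deck transformations of it.
\<close>

definition acts_by_covering_transformations ::
    "('g, 'm) monoid_scheme \<Rightarrow> ('g \<Rightarrow> 'a \<Rightarrow> 'a) \<Rightarrow> 'a::t2_space set \<Rightarrow> bool" where
  "acts_by_covering_transformations J \<phi> Y \<longleftrightarrow>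
     group_action J Y \<phi> \<and>
     (\<forall>g\<in>carrier J. homeomorphic_map (top_of_set Y) (top_of_set Y) (\<phi> g)) \<and>
     (\<forall>y\<in>Y. \<exists>U. openin (top_of_set Y) U \<and> y \<in> U \<and>
        (\<forall>g\<in>carrier J. g \<noteq> \<one>\<^bsub>J\<^esub> \<longrightarrow> \<phi> g ` U \<inter> U = {}))"

definition cell_preserving ::
    "('g, 'm) monoid_scheme \<Rightarrow> ('g \<Rightarrow> 'a \<Rightarrow> 'a) \<Rightarrow> (nat \<Rightarrow> 'a set set) \<Rightarrow> bool" where
  "cell_preserving J \<phi> E \<longleftrightarrow> (\<forall>g\<in>carrier J. \<forall>n. \<forall>e\<in>E n. \<phi> g ` e \<in> E n)"

definition translates ::
    "('g, 'm) monoid_scheme \<Rightarrow> ('g \<Rightarrow> 'a \<Rightarrow> 'a) \<Rightarrow> 'a set \<Rightarrow> 'a set" where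
  "translates J \<phi> A = (\<Union>g\<in>carrier J. \<phi> g ` A)"

text \<open>
  The Cayley graph has vertex set \<open>carrier J\<close> and, for \<open>g\<close> in \<open>J\<close> and \<open>s\<close> in the generating set \<open>S\<close>,
  an edge \<open>(g, s)\<close> from \<open>g\<close> to \<open>gs\<close> (so a generator of order two gives two edges between \<open>g\<close> and \<open>gs\<close>);
  \<open>J\<close> acts by left multiplication. An oriented edge is a triple \<open>(g, s, b)\<close>, traversed
  from \<open>g\<close> to \<open>gs\<close> if \<open>b\<close> holds, and from \<open>gs\<close> to \<open>g\<close> otherwise.
\<close>

fun cayley_source :: "('g, 'm) monoid_scheme \<Rightarrow> 'g \<times> 'g \<times> bool \<Rightarrow> 'g" where
  "cayley_source J (g, s, b) = (if b then g else g \<otimes>\<^bsub>J\<^esub> s)"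

fun cayley_target :: "('g, 'm) monoid_scheme \<Rightarrow> 'g \<times> 'g \<times> bool \<Rightarrow> 'g" where
  "cayley_target J (g, s, b) = (if b then g \<otimes>\<^bsub>J\<^esub> s else g)"

text \<open>
  As \<open>S\<close> is finite, the Cayley graph is locally finite, so an edge path ray in it is proper
  iff it passes through each vertex only finitely often.
\<close>

definition proper_cayley_ray ::
    "('g, 'm) monoid_scheme \<Rightarrow> 'g set \<Rightarrow> (nat \<Rightarrow> 'g \<times> 'g \<times> bool) \<Rightarrow> bool" where
  "proper_cayley_ray J S r \<longleftrightarrow>
     range r \<subseteq> carrier J \<times> S \<times> UNIV \<and>
     (\<forall>i. cayley_target J (r i) = cayley_source J (r (Suc i))) \<and>
     (\<forall>v\<in>carrier J. finite {i. cayley_source J (r i) = v})"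

text \<open>
  An equivariant map \<open>z\<close> from the Cayley graph to \<open>Y\<close> taking the vertex \<open>1\<close> to the base vertex \<open>base\<close>
  is given by its restrictions \<open>z g s\<close>, parametrized by \<open>{0..1}\<close>, to the edges \<open>(g, s)\<close>.
  It takes the vertex \<open>g\<close> to \<open>\<phi> g base\<close>.
\<close>

definition cayley_map ::
    "('g, 'm) monoid_scheme \<Rightarrow> ('g \<Rightarrow> 'a \<Rightarrow> 'a) \<Rightarrow> (nat \<Rightarrow> 'a::t2_space set set) \<Rightarrow> 'g set \<Rightarrow> 'a
       \<Rightarrow> ('g \<Rightarrow> 'g \<Rightarrow> real \<Rightarrow> 'a) \<Rightarrow> bool" where
  "cayley_map J \<phi> E S base z \<longleftrightarrow>
     (\<forall>g\<in>carrier J. \<forall>s\<in>S.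
        pathstart (z g s) = \<phi> g base \<and> pathfinish (z g s) = \<phi> (g \<otimes>\<^bsub>J\<^esub> s) base) \<and>
     (\<forall>h\<in>carrier J. \<forall>g\<in>carrier J. \<forall>s\<in>S. \<forall>t\<in>{0..1}. z (h \<otimes>\<^bsub>J\<^esub> g) s t = \<phi> h (z g s t)) \<and>
     (\<exists>K. \<forall>g\<in>carrier J. \<forall>s\<in>S. \<exists>k\<le>K. edge_path E k (z g s))"

fun oriented_edge_image ::
    "('g \<Rightarrow> 'g \<Rightarrow> real \<Rightarrow> 'a::t2_space) \<Rightarrow> 'g \<times> 'g \<times> bool \<Rightarrow> real \<Rightarrow> 'a" where
  "oriented_edge_image z (g, s, b) = (if b then z g s else reversepath (z g s))"

text \<open>The ray \<open>z(r)\<close>: the \<open>i\<close>-th edge of \<open>r\<close> is traversed on the interval from \<open>i\<close> to \<open>i + 1\<close>.\<close>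

definition ray_image ::
    "('g \<Rightarrow> 'g \<Rightarrow> real \<Rightarrow> 'a::t2_space) \<Rightarrow> (nat \<Rightarrow> 'g \<times> 'g \<times> bool) \<Rightarrow> real \<Rightarrow> 'a" where
  "ray_image z r t = oriented_edge_image z (r (nat \<lfloor>t\<rfloor>)) (frac t)"

definition initial_segment :: "(real \<Rightarrow> 'a) \<Rightarrow> real \<Rightarrow> real \<Rightarrow> 'a" where
  "initial_segment r a = (\<lambda>t. r (a * t))"

definition semistable_in ::
    "('g, 'm) monoid_scheme \<Rightarrow> ('g \<Rightarrow> 'a \<Rightarrow> 'a) \<Rightarrow> 'a::t2_space set \<Rightarrow> (nat \<Rightarrow> 'a set set)
       \<Rightarrow> 'a set \<Rightarrow> bool" where
  "semistable_in J \<phi> Y E C\<^sub>0 \<longleftrightarrow>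
     (\<exists>base S z C.
        base \<in> vertices E \<and> finite_generating_set J S \<and> cayley_map J \<phi> E S base z \<and>
        compact C \<and> C \<subseteq> Y \<and>
        (\<forall>D r s.
           compact D \<and> D \<subseteq> Y \<and>
           proper_cayley_ray J S r \<and> proper_cayley_ray J S s \<and>
           cayley_source J (r 0) = cayley_source J (s 0) \<and>
           ray_image z r ` {0..} \<subseteq> Y - C \<and> ray_image z s ` {0..} \<subseteq> Y - C \<longrightarrow>
           (\<exists>a b \<delta>.
              0 \<le> a \<and> 0 \<le> b \<and> path \<delta> \<and> path_image \<delta> \<subseteq> Y - D \<and>
              pathstart \<delta> = ray_image z r a \<and> pathfinish \<delta> = ray_image z s b \<and>
              homotopic_paths (Y - C\<^sub>0)
                (initial_segment (ray_image z r) a +++ \<delta> +++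
                   reversepath (initial_segment (ray_image z s) b))
                (\<lambda>t. ray_image z r 0))))"

definition J_bounded ::
    "('g, 'm) monoid_scheme \<Rightarrow> ('g \<Rightarrow> 'a \<Rightarrow> 'a) \<Rightarrow> 'a::t2_space set \<Rightarrow> 'a set \<Rightarrow> bool" where
  "J_bounded J \<phi> Y A \<longleftrightarrow> (\<exists>D. compact D \<and> D \<subseteq> Y \<and> A \<subseteq> translates J \<phi> D)"

definition co_semistable_wrt_ray ::
    "'a::t2_space set \<Rightarrow> 'a set \<Rightarrow> (real \<Rightarrow> 'a) \<Rightarrow> 'a set \<Rightarrow> bool" where
  "co_semistable_wrt_ray Y U r C\<^sub>0 \<longleftrightarrow>
     (\<forall>D \<alpha>.
        compact D \<and> D \<subseteq> Y \<and>
        path \<alpha> \<and> path_image \<alpha> \<subseteq> U \<and> pathstart \<alpha> = r 0 \<and> pathfinish \<alpha> = r 0 \<longrightarrow>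
        (\<exists>n \<ge> 0 :: real. \<exists>H :: real \<times> real \<Rightarrow> 'a.
           continuous_on ({0..1} \<times> {0..n}) H \<and> H ` ({0..1} \<times> {0..n}) \<subseteq> Y - C\<^sub>0 \<and>
           (\<forall>t\<in>{0..1}. H (t, 0) = \<alpha> t) \<and>
           (\<forall>s\<in>{0..n}. H (0, s) = r s \<and> H (1, s) = r s) \<and>
           (\<forall>t\<in>{0..1}. H (t, n) \<in> Y - D)))"

definition co_semistable_in ::
    "('g, 'm) monoid_scheme \<Rightarrow> ('g \<Rightarrow> 'a \<Rightarrow> 'a) \<Rightarrow> 'a::t2_space set \<Rightarrow> (nat \<Rightarrow> 'a set set)
       \<Rightarrow> 'a set \<Rightarrow> bool" where
  "co_semistable_in J \<phi> Y E C\<^sub>0 \<longleftrightarrow>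
     (\<exists>C. finite_subcomplex E C \<and> C\<^sub>0 \<subseteq> C \<and>
        (\<forall>U r.
           U \<in> components (Y - translates J \<phi> C) \<and> \<not> J_bounded J \<phi> Y U \<and>
           proper_ray Y r \<and> r ` {0..} \<subseteq> U \<and> J_bounded J \<phi> Y (r ` {0..}) \<longrightarrow>
           co_semistable_wrt_ray Y U r C\<^sub>0))"

end

theory Submission
  imports Defs
begin

text \<open>A proper homotopy between two rays is a ladder: far out along the rays there are paths from one ray to
the other (the rungs), and the squares between consecutive rungs avoid larger and larger compact sets.
So it suffices to find, for each compact \<open>C0\<close>, a compact \<open>D\<close> such that a rung off \<open>D\<close> between rays off
\<open>D\<close> can be pushed along the rays out of any compact set \<open>F\<close>, by a homotopy off \<open>C0\<close>
(\<open>pushes\<close>, \<open>semistable_of_pushes\<close>). The point is that \<open>D\<close> may not depend on \<open>F\<close>.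

Let \<open>J\<close> be the group that belongs to \<open>C0\<close>. For a target \<open>F\<close>, consider paths off \<open>C0\<close> from a point to
points outside \<open>F\<close>, where two paths count as equal if they differ by a path outside \<open>F\<close>
(\<open>eqv\<close>). At a point \<open>p\<close> near the orbit of the base point there is a distinguished class: run from \<open>p\<close>
to the orbit and along the image of a Cayley ray. By semistability of \<open>J\<close> the class does not depend on
the Cayley ray (\<open>semi_eqv\<close>, \<open>reach_unique\<close>). A path \<open>\<gamma>\<close> from \<open>p\<close> to \<open>q\<close> transports if
following \<open>\<gamma>\<close> and then the class of \<open>q\<close> gives the class of \<open>p\<close>. Far away from \<open>F\<close> the class is that
of the constant path (\<open>reach_const_far\<close>); hence a loop at such a point that transports is
homotopic to a loop outside \<open>F\<close>. Applied to the loop formed by a rung, the two rays and paths that join the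
rays to a far orbit point, this pushes the rung out of \<open>F\<close> (\<open>far_collar_pushes\<close>).

It remains to find a compact \<open>D\<close>, for all \<open>F\<close> at once, such that all paths off \<open>D\<close> between points near the
orbit transport (\<open>transports_outside\<close>). Such a path is cut into pieces near the orbit and
pieces in the complement of the orbit of a compact set.

The pieces near the orbit are cut again into short pieces,
each of which is a translate of a path in one fixed compact set (\<open>transports_near_orbit\<close>). It can be compared there with one of
finitely many edge paths, since all loops in a compact set contract in a common compact set
(\<open>loops_bounded\<close>), and all but finitely many translates of that set avoid a given compact set.

A piece in the complement lies in a component \<open>U\<close>. If \<open>U\<close> is \<open>J\<close>-bounded, it is near the orbit.
Otherwise consider the collar of \<open>U\<close>, its intersection with a neighbourhood of the orbit. The collar is
connected, because in a simply connected space two connected open sets that cover the space have a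
connected intersection (\<open>simply_connected_unicoherent_open\<close>). It is tiled by translates of finitely
many sets, and the nerve of the tiling is a connected locally finite graph. The graph is infinite, as \<open>Y\<close> has one end;
hence it contains rays, which give \<open>J\<close>-bounded proper rays in \<open>U\<close> (\<open>bounded_ray\<close>). Co-semistability
along these shows that all loops in \<open>U\<close> at points of the collar transport (\<open>loop_transports\<close>).
So a path in \<open>U\<close> transports if a single other path in \<open>U\<close> with the same end points does. If the end points lie in the same
part of the collar off the exceptional set of the previous step, there is a path within the collar. There are only
finitely many pairs of distinct parts. For each pair, either some compact set meets all paths in \<open>U\<close>
from one part to the other, and it is added to \<open>D\<close>; or there is such a path off any compact set,
and a path far away from \<open>F\<close> transports because it connects points whose classes are constant
(\<open>crossing_transports\<close>).\<close>

section \<open>Homotopies of paths in a topological space\<close>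

text \<open>Homotopies of paths below are images of straight line homotopies in a segment or a rectangle.\<close>

lemma homotopic_paths_of_convex_domain:
  fixes f :: "'b::real_normed_vector \<Rightarrow> 'a::topological_space"
  assumes "continuous_on T f" "convex T" "f ` T \<subseteq> S"
    and "path g" "path k" "path_image g \<subseteq> T" "path_image k \<subseteq> T"
    and "pathstart k = pathstart g" "pathfinish k = pathfinish g"
  shows "homotopic_paths S (f \<circ> g) (f \<circ> k)"
proof (rule homotopic_paths_continuous_image)
  show "homotopic_paths T g k"
  proof (rule homotopic_paths_linear)
    fix t :: real assume "t \<in> {0..1}"
    then have "g t \<in> T" "k t \<in> T" using assms by (auto simp: path_image_def)
    then show "closed_segment (g t) (k t) \<subseteq> T"
      using \<open>convex T\<close> closed_segment_subset by blast
  qed (use assms in auto)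
qed (use assms in auto)

definition path_in :: "'a::topological_space set \<Rightarrow> (real \<Rightarrow> 'a) \<Rightarrow> 'a \<Rightarrow> 'a \<Rightarrow> bool" where
  "path_in S p x y \<longleftrightarrow> path p \<and> path_image p \<subseteq> S \<and> pathstart p = x \<and> pathfinish p = y"

lemma path_in_join: "path_in S p x y \<Longrightarrow> path_in S q y z \<Longrightarrow> path_in S (p +++ q) x z"
  by (auto simp: path_in_def path_image_join)

lemma path_in_rev: "path_in S p x y \<Longrightarrow> path_in S (reversepath p) y x"
  by (auto simp: path_in_def)

lemma path_in_const: "x \<in> S \<Longrightarrow> path_in S (\<lambda>_. x) x x"
  by (auto simp: path_in_def path_def path_image_def pathstart_def pathfinish_def)

lemma path_in_mono: "path_in S p x y \<Longrightarrow> S \<subseteq> T \<Longrightarrow> path_in T p x y"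
  by (auto simp: path_in_def)

lemma path_in_hom: "homotopic_paths S p q \<Longrightarrow> path_in S p x y \<Longrightarrow> path_in S q x y"
  using homotopic_paths_imp_path[of S p q] homotopic_paths_imp_subset[of S p q]
    homotopic_paths_imp_pathstart[of S p q] homotopic_paths_imp_pathfinish[of S p q]
  by (auto simp: path_in_def)

lemma path_in_ends: "path_in S p x y \<Longrightarrow> x \<in> S \<and> y \<in> S"
  by (auto simp: path_in_def pathstart_in_path_image pathfinish_in_path_image subset_iff)

lemma path_in_refl: "path_in S p x y \<Longrightarrow> homotopic_paths S p p"
  by (simp add: path_in_def)

lemma hom_join: "homotopic_paths S p p' \<Longrightarrow> homotopic_paths S q q' \<Longrightarrow> path_in S p x y \<Longrightarrow> path_in S q y z
   \<Longrightarrow> homotopic_paths S (p +++ q) (p' +++ q')"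
  by (rule homotopic_paths_join) (auto simp: path_in_def)

lemma hom_join_left: "homotopic_paths S q q' \<Longrightarrow> path_in S p x y \<Longrightarrow> path_in S q y z
   \<Longrightarrow> homotopic_paths S (p +++ q) (p +++ q')"
  by (rule homotopic_paths_join) (auto simp: path_in_def)

lemma hom_join_right: "homotopic_paths S p p' \<Longrightarrow> path_in S p x y \<Longrightarrow> path_in S q y z
   \<Longrightarrow> homotopic_paths S (p +++ q) (p' +++ q)"
  by (rule homotopic_paths_join) (auto simp: path_in_def)

lemma hom_assoc: "path_in S p x y \<Longrightarrow> path_in S q y z \<Longrightarrow> path_in S r z w
   \<Longrightarrow> homotopic_paths S (p +++ (q +++ r)) ((p +++ q) +++ r)"
  by (rule homotopic_paths_assoc) (auto simp: path_in_def)

lemma hom_assoc': "path_in S p x y \<Longrightarrow> path_in S q y z \<Longrightarrow> path_in S r z w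
   \<Longrightarrow> homotopic_paths S ((p +++ q) +++ r) (p +++ (q +++ r))"
  using hom_assoc homotopic_paths_sym by blast

text \<open>A path is the image of the segment \<open>linepath 0 1\<close>, so the unit and inverse laws hold because
  they hold in an interval.\<close>

lemma hom_rid: 
  assumes "path_in S p x y" shows "homotopic_paths S (p +++ (\<lambda>_. y)) p"
proof -
  have "homotopic_paths S (p \<circ> (linepath 0 1 +++ linepath 1 1)) (p \<circ> linepath 0 (1::real))"
    by (rule homotopic_paths_of_convex_domain[where T="{0..1}"])
      (use assms in \<open>auto simp: path_in_def path_def[of p] path_image_def[of p] path_image_join closed_segment_eq_real_ivl\<close>)
  moreover have "p \<circ> linepath 0 1 = p" by (auto simp: linepath_def)
  moreover have "p \<circ> linepath 1 1 = (\<lambda>_. y)" using assms by (auto simp: linepath_def path_in_def pathfinish_def)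
  ultimately show ?thesis by (simp add: path_compose_join)
qed

lemma hom_rinv: 
  assumes "path_in S p x y" shows "homotopic_paths S (p +++ reversepath p) (\<lambda>_. x)"
proof -
  have "homotopic_paths S (p \<circ> (linepath 0 1 +++ linepath 1 0)) (p \<circ> linepath 0 (0::real))"
    by (rule homotopic_paths_of_convex_domain[where T="{0..1}"])
      (use assms in \<open>auto simp: path_in_def path_def[of p] path_image_def[of p] path_image_join closed_segment_eq_real_ivl\<close>)
  moreover have "p \<circ> linepath 0 1 = p" by (auto simp: linepath_def)
  moreover have "p \<circ> linepath 1 0 = reversepath p" by (auto simp: linepath_def reversepath_def)
  moreover have "p \<circ> linepath 0 0 = (\<lambda>_. x)" using assms by (auto simp: linepath_def path_in_def pathstart_def)
  ultimately show ?thesis by (simp add: path_compose_join)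
qed

lemma hom_lid: 
  assumes "path_in S p x y" shows "homotopic_paths S ((\<lambda>_. x) +++ p) p"
proof -
  have "homotopic_paths S (p \<circ> (linepath 0 0 +++ linepath 0 1)) (p \<circ> linepath 0 (1::real))"
    by (rule homotopic_paths_of_convex_domain[where T="{0..1}"])
      (use assms in \<open>auto simp: path_in_def path_def[of p] path_image_def[of p] path_image_join closed_segment_eq_real_ivl\<close>)
  moreover have "p \<circ> linepath 0 1 = p" by (auto simp: linepath_def)
  moreover have "p \<circ> linepath 0 0 = (\<lambda>_. x)" using assms by (auto simp: linepath_def path_in_def pathstart_def)
  ultimately show ?thesis by (simp add: path_compose_join)
qed

lemma hom_linv: 
  assumes "path_in S p x y" shows "homotopic_paths S (reversepath p +++ p) (\<lambda>_. y)"
  using hom_rinv[OF path_in_rev[OF assms]] by simp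

lemma hom_cancel_left:
  assumes "path_in S p x y" "path_in S q y z"
  shows "homotopic_paths S (reversepath p +++ (p +++ q)) q"
  using hom_assoc[OF path_in_rev[OF assms(1)] assms]
    hom_join_right[OF hom_linv[OF assms(1)] path_in_join[OF path_in_rev[OF assms(1)] assms(1)] assms(2)]
    hom_lid[OF assms(2)]
  by (meson homotopic_paths_trans)

lemma hom_cancel_right:
  assumes "path_in S p x y" "path_in S q y z"
  shows "homotopic_paths S ((p +++ q) +++ reversepath q) p"
  using hom_assoc'[OF assms path_in_rev[OF assms(2)]]
    hom_join_left[OF hom_rinv[OF assms(2)] assms(1) path_in_join[OF assms(2) path_in_rev[OF assms(2)]]]
    hom_rid[OF assms(1)]
  by (meson homotopic_paths_trans)

lemma hom_cancel_left':
  assumes "path_in S p x y" "path_in S q x z"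
  shows "homotopic_paths S (p +++ (reversepath p +++ q)) q"
  using hom_cancel_left[OF path_in_rev[OF assms(1)] assms(2)] by simp

lemma hom_cancel_right':
  assumes "path_in S p x y" "path_in S q z y"
  shows "homotopic_paths S ((p +++ reversepath q) +++ q) p"
  using hom_cancel_right[OF assms(1) path_in_rev[OF assms(2)]] by simp

lemma hom_of_loop:
  assumes "path_in S p x y" "path_in S q x y" "homotopic_paths S (p +++ reversepath q) (\<lambda>_. x)"
  shows "homotopic_paths S p q"
proof -
  have "homotopic_paths S p ((p +++ reversepath q) +++ q)"
    using hom_cancel_right'[OF assms(1,2)] homotopic_paths_sym by blast
  also have "homotopic_paths S \<dots> ((\<lambda>_. x) +++ q)"
    by (rule hom_join_right[OF assms(3) path_in_join[OF assms(1) path_in_rev[OF assms(2)]] assms(2)])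
  also have "homotopic_paths S \<dots> q" by (rule hom_lid[OF assms(2)])
  finally show ?thesis .
qed

definition piece :: "real \<Rightarrow> real \<Rightarrow> (real \<Rightarrow> 'a::topological_space) \<Rightarrow> real \<Rightarrow> 'a" where
  "piece a b f = f \<circ> linepath a b"

lemma path_in_piece:
  assumes "continuous_on T f" "convex T" "a \<in> T" "b \<in> T" "f ` T \<subseteq> S"
  shows "path_in S (piece a b f) (f a) (f b)"
proof -
  have seg: "piece a b f = f \<circ> linepath a b"
    by (simp add: piece_def)
  have sub: "closed_segment a b \<subseteq> T" using assms closed_segment_subset by blast
  have "path (f \<circ> linepath a b)"
    by (rule path_continuous_image) (use sub continuous_on_subset[OF assms(1)] in auto)
  moreover have "path_image (f \<circ> linepath a b) \<subseteq> S"
    using sub assms(5) by (auto simp: path_image_compose)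
  ultimately show ?thesis
    unfolding path_in_def seg by (auto simp: pathstart_compose pathfinish_compose)
qed

lemma hom_piece_join:
  fixes f :: "real \<Rightarrow> 'a::topological_space"
  assumes "continuous_on T f" "convex T" "a \<in> T" "b \<in> T" "c \<in> T" "f ` T \<subseteq> S"
  shows "homotopic_paths S (piece a b f +++ piece b c f) (piece a c f)"
proof -
  have seg: "piece a b f = f \<circ> linepath a b" for a b
    by (simp add: piece_def)
  have sub: "closed_segment a b \<subseteq> T" if "a \<in> T" "b \<in> T" for a b
    using that assms closed_segment_subset by blast
  have "homotopic_paths S (f \<circ> (linepath a b +++ linepath b c)) (f \<circ> linepath a c)"
    by (rule homotopic_paths_of_convex_domain[where T=T])
      (use assms sub in \<open>auto simp: path_image_join\<close>)
  then show ?thesis by (simp add: seg path_compose_join)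
qed

lemma initial_segment_eq_piece: "initial_segment r a = piece 0 a r"
  by (auto simp: initial_segment_def piece_def linepath_def mult.commute)

text \<open>The two ways around a rectangle are homotopic in the rectangle.\<close>

lemma hom_rectangle:
  fixes H :: "real \<times> real \<Rightarrow> 'a::topological_space"
  assumes "continuous_on ({a..b} \<times> {c..d}) H" "H ` ({a..b} \<times> {c..d}) \<subseteq> S" "a \<le> b" "c \<le> d"
  shows "homotopic_paths S (piece a b (\<lambda>t. H (t,c)) +++ piece c d (\<lambda>u. H (b,u)))
                           (piece c d (\<lambda>u. H (a,u)) +++ piece a b (\<lambda>t. H (t,d)))"
proof -
  have h: "piece a b (\<lambda>t. H (t,k)) = H \<circ> linepath (a,k) (b,k)" for a b k
    by (auto simp: piece_def linepath_def fun_eq_iff algebra_simps)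
  have v: "piece a b (\<lambda>t. H (k,t)) = H \<circ> linepath (k,a) (k,b)" for a b k
    by (auto simp: piece_def linepath_def fun_eq_iff algebra_simps)
  let ?T = "{a..b} \<times> {c..d}"
  have sub: "closed_segment x y \<subseteq> ?T" if "x \<in> ?T" "y \<in> ?T" for x y
    using that by (intro closed_segment_subset convex_Times convex_closed_interval) auto
  have "convex ?T" by (intro convex_Times) auto
  then have "homotopic_paths S (H \<circ> (linepath (a,c) (b,c) +++ linepath (b,c) (b,d)))
          (H \<circ> (linepath (a,c) (a,d) +++ linepath (a,d) (b,d)))"
  proof (rule homotopic_paths_of_convex_domain[OF assms(1) _ assms(2)])
    have "closed_segment (a,c) (b,c) \<subseteq> ?T" "closed_segment (b,c) (b,d) \<subseteq> ?T"
      "closed_segment (a,c) (a,d) \<subseteq> ?T" "closed_segment (a,d) (b,d) \<subseteq> ?T"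
      using assms(3,4) by (intro sub; simp)+
    then show "path_image (linepath (a,c) (b,c) +++ linepath (b,c) (b,d)) \<subseteq> ?T"
      "path_image (linepath (a,c) (a,d) +++ linepath (a,d) (b,d)) \<subseteq> ?T"
      by (simp_all add: path_image_join)
  qed simp_all
  then show ?thesis by (simp add: h v path_compose_join)
qed

lemma piece_01 [simp]: "piece 0 1 f = f"
  by (auto simp: piece_def linepath_def)

text \<open>In a free homotopy the base point travels along a path \<open>\<sigma>\<close>, so \<open>p\<close> is conjugate by \<open>\<sigma>\<close> to a constant path.\<close>

lemma hom_null_of_homotopic_loops:
  assumes "homotopic_loops S p (\<lambda>_. a)"
  shows "homotopic_paths S p (\<lambda>_. pathstart p)"
proof -
  obtain h where h: "continuous_on ({0..1::real} \<times> {0..1::real}) h" "h ` ({0..1} \<times> {0..1}) \<subseteq> S"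
     "\<And>x. x \<in> {0..1} \<Longrightarrow> h (0,x) = p x" "\<And>x. x \<in> {0..1} \<Longrightarrow> h (1,x) = a"
     "\<And>t. t \<in> {0..1} \<Longrightarrow> h (t,1) = h (t,0)"
    using assms by (auto simp: homotopic_loops pathstart_def pathfinish_def image_subset_iff_funcset)
  have p: "path_in S p (p 0) (p 0)"
    using homotopic_loops_imp_path[OF assms] homotopic_loops_imp_loop[OF assms] homotopic_loops_imp_subset[OF assms]
    by (auto simp: path_in_def pathstart_def pathfinish_def)
  define \<sigma> where "\<sigma> = (\<lambda>t. h (t,0))"
  have \<sigma>: "path_in S \<sigma> (p 0) a"
  proof -
    have "continuous_on {0..1} \<sigma>"
      unfolding \<sigma>_def by (auto intro!: continuous_on_compose2[OF h(1)] continuous_intros)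
    moreover have "\<sigma> ` {0..1} \<subseteq> S" "\<sigma> 0 = p 0" "\<sigma> 1 = a" using h(2-4) by (auto simp: \<sigma>_def)
    ultimately show ?thesis by (auto simp: path_in_def path_def path_image_def pathstart_def pathfinish_def)
  qed
  have top: "homotopic_paths S (\<lambda>t. h (t,1)) \<sigma>"
    by (rule homotopic_paths_sym, rule homotopic_paths_eq) (use \<sigma> h in \<open>auto simp: path_in_def \<sigma>_def\<close>)
  have right: "homotopic_paths S (\<lambda>t. h (1,t)) (\<lambda>_. a)"
    by (rule homotopic_paths_sym, rule homotopic_paths_eq) (use path_in_const[of a S] path_in_ends[OF \<sigma>] h in \<open>auto simp: path_in_def\<close>)
  have left: "homotopic_paths S (\<lambda>t. h (0,t)) p"
    by (rule homotopic_paths_sym, rule homotopic_paths_eq) (use p h in \<open>auto simp: path_in_def\<close>)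
  have a: "path_in S (\<lambda>_. a) a a" using path_in_ends[OF \<sigma>] by (simp add: path_in_const)
  have "homotopic_paths S (\<sigma> +++ (\<lambda>t. h (1,t))) ((\<lambda>u. h (0,u)) +++ (\<lambda>t. h (t,1)))"
    using hom_rectangle[OF h(1,2)] by (simp add: \<sigma>_def)
  moreover have "homotopic_paths S (\<sigma> +++ (\<lambda>_. a)) (\<sigma> +++ (\<lambda>t. h (1,t)))"
    using hom_join_left[OF homotopic_paths_sym[OF right] \<sigma> a] .
  moreover have "homotopic_paths S ((\<lambda>u. h (0,u)) +++ (\<lambda>t. h (t,1))) (p +++ \<sigma>)"
    by (rule homotopic_paths_sym, rule hom_join[OF homotopic_paths_sym[OF left] homotopic_paths_sym[OF top] p \<sigma>])
  ultimately have "homotopic_paths S (p +++ \<sigma>) \<sigma>"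
    using hom_rid[OF \<sigma>] by (meson homotopic_paths_trans homotopic_paths_sym)
  then have "homotopic_paths S ((p +++ \<sigma>) +++ reversepath \<sigma>) (\<sigma> +++ reversepath \<sigma>)"
    using hom_join_right path_in_join[OF p \<sigma>] path_in_rev[OF \<sigma>] by blast
  then show ?thesis
    using hom_cancel_right[OF p \<sigma>] hom_rinv[OF \<sigma>] unfolding pathstart_def
    by (meson homotopic_paths_trans homotopic_paths_sym)
qed

text \<open>Conversely, a homotopy between the two ways around a square fills the square. A homotopy of
  paths with fixed end points is a map of a square that is constant on two opposite edges;
  collapsing these edges to points gives a square again.\<close>

lemma square_of_hom:
  fixes \<alpha> :: "real \<Rightarrow> 'a::topological_space"
  assumes "homotopic_paths S (\<alpha> +++ s) (r +++ \<delta>)"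
    and "pathfinish \<alpha> = pathstart s" "pathfinish r = pathstart \<delta>"
  obtains G where "continuous_on ({0..1} \<times> {0..1}) G" "G ` ({0..1} \<times> {0..1}) \<subseteq> S"
    "\<And>t. t \<in> {0..1} \<Longrightarrow> G (t,0) = r t" "\<And>t. t \<in> {0..1} \<Longrightarrow> G (t,1) = s t"
    "\<And>u. u \<in> {0..1} \<Longrightarrow> G (0,u) = \<alpha> u" "\<And>u. u \<in> {0..1} \<Longrightarrow> G (1,u) = \<delta> u"
proof -
  let ?I = "{0..1::real} \<times> {0..1::real}"
  obtain K where K: "continuous_on ?I K" "K ` ?I \<subseteq> S"
     "\<And>x. x \<in> {0..1} \<Longrightarrow> K (0,x) = (\<alpha> +++ s) x" "\<And>x. x \<in> {0..1} \<Longrightarrow> K (1,x) = (r +++ \<delta>) x"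
     "\<And>t. t \<in> {0..1} \<Longrightarrow> K (t,0) = \<alpha> 0" "\<And>t. t \<in> {0..1} \<Longrightarrow> K (t,1) = s 1"
    using assms(1) by (auto simp: homotopic_paths pathstart_def pathfinish_def joinpaths_def image_subset_iff_funcset)
  \<comment> \<open>\<open>q (l, \<cdot>)\<close> is the straight path between the two ways around the square, with weight \<open>l\<close>.\<close>
  define q :: "real \<times> real \<Rightarrow> real \<times> real" where
    "q = (\<lambda>z. (fst z * min 1 (2 * snd z) + (1 - fst z) * max 0 (2 * snd z - 1),
               (1 - fst z) * min 1 (2 * snd z) + fst z * max 0 (2 * snd z - 1)))"
  have contq: "continuous_on ?I q"
    unfolding q_def by (intro continuous_intros)
  have surj: "\<exists>l \<tau>. l \<in> {0..1} \<and> \<tau> \<in> {0..1} \<and> q (l,\<tau>) = (t,u)" if "t \<in> {0..1}" "u \<in> {0..1}" for t u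
  proof (cases "t + u \<le> 1")
    case True
    show ?thesis
    proof (cases "t + u = 0")
      case True then have "q (0,0) = (t,u)" using that by (auto simp: q_def)
      then show ?thesis by (intro exI[of _ 0]) auto
    next
      case False then have pos: "t + u > 0" using that by auto
      have 1: "t / (t+u) * (t+u) = t" "1 - t/(t+u) = u / (t+u)" "u / (t+u) * (t+u) = u"
        using pos by (auto simp: field_simps)
      have "min 1 (2 * ((t+u)/2)) = t+u" "max 0 (2 * ((t+u)/2) - 1) = 0" using True by auto
      then have "q (t/(t+u), (t+u)/2) = (t,u)"
        unfolding q_def fst_conv snd_conv 1(2) using 1 by simp
      then show ?thesis using that True pos by (intro exI[of _ "t/(t+u)"] exI[of _ "(t+u)/2"]) auto
    qed
  next
    case False
    show ?thesis
    proof (cases "t + u = 2")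
      case True then have "q (0,1) = (t,u)" using that by (auto simp: q_def)
      then show ?thesis by (intro exI[of _ 0] exI[of _ 1]) auto
    next
      case nz: False then have pos: "2 - t - u > 0" using that by auto
      define l where "l = (1 - u) / (2 - t - u)"
      have l: "l * (2 - t - u) = 1 - u" "(1 - l) * (2-t-u) = 1 - t" using pos by (auto simp: l_def field_simps)
      have tu: "l + (1-l) * (t+u-1) = t" "(1-l) + l * (t+u-1) = u" using l by (auto simp: algebra_simps)
      have m: "min 1 (2 * ((t+u)/2)) = 1" "max 0 (2 * ((t+u)/2) - 1) = t+u-1" using False by auto
      have "q (l, (t+u)/2) = (l + (1-l) * (t+u-1), (1-l) + l * (t+u-1))"
        unfolding q_def fst_conv snd_conv m by simp
      then have "q (l, (t+u)/2) = (t,u)" unfolding tu .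
      moreover have "l \<in> {0..1}" using that pos by (auto simp: l_def field_simps)
      ultimately show ?thesis using that False by (intro exI[of _ l] exI[of _ "(t+u)/2"]) auto
    qed
  qed
  have onto: "?I \<subseteq> q ` ?I"
  proof
    fix z assume "z \<in> ?I"
    then obtain l \<tau> where "l \<in> {0..1}" "\<tau> \<in> {0..1}" "q (l,\<tau>) = z"
      using surj[of "fst z" "snd z"] by (auto simp: mem_Times_iff)
    then show "z \<in> q ` ?I" by (intro image_eqI[of _ _ "(l,\<tau>)"]) auto
  qed
  have into: "q ` ?I \<subseteq> ?I"
  proof -
    have cb: "0 \<le> l * x + (1-l) * y \<and> l * x + (1-l) * y \<le> 1" if "0 \<le> l" "l \<le> 1" "0 \<le> x" "x \<le> 1" "0 \<le> y" "y \<le> 1" for l x y :: real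
      using that convex_bound_le[of x 1 y l "1-l"] by auto
    have "q (l, \<tau>) \<in> ?I" if "l \<in> {0..1}" "\<tau> \<in> {0..1}" for l \<tau>
      using cb[of l "min 1 (2*\<tau>)" "max 0 (2*\<tau> - 1)"] cb[of "1-l" "min 1 (2*\<tau>)" "max 0 (2*\<tau> - 1)"] that
      by (auto simp: q_def)
    then have "q (fst z, snd z) \<in> ?I" if "z \<in> ?I" for z using that by (metis mem_Times_iff)
    then show ?thesis by (simp add: image_subset_iff)
  qed
  have qm: "quotient_map (top_of_set ?I) (top_of_set ?I) q"
    by (rule continuous_imp_quotient_map) (use contq into onto in \<open>auto simp: compact_space_subtopology compactin_euclidean_iff compact_Times Hausdorff_space_subtopology\<close>)
  have Kq: "K z = K z'" if "z \<in> ?I" "z' \<in> ?I" "q z = q z'" for z z'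
  proof -
    obtain l \<tau> l' \<tau>' where zz: "z = (l,\<tau>)" "z' = (l',\<tau>')" by (cases z, cases z') auto
    have sum: "fst (q (l,\<tau>)) + snd (q (l,\<tau>)) = 2 * \<tau>" if "\<tau> \<in> {0..1}" for l \<tau>
      using that by (auto simp: q_def min_def max_def algebra_simps)
    have eq: "\<tau> = \<tau>'" using sum[of \<tau> l] sum[of \<tau>' l'] that zz by auto
    show ?thesis
    proof (cases "\<tau> = 0 \<or> \<tau> = 1")
      case True then show ?thesis using K(5,6) that zz eq by auto
    next
      case False
      have df: "fst (q (l,\<tau>)) - snd (q (l,\<tau>)) = (2 * l - 1) * (min 1 (2*\<tau>) - max 0 (2*\<tau>-1))" for l
      proof -
        have "(l * a + (1-l) * b) - ((1-l) * a + l * b) = (2 * l - 1) * (a - b)" for a b :: real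
          by (simp add: algebra_simps)
        then show ?thesis unfolding q_def fst_conv snd_conv .
      qed
      have m: "min 1 (2*\<tau>) - max 0 (2*\<tau>-1) \<noteq> 0" using False that(1) zz(1) by (auto simp: min_def max_def)
      have "q (l,\<tau>) = q (l',\<tau>)" using that(3) unfolding zz eq .
      then have "(2 * l - 1) * (min 1 (2*\<tau>) - max 0 (2*\<tau>-1)) = (2 * l' - 1) * (min 1 (2*\<tau>) - max 0 (2*\<tau>-1))"
        unfolding df[symmetric] by (rule arg_cong)
      then have "l = l'" using m by simp
      then show ?thesis using zz eq by simp
    qed
  qed
  obtain G where G: "continuous_map (top_of_set ?I) (top_of_set S) G" "\<And>z. z \<in> ?I \<Longrightarrow> G (q z) = K z"
  proof (rule quotient_map_lift_exists[OF qm, of "top_of_set S" K])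
    show "continuous_map (top_of_set ?I) (top_of_set S) K" using K(1,2) by (simp add: image_subset_iff_funcset)
    show "K z = K z'" if "z \<in> topspace (top_of_set ?I)" "z' \<in> topspace (top_of_set ?I)" "q z = q z'" for z z'
      by (rule Kq) (use that in simp_all)
    fix G assume G: "continuous_map (top_of_set ?I) (top_of_set S) G" "\<And>x. x \<in> topspace (top_of_set ?I) \<Longrightarrow> G (q x) = K x"
    show thesis by (rule that[OF G(1)]) (use G(2) in simp)
  qed
  show thesis
  proof
    show "continuous_on ?I G" "G ` ?I \<subseteq> S" using G(1) by (auto simp: image_subset_iff_funcset)
    fix t :: real assume t: "t \<in> {0..1}"
    have q1: "q (1, t/2) = (t, 0)" "q (0, t/2) = (0,t)" using t by (simp_all add: q_def)
    have m: "min 1 (2 * ((t+1)/2)) = 1" "max 0 (2 * ((t+1)/2) - 1) = t" using t by (auto simp: max_def field_simps)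
    have q2: "q (0, (t+1)/2) = (t,1)" "q (1, (t+1)/2) = (1, t)" unfolding q_def fst_conv snd_conv m by simp_all
    have I: "(1,t/2) \<in> ?I" "(0,t/2) \<in> ?I" "(0,(t+1)/2) \<in> ?I" "(1,(t+1)/2) \<in> ?I" using t by auto
    have j1: "(f +++ g) (t/2) = f t" for f g :: "real \<Rightarrow> 'a" using t by (simp add: joinpaths_def)
    have j2: "(f +++ g) ((t+1)/2) = g t" if "pathfinish f = pathstart g" for f g :: "real \<Rightarrow> 'a"
      using t that by (auto simp: joinpaths_def pathstart_def pathfinish_def field_simps)
    have h: "t/2 \<in> {0..1}" "(t+1)/2 \<in> {0..1}" using t by auto
    show "G (t,0) = r t" using G(2)[OF I(1)] K(4)[OF h(1)] unfolding q1 j1 by simp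
    show "G (0,t) = \<alpha> t" using G(2)[OF I(2)] K(3)[OF h(1)] unfolding q1 j1 by simp
    show "G (t,1) = s t" using G(2)[OF I(3)] K(3)[OF h(2)] unfolding q2 j2[OF assms(2)] by simp
    show "G (1,t) = \<delta> t" using G(2)[OF I(4)] K(4)[OF h(2)] unfolding q2 j2[OF assms(3)] by simp
  qed
qed

section \<open>Local topology of locally finite CW complexes\<close>

definition unit_ball :: "nat \<Rightarrow> (nat \<Rightarrow> real) set" where
  "unit_ball n = {x. (\<forall>i\<ge>n. x i = 0) \<and> (\<Sum>i<n. (x i)\<^sup>2) \<le> 1}"

definition unit_ball_interior :: "nat \<Rightarrow> (nat \<Rightarrow> real) set" where
  "unit_ball_interior n = {x. (\<forall>i\<ge>n. x i = 0) \<and> (\<Sum>i<n. (x i)\<^sup>2) < 1}"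

lemma closed_disc_eq: "closed_disc n = top_of_set (unit_ball n)"
proof -
  have "{x. \<forall>i\<ge>n. x i = 0} \<inter> {x::nat\<Rightarrow>real. (\<Sum>i<n. (x i)\<^sup>2) \<le> 1} = unit_ball n"
    by (auto simp: unit_ball_def)
  then show ?thesis
    by (simp add: closed_disc_def Euclidean_space_def euclidean_product_topology subtopology_subtopology)
qed

lemma open_disc_eq: "open_disc n = top_of_set (unit_ball_interior n)"
proof -
  have "{x. \<forall>i\<ge>n. x i = 0} \<inter> {x::nat\<Rightarrow>real. (\<Sum>i<n. (x i)\<^sup>2) < 1} = unit_ball_interior n"
    by (auto simp: unit_ball_interior_def)
  then show ?thesis
    by (simp add: open_disc_def Euclidean_space_def euclidean_product_topology subtopology_subtopology)
qed

lemma unit_ball_interior_subset: "unit_ball_interior n \<subseteq> unit_ball n"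
  by (auto simp: unit_ball_def unit_ball_interior_def)

lemma continuous_on_coord: "continuous_on S (\<lambda>x::nat\<Rightarrow>real. x i)"
  by (rule continuous_on_subset[OF continuous_on_product_coordinates]) auto

lemma compact_unit_ball: "compact (unit_ball n)"
proof -
  let ?B = "PiE UNIV (\<lambda>i. if i < n then {-1..1} else {0::real})"
  have "compactin (product_topology (\<lambda>i::nat. euclidean::real topology) UNIV) ?B"
    by (auto simp: compactin_PiE)
  then have B: "compact ?B" by (simp add: euclidean_product_topology)
  have eq: "unit_ball n = ?B \<inter> {x. (\<Sum>i<n. (x i)\<^sup>2) \<le> 1}"
  proof -
    have "x \<in> ?B" if x: "x \<in> unit_ball n" for x
    proof -
      have "x i \<in> (if i < n then {-1..1} else {0::real})" for i
      proof (cases "i < n")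
        case True
        then have "(x i)\<^sup>2 \<le> (\<Sum>i<n. (x i)\<^sup>2)" by (intro member_le_sum) auto
        then have "(x i)\<^sup>2 \<le> 1" using x by (auto simp: unit_ball_def)
        then have "\<bar>x i\<bar> \<le> 1" by (simp add: abs_square_le_1)
        then show ?thesis using True by auto
      qed (use x in \<open>auto simp: unit_ball_def\<close>)
      then show ?thesis by auto
    qed
    moreover have "x i = 0" if "x \<in> ?B" "n \<le> i" for x i
      using PiE_mem[OF that(1), of i] that(2) by auto
    ultimately show ?thesis by (auto simp: unit_ball_def)
  qed
  have "closed {x::nat\<Rightarrow>real. (\<Sum>i<n. (x i)\<^sup>2) \<le> 1}"
    by (intro closed_Collect_le continuous_intros continuous_on_coord)
  then show ?thesis unfolding eq using B by (rule compact_Int_closed[rotated])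
qed

text \<open>The radial retraction makes the ball a retract of Euclidean space.\<close>

lemma locally_path_connected_unit_ball: "locally_path_connected_space (top_of_set (unit_ball n))"
proof -
  let ?E = "{x::nat\<Rightarrow>real. \<forall>i\<ge>n. x i = 0}"
  have E: "Euclidean_space n = top_of_set ?E"
    by (simp add: Euclidean_space_def euclidean_product_topology)
  define \<rho> where "\<rho> = (\<lambda>x::nat\<Rightarrow>real. \<lambda>i. x i / max 1 (sqrt (\<Sum>i<n. (x i)\<^sup>2)))"
  have c: "continuous_on ?E \<rho>"
    unfolding \<rho>_def by (intro continuous_intros continuous_on_coord) auto
  have into: "\<rho> x \<in> unit_ball n" if "x \<in> ?E" for x
  proof -
    define N where "N = sqrt (\<Sum>i<n. (x i)\<^sup>2)"
    have N: "N\<^sup>2 = (\<Sum>i<n. (x i)\<^sup>2)" "N \<ge> 0" by (auto simp: N_def sum_nonneg)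
    have "(\<Sum>i<n. (\<rho> x i)\<^sup>2) = N\<^sup>2 / (max 1 N)\<^sup>2"
      by (simp add: \<rho>_def N_def[symmetric] power_divide N(1) sum_divide_distrib)
    also have "\<dots> \<le> 1" using N(2) by (auto simp: max_def divide_simps)
    finally show ?thesis using that by (auto simp: unit_ball_def \<rho>_def)
  qed
  have id: "\<rho> x = x" if "x \<in> unit_ball n" for x
    using that by (auto simp: \<rho>_def unit_ball_def max_def)
  have "retraction_maps (top_of_set ?E) (top_of_set (unit_ball n)) \<rho> id"
    using c into id by (auto simp: retraction_maps_def unit_ball_def)
  then show ?thesis
    using locally_path_connected_space_retraction_map_image locally_path_connected_Euclidean_space[of n]
    unfolding E retraction_map_def by blast
qed

text \<open>The topology of the complex that the argument at infinity uses. The contracting set in \<open>small_loops\<close> is compact, as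
  all but finitely many of its translates have to avoid a given compact set.\<close>

locale nice_space =
  fixes Y :: "'a::t2_space set"
  assumes lpc: "locally path_connected Y"
    and compact_nbhd: "\<And>K. compact K \<Longrightarrow> K \<subseteq> Y \<Longrightarrow>
      \<exists>V L. openin (top_of_set Y) V \<and> K \<subseteq> V \<and> V \<subseteq> L \<and> compact L \<and> L \<subseteq> Y"
    and small_loops: "\<And>y. y \<in> Y \<Longrightarrow>
      \<exists>W L. openin (top_of_set Y) W \<and> y \<in> W \<and> compact L \<and> L \<subseteq> Y \<and>
        (\<forall>p x. path_in W p x x \<longrightarrow> homotopic_paths L p (\<lambda>_. x))"
    and simply_conn: "simply_connected Y"
    and exhaustion: "Y \<noteq> {} \<Longrightarrow>
      \<exists>K :: nat \<Rightarrow> 'a set. (\<forall>n. compact (K n) \<and> K n \<noteq> {} \<and> K n \<subseteq> Y \<and>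
          (\<exists>V. openin (top_of_set Y) V \<and> K n \<subseteq> V \<and> V \<subseteq> K (Suc n))) \<and> (\<Union>n. K n) = Y"

lemma simply_connected_path:
  assumes "simply_connected Y" "x \<in> Y" "y \<in> Y"
  obtains p where "path_in Y p x y"
proof -
  have "homotopic_loops Y (\<lambda>_. x) (\<lambda>_. y)"
    using assms path_in_const[OF assms(2)] path_in_const[OF assms(3)]
    by (auto simp: simply_connected_def path_in_def)
  then obtain h where h: "continuous_on ({0..1::real} \<times> {0..1::real}) h" "h ` ({0..1} \<times> {0..1}) \<subseteq> Y"
     "\<And>t. t \<in> {0..1} \<Longrightarrow> h (0,t) = x" "\<And>t. t \<in> {0..1} \<Longrightarrow> h (1,t) = y"
    by (auto simp: homotopic_loops image_subset_iff_funcset)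
  have "continuous_on {0..1} (\<lambda>t. h (t,0))"
    by (auto intro!: continuous_on_compose2[OF h(1)] continuous_intros)
  then have "path_in Y (\<lambda>t. h (t,0)) x y"
    using h(2-4) by (auto simp: path_in_def path_def path_image_def pathstart_def pathfinish_def)
  then show thesis using that by blast
qed

lemma simply_connected_null:
  assumes "simply_connected Y" "path_in Y p x x"
  shows "homotopic_paths Y p (\<lambda>_. x)"
proof -
  have "homotopic_loops Y p (\<lambda>_. x)"
    using assms path_in_const[of x Y] path_in_ends[OF assms(2)]
    by (auto simp: simply_connected_def path_in_def)
  then show ?thesis using hom_null_of_homotopic_loops[of Y p x] assms(2) by (simp add: path_in_def)
qed

locale CW =
  fixes Y :: "'a::t2_space set" and E :: "nat \<Rightarrow> 'a set set" 
  assumes cw: "locally_finite_CW_structure Y E"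
begin

definition cell_index :: "(nat \<times> 'a set) set" where
  "cell_index = {(n, e). e \<in> E n}"

definition char_map :: "nat \<times> 'a set \<Rightarrow> (nat \<Rightarrow> real) \<Rightarrow> 'a" where
  "char_map c = (SOME \<Phi>. characteristic_map Y E (fst c) (snd c) \<Phi>)"

definition closed_cell :: "nat \<times> 'a set \<Rightarrow> 'a set" where
  "closed_cell c = char_map c ` unit_ball (fst c)"

lemma CW: "CW_structure Y E" using cw by (simp add: locally_finite_CW_structure_def)

lemma cells_cover: "\<Union>(cells E) = Y"
  using CW by (simp add: CW_structure_def)

lemma loc_finite: "y \<in> Y \<Longrightarrow> \<exists>U. openin (top_of_set Y) U \<and> y \<in> U \<and> finite {e \<in> cells E. e \<inter> U \<noteq> {}}"
  using cw by (simp add: locally_finite_CW_structure_def)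

lemma char_map: "c \<in> cell_index \<Longrightarrow> characteristic_map Y E (fst c) (snd c) (char_map c)"
proof -
  assume "c \<in> cell_index"
  then have "snd c \<in> E (fst c)" by (auto simp: cell_index_def)
  then have "\<exists>\<Phi>. characteristic_map Y E (fst c) (snd c) \<Phi>" using CW unfolding CW_structure_def by blast
  then show ?thesis unfolding char_map_def by (rule someI_ex)
qed

lemma char_map_cont: "c \<in> cell_index \<Longrightarrow> continuous_on (unit_ball (fst c)) (char_map c)"
  using char_map[of c] by (auto simp: characteristic_map_def closed_disc_eq)

lemma char_map_into: "c \<in> cell_index \<Longrightarrow> closed_cell c \<subseteq> Y"
  using char_map[of c] by (auto simp: characteristic_map_def closed_disc_eq closed_cell_def)

lemma char_map_homeo: "c \<in> cell_index \<Longrightarrow> 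
    homeomorphic_map (top_of_set (unit_ball_interior (fst c))) (top_of_set (snd c)) (char_map c)"
  using char_map[of c] by (auto simp: characteristic_map_def open_disc_eq)

lemma char_map_open: "c \<in> cell_index \<Longrightarrow> char_map c ` unit_ball_interior (fst c) = snd c"
  using homeomorphic_imp_surjective_map[OF char_map_homeo[of c]] by simp

lemma char_map_inj: "c \<in> cell_index \<Longrightarrow> inj_on (char_map c) (unit_ball_interior (fst c))"
  using homeomorphic_imp_injective_map[OF char_map_homeo[of c]] by simp

lemma compact_closed_cell: "c \<in> cell_index \<Longrightarrow> compact (closed_cell c)"
  unfolding closed_cell_def by (intro compact_continuous_image char_map_cont compact_unit_ball)

lemma cell_subset: "c \<in> cell_index \<Longrightarrow> snd c \<subseteq> closed_cell c"
  using char_map_open[of c] unit_ball_interior_subset[of "fst c"] by (auto simp: closed_cell_def)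

lemma closure_cell: "c \<in> cell_index \<Longrightarrow> closure (snd c) \<subseteq> closed_cell c"
  by (simp add: cell_subset closure_minimal compact_closed_cell compact_imp_closed)

lemma cell_disjoint: "c \<in> cell_index \<Longrightarrow> d \<in> cell_index \<Longrightarrow> snd c \<inter> snd d \<noteq> {} \<Longrightarrow> c = d"
  using CW by (fastforce simp: CW_structure_def cell_index_def)

lemma cell_boundary: "c \<in> cell_index \<Longrightarrow> 
   \<exists>F. finite F \<and> F \<subseteq> cell_index \<and> (\<forall>d\<in>F. fst d < fst c) \<and>
     char_map c ` (unit_ball (fst c) - unit_ball_interior (fst c)) \<subseteq> \<Union>(snd ` F)"
proof -
  assume c: "c \<in> cell_index"
  obtain F where F: "finite F" "F \<subseteq> (\<Union>m<fst c. E m)"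
     "char_map c ` (unit_ball (fst c) - unit_ball_interior (fst c)) \<subseteq> \<Union>F"
    using char_map[OF c] unfolding characteristic_map_def closed_disc_eq open_disc_eq by auto
  have "\<forall>e\<in>F. \<exists>m. m < fst c \<and> e \<in> E m" using F(2) by auto
  then obtain m where m: "\<And>e. e \<in> F \<Longrightarrow> m e < fst c \<and> e \<in> E (m e)" by metis
  show ?thesis
    by (rule exI[of _ "(\<lambda>e. (m e, e)) ` F"]) (use F m in \<open>auto simp: cell_index_def image_image\<close>)
qed

lemma Y_eq: "Y = \<Union>(snd ` cell_index)"
  using CW unfolding CW_structure_def cells_def cell_index_def by force

text \<open>The index of a cell records its dimension, which the inductions over subcomplexes need. The condition says that the boundary of
  each cell lies in the cells of lower dimension.\<close>

definition subcx :: "(nat \<times> 'a set) set \<Rightarrow> bool" where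
  "subcx F \<longleftrightarrow> finite F \<and> F \<subseteq> cell_index \<and>
     (\<forall>c\<in>F. char_map c ` (unit_ball (fst c) - unit_ball_interior (fst c)) \<subseteq> \<Union>(snd ` {d\<in>F. fst d < fst c}))"

definition carrier_of :: "(nat \<times> 'a set) set \<Rightarrow> 'a set" where
  "carrier_of F = \<Union>(snd ` F)"

lemma subcx_Un: "subcx F \<Longrightarrow> subcx G \<Longrightarrow> subcx (F \<union> G)"
  unfolding subcx_def by (intro conjI) (blast | auto)+

lemma subcx_Union: "finite I \<Longrightarrow> (\<And>i. i \<in> I \<Longrightarrow> subcx (F i)) \<Longrightarrow> subcx (\<Union>i\<in>I. F i)"
proof (induction rule: finite_induct)
  case empty then show ?case by (simp add: subcx_def)
next
  case (insert x I) then show ?case using subcx_Un by simp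
qed

lemma subcx_exists: "c \<in> cell_index \<Longrightarrow> \<exists>F. subcx F \<and> c \<in> F"
proof (induction "fst c" arbitrary: c rule: less_induct)
  case less
  obtain F where F: "finite F" "F \<subseteq> cell_index" "\<forall>d\<in>F. fst d < fst c"
     "char_map c ` (unit_ball (fst c) - unit_ball_interior (fst c)) \<subseteq> \<Union>(snd ` F)"
    using cell_boundary[OF less.prems] by blast
  have "\<forall>d\<in>F. \<exists>G. subcx G \<and> d \<in> G" using less.hyps F by blast
  then obtain G where G: "\<And>d. d \<in> F \<Longrightarrow> subcx (G d) \<and> d \<in> G d" by metis
  let ?H = "\<Union>d\<in>F. G d"
  have H: "subcx ?H" using subcx_Union F(1) G by blast
  have "F \<subseteq> {d \<in> insert c ?H. fst d < fst c}" using F(3) G by auto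
  then have 1: "char_map c ` (unit_ball (fst c) - unit_ball_interior (fst c)) \<subseteq> \<Union>(snd ` {d \<in> insert c ?H. fst d < fst c})"
    by (intro order_trans[OF F(4)] Union_mono image_mono)
  have "subcx (insert c ?H)"
    unfolding subcx_def
  proof (intro conjI ballI)
    fix d assume "d \<in> insert c ?H"
    then consider "d = c" | "d \<in> ?H" by blast
    then show "char_map d ` (unit_ball (fst d) - unit_ball_interior (fst d)) \<subseteq> \<Union>(snd ` {k \<in> insert c ?H. fst k < fst d})"
    proof cases
      case 2
      then have "char_map d ` (unit_ball (fst d) - unit_ball_interior (fst d)) \<subseteq> \<Union>(snd ` {k \<in> ?H. fst k < fst d})"
        using H unfolding subcx_def by blast
      also have "\<dots> \<subseteq> \<Union>(snd ` {k \<in> insert c ?H. fst k < fst d})"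
        by (intro Union_mono image_mono) auto
      finally show ?thesis .
    qed (use 1 in simp)
  qed (use H less.prems in \<open>auto simp: subcx_def\<close>)
  then show ?case by blast
qed

lemma carrier_eq_closed_cells: "subcx F \<Longrightarrow> carrier_of F = (\<Union>c\<in>F. closed_cell c)"
proof
  assume F: "subcx F"
  show "carrier_of F \<subseteq> (\<Union>c\<in>F. closed_cell c)"
    using F cell_subset by (force simp: carrier_of_def subcx_def)
  show "(\<Union>c\<in>F. closed_cell c) \<subseteq> carrier_of F"
  proof safe
    fix c x assume c: "c \<in> F" "x \<in> closed_cell c"
    then obtain v where v: "v \<in> unit_ball (fst c)" "x = char_map c v" by (auto simp: closed_cell_def)
    show "x \<in> carrier_of F"
    proof (cases "v \<in> unit_ball_interior (fst c)")
      case True then show ?thesis using v c char_map_open[of c] F by (auto simp: carrier_of_def subcx_def)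
    next
      case False 
      then have "x \<in> \<Union>(snd ` {d\<in>F. fst d < fst c})" using F c v unfolding subcx_def by blast
      then show ?thesis unfolding carrier_of_def by blast
    qed
  qed
qed

lemma compact_carrier: "subcx F \<Longrightarrow> compact (carrier_of F)"
  unfolding carrier_eq_closed_cells by (intro compact_UN) (auto simp: subcx_def compact_closed_cell)

lemma carrier_subset: "subcx F \<Longrightarrow> carrier_of F \<subseteq> Y"
  unfolding carrier_eq_closed_cells using char_map_into by (fastforce simp: subcx_def)

lemma compact_in_subcx:
  assumes "compact K" "K \<subseteq> Y"
  obtains F V where "subcx F" "openin (top_of_set Y) V" "K \<subseteq> V" "V \<subseteq> carrier_of F"
proof -
  have "\<exists>F V. subcx F \<and> openin (top_of_set Y) V \<and> y \<in> V \<and> V \<subseteq> carrier_of F" if yY: "y \<in> Y" for y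
  proof -
    obtain U where U: "openin (top_of_set Y) U" "y \<in> U" "finite {e \<in> cells E. e \<inter> U \<noteq> {}}"
      using loc_finite[OF yY] by blast
    have "\<exists>F. subcx F \<and> e \<in> snd ` F" if e: "e \<in> cells E" for e
    proof -
      obtain n where "(n,e) \<in> cell_index" using e by (auto simp: cells_def cell_index_def)
      then obtain F where "subcx F" "(n,e) \<in> F" using subcx_exists by blast
      then show ?thesis by (intro exI[of _ F] conjI image_eqI[of _ _ "(n,e)"]) auto
    qed
    then obtain F where F: "\<And>e. e \<in> cells E \<Longrightarrow> subcx (F e) \<and> e \<in> snd ` F e" by metis
    let ?F = "\<Union>e\<in>{e \<in> cells E. e \<inter> U \<noteq> {}}. F e"
    have "subcx ?F" using U(3) F by (intro subcx_Union) auto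
    moreover have "U \<subseteq> carrier_of ?F"
    proof
      fix x assume x: "x \<in> U"
      then have "x \<in> Y" using U(1) openin_imp_subset by blast
      then obtain e where e: "e \<in> cells E" "x \<in> e" using cells_cover by blast
      then have "e \<in> snd ` F e" using F by blast
      moreover have "F e \<subseteq> ?F" using e x by blast
      ultimately show "x \<in> carrier_of ?F" using e(2) unfolding carrier_of_def by blast
    qed
    ultimately show ?thesis using U by blast
  qed
  then obtain F V where FV: "\<And>y. y \<in> Y \<Longrightarrow> subcx (F y) \<and> openin (top_of_set Y) (V y) \<and> y \<in> V y \<and> V y \<subseteq> carrier_of (F y)"
    by (metis (no_types))
  have "\<forall>y\<in>K. \<exists>T. open T \<and> V y = Y \<inter> T" using FV assms(2) by (meson openin_open subsetD)
  then obtain T where T: "\<And>y. y \<in> K \<Longrightarrow> open (T y) \<and> V y = Y \<inter> T y" by metis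
  have "open (T y)" if "y \<in> K" for y using T that by blast
  moreover have "K \<subseteq> (\<Union>y\<in>K. T y)"
  proof
    fix y assume "y \<in> K"
    then have "y \<in> V y" using FV assms(2) by blast
    then show "y \<in> (\<Union>y\<in>K. T y)" using T \<open>y \<in> K\<close> by blast
  qed
  ultimately obtain A where A: "A \<subseteq> K" "finite A" "K \<subseteq> (\<Union>y\<in>A. T y)"
    by (rule compactE_image[OF assms(1)])
  have AY: "A \<subseteq> Y" using A assms(2) by blast
  show thesis
  proof
    show "subcx (\<Union>y\<in>A. F y)" using A(2) AY FV by (intro subcx_Union) auto
    show "openin (top_of_set Y) (\<Union>y\<in>A. V y)" using AY FV by (intro openin_Union) auto
    have "(\<Union>y\<in>A. V y) = Y \<inter> (\<Union>y\<in>A. T y)" using T A(1) by blast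
    then show "K \<subseteq> (\<Union>y\<in>A. V y)" using A(3) assms(2) by simp
    have "V y \<subseteq> carrier_of (\<Union>y\<in>A. F y)" if "y \<in> A" for y
    proof -
      have "V y \<subseteq> carrier_of (F y)" using FV that AY by blast
      also have "\<dots> \<subseteq> carrier_of (\<Union>y\<in>A. F y)" using that unfolding carrier_of_def by blast
      finally show ?thesis .
    qed
    then show "(\<Union>y\<in>A. V y) \<subseteq> carrier_of (\<Union>y\<in>A. F y)" by blast
  qed
qed

text \<open>\<open>Y\<close> is a quotient of the disjoint union of the closed balls, and local path connectedness passes to quotients.\<close>

lemma locally_path_connected_CW: "locally path_connected Y"
proof -
  let ?X = "\<lambda>c::nat \<times> 'a set. top_of_set (unit_ball (fst c))"
  let ?f = "\<lambda>(c,v). char_map c v"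
  have "quotient_map (sum_topology ?X cell_index) (top_of_set Y) ?f"
    unfolding quotient_map_closedin
  proof (intro conjI allI impI)
    have "(\<Union>c\<in>cell_index. closed_cell c) = Y"
    proof
      show "Y \<subseteq> (\<Union>c\<in>cell_index. closed_cell c)" using cell_subset by (subst Y_eq) blast
    qed (use char_map_into in blast)
    moreover have image_Sigma_case: "(\<lambda>(c,v). char_map c v) ` Sigma cell_index B = (\<Union>c\<in>cell_index. char_map c ` B c)" for B
      by (auto simp: image_iff)
    ultimately show "?f ` topspace (sum_topology ?X cell_index) = topspace (top_of_set Y)"
      by (simp add: closed_cell_def image_Sigma_case)
    fix U assume U: "U \<subseteq> topspace (top_of_set Y)"
    let ?P = "{x \<in> topspace (sum_topology ?X cell_index). ?f x \<in> U}"
    have iff: "closedin (sum_topology ?X cell_index) ?P \<longleftrightarrow>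
        (\<forall>c\<in>cell_index. closedin (?X c) {v \<in> unit_ball (fst c). char_map c v \<in> U})"
      by (subst closedin_sum_topology) (auto cong: conj_cong)
    show "closedin (sum_topology ?X cell_index) ?P = closedin (top_of_set Y) U"
      unfolding iff
    proof
      assume L: "\<forall>c\<in>cell_index. closedin (?X c) {v \<in> unit_ball (fst c). char_map c v \<in> U}"
      have "closedin (top_of_set Y) (U \<inter> closure e)" if eE: "e \<in> cells E" for e
      proof -
        obtain n where c: "(n,e) \<in> cell_index" using eE by (auto simp: cells_def cell_index_def)
        have "compact {v \<in> unit_ball n. char_map (n,e) v \<in> U}"
          using L c compact_unit_ball closedin_compact by fastforce
        then have "compact (char_map (n,e) ` {v \<in> unit_ball n. char_map (n,e) v \<in> U})"
          using char_map_cont[OF c] by (intro compact_continuous_image) (auto elim: continuous_on_subset)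
        moreover have "char_map (n,e) ` {v \<in> unit_ball n. char_map (n,e) v \<in> U} = U \<inter> closed_cell (n,e)"
          by (auto simp: closed_cell_def)
        ultimately have "closed (U \<inter> closed_cell (n,e))" using compact_imp_closed by metis
        then have "closed ((U \<inter> closed_cell (n,e)) \<inter> closure e)" by blast
        moreover have "(U \<inter> closed_cell (n,e)) \<inter> closure e = U \<inter> closure e" using closure_cell[OF c] by auto
        ultimately show ?thesis using U by (metis closed_subset inf.coboundedI1 topspace_euclidean_subtopology)
      qed
      then show "closedin (top_of_set Y) U" using CW U unfolding CW_structure_def by simp
    next
      assume R: "closedin (top_of_set Y) U"
      show "\<forall>c\<in>cell_index. closedin (?X c) {v \<in> unit_ball (fst c). char_map c v \<in> U}"
      proof
        fix c assume c: "c \<in> cell_index"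
        have "continuous_map (?X c) (top_of_set Y) (char_map c)"
          using char_map[OF c] by (simp add: characteristic_map_def closed_disc_eq)
        then show "closedin (?X c) {v \<in> unit_ball (fst c). char_map c v \<in> U}"
          using R unfolding continuous_map_closedin by simp
      qed
    qed
  qed
  moreover have "locally_path_connected_space (sum_topology ?X cell_index)"
    by (simp add: locally_path_connected_space_sum_topology locally_path_connected_unit_ball)
  ultimately have "locally_path_connected_space (top_of_set Y)"
    using locally_path_connected_space_quotient_map_image by blast
  then have *: "\<And>V x. openin (top_of_set Y) V \<and> x \<in> V \<Longrightarrow> 
      (\<exists>U. openin (top_of_set Y) U \<and> path_connectedin (top_of_set Y) U \<and> x \<in> U \<and> U \<subseteq> V)"
    unfolding locally_path_connected_space by blast
  show ?thesis
    unfolding locally_path_connected using * by (metis path_connectedin_euclidean path_connectedin_subtopology)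
qed

end

lemma Hausdorff_space_t2: "Hausdorff_space (euclidean :: 'b::t2_space topology)"
  unfolding Hausdorff_space_def using hausdorff by (fastforce simp: disjnt_def)

context CW
begin

lemma top_cell_removal:
  assumes F: "subcx F" and c: "c \<in> F" and max: "\<And>d. d \<in> F \<Longrightarrow> fst d \<le> fst c"
  shows "subcx (F - {c})" "carrier_of F = carrier_of (F - {c}) \<union> closed_cell c"
    "carrier_of F - carrier_of (F - {c}) = snd c"
    "v \<in> unit_ball (fst c) - unit_ball_interior (fst c) \<Longrightarrow> char_map c v \<in> carrier_of (F - {c})"
proof -
  have Fi: "F \<subseteq> cell_index" "finite F" using F by (auto simp: subcx_def)
  have low: "{k \<in> F. fst k < fst d} = {k \<in> F - {c}. fst k < fst d}" if "d \<in> F" for d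
    using max[OF that] by auto
  have bd: "char_map d ` (unit_ball (fst d) - unit_ball_interior (fst d)) \<subseteq> \<Union>(snd ` {k\<in>F - {c}. fst k < fst d})" if "d \<in> F" for d
    using F that unfolding low[OF that, symmetric] subcx_def by blast
  show sub: "subcx (F - {c})" unfolding subcx_def using Fi bd by (intro conjI ballI) auto
  have "carrier_of F = (\<Union>d\<in>F. closed_cell d)" by (rule carrier_eq_closed_cells[OF F])
  also have "\<dots> = (\<Union>d\<in>F - {c}. closed_cell d) \<union> closed_cell c" using c by blast
  finally show "carrier_of F = carrier_of (F - {c}) \<union> closed_cell c"
    unfolding carrier_eq_closed_cells[OF sub] .
  have "snd d \<inter> snd c = {}" if "d \<in> F - {c}" for d
    using cell_disjoint[of d c] that c Fi by blast
  moreover have "carrier_of F = carrier_of (F - {c}) \<union> snd c" using c unfolding carrier_of_def by blast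
  ultimately show "carrier_of F - carrier_of (F - {c}) = snd c" unfolding carrier_of_def by blast
  show "char_map c v \<in> carrier_of (F - {c})" if "v \<in> unit_ball (fst c) - unit_ball_interior (fst c)"
    using bd[OF c] that unfolding carrier_of_def by blast
qed

definition radius :: "nat \<Rightarrow> (nat \<Rightarrow> real) \<Rightarrow> real" where
  "radius n v = sqrt (\<Sum>i<n. (v i)\<^sup>2)"

text \<open>The radial motion of \<open>v\<close>, which reaches the sphere at time 1.\<close>

definition push_out :: "nat \<Rightarrow> real \<Rightarrow> (nat \<Rightarrow> real) \<Rightarrow> (nat \<Rightarrow> real)" where
  "push_out n t v = (\<lambda>i. ((1 - t) + t / radius n v) * v i)"

lemma radius_scale: "radius n (\<lambda>i. a * v i) = \<bar>a\<bar> * radius n v"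
  by (simp add: radius_def power_mult_distrib sum_distrib_left[symmetric] real_sqrt_mult)

lemma radius_nonneg: "radius n v \<ge> 0"
  by (simp add: radius_def sum_nonneg)

lemma unit_ball_radius: "v \<in> unit_ball n \<longleftrightarrow> (\<forall>i\<ge>n. v i = 0) \<and> radius n v \<le> 1"
  by (simp add: unit_ball_def radius_def)

lemma unit_ball_interior_radius: "v \<in> unit_ball_interior n \<longleftrightarrow> (\<forall>i\<ge>n. v i = 0) \<and> radius n v < 1"
  by (simp add: unit_ball_interior_def radius_def)

lemma radius_zero: "v \<in> unit_ball n \<Longrightarrow> radius n v = 0 \<Longrightarrow> v = (\<lambda>_. 0)"
proof
  fix i assume v: "v \<in> unit_ball n" "radius n v = 0"
  show "v i = 0"
  proof (cases "i < n")
    case True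
    have "(\<Sum>i<n. (v i)\<^sup>2) = 0" using v(2) by (simp add: radius_def)
    then show ?thesis using True by (simp add: sum_nonneg_eq_0_iff)
  qed (use v in \<open>auto simp: unit_ball_def\<close>)
qed

lemma push_out:
  assumes "v \<in> unit_ball n" "v \<noteq> (\<lambda>_. 0)" "t \<in> {0..1}"
  shows "push_out n t v \<in> unit_ball n" "push_out n 0 v = v" "push_out n t v \<noteq> (\<lambda>_. 0)"
    "v \<notin> unit_ball_interior n \<Longrightarrow> push_out n t v = v"
    "push_out n 1 v \<notin> unit_ball_interior n"
proof -
  define N where "N = radius n v"
  have N: "0 < N" "N \<le> 1"
    using radius_zero[OF assms(1)] assms(1,2) radius_nonneg[of n v] by (auto simp: N_def unit_ball_radius)
  have r: "radius n (push_out n t v) = (1-t) * N + t" if "t \<in> {0..1}" for t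
  proof -
    have "(1 - t) + t / N \<ge> 0" using that N by auto
    then have "radius n (push_out n t v) = ((1 - t) + t / N) * N"
      unfolding push_out_def radius_scale N_def[symmetric] by simp
    also have "\<dots> = (1-t) * N + t" using N by (simp add: field_simps)
    finally show ?thesis .
  qed
  have "(1-t) * N + t \<le> 1" using convex_bound_le[of N 1 1 "1-t" t] assms(3) N by auto
  then show "push_out n t v \<in> unit_ball n"
    using r[OF assms(3)] assms(1) by (auto simp: unit_ball_radius push_out_def)
  show "push_out n 0 v = v" by (simp add: push_out_def)
  have "(1-t) * N + t > 0"
  proof (cases "t = 1")
    case False then show ?thesis using assms(3) N by (intro add_pos_nonneg mult_pos_pos) auto
  qed auto
  moreover have "radius n (\<lambda>_. 0) = 0" by (simp add: radius_def)
  ultimately show "push_out n t v \<noteq> (\<lambda>_. 0)" using r[OF assms(3)] by auto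
  show "push_out n t v = v" if "v \<notin> unit_ball_interior n"
  proof -
    have "N = 1" using that assms(1) N by (auto simp: unit_ball_interior_radius unit_ball_radius N_def)
    then show ?thesis by (simp add: push_out_def N_def)
  qed
  show "push_out n 1 v \<notin> unit_ball_interior n" using r[of 1] by (auto simp: unit_ball_interior_radius)
qed

text \<open>Off the center of a cell of maximal dimension, the complex deforms into the rest of the complex:
  the punctured cell is pushed radially onto its boundary.\<close>

lemma punctured_deformation:
  assumes F: "subcx F" and c: "c \<in> F" and max: "\<And>d. d \<in> F \<Longrightarrow> fst d \<le> fst c"
  defines "A \<equiv> carrier_of F" and "A' \<equiv> carrier_of (F - {c})" and "z \<equiv> char_map c (\<lambda>_. 0)"
  obtains R where "continuous_on ({0..1} \<times> (A - {z})) R" 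
    "\<And>t x. t \<in> {0..1::real} \<Longrightarrow> x \<in> A - {z} \<Longrightarrow> R (t,x) \<in> A"
    "\<And>x. x \<in> A - {z} \<Longrightarrow> R (0,x) = x" "\<And>x. x \<in> A - {z} \<Longrightarrow> R (1,x) \<in> A'"
    "\<And>t x. x \<in> A' \<Longrightarrow> R (t,x) = x" 
    "z \<notin> A'"
proof -
  define n where "n = fst c"
  define \<Phi> where "\<Phi> = char_map c"
  let ?o = "(\<lambda>_. 0) :: nat \<Rightarrow> real"
  let ?D = "unit_ball n" let ?I = "{0..1::real}" let ?C = "closed_cell c"
  note rem = top_cell_removal[OF F c max]
  have ci: "c \<in> cell_index" using F c by (auto simp: subcx_def)
  have oI: "?o \<in> unit_ball_interior n" by (simp add: unit_ball_interior_def)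
  have C: "?C = \<Phi> ` ?D" by (simp add: closed_cell_def n_def \<Phi>_def)
  have cont: "continuous_on ?D \<Phi>" using char_map_cont[OF ci] by (simp add: n_def \<Phi>_def)
  have inj: "inj_on \<Phi> (unit_ball_interior n)" using char_map_inj[OF ci] by (simp add: n_def \<Phi>_def)
  have int: "\<Phi> ` unit_ball_interior n = snd c" using char_map_open[OF ci] by (simp add: n_def \<Phi>_def)
  have bdA: "\<Phi> v \<in> A'" if "v \<in> ?D" "v \<notin> unit_ball_interior n" for v
    using rem(4)[of v] that unfolding A'_def \<Phi>_def n_def by blast
  have inA: "\<Phi> v \<notin> A'" if "v \<in> unit_ball_interior n" for v
    using rem(3) int that unfolding A'_def by blast
  have AC: "A = A' \<union> ?C" using rem(2) by (simp add: A_def A'_def)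
  have zA: "z \<notin> A'" using inA[OF oI] by (simp add: z_def \<Phi>_def)
  have phi_z: "\<Phi> v = z \<longleftrightarrow> v = ?o" if "v \<in> ?D" for v
  proof
    assume e: "\<Phi> v = z"
    then have "v \<in> unit_ball_interior n" using zA bdA[OF that] by auto
    then show "v = ?o" using inj oI e by (simp add: z_def \<Phi>_def inj_on_def)
  qed (simp add: z_def \<Phi>_def)
  define R where "R = (\<lambda>(t::real,x). if x \<in> A' then x else \<Phi> (push_out n t (inv_into (unit_ball_interior n) \<Phi> x)))"
  have RA': "R (t,x) = x" if "x \<in> A'" for t x using that by (simp add: R_def)
  have Rphi: "R (t, \<Phi> v) = \<Phi> (push_out n t v)" if "v \<in> ?D" "v \<noteq> ?o" "t \<in> ?I" for t v
  proof (cases "v \<in> unit_ball_interior n")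
    case True then show ?thesis using inA[OF True] inv_into_f_f[OF inj True] by (simp add: R_def)
  next
    case False then show ?thesis using bdA[OF that(1) False] push_out(4)[OF that False] by (simp add: R_def)
  qed
  have pt: "x \<in> A' \<or> (\<exists>v\<in>?D. v \<noteq> ?o \<and> x = \<Phi> v)" if "x \<in> A - {z}" for x
  proof -
    have "x \<in> A' \<or> x \<in> \<Phi> ` ?D" using that AC C by blast
    moreover have "v \<noteq> ?o" if "x = \<Phi> v" for v using that \<open>x \<in> A - {z}\<close> by (auto simp: z_def \<Phi>_def)
    ultimately show ?thesis by blast
  qed
  have closedA': "closed A'" unfolding A'_def by (intro compact_imp_closed compact_carrier rem(1))
  have closedC: "closed ?C" by (intro compact_imp_closed compact_closed_cell ci)
  let ?P = "?I \<times> A'" let ?Q = "?I \<times> (?C - {z})"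
  have cP: "continuous_on ?P R"
    by (rule continuous_on_eq[of _ snd]) (auto simp: RA' intro: continuous_intros)
  have cQ: "continuous_on ?Q R"
  proof -
    let ?q = "\<lambda>(t::real, v). (t, \<Phi> v)"
    have cq: "continuous_on (?I \<times> ?D) ?q"
      unfolding case_prod_unfold by (intro continuous_intros continuous_on_compose2[OF cont]) auto
    have "quotient_map (top_of_set (?I \<times> ?D)) (top_of_set (?I \<times> ?C)) ?q"
    proof (rule continuous_imp_quotient_map)
      show "continuous_map (top_of_set (?I \<times> ?D)) (top_of_set (?I \<times> ?C)) ?q"
        using cq by (auto simp: C)
      show "compact_space (top_of_set (?I \<times> ?D))"
        by (simp add: compact_space_subtopology compactin_euclidean_iff compact_Times compact_unit_ball)
      show "Hausdorff_space (top_of_set (?I \<times> ?C))" by (intro Hausdorff_space_subtopology Hausdorff_space_t2)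
      show "?q ` topspace (top_of_set (?I \<times> ?D)) = topspace (top_of_set (?I \<times> ?C))"
        by (auto simp: C image_iff)
    qed
    moreover have "{x \<in> topspace (top_of_set (?I \<times> ?D)). ?q x \<in> ?Q} = ?I \<times> (?D - {?o})"
      using phi_z by (auto simp: C)
    moreover have "openin (top_of_set (?I \<times> ?C)) ?Q"
    proof -
      have "open (UNIV \<times> (- {z}) :: (real \<times> 'a) set)" by (intro open_Times) auto
      moreover have "?Q = (?I \<times> ?C) \<inter> (UNIV \<times> (- {z}))" by auto
      ultimately show ?thesis by (metis openin_open)
    qed
    ultimately have "quotient_map (subtopology (top_of_set (?I \<times> ?D)) (?I \<times> (?D - {?o}))) (subtopology (top_of_set (?I \<times> ?C)) ?Q) ?q"
      using quotient_map_restriction by blast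
    moreover have "(?I \<times> ?D) \<inter> (?I \<times> (?D - {?o})) = ?I \<times> (?D - {?o})" "(?I \<times> ?C) \<inter> ?Q = ?Q" by auto
    ultimately have qm: "quotient_map (top_of_set (?I \<times> (?D - {?o}))) (top_of_set ?Q) ?q"
      by (simp add: subtopology_subtopology)
    have radc: "continuous_on (?I \<times> (?D - {?o})) (\<lambda>z. radius n (snd z))"
      unfolding radius_def by (intro continuous_intros continuous_on_compose2[OF continuous_on_coord]) auto
    have nz: "radius n v \<noteq> 0" if "v \<in> ?D - {?o}" for v using radius_zero that by auto
    have "continuous_on (?I \<times> (?D - {?o})) (\<lambda>z. push_out n (fst z) (snd z))"
      unfolding push_out_def using nz
      by (intro continuous_intros radc continuous_on_compose2[OF continuous_on_coord]) auto
    then have "continuous_on (?I \<times> (?D - {?o})) (\<lambda>z. \<Phi> (push_out n (fst z) (snd z)))"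
    proof (rule continuous_on_compose2[OF cont])
      show "(\<lambda>z. push_out n (fst z) (snd z)) ` (?I \<times> (?D - {?o})) \<subseteq> ?D"
      proof (rule image_subsetI)
        fix w assume "w \<in> ?I \<times> (?D - {?o})"
        then show "push_out n (fst w) (snd w) \<in> ?D" by (intro push_out(1)) (simp_all add: mem_Times_iff)
      qed
    qed
    then have "continuous_on (?I \<times> (?D - {?o})) (R \<circ> ?q)"
    proof (rule continuous_on_eq)
      fix w assume "w \<in> ?I \<times> (?D - {?o})"
      then show "\<Phi> (push_out n (fst w) (snd w)) = (R \<circ> ?q) w"
        using Rphi[of "snd w" "fst w"] by (simp add: mem_Times_iff case_prod_unfold)
    qed
    then have "continuous_map (top_of_set (?I \<times> (?D - {?o}))) euclidean (R \<circ> ?q)" by simp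
    then have "continuous_map (top_of_set ?Q) euclidean R" using continuous_compose_quotient_map[OF qm] by blast
    then show ?thesis by simp
  qed
  have PQ: "?I \<times> (A - {z}) = ?P \<union> ?Q" using AC zA by auto
  have "continuous_on (?P \<union> ?Q) R"
  proof (rule continuous_on_Un_local[OF _ _ cP cQ])
    have "closed (?I \<times> A')" "closed (?I \<times> ?C)" using closedA' closedC by (auto intro: closed_Times)
    moreover have "?P = (?P \<union> ?Q) \<inter> (?I \<times> A')" "?Q = (?P \<union> ?Q) \<inter> (?I \<times> ?C)" using zA AC by auto
    ultimately show "closedin (top_of_set (?P \<union> ?Q)) ?P" "closedin (top_of_set (?P \<union> ?Q)) ?Q"
      by (metis closedin_closed_Int)+
  qed
  then have cR: "continuous_on (?I \<times> (A - {z})) R" by (simp add: PQ)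
  show thesis
  proof (rule that[OF cR _ _ _ RA' zA])
    fix t :: real and x assume t: "t \<in> ?I" and x: "x \<in> A - {z}"
    show "R (t,x) \<in> A"
      using pt[OF x] Rphi[OF _ _ t] RA' push_out(1)[OF _ _ t] AC C by (metis UnI1 UnI2 imageI)
  next
    fix x assume x: "x \<in> A - {z}"
    have "0 \<in> ?I" "1 \<in> ?I" by auto
    then show "R (0,x) = x" "R (1,x) \<in> A'"
      using pt[OF x] Rphi RA' push_out(1,2,5) bdA by metis+
  qed
qed

text \<open>Induction on the number of cells. A point of a cell of maximal dimension has this cell as a neighbourhood, and loops
  in it contract radially. Near any other point, the deformation off the center of the cell moves loops into the
  remaining subcomplex, where the induction hypothesis applies.\<close>

lemma small_loops_subcx:
  "subcx F \<Longrightarrow> y \<in> carrier_of F \<Longrightarrow> \<exists>W. openin (top_of_set (carrier_of F)) W \<and> y \<in> W \<and>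
     (\<forall>p x. path_in W p x x \<longrightarrow> homotopic_paths (carrier_of F) p (\<lambda>_. x))"
proof (induction "card F" arbitrary: F y rule: less_induct)
  case less
  note F = less.prems(1)
  have fin: "finite F" "F \<noteq> {}" using less.prems by (auto simp: subcx_def carrier_of_def)
  have "Max (fst ` F) \<in> fst ` F" using fin by auto
  then obtain c where c: "c \<in> F" "fst c = Max (fst ` F)" by fastforce
  have max: "fst d \<le> fst c" if "d \<in> F" for d using that c(2) fin by auto
  define A where "A = carrier_of F"
  define A' where "A' = carrier_of (F - {c})"
  define z where "z = char_map c (\<lambda>_. 0)"
  note rem = top_cell_removal[OF F c(1) max]
  obtain R where R: "continuous_on ({0..1} \<times> (A - {z})) R" 
    "\<And>t x. t \<in> {0..1::real} \<Longrightarrow> x \<in> A - {z} \<Longrightarrow> R (t,x) \<in> A"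
    "\<And>x. x \<in> A - {z} \<Longrightarrow> R (0,x) = x" "\<And>x. x \<in> A - {z} \<Longrightarrow> R (1,x) \<in> A'"
    "\<And>t x. x \<in> A' \<Longrightarrow> R (t,x) = x" "z \<notin> A'"
    using punctured_deformation[OF F c(1) max] unfolding A_def A'_def z_def by blast
  have A'A: "A' \<subseteq> A" by (auto simp: A_def A'_def carrier_of_def)
  have ci: "c \<in> cell_index" using F c by (auto simp: subcx_def)
  have yA: "y \<in> A" using less.prems by (simp add: A_def)
  show ?case
  proof (cases "y \<in> A'")
    case True
    have "card (F - {c}) < card F" using fin c by (meson card_Diff1_less)
    then obtain W' where W': "openin (top_of_set A') W'" "y \<in> W'"
       "\<And>p x. path_in W' p x x \<Longrightarrow> homotopic_paths A' p (\<lambda>_. x)"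
      using less.hyps[OF _ rem(1), of y] True unfolding A'_def by blast
    define W where "W = (A - {z}) \<inter> (\<lambda>x. R (1,x)) -` W'"
    have c1: "continuous_on (A - {z}) (\<lambda>x. R (1,x))"
      by (rule continuous_on_compose2[OF R(1)]) (auto intro!: continuous_intros)
    have "openin (top_of_set (A - {z})) W"
      unfolding W_def by (rule continuous_openin_preimage[OF c1 _ W'(1)]) (use R(4) in auto)
    moreover have "openin (top_of_set A) (A - {z})" by (simp add: openin_delete)
    ultimately have oW: "openin (top_of_set A) W" by (rule openin_trans)
    have yW: "y \<in> W" using True A'A R(5)[OF True] R(6) W'(2) by (auto simp: W_def)
    have "homotopic_paths A p (\<lambda>_. x)" if p: "path_in W p x x" for p x
    proof -
      have pW: "p s \<in> A - {z}" "R (1, p s) \<in> W'" if "s \<in> {0..1}" for s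
        using p that unfolding path_in_def path_image_def W_def by blast+
      have pc: "continuous_on {0..1} p" using p by (simp add: path_in_def path_def)
      have pp: "p 0 = x" "p 1 = x" using p by (auto simp: path_in_def pathstart_def pathfinish_def)
      have ch: "continuous_on ({0..1} \<times> {0..1}) (\<lambda>w. R (fst w, p (snd w)))"
      proof (rule continuous_on_compose2[OF R(1)])
        show "continuous_on ({0..1} \<times> {0..1}) (\<lambda>w::real \<times> real. (fst w, p (snd w)))"
          by (intro continuous_intros continuous_on_compose2[OF pc]) auto
        have "(fst w, p (snd w)) \<in> {0..1} \<times> (A - {z})" if "w \<in> {0..1} \<times> {0..1}" for w
          using pW(1)[of "snd w"] that by (simp add: mem_Times_iff)
        then show "(\<lambda>w. (fst w, p (snd w))) ` ({0..1} \<times> {0..1}) \<subseteq> {0..1} \<times> (A - {z})" by blast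
      qed
      have h1: "homotopic_loops A p (\<lambda>s. R (1, p s))"
        unfolding homotopic_loops
        by (rule exI[of _ "\<lambda>w. R (fst w, p (snd w))"]) (use ch pW R(2,3) pp in \<open>auto simp: pathstart_def pathfinish_def\<close>)
      have "continuous_on {0..1} (\<lambda>s. R (1, p s))"
        using pW(1) by (intro continuous_on_compose2[OF c1] pc) blast
      then have "path_in W' (\<lambda>s. R (1, p s)) (R (1,x)) (R (1,x))"
        using pW pp by (auto simp: path_in_def path_def path_image_def pathstart_def pathfinish_def)
      then have "homotopic_paths A' (\<lambda>s. R (1, p s)) (\<lambda>_. R (1,x))" by (rule W'(3))
      then have "homotopic_paths A (\<lambda>s. R (1, p s)) (\<lambda>_. R (1,x))" using A'A homotopic_paths_subset by blast
      then have "homotopic_loops A (\<lambda>s. R (1, p s)) (\<lambda>_. R (1,x))"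
        by (rule homotopic_paths_imp_homotopic_loops) (auto simp: pp pathstart_def pathfinish_def)
      then have "homotopic_loops A p (\<lambda>_. R (1,x))" using h1 homotopic_loops_trans by blast
      then show ?thesis using hom_null_of_homotopic_loops[of A p] pp by (simp add: pathstart_def)
    qed
    then show ?thesis using oW yW unfolding A_def by blast
  next
    case False
    have W: "snd c = A - A'" using rem(3) by (simp add: A_def A'_def)
    have "closed A'" unfolding A'_def by (intro compact_imp_closed compact_carrier rem(1))
    then have oW: "openin (top_of_set A) (snd c)" unfolding W
      by (simp add: Diff_eq open_Compl openin_open_Int)
    define n where "n = fst c"
    define \<Phi> where "\<Phi> = char_map c"
    have "homeomorphic_map (top_of_set (unit_ball_interior n)) (top_of_set (snd c)) \<Phi>"
      using char_map_homeo[OF ci] by (simp add: n_def \<Phi>_def)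
    then obtain g where g: "homeomorphic_maps (top_of_set (unit_ball_interior n)) (top_of_set (snd c)) \<Phi> g"
      by (meson homeomorphic_map_maps)
    have gc: "continuous_on (snd c) g" "\<And>x. x \<in> snd c \<Longrightarrow> g x \<in> unit_ball_interior n" "\<And>x. x \<in> snd c \<Longrightarrow> \<Phi> (g x) = x"
      using g by (auto simp: homeomorphic_maps_def)
    have cont: "continuous_on (unit_ball n) \<Phi>" using char_map_cont[OF ci] by (simp add: n_def \<Phi>_def)
    have CA: "\<Phi> ` unit_ball n \<subseteq> A" using rem(2) by (auto simp: A_def n_def \<Phi>_def closed_cell_def)
    have "homotopic_paths A p (\<lambda>_. x)" if p: "path_in (snd c) p x x" for p x
    proof -
      have pW: "p s \<in> snd c" if "s \<in> {0..1}" for s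
        using p that unfolding path_in_def path_image_def by blast
      have pc: "continuous_on {0..1} p" using p by (simp add: path_in_def path_def)
      have pp: "p 0 = x" "p 1 = x" using p by (auto simp: path_in_def pathstart_def pathfinish_def)
      let ?k = "\<lambda>w. (\<lambda>i. (1 - fst w) * g (p (snd w)) i) :: nat \<Rightarrow> real"
      have gp: "continuous_on ({0..1} \<times> {0..1}) (\<lambda>w. g (p (snd w)))"
        using pW by (intro continuous_on_compose2[OF gc(1)] continuous_on_compose2[OF pc] continuous_intros) auto
      have ck: "continuous_on ({0..1} \<times> {0..1}) ?k"
        by (intro continuous_on_coordinatewise_then_product continuous_on_mult continuous_intros
             continuous_on_product_then_coordinatewise[OF gp])
      have kin: "?k w \<in> unit_ball n" if "w \<in> {0..1} \<times> {0..1}" for w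
      proof -
        have "g (p (snd w)) \<in> unit_ball_interior n" using gc(2) pW that by auto
        then have v: "\<forall>i\<ge>n. g (p (snd w)) i = 0" "radius n (g (p (snd w))) < 1"
          by (auto simp: unit_ball_interior_radius)
        have "radius n (?k w) = \<bar>1 - fst w\<bar> * radius n (g (p (snd w)))" by (rule radius_scale)
        also have "\<dots> \<le> 1 * 1" using v that by (intro mult_mono) (auto simp: radius_nonneg)
        finally show ?thesis using v by (simp add: unit_ball_radius)
      qed
      have ch: "continuous_on ({0..1} \<times> {0..1}) (\<lambda>w. \<Phi> (?k w))"
        using kin by (intro continuous_on_compose2[OF cont ck]) blast
      have "homotopic_loops A p (\<lambda>_. z)"
        unfolding homotopic_loops
      proof (intro exI[of _ "\<lambda>w. \<Phi> (?k w)"] conjI ballI ch)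
        show "(\<lambda>w. \<Phi> (?k w)) \<in> {0..1} \<times> {0..1} \<rightarrow> A" using kin CA by blast
        show "\<Phi> (?k (0,x)) = p x" if "x \<in> {0..1}" for x using gc(3)[OF pW[OF that]] by simp
        show "\<Phi> (?k (1,x)) = z" for x by (simp add: z_def \<Phi>_def)
        show "pathfinish ((\<lambda>w. \<Phi> (?k w)) \<circ> Pair t) = pathstart ((\<lambda>w. \<Phi> (?k w)) \<circ> Pair t)" for t
          by (simp add: pathstart_def pathfinish_def pp)
      qed
      then show ?thesis using hom_null_of_homotopic_loops[of A p] pp by (simp add: pathstart_def)
    qed
    moreover have "y \<in> snd c" using False yA W by blast
    ultimately show ?thesis using oW unfolding A_def by blast
  qed
qed

text \<open>Iterating the choice of a finite subcomplex that is a neighbourhood of the previous one gives a union that is open;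
  it is closed as a union of cells that contains the closed cells of its cells, so it is all of the connected \<open>Y\<close>.\<close>

lemma exhaustion_CW:
  assumes "connected Y" "y0 \<in> Y"
  shows "\<exists>K :: nat \<Rightarrow> 'a set. (\<forall>n. compact (K n) \<and> K n \<noteq> {} \<and> K n \<subseteq> Y \<and>
          (\<exists>V. openin (top_of_set Y) V \<and> K n \<subseteq> V \<and> V \<subseteq> K (Suc n))) \<and> (\<Union>n. K n) = Y"
proof -
  have "\<exists>G. subcx F \<longrightarrow> subcx G \<and> (\<exists>V. openin (top_of_set Y) V \<and> carrier_of F \<subseteq> V \<and> V \<subseteq> carrier_of G)" for F
    using compact_in_subcx[OF compact_carrier carrier_subset] by metis
  then obtain N where N: "\<And>F. subcx F \<Longrightarrow> subcx (N F) \<and> (\<exists>V. openin (top_of_set Y) V \<and> carrier_of F \<subseteq> V \<and> V \<subseteq> carrier_of (N F))"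
    by metis
  obtain F0 where F0: "subcx F0" "y0 \<in> carrier_of F0"
    using compact_in_subcx[of "{y0}"] assms(2) by (metis compact_sing empty_subsetI insert_subset subsetD)
  define G where "G n = (N ^^ n) F0" for n
  have G: "subcx (G n)" for n by (induction n) (use F0 N in \<open>auto simp: G_def\<close>)
  have step: "\<exists>V. openin (top_of_set Y) V \<and> carrier_of (G n) \<subseteq> V \<and> V \<subseteq> carrier_of (G (Suc n))" for n
    using N[OF G[of n]] by (simp add: G_def)
  define Z where "Z = (\<Union>n. carrier_of (G n))"
  have ZY: "Z \<subseteq> Y" using carrier_subset[OF G] by (auto simp: Z_def)
  have "openin (top_of_set Y) Z"
  proof -
    obtain V where V: "\<And>n. openin (top_of_set Y) (V n) \<and> carrier_of (G n) \<subseteq> V n \<and> V n \<subseteq> carrier_of (G (Suc n))"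
      using step by metis
    have "Z = (\<Union>n. V n)"
    proof
      show "Z \<subseteq> (\<Union>n. V n)" unfolding Z_def using V by (intro UN_mono) auto
      show "(\<Union>n. V n) \<subseteq> Z" unfolding Z_def using V by (intro UN_least) (meson UN_upper UNIV_I order_trans)
    qed
    then show ?thesis using V by auto
  qed
  moreover have "closedin (top_of_set Y) Z"
  proof -
    have "closedin (top_of_set Y) (Z \<inter> closure e)" if e: "e \<in> cells E" for e
    proof -
      obtain n where c: "(n,e) \<in> cell_index" using e by (auto simp: cells_def cell_index_def)
      obtain H where H: "subcx H" "(n,e) \<in> H" using subcx_exists[OF c] by blast
      have Hi: "H \<subseteq> cell_index" "finite H" using H by (auto simp: subcx_def)
      have Gi: "(\<Union>n. G n) \<subseteq> cell_index" using G by (auto simp: subcx_def)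
      let ?B = "\<Union>d\<in>H \<inter> (\<Union>n. G n). closed_cell d"
      have eH: "closure e \<subseteq> carrier_of H"
        using closure_cell[OF c] H(2) unfolding carrier_eq_closed_cells[OF H(1)] by auto
      have "?B \<subseteq> Z"
      proof -
        have "closed_cell d \<subseteq> Z" if "d \<in> G n" for d n
          using that unfolding Z_def carrier_eq_closed_cells[OF G] by blast
        then show ?thesis by blast
      qed
      moreover have "Z \<inter> carrier_of H \<subseteq> ?B"
      proof
        fix x assume x: "x \<in> Z \<inter> carrier_of H"
        then obtain d n where d: "d \<in> H" "x \<in> snd d" "x \<in> carrier_of (G n)" by (auto simp: Z_def carrier_of_def)
        then obtain d' where d': "d' \<in> G n" "x \<in> snd d'" unfolding carrier_of_def by blast
        have "d = d'" using cell_disjoint[of d d'] d d' Hi Gi by blast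
        then show "x \<in> ?B" using d d' Hi cell_subset[of d] by blast
      qed
      ultimately have "Z \<inter> closure e = ?B \<inter> closure e" using eH by blast
      moreover have "closed (?B \<inter> closure e)"
        using Hi by (intro closed_Int compact_imp_closed compact_UN) (auto intro: compact_closed_cell)
      ultimately show ?thesis using ZY by (metis closed_subset inf.coboundedI1)
    qed
    then show ?thesis using CW ZY by (simp add: CW_structure_def)
  qed
  ultimately have "Z = {} \<or> Z = Y" using assms(1) by (simp add: connected_clopen)
  moreover have "y0 \<in> carrier_of (G n)" for n
  proof (induction n)
    case (Suc n) then show ?case using step[of n] by blast
  qed (use F0 in \<open>simp add: G_def\<close>)
  ultimately have "Z = Y" "\<And>n. carrier_of (G n) \<noteq> {}" unfolding Z_def by blast+
  then show ?thesis
    by (intro exI[of _ "\<lambda>n. carrier_of (G n)"] conjI allI compact_carrier carrier_subset G step) (auto simp: Z_def)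
qed

lemma nice: 
  assumes "simply_connected Y"
  shows "nice_space Y"
proof
  show "locally path_connected Y" by (rule locally_path_connected_CW)
  show "simply_connected Y" by fact
  show "\<exists>V L. openin (top_of_set Y) V \<and> K \<subseteq> V \<and> V \<subseteq> L \<and> compact L \<and> L \<subseteq> Y" if "compact K" "K \<subseteq> Y" for K
    using compact_in_subcx[OF that] compact_carrier carrier_subset by metis
  show "\<exists>W L. openin (top_of_set Y) W \<and> y \<in> W \<and> compact L \<and> L \<subseteq> Y \<and> (\<forall>p x. path_in W p x x \<longrightarrow> homotopic_paths L p (\<lambda>_. x))" if "y \<in> Y" for y
  proof -
    obtain F V where FV: "subcx F" "openin (top_of_set Y) V" "{y} \<subseteq> V" "V \<subseteq> carrier_of F"
      using compact_in_subcx[of "{y}"] \<open>y \<in> Y\<close> by auto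
    obtain W where W: "openin (top_of_set (carrier_of F)) W" "y \<in> W" 
        "\<And>p x. path_in W p x x \<Longrightarrow> homotopic_paths (carrier_of F) p (\<lambda>_. x)"
      using small_loops_subcx[OF FV(1), of y] FV by blast
    obtain T where T: "open T" "W = carrier_of F \<inter> T" using W(1) by (auto simp: openin_open)
    have "W \<inter> V = V \<inter> T" using T FV(4) by blast
    then have "openin (top_of_set Y) (W \<inter> V)" using FV(2) T(1) by (simp add: openin_Int_open)
    then show ?thesis using W FV compact_carrier carrier_subset path_in_mono[of "W \<inter> V" _ _ _ W]
      by (intro exI[of _ "W \<inter> V"] exI[of _ "carrier_of F"]) auto
  qed
  have "path_component Y x y" if xy: "x \<in> Y" "y \<in> Y" for x y
  proof -
    obtain p where "path_in Y p x y" by (rule simply_connected_path[OF assms xy])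
    then show ?thesis unfolding path_component_def path_in_def by blast
  qed
  then have "connected Y" by (simp add: path_connected_component path_connected_imp_connected)
  then show "\<exists>K :: nat \<Rightarrow> 'a set. (\<forall>n. compact (K n) \<and> K n \<noteq> {} \<and> K n \<subseteq> Y \<and>
          (\<exists>V. openin (top_of_set Y) V \<and> K n \<subseteq> V \<and> V \<subseteq> K (Suc n))) \<and> (\<Union>n. K n) = Y" if "Y \<noteq> {}"
    using exhaustion_CW that by blast
qed

end

section \<open>Paths cut into pieces\<close>

lemma path_connected_path_in: "path_connected S \<Longrightarrow> x \<in> S \<Longrightarrow> y \<in> S \<Longrightarrow> \<exists>p. path_in S p x y"
  unfolding path_connected_def path_in_def by blast

lemma path_connected_of_paths: "(\<And>x y. x \<in> S \<Longrightarrow> y \<in> S \<Longrightarrow> \<exists>p. path_in S p x y) \<Longrightarrow> path_connected S"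
  unfolding path_connected_def path_in_def by blast

lemma path_cont: "path_in S p x y \<Longrightarrow> continuous_on {0..1} p" "path_in S p x y \<Longrightarrow> p ` {0..1} \<subseteq> S"
  "path_in S p x y \<Longrightarrow> p 0 = x" "path_in S p x y \<Longrightarrow> p 1 = y"
  by (auto simp: path_in_def path_def path_image_def pathstart_def pathfinish_def)

lemma path_inI: "continuous_on {0..1} p \<Longrightarrow> p ` {0..1} \<subseteq> S \<Longrightarrow> p 0 = x \<Longrightarrow> p 1 = y \<Longrightarrow> path_in S p x y"
  by (auto simp: path_in_def path_def path_image_def pathstart_def pathfinish_def)

lemma path_in_image: "path_in S p x y \<Longrightarrow> path_image p \<subseteq> T \<Longrightarrow> path_in T p x y"
  by (simp add: path_in_def)

lemma image_split: "a \<le> b \<Longrightarrow> b \<le> c \<Longrightarrow> f ` {a..c} = f ` {a..b} \<union> f ` {b..c::real}"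
  by (simp add: image_Un[symmetric] ivl_disj_un_two_touch)

text \<open>A path from \<open>A\<close> to \<open>A\<close> in the union of the open sets \<open>A\<close> and \<open>B\<close> is a composite of paths in
  \<open>A\<close> and of paths in \<open>B\<close> between points of \<open>A\<close>.\<close>

lemma two_cover_chain:
  fixes \<gamma> :: "real \<Rightarrow> 'a::topological_space"
  assumes \<gamma>: "continuous_on {0..1} \<gamma>" "\<gamma> ` {0..1} \<subseteq> Y"
    and AB: "openin (top_of_set Y) A" "openin (top_of_set Y) B" "Y \<subseteq> A \<union> B"
    and trans: "\<And>s t u. 0 \<le> s \<Longrightarrow> s \<le> t \<Longrightarrow> t \<le> u \<Longrightarrow> u \<le> 1 \<Longrightarrow> \<gamma> s \<in> A \<Longrightarrow> \<gamma> t \<in> A \<Longrightarrow> \<gamma> u \<in> A \<Longrightarrow> R s t \<Longrightarrow> R t u \<Longrightarrow> R s u"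
    and RA: "\<And>s t. 0 \<le> s \<Longrightarrow> s \<le> t \<Longrightarrow> t \<le> 1 \<Longrightarrow> \<gamma> ` {s..t} \<subseteq> A \<Longrightarrow> R s t"
    and RB: "\<And>s t. 0 \<le> s \<Longrightarrow> s \<le> t \<Longrightarrow> t \<le> 1 \<Longrightarrow> \<gamma> ` {s..t} \<subseteq> B \<Longrightarrow> \<gamma> s \<in> A \<Longrightarrow> \<gamma> t \<in> A \<Longrightarrow> R s t"
    and ends: "\<gamma> 0 \<in> A" "\<gamma> 1 \<in> A"
  shows "R 0 1"
proof -
  define Q where "Q s t \<longleftrightarrow> (\<exists>s' t'. s \<le> s' \<and> s' \<le> t' \<and> t' \<le> t \<and> \<gamma> s' \<in> A \<and> \<gamma> t' \<in> A \<and> R s' t' \<and>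
      (s = s' \<or> \<gamma> ` {s..s'} \<subseteq> B) \<and> (t' = t \<or> \<gamma> ` {t'..t} \<subseteq> B))" for s t
  \<comment> \<open>Either the whole piece lies in \<open>B\<close>, or it does so before its first and after its last chosen point of \<open>A\<close>.\<close>
  define P where "P s t \<longleftrightarrow> (0 \<le> s \<and> s \<le> t \<and> t \<le> 1 \<longrightarrow> \<gamma> ` {s..t} \<subseteq> B \<or> Q s t)" for s t
  have near: "\<exists>d>0. \<forall>s. s \<in> {0..1} \<and> \<bar>s - x\<bar> < d \<longrightarrow> \<gamma> s \<in> C" if x: "x \<in> {0..1}" "\<gamma> x \<in> C" and C: "openin (top_of_set Y) C" for x C
  proof -
    have "openin (top_of_set {0..1}) ({0..1} \<inter> \<gamma> -` C)"
      by (rule continuous_openin_preimage[OF \<gamma>(1) _ C]) (use \<gamma>(2) in auto)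
    moreover have "x \<in> {0..1} \<inter> \<gamma> -` C" using x by auto
    ultimately obtain d where d: "d > 0" "\<forall>s\<in>{0..1}. dist s x < d \<longrightarrow> s \<in> {0..1} \<inter> \<gamma> -` C"
      unfolding openin_euclidean_subtopology_iff by blast
    then show ?thesis by (intro exI[of _ d]) (auto simp: dist_real_def)
  qed
  have joinR: "R t' s''" if "0 \<le> t'" "t' \<le> t" "t \<le> s''" "s'' \<le> 1" "\<gamma> t' \<in> A" "\<gamma> s'' \<in> A"
    "(t' = t \<or> \<gamma> ` {t'..t} \<subseteq> B)" "t = s'' \<or> \<gamma> ` {t..s''} \<subseteq> B" for t' t s''
  proof -
    have e: "\<gamma> ` {t'..s''} = \<gamma> ` {t'..t} \<union> \<gamma> ` {t..s''}" using that by (intro image_split) auto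
    show ?thesis
    proof (cases "t' = t \<and> t = s''")
      case True then show ?thesis using RA[of t' s''] that by auto
    next
      case False
      then have "\<gamma> ` {t'..s''} \<subseteq> B"
      proof (cases "t' = t")
        case True
        then have "\<gamma> ` {t..s''} \<subseteq> B" using False that(8) by blast
        then show ?thesis using True by simp
      next
        case False
        then have "\<gamma> ` {t'..t} \<subseteq> B" using that(7) by blast
        moreover from this have "\<gamma> ` {t..s''} \<subseteq> B" using that(2,3,8) by (cases "t = s''") auto
        ultimately show ?thesis using e by blast
      qed
      then show ?thesis using RB[of t' s''] that by auto
    qed
  qed
  have "P 0 1"
  proof (rule Bolzano[of 0 1 P])
    show "(0::real) \<le> 1" by simp
    fix s t u assume P: "P s t" "P t u" and le: "s \<le> t" "t \<le> u"
    show "P s u" unfolding P_def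
    proof
      assume b: "0 \<le> s \<and> s \<le> u \<and> u \<le> 1"
      have e: "\<gamma> ` {s..u} = \<gamma> ` {s..t} \<union> \<gamma> ` {t..u}" using le by (intro image_split) auto
      consider "\<gamma> ` {s..t} \<subseteq> B" "\<gamma> ` {t..u} \<subseteq> B" | "\<gamma> ` {s..t} \<subseteq> B" "Q t u" | "Q s t" "\<gamma> ` {t..u} \<subseteq> B" | "Q s t" "Q t u"
        using P b le unfolding P_def by auto
      then show "\<gamma> ` {s..u} \<subseteq> B \<or> Q s u"
      proof cases
        case 1 then show ?thesis using e by simp
      next
        case 2
        obtain s' t' where q: "t \<le> s'" "s' \<le> t'" "t' \<le> u" "\<gamma> s' \<in> A" "\<gamma> t' \<in> A" "R s' t'"
          "(t = s' \<or> \<gamma> ` {t..s'} \<subseteq> B)" "(t' = u \<or> \<gamma> ` {t'..u} \<subseteq> B)"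
          using 2(2) unfolding Q_def by blast
        have "\<gamma> ` {s..s'} = \<gamma> ` {s..t} \<union> \<gamma> ` {t..s'}" using le q by (intro image_split) auto
        moreover have "\<gamma> ` {t..s'} \<subseteq> B" using q(7) 2(1) le by (cases "t = s'") auto
        ultimately have "\<gamma> ` {s..s'} \<subseteq> B" using 2(1) by simp
        then have "Q s u" unfolding Q_def using q le by (intro exI[of _ s'] exI[of _ t'] conjI) simp_all
        then show ?thesis ..
      next
        case 3
        obtain s' t' where q: "s \<le> s'" "s' \<le> t'" "t' \<le> t" "\<gamma> s' \<in> A" "\<gamma> t' \<in> A" "R s' t'"
          "(s = s' \<or> \<gamma> ` {s..s'} \<subseteq> B)" "(t' = t \<or> \<gamma> ` {t'..t} \<subseteq> B)"
          using 3(1) unfolding Q_def by blast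
        have "\<gamma> ` {t'..u} = \<gamma> ` {t'..t} \<union> \<gamma> ` {t..u}" using le q by (intro image_split) auto
        moreover have "\<gamma> ` {t'..t} \<subseteq> B" using q(8) 3(2) le by (cases "t' = t") auto
        ultimately have "\<gamma> ` {t'..u} \<subseteq> B" using 3(2) by simp
        then have "Q s u" unfolding Q_def using q le by (intro exI[of _ s'] exI[of _ t'] conjI) simp_all
        then show ?thesis ..
      next
        case 4
        obtain s' t' where q: "s \<le> s'" "s' \<le> t'" "t' \<le> t" "\<gamma> s' \<in> A" "\<gamma> t' \<in> A" "R s' t'"
          "(s = s' \<or> \<gamma> ` {s..s'} \<subseteq> B)" "(t' = t \<or> \<gamma> ` {t'..t} \<subseteq> B)"
          using 4(1) unfolding Q_def by blast
        obtain s2 t2 where q2: "t \<le> s2" "s2 \<le> t2" "t2 \<le> u" "\<gamma> s2 \<in> A" "\<gamma> t2 \<in> A" "R s2 t2"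
          "(t = s2 \<or> \<gamma> ` {t..s2} \<subseteq> B)" "(t2 = u \<or> \<gamma> ` {t2..u} \<subseteq> B)"
          using 4(2) unfolding Q_def by blast
        have "R t' s2" using joinR[of t' t s2] q q2 b by linarith
        then have "R s' s2" using trans[of s' t' s2] q q2 b by linarith
        then have "R s' t2" using trans[of s' s2 t2] q q2 b by linarith
        then have "Q s u" unfolding Q_def using q q2 by (intro exI[of _ s'] exI[of _ t2] conjI) simp_all
        then show ?thesis ..
      qed
    qed
  next
    fix x :: real assume x: "0 \<le> x" "x \<le> 1"
    then have xI: "x \<in> {0..1}" by simp
    then have "\<gamma> x \<in> A \<or> \<gamma> x \<in> B" using \<gamma>(2) AB(3) by (auto simp: image_subset_iff)
    then show "\<exists>d>0. \<forall>a b. a \<le> x \<and> x \<le> b \<and> b - a < d \<longrightarrow> P a b"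
    proof
      assume "\<gamma> x \<in> A"
      then obtain d where d: "d > 0" "\<And>s. s \<in> {0..1} \<Longrightarrow> \<bar>s - x\<bar> < d \<Longrightarrow> \<gamma> s \<in> A"
        using near[OF xI \<open>\<gamma> x \<in> A\<close> AB(1)] by blast
      have "P a b" if h: "a \<le> x" "x \<le> b" "b - a < d" for a b
        unfolding P_def
      proof
        assume ab: "0 \<le> a \<and> a \<le> b \<and> b \<le> 1"
        have "\<gamma> ` {a..b} \<subseteq> A" using d(2) h ab by auto
        then have "Q a b" unfolding Q_def using RA[of a b] ab by (intro exI[of _ a] exI[of _ b]) auto
        then show "\<gamma> ` {a..b} \<subseteq> B \<or> Q a b" ..
      qed
      then show ?thesis using d(1) by blast
    next
      assume "\<gamma> x \<in> B"
      then obtain d where d: "d > 0" "\<And>s. s \<in> {0..1} \<Longrightarrow> \<bar>s - x\<bar> < d \<Longrightarrow> \<gamma> s \<in> B"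
        using near[OF xI \<open>\<gamma> x \<in> B\<close> AB(2)] by blast
      have "P a b" if h: "a \<le> x" "x \<le> b" "b - a < d" for a b
        unfolding P_def using d(2) h by auto
      then show ?thesis using d(1) by blast
    qed
  qed
  then consider "\<gamma> ` {0..1} \<subseteq> B" | "Q 0 1" unfolding P_def by auto
  then show ?thesis
  proof cases
    case 1 then show ?thesis using RB[of 0 1] ends by simp
  next
    case 2
    obtain s' t' where q: "0 \<le> s'" "s' \<le> t'" "t' \<le> 1" "\<gamma> s' \<in> A" "\<gamma> t' \<in> A" "R s' t'"
      "(0 = s' \<or> \<gamma> ` {0..s'} \<subseteq> B)" "(t' = 1 \<or> \<gamma> ` {t'..1} \<subseteq> B)"
      using 2 unfolding Q_def by blast
    have "R 0 s'" using joinR[of 0 0 s'] q ends by auto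
    then have "R 0 t'" using trans[of 0 s' t'] q ends by auto
    moreover have "R t' 1" using joinR[of t' 1 1] q ends by auto
    ultimately show ?thesis using trans[of 0 t' 1] q ends by auto
  qed
qed

text \<open>The form of Bolzano's principle in which a transitive relation is verified on short pieces of a path.\<close>

lemma Bolzano_path:
  fixes \<gamma> :: "real \<Rightarrow> 'a::topological_space"
  assumes \<gamma>: "continuous_on {0..1} \<gamma>" "\<gamma> ` {0..1} \<subseteq> Y"
    and cover: "\<And>x. x \<in> {0..1} \<Longrightarrow> \<exists>V. openin (top_of_set Y) V \<and> \<gamma> x \<in> V \<and>
        (\<forall>s t. 0 \<le> s \<longrightarrow> s \<le> t \<longrightarrow> t \<le> 1 \<longrightarrow> \<gamma> ` {s..t} \<subseteq> V \<longrightarrow> R s t)"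
    and trans: "\<And>s t u. 0 \<le> s \<Longrightarrow> s \<le> t \<Longrightarrow> t \<le> u \<Longrightarrow> u \<le> 1 \<Longrightarrow> R s t \<Longrightarrow> R t u \<Longrightarrow> R s u"
  shows "R 0 1"
proof -
  have "0 \<le> (0::real) \<and> (0::real) \<le> 1 \<and> (1::real) \<le> 1 \<longrightarrow> R 0 1"
  proof (rule Bolzano[of 0 1 "\<lambda>s t. 0 \<le> s \<and> s \<le> t \<and> t \<le> 1 \<longrightarrow> R s t"])
    show "0 \<le> a \<and> a \<le> c \<and> c \<le> 1 \<longrightarrow> R a c"
      if "0 \<le> a \<and> a \<le> b \<and> b \<le> 1 \<longrightarrow> R a b" "0 \<le> b \<and> b \<le> c \<and> c \<le> 1 \<longrightarrow> R b c" "a \<le> b" "b \<le> c" for a b c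
      using trans[of a b c] that by linarith
    fix x :: real assume x: "0 \<le> x" "x \<le> 1"
    obtain V where V: "openin (top_of_set Y) V" "\<gamma> x \<in> V" "\<And>s t. 0 \<le> s \<Longrightarrow> s \<le> t \<Longrightarrow> t \<le> 1 \<Longrightarrow> \<gamma> ` {s..t} \<subseteq> V \<Longrightarrow> R s t"
      using cover[of x] x by auto
    have "openin (top_of_set {0..1}) ({0..1} \<inter> \<gamma> -` V)"
      by (rule continuous_openin_preimage[OF \<gamma>(1) _ V(1)]) (use \<gamma>(2) in auto)
    moreover have "x \<in> {0..1} \<inter> \<gamma> -` V" using x V by auto
    ultimately obtain d where d: "d > 0" "\<forall>s\<in>{0..1}. dist s x < d \<longrightarrow> s \<in> {0..1} \<inter> \<gamma> -` V"
      unfolding openin_euclidean_subtopology_iff by blast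
    have "R a b" if h: "a \<le> x" "x \<le> b" "b - a < d" "0 \<le> a" "a \<le> b" "b \<le> 1" for a b
    proof (rule V(3))
      show "\<gamma> ` {a..b} \<subseteq> V"
      proof
        fix y assume "y \<in> \<gamma> ` {a..b}"
        then obtain s where s: "s \<in> {a..b}" "y = \<gamma> s" by blast
        then have "s \<in> {0..1}" "dist s x < d" using h by (auto simp: dist_real_def)
        then show "y \<in> V" using d(2) s by auto
      qed
    qed (use h in auto)
    then show "\<exists>d>0. \<forall>a b. a \<le> x \<and> x \<le> b \<and> b - a < d \<longrightarrow> 0 \<le> a \<and> a \<le> b \<and> b \<le> 1 \<longrightarrow> R a b"
      using d(1) by blast
  qed simp
  then show ?thesis by simp
qed

section \<open>Rays in locally finite graphs\<close>

text \<open>Koenig's lemma. The ray follows shortest paths from \<open>v\<close>, through vertices that lie on shortest paths to infinitely many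
  others; so the distance from \<open>v\<close> grows along it, and it is injective.\<close>

lemma ray_of_infinite:
  assumes inf: "infinite {w. adj\<^sup>*\<^sup>* v w}" and fin: "\<And>x. finite {w. adj x w}"
  obtains f :: "nat \<Rightarrow> 'v" where "f 0 = v" "\<forall>i. adj (f i) (f (Suc i))" "inj f"
proof -
  define d where "d w = (LEAST n. (adj ^^ n) v w)" for w
  define desc where "desc x = {w. \<exists>n. d w = d x + n \<and> (adj ^^ n) x w \<and> adj\<^sup>*\<^sup>* v w}" for x
  have dle: "d w \<le> n" if "(adj ^^ n) v w" for n w unfolding d_def using that by (rule Least_le)
  have dat: "(adj ^^ d w) v w" if "adj\<^sup>*\<^sup>* v w" for w
    unfolding d_def using that rtranclp_imp_relpowp by (metis LeastI)
  have dv: "d v = 0" using dle[of 0 v] by simp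
  have "desc v = {w. adj\<^sup>*\<^sup>* v w}" using dat dv by (auto simp: desc_def)
  then have 0: "adj\<^sup>*\<^sup>* v v \<and> infinite (desc v)" using inf by simp
  have step: "\<exists>y. (adj\<^sup>*\<^sup>* v y \<and> infinite (desc y)) \<and> adj x y \<and> d y = Suc (d x)" if x: "adj\<^sup>*\<^sup>* v x \<and> infinite (desc x)" for x
  proof (rule ccontr)
    assume neg: "\<not> ?thesis"
    have "desc x \<subseteq> {x} \<union> (\<Union>y\<in>{y. adj x y \<and> d y = Suc (d x)}. desc y)"
    proof
      fix w assume "w \<in> desc x"
      then obtain n where n: "d w = d x + n" "(adj ^^ n) x w" "adj\<^sup>*\<^sup>* v w" by (auto simp: desc_def)
      show "w \<in> {x} \<union> (\<Union>y\<in>{y. adj x y \<and> d y = Suc (d x)}. desc y)"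
      proof (cases n)
        case 0 then show ?thesis using n by simp
      next
        case (Suc m)
        then obtain y where y: "adj x y" "(adj ^^ m) y w" using n(2) relpowp_Suc_D2 by metis
        have "(adj ^^ Suc (d x)) v y" using dat[of x] x y(1) by auto
        then have 1: "d y \<le> Suc (d x)" by (rule dle)
        have "adj\<^sup>*\<^sup>* v y" using x y(1) by auto
        then have "(adj ^^ (d y + m)) v w" using dat[of y] y(2) by (auto simp: relpowp_add)
        then have "d w \<le> d y + m" by (rule dle)
        then have "d y = Suc (d x)" "d w = d y + m" using 1 n(1) Suc by auto
        then show ?thesis using y n(3) by (auto simp: desc_def)
      qed
    qed
    moreover have "finite (desc y)" if "adj x y" "d y = Suc (d x)" for y
    proof -
      have "adj\<^sup>*\<^sup>* v y" using x that(1) by (meson rtranclp.rtrancl_into_rtrancl)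
      then show ?thesis using neg that by blast
    qed
    then have "finite ({x} \<union> (\<Union>y\<in>{y. adj x y \<and> d y = Suc (d x)}. desc y))" using fin[of x] by auto
    ultimately show False using x finite_subset by blast
  qed
  obtain f where f: "\<And>n. adj\<^sup>*\<^sup>* v (f n) \<and> infinite (desc (f n))" "\<And>n. adj (f n) (f (Suc n)) \<and> d (f (Suc n)) = Suc (d (f n))" "f 0 = v"
  proof -
    have "\<exists>f. f 0 = v \<and> (\<forall>n. (adj\<^sup>*\<^sup>* v (f n) \<and> infinite (desc (f n)))) \<and> (\<forall>n. adj (f n) (f (Suc n)) \<and> d (f (Suc n)) = Suc (d (f n)))"
    proof -
      define g where "g x = (SOME y. (adj\<^sup>*\<^sup>* v y \<and> infinite (desc y)) \<and> adj x y \<and> d y = Suc (d x))" for x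
      have g: "(adj\<^sup>*\<^sup>* v (g x) \<and> infinite (desc (g x))) \<and> adj x (g x) \<and> d (g x) = Suc (d x)" if "adj\<^sup>*\<^sup>* v x \<and> infinite (desc x)" for x
        unfolding g_def using step[OF that] by (rule someI_ex)
      have h: "adj\<^sup>*\<^sup>* v ((g ^^ n) v) \<and> infinite (desc ((g ^^ n) v))" for n by (induction n) (use 0 g in auto)
      then show ?thesis using g by (intro exI[of _ "\<lambda>n. (g ^^ n) v"]) auto
    qed
    then show thesis using that by blast
  qed
  have "d (f n) = n" for n by (induction n) (use f dv in auto)
  then have "inj f" by (metis injI)
  then show thesis using that f by blast
qed

text \<open>Deleting finitely many vertices from a locally finite graph leaves only finitely many
  components next to the deleted set; the finite ones among them are deleted as well.\<close>

lemma rays_off_finite_set: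
  assumes sym: "\<And>x y. adj x y \<Longrightarrow> adj y x" and fin: "\<And>x. finite {w. adj x w}" and B: "finite B"
  obtains M where "finite M" "B \<subseteq> M" 
    "\<forall>v. infinite {w. adj\<^sup>*\<^sup>* v w} \<longrightarrow> v \<notin> M \<longrightarrow>
        infinite {w. (\<lambda>x y. adj x y \<and> x \<notin> B \<and> y \<notin> B)\<^sup>*\<^sup>* v w}"
proof -
  define adjB where "adjB = (\<lambda>x y. adj x y \<and> x \<notin> B \<and> y \<notin> B)"
  define N where "N = {x. x \<notin> B \<and> (\<exists>b\<in>B. adj b x)}"
  have finN: "finite N"
  proof (rule finite_subset)
    show "N \<subseteq> (\<Union>b\<in>B. {x. adj b x})" by (auto simp: N_def)
    show "finite (\<Union>b\<in>B. {x. adj b x})" using B fin by auto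
  qed
  define M where "M = B \<union> (\<Union>x\<in>{x\<in>N. finite {w. adjB\<^sup>*\<^sup>* x w}}. {w. adjB\<^sup>*\<^sup>* x w})"
  have symB: "adjB\<^sup>*\<^sup>* y x" if "adjB\<^sup>*\<^sup>* x y" for x y
    using that by (induction rule: rtranclp_induct) (auto simp: adjB_def dest: sym intro: converse_rtranclp_into_rtranclp)
  show thesis
  proof (rule that[of M])
    show "finite M" "B \<subseteq> M" using B finN by (auto simp: M_def)
    show "\<forall>v. infinite {w. adj\<^sup>*\<^sup>* v w} \<longrightarrow> v \<notin> M \<longrightarrow>
        infinite {w. (\<lambda>x y. adj x y \<and> x \<notin> B \<and> y \<notin> B)\<^sup>*\<^sup>* v w}"
    proof (intro allI impI)
    fix v assume v: "infinite {w. adj\<^sup>*\<^sup>* v w}" "v \<notin> M"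
    have "infinite {w. adjB\<^sup>*\<^sup>* v w}"
    proof
      assume f: "finite {w. adjB\<^sup>*\<^sup>* v w}"
      have vB: "v \<notin> B" using v by (auto simp: M_def)
      have "adjB\<^sup>*\<^sup>* v w" if "adj\<^sup>*\<^sup>* v w" for w
        using that
      proof (induction rule: rtranclp_induct)
        case (step x y)
        have xB: "x \<notin> B" using step.IH vB by (induction rule: rtranclp_induct) (auto simp: adjB_def)
        have "y \<notin> B"
        proof
          assume "y \<in> B"
          then have xN: "x \<in> N" using xB sym[OF step.hyps(2)] by (auto simp: N_def)
          have "{w. adjB\<^sup>*\<^sup>* x w} \<subseteq> {w. adjB\<^sup>*\<^sup>* v w}" using step.IH by auto
          then have "finite {w. adjB\<^sup>*\<^sup>* x w}" using f finite_subset by blast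
          then have "v \<in> M" using xN symB[OF step.IH] by (auto simp: M_def)
          then show False using v by simp
        qed
        then have "adjB x y" using xB step.hyps by (simp add: adjB_def)
        then show ?case using step.IH by auto
      qed auto
      then have "{w. adj\<^sup>*\<^sup>* v w} \<subseteq> {w. adjB\<^sup>*\<^sup>* v w}" by blast
      then show False using v(1) f finite_subset by blast
    qed
    then show "infinite {w. (\<lambda>x y. adj x y \<and> x \<notin> B \<and> y \<notin> B)\<^sup>*\<^sup>* v w}" by (simp add: adjB_def)
    qed
  qed
qed

section \<open>Unicoherence\<close>

text \<open>A discrete Stokes theorem: \<open>h\<close> and \<open>v\<close> are the values of a closed cochain on the horizontal and vertical
  edges of a grid.\<close>

lemma grid_count:
  fixes h v :: "nat \<Rightarrow> nat \<Rightarrow> int"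
  assumes sq: "\<And>i j. i < N \<Longrightarrow> j < N \<Longrightarrow> h i j + v (Suc i) j = v i j + h i (Suc j)"
    and bot: "\<And>i. i < N \<Longrightarrow> h i 0 = 0" and top: "\<And>i. i < N \<Longrightarrow> h i N = 0"
  shows "(\<Sum>j<N. v 0 j) = (\<Sum>j<N. v N j)"
proof -
  have "(\<Sum>j<N. v i j) = (\<Sum>j<N. v (Suc i) j)" if i: "i < N" for i
  proof -
    have "(\<Sum>j<N. v (Suc i) j - v i j) = (\<Sum>j<N. h i (Suc j) - h i j)"
      by (rule sum.cong) (use sq[OF i] in \<open>auto simp: algebra_simps\<close>)
    also have "\<dots> = h i N - h i 0" by (rule sum_lessThan_telescope)
    finally show ?thesis using bot[OF i] top[OF i] by (simp add: sum_subtractf)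
  qed
  then have "i \<le> N \<Longrightarrow> (\<Sum>j<N. v 0 j) = (\<Sum>j<N. v i j)" for i by (induction i) auto
  then show ?thesis by blast
qed

text \<open>If the intersection were the disjoint union of open sets \<open>P\<close> and \<open>Q\<close>, a path in \<open>A\<close> and a path in \<open>B\<close> from \<open>P\<close> to \<open>Q\<close>
  would be homotopic. On a fine grid in the homotopy, count the passages from \<open>P\<close> to \<open>Q\<close> along edges in \<open>B\<close> but not in \<open>A\<close>: the count is closed,
  it is 0 along the path in \<open>A\<close> and 1 along the path in \<open>B\<close>.\<close>

lemma simply_connected_unicoherent_open:
  fixes Y :: "'a::topological_space set"
  assumes Y: "simply_connected Y" 
    and A: "openin (top_of_set Y) A" "path_connected A" and B: "openin (top_of_set Y) B" "path_connected B"
    and AB: "A \<union> B = Y"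
  shows "connected (A \<inter> B)"
proof (rule ccontr)
  assume "\<not> connected (A \<inter> B)"
  then obtain P Q where PQ: "openin (top_of_set (A \<inter> B)) P" "openin (top_of_set (A \<inter> B)) Q" 
      "A \<inter> B \<subseteq> P \<union> Q" "P \<inter> Q = {}" "P \<noteq> {}" "Q \<noteq> {}"
    unfolding connected_openin by blast
  have sub: "P \<subseteq> A \<inter> B" "Q \<subseteq> A \<inter> B" using PQ openin_imp_subset by blast+
  obtain p q where pq: "p \<in> P" "q \<in> Q" using PQ by blast
  obtain \<alpha> where \<alpha>: "path_in A \<alpha> p q" using path_connected_path_in[OF A(2), of p q] pq sub by blast
  obtain \<beta> where \<beta>: "path_in B \<beta> p q" using path_connected_path_in[OF B(2), of p q] pq sub by blast
  have \<alpha>Y: "path_in Y \<alpha> p q" and \<beta>Y: "path_in Y \<beta> p q" using \<alpha> \<beta> AB path_in_mono by blast+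
  have "homotopic_paths Y (\<alpha> +++ reversepath \<beta>) (\<lambda>_. p)"
    by (rule simply_connected_null[OF Y path_in_join[OF \<alpha>Y path_in_rev[OF \<beta>Y]]])
  then have "homotopic_paths Y \<alpha> \<beta>" by (rule hom_of_loop[OF \<alpha>Y \<beta>Y])
  then obtain H :: "real \<times> real \<Rightarrow> 'a" where H: "continuous_on ({0..1} \<times> {0..1}) H" "H ` ({0..1} \<times> {0..1}) \<subseteq> Y"
     "\<And>x. x \<in> {0..1} \<Longrightarrow> H (0,x) = \<alpha> x" "\<And>x. x \<in> {0..1} \<Longrightarrow> H (1,x) = \<beta> x"
     "\<And>t. t \<in> {0..1} \<Longrightarrow> H (t,0) = p" "\<And>t. t \<in> {0..1} \<Longrightarrow> H (t,1) = q"
  proof -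
    obtain h :: "real \<times> real \<Rightarrow> 'a" where h: "continuous_on ({0..1} \<times> {0..1}) h" "h \<in> {0..1} \<times> {0..1} \<rightarrow> Y"
      "\<forall>x\<in>{0..1}. h (0,x) = \<alpha> x" "\<forall>x\<in>{0..1}. h (1,x) = \<beta> x"
      "\<forall>t\<in>{0..1}. pathstart (h \<circ> Pair t) = pathstart \<alpha> \<and> pathfinish (h \<circ> Pair t) = pathfinish \<alpha>"
      using \<open>homotopic_paths Y \<alpha> \<beta>\<close> unfolding homotopic_paths by blast
    show thesis
      by (rule that[of h]) (use h \<alpha>Y in \<open>simp_all add: pathstart_def pathfinish_def path_in_def image_subset_iff_funcset\<close>)
  qed
  let ?I = "{0..1} \<times> {0..1} :: (real \<times> real) set"
  have HY: "H \<in> ?I \<rightarrow> Y" using H(2) by blast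
  obtain OA where OA: "open OA" "?I \<inter> H -` A = ?I \<inter> OA"
    using continuous_openin_preimage[OF H(1) HY A(1)] unfolding openin_open by blast
  obtain OB where OB: "open OB" "?I \<inter> H -` B = ?I \<inter> OB"
    using continuous_openin_preimage[OF H(1) HY B(1)] unfolding openin_open by blast
  have OAi: "H x \<in> A \<longleftrightarrow> x \<in> OA" and OBi: "H x \<in> B \<longleftrightarrow> x \<in> OB" if "x \<in> ?I" for x
  proof -
    have "x \<in> ?I \<inter> H -` A \<longleftrightarrow> x \<in> ?I \<inter> OA" "x \<in> ?I \<inter> H -` B \<longleftrightarrow> x \<in> ?I \<inter> OB"
      unfolding OA(2) OB(2) by (rule refl)+
    then show "H x \<in> A \<longleftrightarrow> x \<in> OA" "H x \<in> B \<longleftrightarrow> x \<in> OB" unfolding Int_iff vimage_eq using that by blast+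
  qed
  have cov: "?I \<subseteq> \<Union>{OA, OB}"
  proof
    fix x assume x: "x \<in> ?I"
    then have "H x \<in> A \<or> H x \<in> B" using HY AB by blast
    then show "x \<in> \<Union>{OA, OB}" using OAi[OF x] OBi[OF x] by auto
  qed
  have "\<exists>\<delta>>0. \<forall>T. T \<subseteq> ?I \<longrightarrow> diameter T < \<delta> \<longrightarrow> (\<exists>C\<in>{OA,OB}. T \<subseteq> C)"
  proof (rule Lebesgue_number_lemma[OF _ _ cov])
    show "compact ?I" by (intro compact_Times compact_Icc)
    show "open C" if "C \<in> {OA,OB}" for C using that OA(1) OB(1) by auto
    show ?thesis if "0 < d" "\<And>T. T \<subseteq> ?I \<Longrightarrow> diameter T < d \<Longrightarrow> \<exists>C\<in>{OA,OB}. T \<subseteq> C" for d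
      using that by (intro exI[of _ d]) simp
  qed simp
  then obtain \<delta> where \<delta>: "\<delta> > 0" "\<And>T. T \<subseteq> ?I \<Longrightarrow> diameter T < \<delta> \<Longrightarrow> \<exists>C\<in>{OA,OB}. T \<subseteq> C"
    by blast
  obtain N :: nat where N: "N > 0" "2 / real N < \<delta>"
  proof -
    obtain N :: nat where n: "real N > 2 / \<delta>" using reals_Archimedean2 by blast
    have "2 / \<delta> > 0" using \<delta>(1) by simp
    then have "real N > 0" using n by linarith
    moreover have "2 < \<delta> * real N" using n \<delta>(1) by (simp add: divide_less_eq mult.commute)
    ultimately have "N > 0" "2 / real N < \<delta>" by (simp_all add: divide_less_eq)
    then show thesis using that by blast
  qed
  define c where "c i = real i / real N" for i :: nat
  have c: "c 0 = 0" "c N = 1" "\<And>i. c i \<le> c (Suc i)" "\<And>i. c i \<ge> 0" "\<And>i. i \<le> N \<Longrightarrow> c i \<le> 1" "\<And>i. c (Suc i) - c i = 1 / real N"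
    using N(1) by (simp_all add: c_def divide_right_mono add_divide_distrib)
  define Sq where "Sq i j = {c i..c (Suc i)} \<times> {c j..c (Suc j)}" for i j
  have SqI: "Sq i j \<subseteq> ?I" if "i < N" "j < N" for i j
  proof -
    have "c (Suc i) \<le> 1" "c (Suc j) \<le> 1" using c(5) that by auto
    then show ?thesis using c(4)[of i] c(4)[of j] by (auto simp: Sq_def)
  qed
  have Sq: "H ` Sq i j \<subseteq> A \<or> H ` Sq i j \<subseteq> B" if ij: "i < N" "j < N" for i j
  proof -
    have d: "dist x y \<le> 2 / real N" if xy: "x \<in> Sq i j" "y \<in> Sq i j" for x y
    proof -
      have "dist x y \<le> \<bar>fst x - fst y\<bar> + \<bar>snd x - snd y\<bar>"
        unfolding dist_prod_def dist_real_def by (rule sqrt_sum_squares_le_sum_abs[THEN order_trans]) simp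
      also have "\<dots> \<le> 1 / real N + 1 / real N"
        using xy c(6)[of i] c(6)[of j] by (intro add_mono) (auto simp: Sq_def mem_Times_iff)
      finally show ?thesis by simp
    qed
    have "diameter (Sq i j) \<le> 2 / real N"
    proof (rule diameter_le)
      show "Sq i j \<noteq> {} \<or> 0 \<le> 2 / real N" by simp
      show "norm (x - y) \<le> 2 / real N" if "x \<in> Sq i j" "y \<in> Sq i j" for x y
        using d[OF that] by (simp only: dist_norm)
    qed
    then have "diameter (Sq i j) < \<delta>" using N(2) by linarith
    then have "\<exists>C\<in>{OA,OB}. Sq i j \<subseteq> C" by (rule \<delta>(2)[OF SqI[OF ij]])
    then have "Sq i j \<subseteq> OA \<or> Sq i j \<subseteq> OB" by simp
    then show ?thesis
    proof
      assume s: "Sq i j \<subseteq> OA"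
      have "H x \<in> A" if "x \<in> Sq i j" for x using OAi[OF subsetD[OF SqI[OF ij] that]] s that by blast
      then show ?thesis by blast
    next
      assume s: "Sq i j \<subseteq> OB"
      have "H x \<in> B" if "x \<in> Sq i j" for x using OBi[OF subsetD[OF SqI[OF ij] that]] s that by blast
      then show ?thesis by blast
    qed
  qed
  define f where "f y = (if y \<in> Q then 1 else 0 :: int)" for y
  \<comment> \<open>The cochain that counts passages from \<open>P\<close> to \<open>Q\<close> along edges that are not mapped into \<open>A\<close>; the value of \<open>f\<close> does not change along an edge mapped into both \<open>A\<close> and \<open>B\<close>.\<close>
  define w where "w S a b = (if H ` S \<subseteq> A then 0 else f (H b) - f (H a))" for S a b
  have fconst: "f (H a) = f (H b)" if S: "connected S" "S \<subseteq> ?I" "a \<in> S" "b \<in> S" "H ` S \<subseteq> A \<inter> B" for S a b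
  proof -
    have con: "connected (H ` S)" using S H(1) by (intro connected_continuous_image) (auto elim: continuous_on_subset)
    have "H ` S \<inter> P = {} \<or> H ` S \<inter> Q = {}"
    proof (rule ccontr)
      assume n: "\<not> ?thesis"
      obtain U where U: "open U" "P = A \<inter> B \<inter> U" using PQ(1) unfolding openin_open by blast
      obtain V where V: "open V" "Q = A \<inter> B \<inter> V" using PQ(2) unfolding openin_open by blast
      have PU: "y \<in> P \<longleftrightarrow> y \<in> U" and QV: "y \<in> Q \<longleftrightarrow> y \<in> V" if "y \<in> H ` S" for y
      proof -
        have "y \<in> A \<inter> B" using that S(5) by blast
        then show "y \<in> P \<longleftrightarrow> y \<in> U" "y \<in> Q \<longleftrightarrow> y \<in> V" unfolding U(2) V(2) by simp_all
      qed
      have "H ` S \<subseteq> U \<union> V"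
      proof
        fix y assume y: "y \<in> H ` S"
        then have "y \<in> P \<or> y \<in> Q" using S(5) PQ(3) by blast
        then show "y \<in> U \<union> V" using PU[OF y] QV[OF y] by blast
      qed
      moreover have "U \<inter> V \<inter> H ` S = {}"
      proof (rule ccontr)
        assume "U \<inter> V \<inter> H ` S \<noteq> {}"
        then obtain y where y: "y \<in> U" "y \<in> V" "y \<in> H ` S" by blast
        then have "y \<in> P \<inter> Q" using PU[OF y(3)] QV[OF y(3)] by blast
        then show False unfolding PQ(4) by simp
      qed
      moreover obtain y z where "y \<in> H ` S" "y \<in> P" "z \<in> H ` S" "z \<in> Q" using n by blast
      then have "U \<inter> H ` S \<noteq> {}" "V \<inter> H ` S \<noteq> {}" using PU QV by blast+
      ultimately show False using con U(1) V(1) connectedD by blast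
    qed
    moreover have "H a \<in> P \<union> Q" "H b \<in> P \<union> Q" using S(3,4,5) PQ(3) by blast+
    ultimately show ?thesis using S(3,4) unfolding f_def by (metis Un_iff disjoint_iff image_eqI)
  qed
  have weq: "w S a b = f (H b) - f (H a)" if "connected S" "S \<subseteq> ?I" "a \<in> S" "b \<in> S" "H ` S \<subseteq> B" for S a b
  proof (cases "H ` S \<subseteq> A")
    case True then have "f (H a) = f (H b)" using fconst[OF that(1-4)] that(5) by blast
    then show ?thesis using True by (simp add: w_def)
  qed (simp add: w_def)
  define he where "he i j = {c i..c (Suc i)} \<times> {c j}" for i j
  define ve where "ve i j = {c i} \<times> {c j..c (Suc j)}" for i j
  define h where "h i j = w (he i j) (c i, c j) (c (Suc i), c j)" for i j
  define v where "v i j = w (ve i j) (c i, c j) (c i, c (Suc j))" for i j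
  have edges: "connected (he i j)" "connected (ve i j)" "(c i, c j) \<in> he i j" "(c (Suc i), c j) \<in> he i j"
     "(c i, c j) \<in> ve i j" "(c i, c (Suc j)) \<in> ve i j" for i j
    using c(3) by (auto simp: he_def ve_def intro!: connected_Times)
  have "(\<Sum>j<N. v 0 j) = (\<Sum>j<N. v N j)"
  proof (rule grid_count)
    fix i j assume ij: "i < N" "j < N"
    have inS: "he i j \<subseteq> Sq i j" "he i (Suc j) \<subseteq> Sq i j" "ve i j \<subseteq> Sq i j" "ve (Suc i) j \<subseteq> Sq i j"
      using c(3)[of i] c(3)[of j] by (auto simp: he_def ve_def Sq_def)
    show "h i j + v (Suc i) j = v i j + h i (Suc j)"
    proof (cases "H ` Sq i j \<subseteq> A")
      case True
      then have "H ` he i j \<subseteq> A" "H ` he i (Suc j) \<subseteq> A" "H ` ve i j \<subseteq> A" "H ` ve (Suc i) j \<subseteq> A"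
        using inS by blast+
      then show ?thesis by (simp add: h_def v_def w_def)
    next
      case False
      then have "H ` Sq i j \<subseteq> B" using Sq[OF ij] by blast
      then have b: "H ` he i j \<subseteq> B" "H ` he i (Suc j) \<subseteq> B" "H ` ve i j \<subseteq> B" "H ` ve (Suc i) j \<subseteq> B"
        using inS by blast+
      have I: "he i j \<subseteq> ?I" "he i (Suc j) \<subseteq> ?I" "ve i j \<subseteq> ?I" "ve (Suc i) j \<subseteq> ?I" 
        using inS SqI[OF ij] by blast+
      show ?thesis unfolding h_def v_def
        using weq[OF edges(1) I(1) edges(3,4) b(1)] weq[OF edges(1) I(2) edges(3,4) b(2)]
          weq[OF edges(2) I(3) edges(5,6) b(3)] weq[OF edges(2) I(4) edges(5,6) b(4)] by simp
    qed
  next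
    fix i assume i: "i < N"
    have cI: "{c i..c (Suc i)} \<subseteq> {0..1}" using c(4)[of i] c(5)[of "Suc i"] i by auto
    have "H ` he i 0 \<subseteq> {p}" "H ` he i N \<subseteq> {q}" using H(5,6) cI by (auto simp: he_def c(1,2) subset_iff)
    then have "H ` he i 0 \<subseteq> A" "H ` he i N \<subseteq> A" using pq sub by blast+
    then show "h i 0 = 0" "h i N = 0" by (simp_all add: h_def w_def)
  qed
  moreover have "(\<Sum>j<N. v 0 j) = 0"
  proof (rule sum.neutral, safe)
    fix j assume j: "j < N"
    have cI: "{c j..c (Suc j)} \<subseteq> {0..1}" using c(4)[of j] c(5)[of "Suc j"] j by auto
    have "H ` ve 0 j \<subseteq> \<alpha> ` {0..1}"
    proof (rule image_subsetI)
      fix x assume "x \<in> ve 0 j"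
      then have "fst x = 0" "snd x \<in> {0..1}" using cI by (auto simp: ve_def c(1))
      then show "H x \<in> \<alpha> ` {0..1}" using H(3)[of "snd x"] by (metis image_eqI prod.collapse)
    qed
    then have "H ` ve 0 j \<subseteq> A" using path_cont(2)[OF \<alpha>] by blast
    then show "v 0 j = 0" by (simp add: v_def w_def)
  qed
  moreover have "(\<Sum>j<N. v N j) = (\<Sum>j<N. f (H (1, c (Suc j))) - f (H (1, c j)))"
  proof (rule sum.cong)
    fix j assume "j \<in> {..<N}" then have j: "j < N" by simp
    have cI: "{c j..c (Suc j)} \<subseteq> {0..1}" using c(4)[of j] c(5)[of "Suc j"] j by auto
    have "H ` ve N j \<subseteq> \<beta> ` {0..1}"
    proof (rule image_subsetI)
      fix x assume "x \<in> ve N j"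
      then have "fst x = 1" "snd x \<in> {0..1}" using cI by (auto simp: ve_def c(2))
      then show "H x \<in> \<beta> ` {0..1}" using H(4)[of "snd x"] by (metis image_eqI prod.collapse)
    qed
    then have b: "H ` ve N j \<subseteq> B" using path_cont(2)[OF \<beta>] by blast
    have "ve N j \<subseteq> ?I" using cI by (auto simp: ve_def c(2))
    then show "v N j = f (H (1, c (Suc j))) - f (H (1, c j))"
      unfolding v_def using weq[OF edges(2) _ edges(5,6) b] by (simp add: c(2))
  qed simp
  moreover have "(\<Sum>j<N. f (H (1, c (Suc j))) - f (H (1, c j))) = f (H (1, c N)) - f (H (1, c 0))"
    by (rule sum_lessThan_telescope)
  moreover have "f (H (1, c N)) = 1" "f (H (1, c 0)) = 0"
    using H(5)[of 1] H(6)[of 1] pq PQ(4) by (auto simp: c(1,2) f_def)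
  ultimately show False by simp
qed

section \<open>Filling loops in compact sets\<close>

lemma homotopic_paths_in_compact:
  assumes "homotopic_paths Y p q"
  obtains L where "compact L" "L \<subseteq> Y" "homotopic_paths L p q"
proof -
  obtain h :: "real \<times> real \<Rightarrow> 'a" where h: "continuous_on ({0..1} \<times> {0..1}) h" "h \<in> {0..1} \<times> {0..1} \<rightarrow> Y"
      "\<forall>x\<in>{0..1}. h (0,x) = p x" "\<forall>x\<in>{0..1}. h (1,x) = q x"
      "\<forall>t\<in>{0..1}. pathstart (h \<circ> Pair t) = pathstart p \<and> pathfinish (h \<circ> Pair t) = pathfinish p"
    using assms unfolding homotopic_paths by blast
  let ?L = "h ` ({0..1} \<times> {0..1})"
  show thesis
  proof
    show "compact ?L" by (intro compact_continuous_image h compact_Times compact_Icc)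
    show "?L \<subseteq> Y" using h(2) by blast
    show "homotopic_paths ?L p q" unfolding homotopic_paths
      by (rule exI[of _ h]) (use h in simp)
  qed
qed

lemma hom_telescope:
  assumes A: "path_in S A x b" and B: "path_in S B y b" and C: "path_in S C z b"
  shows "homotopic_paths S ((A +++ reversepath B) +++ (B +++ reversepath C)) (A +++ reversepath C)"
proof -
  note rB = path_in_rev[OF B] and rC = path_in_rev[OF C]
  have "homotopic_paths S ((A +++ reversepath B) +++ (B +++ reversepath C)) (A +++ (reversepath B +++ (B +++ reversepath C)))"
    by (rule hom_assoc'[OF A rB path_in_join[OF B rC]])
  also have "homotopic_paths S \<dots> (A +++ reversepath C)"
    by (rule hom_join_left[OF hom_cancel_left[OF B rC] A path_in_join[OF rB path_in_join[OF B rC]]])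
  finally show ?thesis .
qed

lemma reversepath_join: "path_in S p x y \<Longrightarrow> path_in S q y z \<Longrightarrow> reversepath (p +++ q) = reversepath q +++ reversepath p"
  by (simp add: reversepath_joinpaths path_in_def)

lemma hom_trans3: "homotopic_paths S a b \<Longrightarrow> homotopic_paths S b c \<Longrightarrow> homotopic_paths S c d \<Longrightarrow> homotopic_paths S a d"
  by (meson homotopic_paths_trans)

lemma separate_point_compact:
  fixes y :: "'a::t2_space"
  assumes "compact K" "y \<notin> K"
  obtains U V where "open U" "open V" "y \<in> U" "K \<subseteq> V" "U \<inter> V = {}"
proof (rule Hausdorff_space_compact_separation[OF Hausdorff_space_t2, of "{y}" K])
  fix U V assume "openin euclidean U" "openin euclidean V" "{y} \<subseteq> U" "K \<subseteq> V" "disjnt U V"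
  then show thesis using that[of U V] by (simp add: disjnt_def)
qed (use assms in \<open>auto simp: disjnt_def\<close>)

context nice_space
begin

lemma small_nbhd:
  assumes "openin (top_of_set Y) Ob" "y \<in> Ob"
  obtains V L where "openin (top_of_set Y) V" "path_connected V" "y \<in> V" "V \<subseteq> Ob" "V \<subseteq> L" "compact L" "L \<subseteq> Y"
proof -
  have "y \<in> Y" using assms openin_imp_subset by blast
  then obtain V0 L where 0: "openin (top_of_set Y) V0" "{y} \<subseteq> V0" "V0 \<subseteq> L" "compact L" "L \<subseteq> Y"
    using compact_nbhd[of "{y}"] by (meson compact_sing empty_subsetI insert_subset)
  have "openin (top_of_set Y) (Ob \<inter> V0)" "y \<in> Ob \<inter> V0" using assms 0 by auto
  then obtain V where "openin (top_of_set Y) V" "path_connected V" "y \<in> V" "V \<subseteq> Ob \<inter> V0"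
    using lpc unfolding locally_path_connected by meson
  then show thesis using that[of V L] 0 by blast
qed

lemma open_connected_path_connected:
  assumes "openin (top_of_set Y) S" "connected S"
  shows "path_connected S"
proof -
  have l: "locally path_connected S" by (rule locally_open_subset[OF lpc assms(1)])
  show ?thesis
    unfolding path_connected_component_set
    using assms(2) path_component_eq_connected_component_set[OF l]
    by (simp add: connected_iff_eq_connected_component_set)
qed

lemma component_open:
  assumes "openin (top_of_set Y) S" "U \<in> components S"
  shows "openin (top_of_set Y) U" "path_connected U"
proof -
  have "locally connected S"
    using locally_open_subset[OF lpc assms(1)] by (rule locally_path_connected_imp_locally_connected)
  then have "openin (top_of_set S) U" using assms(2) by (rule openin_components_locally_connected)
  then show o: "openin (top_of_set Y) U" using assms(1) by (rule openin_trans)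
  show "path_connected U" by (rule open_connected_path_connected[OF o in_components_connected[OF assms(2)]])
qed

lemma finite_open_cover:
  assumes "compact K" "K \<subseteq> Y" and "\<And>y. y \<in> K \<Longrightarrow> openin (top_of_set Y) (V y) \<and> y \<in> V y"
  obtains A where "finite A" "A \<subseteq> K" "K \<subseteq> (\<Union>y\<in>A. V y)"
proof -
  have "\<forall>y\<in>K. \<exists>T. open T \<and> V y = Y \<inter> T" using assms(3) unfolding openin_open by blast
  then obtain T where T: "\<And>y. y \<in> K \<Longrightarrow> open (T y) \<and> V y = Y \<inter> T y" by metis
  have "open (T y)" if "y \<in> K" for y using T that by blast
  moreover have "K \<subseteq> (\<Union>y\<in>K. T y)"
  proof
    fix y assume y: "y \<in> K"
    then have "y \<in> V y" using assms(3) by blast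
    then have "y \<in> T y" using T[OF y] by simp
    then show "y \<in> (\<Union>y\<in>K. T y)" using y by blast
  qed
  ultimately obtain A where A: "A \<subseteq> K" "finite A" "K \<subseteq> (\<Union>y\<in>A. T y)"
    by (rule compactE_image[OF assms(1)])
  have "K \<subseteq> (\<Union>y\<in>A. V y)"
  proof
    fix x assume x: "x \<in> K"
    then obtain y where y: "y \<in> A" "x \<in> T y" using A(3) by blast
    then have "x \<in> V y" using T[of y] A(1) x assms(2) by auto
    then show "x \<in> (\<Union>y\<in>A. V y)" using y by blast
  qed
  then show thesis using that A by blast
qed

text \<open>Finitely many small neighbourhoods cover \<open>K\<close>; together with neighbourhoods of paths from them to \<open>b\<close> they form a connected set.\<close>

lemma connected_nbhd:
  assumes K: "compact K" "K \<subseteq> Y" and b: "b \<in> Y"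
  obtains P L where "openin (top_of_set Y) P" "path_connected P" "K \<subseteq> P" "b \<in> P" "P \<subseteq> L" "compact L" "L \<subseteq> Y"
proof -
  have "\<exists>V L. openin (top_of_set Y) V \<and> path_connected V \<and> y \<in> V \<and> V \<subseteq> L \<and> compact L \<and> L \<subseteq> Y" if "y \<in> K" for y
    using small_nbhd[of Y y] that K(2) by (metis openin_subtopology_self subsetD)
  then obtain V L where V: "\<And>y. y \<in> K \<Longrightarrow> openin (top_of_set Y) (V y) \<and> path_connected (V y) \<and> y \<in> V y \<and> V y \<subseteq> L y \<and> compact (L y) \<and> L y \<subseteq> Y"
    by metis
  obtain A where A: "finite A" "A \<subseteq> K" "K \<subseteq> (\<Union>y\<in>A. V y)"
    using finite_open_cover[OF K, of V] V by blast
  have "\<exists>p. path_in Y p y b" if "y \<in> Y" for y using simply_connected_path[OF simply_conn that b] by blast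
  then obtain p where p: "\<And>y. y \<in> Y \<Longrightarrow> path_in Y (p y) y b" by metis
  let ?K2 = "insert b (\<Union>y\<in>A. path_image (p y))"
  have pY: "path (p y)" "path_image (p y) \<subseteq> Y" if "y \<in> A" for y
    using p[of y] that A(2) K(2) unfolding path_in_def by blast+
  have "compact ?K2" using A(1) pY by (intro compact_insert compact_UN compact_path_image) auto
  moreover have "?K2 \<subseteq> Y" using pY b by blast
  ultimately obtain N LN where N: "openin (top_of_set Y) N" "?K2 \<subseteq> N" "N \<subseteq> LN" "compact LN" "LN \<subseteq> Y"
    using compact_nbhd by meson
  let ?M = "N \<union> (\<Union>y\<in>A. V y)"
  have M: "openin (top_of_set Y) ?M" using N(1) V A(2) by (intro openin_Un openin_Union) auto
  let ?P = "path_component_set ?M b"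
  have bM: "b \<in> ?M" using N(2) by blast
  have VP: "V y \<subseteq> ?P" if y: "y \<in> A" for y
  proof
    fix x assume x: "x \<in> V y"
    obtain g where g: "path_in (V y) g x y" using path_connected_path_in[of "V y" x y] V y x A(2) by blast
    have "path_in ?M g x y" using g y by (intro path_in_mono[OF g]) blast
    moreover have "path_in ?M (p y) y b"
    proof (rule path_in_image)
      show "path_in Y (p y) y b" using p[of y] y A(2) K(2) by blast
      have "path_image (p y) \<subseteq> ?K2" using y by blast
      also have "\<dots> \<subseteq> ?M" using N(2) by (rule le_supI1)
      finally show "path_image (p y) \<subseteq> ?M" .
    qed
    ultimately have "path_in ?M (g +++ p y) x b" by (rule path_in_join)
    then have "path_component ?M x b" unfolding path_component_def path_in_def by blast
    then show "x \<in> ?P" by (simp add: path_component_sym)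
  qed
  show thesis
  proof
    show "openin (top_of_set Y) ?P" by (rule locally_path_connected_2[OF lpc M bM])
    show "path_connected ?P" by (rule path_connected_path_component)
    show "K \<subseteq> ?P" using A(3) VP by blast
    show "b \<in> ?P" using bM by (simp add: path_component_refl)
    have VL: "V y \<subseteq> L y" if "y \<in> A" for y using V A(2) that by blast
    have "?P \<subseteq> ?M" by (rule path_component_subset)
    also have "\<dots> \<subseteq> LN \<union> (\<Union>y\<in>A. L y)" using VL by (intro Un_mono N(3) UN_mono) auto
    finally show "?P \<subseteq> LN \<union> (\<Union>y\<in>A. L y)" .
    show "compact (LN \<union> (\<Union>y\<in>A. L y))" using N(4) V A by (intro compact_Un compact_UN) auto
    show "LN \<union> (\<Union>y\<in>A. L y) \<subseteq> Y" using N(5) V A(2) by blast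
  qed
qed

text \<open>A set that is a neighbourhood of \<open>y\<close> is chosen so small that it lies in \<open>W a\<close> if \<open>y\<close> is in the
  shrunken set \<open>F a\<close>, and misses \<open>F a\<close> otherwise. If two such sets meet in a point of \<open>F a\<close>, then both lie in \<open>W a\<close>.\<close>

lemma star_refinement:
  assumes K: "compact K" "K \<subseteq> Y" and W: "\<And>y. y \<in> K \<Longrightarrow> openin (top_of_set Y) (W y) \<and> y \<in> W y"
  obtains \<V> A where "finite \<V>" "\<forall>V\<in>\<V>. openin (top_of_set Y) V \<and> path_connected V \<and> V \<inter> K \<noteq> {}" "K \<subseteq> \<Union>\<V>"
    "finite A" "A \<subseteq> K" "\<forall>V\<in>\<V>. \<forall>V'\<in>\<V>. V \<inter> V' \<inter> K \<noteq> {} \<longrightarrow> (\<exists>y\<in>A. V \<union> V' \<subseteq> W y)"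
proof -
  \<comment> \<open>A shrinking of the cover: \<open>F y\<close> is a compact neighbourhood of \<open>y\<close> in \<open>K\<close> that lies in \<open>W y\<close>.\<close>
  have "\<exists>N F. openin (top_of_set Y) N \<and> y \<in> N \<and> N \<inter> K \<subseteq> F \<and> closed F \<and> F \<subseteq> W y" if y: "y \<in> K" for y
  proof -
    obtain T where T: "open T" "W y = Y \<inter> T" using W[OF y] unfolding openin_open by blast
    have "compact (K - T)" using K(1) T(1) by (rule compact_diff)
    moreover have "y \<notin> K - T" using W[OF y] T(2) by blast
    ultimately obtain U V where UV: "open U" "open V" "y \<in> U" "K - T \<subseteq> V" "U \<inter> V = {}"
      by (rule separate_point_compact)
    have "closed (K - V)" using compact_diff[OF K(1) UV(2)] by (rule compact_imp_closed)
    moreover have "(Y \<inter> U) \<inter> K \<subseteq> K - V" using UV(5) by blast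
    moreover have "K - V \<subseteq> W y" unfolding T(2) using UV(4) K(2) by blast
    moreover have "openin (top_of_set Y) (Y \<inter> U)" "y \<in> Y \<inter> U" using UV y K(2) by (auto simp: openin_open)
    ultimately show ?thesis by blast
  qed
  then obtain N F where NF: "\<And>y. y \<in> K \<Longrightarrow> openin (top_of_set Y) (N y) \<and> y \<in> N y \<and> N y \<inter> K \<subseteq> F y \<and> closed (F y) \<and> F y \<subseteq> W y"
    by metis
  obtain A where A: "finite A" "A \<subseteq> K" "K \<subseteq> (\<Union>y\<in>A. N y)"
    using finite_open_cover[OF K, of N] NF by blast
  have KF: "\<exists>a\<in>A. x \<in> F a" if xK: "x \<in> K" for x
  proof -
    obtain a where "a \<in> A" "x \<in> N a" using A(3) xK by blast
    then show ?thesis using NF[of a] A(2) xK by blast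
  qed
  have "\<exists>V. openin (top_of_set Y) V \<and> path_connected V \<and> y \<in> V \<and> (\<forall>a\<in>A. (y \<in> F a \<longrightarrow> V \<subseteq> W a) \<and> (y \<notin> F a \<longrightarrow> V \<inter> F a = {}))"
    if y: "y \<in> K" for y
  proof -
    define G where "G a = (if y \<in> F a then W a else Y - F a)" for a
    have yY: "y \<in> Y" using y K(2) by blast
    have G: "openin (top_of_set Y) (G a) \<and> y \<in> G a" if "a \<in> A" for a
    proof -
      have a: "a \<in> K" using that A(2) by blast
      have "openin (top_of_set Y) (Y - F a)" using NF[OF a] by (simp add: Diff_eq open_Compl openin_open_Int)
      then show ?thesis using W[OF a] NF[OF a] yY by (auto simp: G_def)
    qed
    have "openin (top_of_set Y) (Y \<inter> \<Inter>(G ` A))"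
    proof (cases "A = {}")
      case False
      then have "openin (top_of_set Y) (\<Inter>(G ` A))" using A(1) G by (intro openin_Inter) auto
      then show ?thesis by (intro openin_Int openin_subtopology_self)
    qed simp
    moreover have "y \<in> Y \<inter> \<Inter>(G ` A)" using G yY by blast
    ultimately obtain V L where V: "openin (top_of_set Y) V" "path_connected V" "y \<in> V" "V \<subseteq> Y \<inter> \<Inter>(G ` A)"
      by (rule small_nbhd)
    have "V \<subseteq> G a" if "a \<in> A" for a using V(4) that by blast
    then have "(y \<in> F a \<longrightarrow> V \<subseteq> W a) \<and> (y \<notin> F a \<longrightarrow> V \<inter> F a = {})" if "a \<in> A" for a
      using that unfolding G_def by (cases "y \<in> F a") fastforce+
    then show ?thesis using V(1-3) by blast
  qed
  then obtain V where V: "\<And>y. y \<in> K \<Longrightarrow> openin (top_of_set Y) (V y) \<and> path_connected (V y) \<and> y \<in> V y \<and>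
      (\<forall>a\<in>A. (y \<in> F a \<longrightarrow> V y \<subseteq> W a) \<and> (y \<notin> F a \<longrightarrow> V y \<inter> F a = {}))"
    by metis
  obtain B where B: "finite B" "B \<subseteq> K" "K \<subseteq> (\<Union>y\<in>B. V y)"
    using finite_open_cover[OF K, of V] V by blast
  show thesis
  proof (rule that[of "V ` B" A])
    show "finite (V ` B)" "finite A" "A \<subseteq> K" "K \<subseteq> \<Union>(V ` B)" using A B by auto
    show "\<forall>U\<in>V ` B. openin (top_of_set Y) U \<and> path_connected U \<and> U \<inter> K \<noteq> {}"
      using V B(2) by blast
    show "\<forall>U\<in>V ` B. \<forall>U'\<in>V ` B. U \<inter> U' \<inter> K \<noteq> {} \<longrightarrow> (\<exists>y\<in>A. U \<union> U' \<subseteq> W y)"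
    proof (intro ballI impI)
    fix U U' assume "U \<in> V ` B" "U' \<in> V ` B" and ne: "U \<inter> U' \<inter> K \<noteq> {}"
    then obtain y y' where y: "y \<in> K" "U = V y" "y' \<in> K" "U' = V y'" using B(2) by blast
    obtain z where z: "z \<in> U" "z \<in> U'" "z \<in> K" using ne by blast
    obtain a where a: "a \<in> A" "z \<in> F a" using KF[OF z(3)] by blast
    have "V y \<subseteq> W a" "V y' \<subseteq> W a" using V[OF y(1)] V[OF y(3)] a z y by blast+
    then show "\<exists>y\<in>A. U \<union> U' \<subseteq> W y" using a(1) y by blast
    qed
  qed
qed

text \<open>All loops in a compact set contract in a common compact set. A loop is cut into pieces, each in one
  set of a finite star refining cover; joining the end points to a base point along tracks chosen once
  for each set of the cover makes the loop a composite of loops from a finite list.\<close>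

lemma loops_bounded:
  assumes K: "compact K" "K \<subseteq> Y"
  obtains L where "compact L" "L \<subseteq> Y" "\<And>p x. path_in K p x x \<Longrightarrow> homotopic_paths L p (\<lambda>_. x)"
proof (cases "K = {}")
  case True
  show thesis by (rule that[of "{}"]) (use True in \<open>auto simp: path_in_def\<close>)
next
  case False
  then obtain b where b: "b \<in> K" by blast
  have "\<forall>y\<in>K. \<exists>W L. openin (top_of_set Y) W \<and> y \<in> W \<and> compact L \<and> L \<subseteq> Y \<and> (\<forall>p x. path_in W p x x \<longrightarrow> homotopic_paths L p (\<lambda>_. x))"
    using small_loops K(2) by blast
  then obtain W M where WM: "\<And>y. y \<in> K \<Longrightarrow> openin (top_of_set Y) (W y) \<and> y \<in> W y"
     "\<And>y. y \<in> K \<Longrightarrow> compact (M y) \<and> M y \<subseteq> Y" "\<And>y p x. y \<in> K \<Longrightarrow> path_in (W y) p x x \<Longrightarrow> homotopic_paths (M y) p (\<lambda>_. x)"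
    by metis
  obtain \<V> A where \<V>0: "finite \<V>" "\<forall>V\<in>\<V>. openin (top_of_set Y) V \<and> path_connected V \<and> V \<inter> K \<noteq> {}" "K \<subseteq> \<Union>\<V>"
    and A: "finite A" "A \<subseteq> K" and star0: "\<forall>V\<in>\<V>. \<forall>V'\<in>\<V>. V \<inter> V' \<inter> K \<noteq> {} \<longrightarrow> (\<exists>y\<in>A. V \<union> V' \<subseteq> W y)"
    by (rule star_refinement[OF K WM(1)])
  have \<V>: "finite \<V>" "\<And>V. V \<in> \<V> \<Longrightarrow> openin (top_of_set Y) V \<and> path_connected V \<and> V \<inter> K \<noteq> {}" "K \<subseteq> \<Union>\<V>"
    using \<V>0 by simp_all
  have star: "\<And>V V'. V \<in> \<V> \<Longrightarrow> V' \<in> \<V> \<Longrightarrow> V \<inter> V' \<inter> K \<noteq> {} \<Longrightarrow> \<exists>y\<in>A. V \<union> V' \<subseteq> W y"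
    using star0 by simp
  have "\<forall>V\<in>\<V>. \<exists>v. v \<in> V \<inter> K" using \<V>(2) by blast
  then obtain v where v: "\<And>V. V \<in> \<V> \<Longrightarrow> v V \<in> V \<and> v V \<in> K" by (metis IntE)
  have "\<forall>V\<in>\<V>. \<exists>t. path_in Y t (v V) b" using simply_connected_path[OF simply_conn] v b K(2) by (metis subsetD)
  then obtain tr where tr: "\<And>V. V \<in> \<V> \<Longrightarrow> path_in Y (tr V) (v V) b" by metis
  define adj where "adj = {(V,V'). V \<in> \<V> \<and> V' \<in> \<V> \<and> V \<inter> V' \<inter> K \<noteq> {}}"
  have fadj: "finite adj" by (rule finite_subset[of _ "\<V> \<times> \<V>"]) (use \<V>(1) in \<open>auto simp: adj_def\<close>)
  \<comment> \<open>A fixed path \<open>c e\<close> for each pair of sets that meet in \<open>K\<close>, and a compact set \<open>H e\<close> in which it contracts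
      relative to the tracks.\<close>
  have "\<exists>c H. path_in (fst e \<union> snd e) c (v (fst e)) (v (snd e)) \<and> compact H \<and> H \<subseteq> Y \<and>
      homotopic_paths H c (tr (fst e) +++ reversepath (tr (snd e)))" if e: "e \<in> adj" for e
  proof -
    obtain V V' where V: "e = (V,V')" "V \<in> \<V>" "V' \<in> \<V>" "V \<inter> V' \<inter> K \<noteq> {}" using e by (auto simp: adj_def)
    obtain z where z: "z \<in> V" "z \<in> V'" using V(4) by blast
    obtain c1 where c1: "path_in V c1 (v V) z" using path_connected_path_in[of V "v V" z] \<V>(2) v V(2) z by blast
    obtain c2 where c2: "path_in V' c2 z (v V')" using path_connected_path_in[of V' z "v V'"] \<V>(2) v V(3) z by blast
    have c: "path_in (V \<union> V') (c1 +++ c2) (v V) (v V')"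
      by (rule path_in_join[OF path_in_mono[OF c1] path_in_mono[OF c2]]) auto
    have "V \<union> V' \<subseteq> Y" using \<V>(2) V(2,3) openin_imp_subset by blast
    then have cY: "path_in Y (c1 +++ c2) (v V) (v V')" using c path_in_mono by blast
    have tY: "path_in Y (tr V +++ reversepath (tr V')) (v V) (v V')"
      by (rule path_in_join[OF tr[OF V(2)] path_in_rev[OF tr[OF V(3)]]])
    have "homotopic_paths Y (c1 +++ c2) (tr V +++ reversepath (tr V'))"
      by (rule hom_of_loop[OF cY tY simply_connected_null[OF simply_conn path_in_join[OF cY path_in_rev[OF tY]]]])
    then obtain H where "compact H" "H \<subseteq> Y" "homotopic_paths H (c1 +++ c2) (tr V +++ reversepath (tr V'))"
      by (rule homotopic_paths_in_compact)
    then show ?thesis using c V(1) by auto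
  qed
  then obtain c H where cH: "\<And>e. e \<in> adj \<Longrightarrow> path_in (fst e \<union> snd e) (c e) (v (fst e)) (v (snd e))"
     "\<And>e. e \<in> adj \<Longrightarrow> compact (H e) \<and> H e \<subseteq> Y"
     "\<And>e. e \<in> adj \<Longrightarrow> homotopic_paths (H e) (c e) (tr (fst e) +++ reversepath (tr (snd e)))"
    by metis
  define L where "L = (\<Union>y\<in>A. M y) \<union> (\<Union>e\<in>adj. H e)"
  have L: "compact L" "L \<subseteq> Y"
    using A fadj WM(2) cH(2) unfolding L_def by (blast intro: compact_Un compact_UN)+
  have M_sub: "M y \<subseteq> L" if "y \<in> A" for y using that by (auto simp: L_def)
  have WL: "W y \<subseteq> L" if "y \<in> A" for y
  proof
    fix x assume x: "x \<in> W y"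
    have "homotopic_paths (M y) (\<lambda>_. x) (\<lambda>_. x)" using WM(3)[of y] path_in_const[OF x] that A(2) by blast
    then have "x \<in> M y" by (auto simp: path_image_def)
    then show "x \<in> L" using M_sub[OF that] by blast
  qed
  have same: "homotopic_paths L p q" if y: "y \<in> A" and p: "path_in (W y) p x z" and q: "path_in (W y) q x z" for y p q x z
  proof -
    have "homotopic_paths (M y) (p +++ reversepath q) (\<lambda>_. x)"
      using WM(3)[of y] path_in_join[OF p path_in_rev[OF q]] y A(2) by blast
    then have "homotopic_paths L (p +++ reversepath q) (\<lambda>_. x)" using M_sub[OF y] homotopic_paths_subset by blast
    then show ?thesis by (rule hom_of_loop[OF path_in_mono[OF p WL[OF y]] path_in_mono[OF q WL[OF y]]])
  qed
  have cL: "homotopic_paths L (c e) (tr (fst e) +++ reversepath (tr (snd e)))" if "e \<in> adj" for e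
    by (rule homotopic_paths_subset[OF cH(3)[OF that]]) (use that in \<open>auto simp: L_def\<close>)
  have trL: "path_in L (tr V) (v V) b" if "V \<in> \<V>" for V
  proof -
    have e: "(V,V) \<in> adj" using \<V>(2)[OF that] that by (auto simp: adj_def)
    have "path_image (tr V +++ reversepath (tr V)) \<subseteq> L"
      using homotopic_paths_imp_subset[OF cL[OF e]] by simp
    then have "path_image (tr V) \<subseteq> L" using tr[OF that] by (simp add: path_image_join path_in_def)
    then show ?thesis using tr[OF that] by (rule path_in_image[rotated])
  qed
  \<comment> \<open>Every point of \<open>K\<close> gets a set of the cover and a track to the base point.\<close>
  have "\<exists>V \<sigma>. V \<in> \<V> \<and> x \<in> V \<and> path_in V \<sigma> x (v V)" if xK: "x \<in> K" for x
  proof -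
    obtain V where V: "V \<in> \<V>" "x \<in> V" using \<V>(3) xK by blast
    then show ?thesis using path_connected_path_in[of V x "v V"] \<V>(2) v by blast
  qed
  then obtain S \<sigma> where S: "\<And>x. x \<in> K \<Longrightarrow> S x \<in> \<V> \<and> x \<in> S x \<and> path_in (S x) (\<sigma> x) x (v (S x))" by metis
  define T where "T x = \<sigma> x +++ tr (S x)" for x
  have SL: "V \<subseteq> L" if V: "V \<in> \<V>" for V
  proof -
    have "V \<inter> V \<inter> K \<noteq> {}" using \<V>(2)[OF V] by blast
    then obtain y where "y \<in> A" "V \<union> V \<subseteq> W y" using star[OF V V] by blast
    then show ?thesis using WL by blast
  qed
  have \<sigma>L: "path_in L (\<sigma> x) x (v (S x))" if "x \<in> K" for x
    using S[OF that] SL path_in_mono by blast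
  have TL: "path_in L (T x) x b" if "x \<in> K" for x
    unfolding T_def using \<sigma>L[OF that] trL S[OF that] path_in_join by blast
  have local1: "homotopic_paths L \<kappa> (T x +++ reversepath (tr V))"
    if x: "x \<in> K" and V: "V \<in> \<V>" and \<kappa>: "path_in V \<kappa> x (v V)" for x V \<kappa>
  proof -
    let ?e = "(S x, V)"
    have xV: "x \<in> V" using path_in_ends[OF \<kappa>] by blast
    have ne: "S x \<inter> V \<inter> K \<noteq> {}" using S[OF x] xV x by blast
    have e: "?e \<in> adj" using ne S[OF x] V by (simp add: adj_def)
    obtain y where y: "y \<in> A" "S x \<union> V \<subseteq> W y" using star[OF _ V ne] S[OF x] by blast
    have s: "path_in (W y) (\<sigma> x) x (v (S x))" using S[OF x] y(2) path_in_mono by blast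
    have k: "path_in (W y) \<kappa> x (v V)" using \<kappa> y(2) path_in_mono by blast
    have cc: "path_in (W y) (c ?e) (v (S x)) (v V)" using cH(1)[OF e] y(2) path_in_mono by fastforce
    have 1: "homotopic_paths L \<kappa> (\<sigma> x +++ c ?e)" by (rule same[OF y(1) k path_in_join[OF s cc]])
    have 2: "homotopic_paths L (\<sigma> x +++ c ?e) (\<sigma> x +++ (tr (S x) +++ reversepath (tr V)))"
      using hom_join_left[OF _ \<sigma>L[OF x] path_in_mono[OF cc WL[OF y(1)]]] cL[OF e] by simp
    have 3: "homotopic_paths L (\<sigma> x +++ (tr (S x) +++ reversepath (tr V))) (T x +++ reversepath (tr V))"
      unfolding T_def using hom_assoc[OF \<sigma>L[OF x] trL path_in_rev[OF trL[OF V]]] S[OF x] by blast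
    show ?thesis by (rule hom_trans3[OF 1 2 3])
  qed
  have main: "homotopic_paths L p (\<lambda>_. x)" if p: "path_in K p x x" for p x
  proof -
    note pc = path_cont[OF p]
    have pK: "p s \<in> K" if "s \<in> {0..1}" for s using pc(2) that by blast
    have KL: "K \<subseteq> L" using \<V>(3) SL by blast
    have piece: "path_in L (piece s t p) (p s) (p t)" if "0 \<le> s" "s \<le> t" "t \<le> 1" for s t
      by (rule path_in_mono[OF path_in_piece[OF pc(1) _ _ _ pc(2)] KL]) (use that in auto)
    have "homotopic_paths L (piece 0 1 p) (T (p 0) +++ reversepath (T (p 1)))"
    proof (rule Bolzano_path[OF pc(1)])
      show "p ` {0..1} \<subseteq> Y" using pc(2) K(2) by blast
      fix u :: real assume u: "u \<in> {0..1}"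
      obtain V where V: "V \<in> \<V>" "p u \<in> V" using \<V>(3) pK[OF u] by blast
      have "homotopic_paths L (piece s t p) (T (p s) +++ reversepath (T (p t)))"
        if st: "0 \<le> s" "s \<le> t" "t \<le> 1" "p ` {s..t} \<subseteq> V" for s t
      proof -
        have I: "s \<in> {0..1}" "t \<in> {0..1}" using st by auto
        have inV: "p s \<in> V" "p t \<in> V" using st by auto
        obtain \<kappa> where \<kappa>: "path_in V \<kappa> (p s) (v V)" using path_connected_path_in[of V "p s" "v V"] \<V>(2) v V inV by blast
        obtain \<kappa>' where \<kappa>': "path_in V \<kappa>' (p t) (v V)" using path_connected_path_in[of V "p t" "v V"] \<V>(2) v V inV by blast
        have pV: "path_in V (piece s t p) (p s) (p t)"
          by (rule path_in_piece[of "{s..t}"]) (use st pc(1) in \<open>auto intro: continuous_on_subset\<close>)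
        have "V \<inter> V \<inter> K \<noteq> {}" using \<V>(2)[OF V(1)] by blast
        then obtain y where y: "y \<in> A" "V \<subseteq> W y" using star[OF V(1) V(1)] by blast
        have 1: "homotopic_paths L (piece s t p) (\<kappa> +++ reversepath \<kappa>')"
          by (rule same[OF y(1) path_in_mono[OF pV y(2)] path_in_mono[OF path_in_join[OF \<kappa> path_in_rev[OF \<kappa>']] y(2)]])
        have h1: "homotopic_paths L \<kappa> (T (p s) +++ reversepath (tr V))" by (rule local1[OF pK[OF I(1)] V(1) \<kappa>])
        have h2: "homotopic_paths L \<kappa>' (T (p t) +++ reversepath (tr V))" by (rule local1[OF pK[OF I(2)] V(1) \<kappa>'])
        have r: "reversepath (T (p t) +++ reversepath (tr V)) = tr V +++ reversepath (T (p t))"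
          using reversepath_join[OF TL[OF pK[OF I(2)]] path_in_rev[OF trL[OF V(1)]]] by simp
        have h3: "homotopic_paths L (reversepath \<kappa>') (tr V +++ reversepath (T (p t)))"
          using homotopic_paths_reversepath_D[OF h2] unfolding r .
        have \<kappa>L: "path_in L \<kappa> (p s) (v V)" "path_in L (reversepath \<kappa>') (v V) (p t)"
          using path_in_mono[OF \<kappa> SL[OF V(1)]] path_in_rev[OF path_in_mono[OF \<kappa>' SL[OF V(1)]]] by blast+
        have 2: "homotopic_paths L (\<kappa> +++ reversepath \<kappa>') ((T (p s) +++ reversepath (tr V)) +++ (tr V +++ reversepath (T (p t))))"
          by (rule hom_join[OF h1 h3 \<kappa>L])
        have 3: "homotopic_paths L ((T (p s) +++ reversepath (tr V)) +++ (tr V +++ reversepath (T (p t)))) (T (p s) +++ reversepath (T (p t)))"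
          by (rule hom_telescope[OF TL[OF pK[OF I(1)]] trL[OF V(1)] TL[OF pK[OF I(2)]]])
        show ?thesis by (rule hom_trans3[OF 1 2 3])
      qed
      then show "\<exists>V. openin (top_of_set Y) V \<and> p u \<in> V \<and> (\<forall>s t. 0 \<le> s \<longrightarrow> s \<le> t \<longrightarrow> t \<le> 1 \<longrightarrow> p ` {s..t} \<subseteq> V \<longrightarrow>
          homotopic_paths L (piece s t p) (T (p s) +++ reversepath (T (p t))))"
        using V \<V>(2) by (intro exI[of _ V]) blast
    next
      fix s t u :: real assume le: "0 \<le> s" "s \<le> t" "t \<le> u" "u \<le> 1"
        and h: "homotopic_paths L (piece s t p) (T (p s) +++ reversepath (T (p t)))"
         "homotopic_paths L (piece t u p) (T (p t) +++ reversepath (T (p u)))"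
      have I: "s \<in> {0..1}" "t \<in> {0..1}" "u \<in> {0..1}" using le by auto
      have 1: "homotopic_paths L (piece s u p) (piece s t p +++ piece t u p)"
        by (rule homotopic_paths_sym, rule hom_piece_join[OF pc(1) _ I]) (use pc(2) KL in auto)
      have 2: "homotopic_paths L (piece s t p +++ piece t u p) ((T (p s) +++ reversepath (T (p t))) +++ (T (p t) +++ reversepath (T (p u))))"
        by (rule hom_join[OF h piece piece]) (use le in auto)
      have 3: "homotopic_paths L ((T (p s) +++ reversepath (T (p t))) +++ (T (p t) +++ reversepath (T (p u)))) (T (p s) +++ reversepath (T (p u)))"
        by (rule hom_telescope[OF TL[OF pK[OF I(1)]] TL[OF pK[OF I(2)]] TL[OF pK[OF I(3)]]])
      show "homotopic_paths L (piece s u p) (T (p s) +++ reversepath (T (p u)))"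
        by (rule hom_trans3[OF 1 2 3])
    qed
    moreover have "x \<in> K" using path_in_ends[OF p] by blast
    then have "homotopic_paths L (T x +++ reversepath (T x)) (\<lambda>_. x)" using hom_rinv[OF TL] by blast
    ultimately show ?thesis unfolding piece_01 pc(3,4) by (rule homotopic_paths_trans)
  qed
  show thesis by (rule that[OF L main])
qed

end

section \<open>Proper rays and infinite concatenations\<close>

lemma openin_Diff_closed:
  assumes "openin (top_of_set Y) V" "closed T" shows "openin (top_of_set Y) (V - T)"
proof -
  obtain U where "open U" "V = Y \<inter> U" using assms(1) unfolding openin_open by blast
  then show ?thesis using assms(2) unfolding openin_open by (intro exI[of _ "U - T"]) auto
qed

context nice_space
begin

text \<open>Locally compact Hausdorff spaces are compactly generated.\<close>

lemma closedin_of_compact_traces: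
  assumes "S \<subseteq> Y" "\<And>K. compact K \<Longrightarrow> K \<subseteq> Y \<Longrightarrow> compact (S \<inter> K)"
  shows "closedin (top_of_set Y) S"
proof -
  have "\<exists>V. openin (top_of_set Y) V \<and> y \<in> V \<and> V \<subseteq> Y - S" if y: "y \<in> Y - S" for y
  proof -
    obtain V L where V: "openin (top_of_set Y) V" "{y} \<subseteq> V" "V \<subseteq> L" "compact L" "L \<subseteq> Y"
      using compact_nbhd[of "{y}"] y by (metis DiffD1 compact_sing empty_subsetI insert_subset)
    have "closed (S \<inter> L)" using assms(2)[OF V(4,5)] by (rule compact_imp_closed)
    then have "openin (top_of_set Y) (V - (S \<inter> L))" by (rule openin_Diff_closed[OF V(1)])
    moreover have "V \<subseteq> Y" using V(3,5) by blast
    ultimately show ?thesis using V y by (intro exI[of _ "V - (S \<inter> L)"]) blast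
  qed
  then have "openin (top_of_set Y) (Y - S)" by (subst openin_subopen) blast
  then show ?thesis using assms(1) by (simp add: closedin_def double_diff)
qed

lemma proper_mapI:
  fixes f :: "'c::heine_borel \<Rightarrow> 'a"
  assumes "closed X" "continuous_on X f" "f ` X \<subseteq> Y"
    and "\<And>D. compact D \<Longrightarrow> D \<subseteq> Y \<Longrightarrow> bounded {x \<in> X. f x \<in> D}"
  shows "proper_map (top_of_set X) (top_of_set Y) f"
proof (rule compact_imp_proper_map_gen)
  show "closedin (top_of_set Y) S" if "S \<subseteq> topspace (top_of_set Y)" "\<And>K. compactin (top_of_set Y) K \<Longrightarrow> compactin (top_of_set Y) (S \<inter> K)" for S
    by (rule closedin_of_compact_traces) (use that in \<open>auto simp: compactin_subtopology\<close>)
  show "f ` topspace (top_of_set X) \<subseteq> topspace (top_of_set Y)" using assms(3) by simp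
  show "continuous_map (top_of_set X) (top_of_set Y) f \<or> kc_space (top_of_set X)"
    using assms(2,3) by (simp add: image_subset_iff_funcset)
  fix K assume "compactin (top_of_set Y) K"
  then have K: "compact K" "K \<subseteq> Y" by (auto simp: compactin_subtopology)
  have "closedin (top_of_set X) (X \<inter> f -` K)"
    using assms(2) compact_imp_closed[OF K(1)] by (rule continuous_closedin_preimage)
  then have "closed (X \<inter> f -` K)" using assms(1) closedin_closed_trans by blast
  moreover have "X \<inter> f -` K = {x \<in> X. f x \<in> K}" by auto
  ultimately have "compact {x \<in> X. f x \<in> K}" using assms(4)[OF K] by (simp add: compact_eq_bounded_closed)
  then show "compactin (top_of_set X) {x \<in> topspace (top_of_set X). f x \<in> K}"
    by (auto simp: compactin_subtopology)
qed

lemma proper_rayI: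
  assumes "continuous_on {0..} r" "r ` {0..} \<subseteq> Y" "\<And>D. compact D \<Longrightarrow> D \<subseteq> Y \<Longrightarrow> \<exists>T. \<forall>t\<ge>T. r t \<notin> D"
  shows "proper_ray Y r"
  unfolding proper_ray_def
proof
  show "continuous_map (top_of_set {0..}) (top_of_set Y) r" using assms(1,2) by (simp add: image_subset_iff_funcset)
  show "proper_map (top_of_set {0..}) (top_of_set Y) r"
  proof (rule proper_mapI[OF _ assms(1,2)])
    fix D assume D: "compact D" "D \<subseteq> Y"
    obtain T where T: "\<forall>t\<ge>T. r t \<notin> D" using assms(3)[OF D] by blast
    have "{x \<in> {0..}. r x \<in> D} \<subseteq> {0..T}" using T by (auto simp: not_le intro: less_imp_le) (meson linorder_le_cases)
    then show "bounded {x \<in> {0..}. r x \<in> D}" using bounded_closed_interval bounded_subset by blast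
  qed simp
qed

end

lemma proper_rayD:
  assumes "proper_ray Y r"
  shows "continuous_on {0..} r" "r ` {0..} \<subseteq> Y" "compact D \<Longrightarrow> D \<subseteq> Y \<Longrightarrow> \<exists>T\<ge>0. \<forall>t\<ge>T. r t \<in> Y - D"
proof -
  show c: "continuous_on {0..} r" and i: "r ` {0..} \<subseteq> Y"
    using assms unfolding proper_ray_def by (auto simp: image_subset_iff_funcset)
  assume D: "compact D" "D \<subseteq> Y"
  have "compactin (top_of_set {0..}) {x \<in> topspace (top_of_set {0..}). r x \<in> D}"
    using assms compactin_proper_map_preimage[of "top_of_set {0..}" "top_of_set Y" r D] D
    unfolding proper_ray_def by (auto simp: compactin_subtopology)
  then have "compact {x \<in> {0..}. r x \<in> D}" by (auto simp: compactin_subtopology)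
  then have "bounded {x \<in> {0..}. r x \<in> D}" by (rule compact_imp_bounded)
  then obtain B where B: "\<And>x. x \<in> {x \<in> {0..}. r x \<in> D} \<Longrightarrow> norm x \<le> B" unfolding bounded_iff by blast
  have "r t \<in> Y - D" if "t \<ge> max 0 (B + 1)" for t
  proof -
    have "t \<ge> 0" "\<not> norm t \<le> B" using that by auto
    then show ?thesis using B[of t] i by auto
  qed
  then show "\<exists>T\<ge>0. \<forall>t\<ge>T. r t \<in> Y - D" by (intro exI[of _ "max 0 (B+1)"]) auto
qed

definition concat_paths :: "(nat \<Rightarrow> real \<Rightarrow> 'a) \<Rightarrow> real \<Rightarrow> 'a" where
  "concat_paths e t = e (nat \<lfloor>t\<rfloor>) (frac t)"

lemma ray_image_eq_concat: "ray_image z r = concat_paths (\<lambda>i. oriented_edge_image z (r i))"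
  by (auto simp: ray_image_def concat_paths_def)

lemma concat_paths_eq:
  assumes "\<And>i. e i 1 = e (Suc i) 0" "real n \<le> t" "t \<le> real n + 1"
  shows "concat_paths e t = e n (t - real n)"
proof (cases "t = real n + 1")
  case True
  have "\<lfloor>t\<rfloor> = int (Suc n)" using True by (simp add: floor_eq_iff)
  then have "nat \<lfloor>t\<rfloor> = Suc n" "frac t = 0" using True by (auto simp: frac_def)
  then have "concat_paths e t = e (Suc n) 0" unfolding concat_paths_def by (simp only:)
  moreover have "t - real n = 1" using True by simp
  ultimately show ?thesis using assms(1)[of n] by simp
next
  case False
  then have "\<lfloor>t\<rfloor> = int n" using assms by (simp add: floor_eq_iff)
  then show ?thesis by (simp add: concat_paths_def frac_def)
qed

lemma concat_paths_continuous:
  fixes e :: "nat \<Rightarrow> real \<Rightarrow> 'a::topological_space"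
  assumes e: "\<And>i. continuous_on {0..1} (e i)" and match: "\<And>i. e i 1 = e (Suc i) 0"
  shows "continuous_on {0..} (concat_paths e)"
proof -
  have "continuous_map (top_of_set {0..}) euclidean (concat_paths e)"
  proof (rule pasting_lemma_locally_finite[where I = UNIV and T = "\<lambda>n. {real n..real n + 1}" and f = "\<lambda>n t. e n (t - real n)"])
    fix x :: real assume "x \<in> topspace (top_of_set {0..})"
    then have x: "x \<ge> 0" by simp
    define n where "n = nat \<lfloor>x\<rfloor>"
    have "real n = of_int \<lfloor>x\<rfloor>" using x by (simp add: n_def)
    then have n: "real n \<le> x" "x \<le> real n + 1" by linarith+
    have "{i \<in> UNIV. {real i..real i + 1} \<inter> ({0..} \<inter> {..<x+1}) \<noteq> {}} \<subseteq> {..n + 2}"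
      using n by (auto simp: not_le)
    then have "finite {i \<in> UNIV. {real i..real i + 1} \<inter> ({0..} \<inter> {..<x+1}) \<noteq> {}}" using finite_subset by blast
    then show "\<exists>V. openin (top_of_set {0..}) V \<and> x \<in> V \<and> finite {i \<in> UNIV. {real i..real i + 1} \<inter> V \<noteq> {}}"
      using x by (intro exI[of _ "{0..} \<inter> {..<x+1}"] conjI openin_open_Int) simp_all
    show "\<exists>j. j \<in> UNIV \<and> x \<in> {real j..real j + 1} \<and> concat_paths e x = e j (x - real j)"
      using n concat_paths_eq[of e n x, OF match n] by (intro exI[of _ n]) simp
  next
    fix i :: nat
    show "closedin (top_of_set {0..}) {real i..real i + 1}" by (intro closed_subset) auto
    have "continuous_on {real i..real i + 1} (\<lambda>t. e i (t - real i))"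
      by (rule continuous_on_compose2[OF e]) (auto intro!: continuous_intros)
    moreover have "{0..} \<inter> {real i..real i + 1} = {real i..real i+1}" by auto
    ultimately show "continuous_map (subtopology (top_of_set {0..}) {real i..real i + 1}) euclidean (\<lambda>t. e i (t - real i))"
      by (simp add: subtopology_subtopology)
  next
    fix i j :: nat and x assume "x \<in> topspace (top_of_set {0..}) \<inter> {real i..real i + 1} \<inter> {real j..real j + 1}"
    then have "real i \<le> x" "x \<le> real i + 1" "real j \<le> x" "x \<le> real j + 1" by auto
    then show "e i (x - real i) = e j (x - real j)"
      using concat_paths_eq[of e i x, OF match] concat_paths_eq[of e j x, OF match] by simp
  qed
  then show ?thesis by simp
qed

lemma concat_paths_mem:
  assumes "\<And>i. e i 1 = e (Suc i) 0" "t \<ge> 0"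
  shows "concat_paths e t \<in> e (nat \<lfloor>t\<rfloor>) ` {0..1}"
proof -
  have "frac t \<in> {0..1}" using frac_ge_0[of t] frac_lt_1[of t] by auto
  then show ?thesis by (simp add: concat_paths_def)
qed

lemma concat_paths_image:
  assumes "\<And>i. e i 1 = e (Suc i) 0" 
  shows "concat_paths e ` {0..} = (\<Union>i. e i ` {0..1})"
proof
  show "concat_paths e ` {0..} \<subseteq> (\<Union>i. e i ` {0..1})" using concat_paths_mem[of e] assms by blast
  show "(\<Union>i. e i ` {0..1}) \<subseteq> concat_paths e ` {0..}"
  proof safe
    fix i :: nat and t :: real assume "t \<in> {0..1}"
    then show "e i t \<in> concat_paths e ` {0..}"
      using concat_paths_eq[of e i "real i + t"] assms by (intro image_eqI[of _ _ "real i + t"]) auto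
  qed
qed

lemma concat_paths_eventually:
  assumes "\<And>i. e i 1 = e (Suc i) 0" "finite {i. e i ` {0..1} \<inter> D \<noteq> {}}"
  shows "\<exists>T\<ge>0. \<forall>t\<ge>T. concat_paths e t \<notin> D"
proof -
  obtain n where n: "{i. e i ` {0..1} \<inter> D \<noteq> {}} \<subseteq> {..<n::nat}" using assms(2) finite_nat_iff_bounded by blast
  have "concat_paths e t \<notin> D" if "t \<ge> real n" for t
  proof
    assume "concat_paths e t \<in> D"
    then have "e (nat \<lfloor>t\<rfloor>) ` {0..1} \<inter> D \<noteq> {}" using concat_paths_mem[of e t] assms(1) that by auto
    then have "nat \<lfloor>t\<rfloor> < n" using n by blast
    then show False using that by linarith
  qed
  then show ?thesis by (intro exI[of _ "real n"]) auto
qed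

section \<open>Properly discontinuous actions\<close>

text \<open>The covering condition alone does not imply that an action is properly discontinuous, but here the group permutes
  the cells, and a compact set meets only finitely many of them.\<close>

lemma (in CW) covering_action_properly_discontinuous:
  assumes cov: "acts_by_covering_transformations J \<phi> Y" and cp: "cell_preserving J \<phi> E"
    and K: "compact K" "K \<subseteq> Y"
  shows "finite {g \<in> carrier J. \<phi> g ` K \<inter> K \<noteq> {}}"
proof -
  have ga: "group_action J Y \<phi>" and wander: "\<And>y. y \<in> Y \<Longrightarrow> \<exists>U. openin (top_of_set Y) U \<and> y \<in> U \<and>
        (\<forall>g\<in>carrier J. g \<noteq> \<one>\<^bsub>J\<^esub> \<longrightarrow> \<phi> g ` U \<inter> U = {})"
    using cov unfolding acts_by_covering_transformations_def by auto
  interpret group_action J Y \<phi> by (rule ga)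
  have grp: "group J" using group_hom group_hom.axioms(1) by blast
  interpret J: group J by (rule grp)
  \<comment> \<open>An infinite family of elements carrying one cell to another would make an infinite orbit
      accumulate in a compact closed cell, against the covering condition.\<close>
  have pair: "finite {g \<in> carrier J. \<phi> g ` e = e'}" if e: "(n,e) \<in> cell_index" and e': "(m,e') \<in> cell_index" for n m e e'
  proof (rule ccontr)
    define S where "S = {g \<in> carrier J. \<phi> g ` e = e'}"
    assume "infinite {g \<in> carrier J. \<phi> g ` e = e'}"
    then have inf: "infinite S" by (simp add: S_def)
    have "(\<lambda>_. 0) \<in> unit_ball_interior n" by (simp add: unit_ball_interior_def)
    then obtain y where y: "y \<in> e" using char_map_open[OF e] by auto
    have yY: "y \<in> Y" using y cell_subset[OF e] char_map_into[OF e] by auto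
    have sep: "g = h" if g: "g \<in> carrier J" "h \<in> carrier J" and U: "\<And>g. g \<in> carrier J \<Longrightarrow> g \<noteq> \<one>\<^bsub>J\<^esub> \<Longrightarrow> \<phi> g ` U \<inter> U = {}" 
      and gU: "\<phi> g y \<in> U" "\<phi> h y \<in> U" for g h U
    proof (rule ccontr)
      assume "g \<noteq> h"
      let ?k = "g \<otimes>\<^bsub>J\<^esub> inv\<^bsub>J\<^esub> h"
      have k: "?k \<in> carrier J" using g by simp
      have "?k \<noteq> \<one>\<^bsub>J\<^esub>" using \<open>g \<noteq> h\<close> g by (metis J.inv_closed J.inv_equality J.inv_inv)
      moreover have "\<phi> ?k (\<phi> h y) = \<phi> g y"
        using composition_rule[of y ?k h] yY g k by (simp add: J.m_assoc)
      then have "\<phi> g y \<in> \<phi> ?k ` U" using gU(2) by (metis imageI)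
      ultimately show False using U[OF k] gU(1) by blast
    qed
    have inj: "inj_on (\<lambda>g. \<phi> g y) S"
    proof (rule inj_onI)
      fix g h assume gh: "g \<in> S" "h \<in> S" "\<phi> g y = \<phi> h y"
      have "\<phi> h y \<in> Y" using gh element_image[of h y] yY by (simp add: S_def)
      from wander[OF this] obtain U where "\<phi> h y \<in> U" "\<forall>g\<in>carrier J. g \<noteq> \<one>\<^bsub>J\<^esub> \<longrightarrow> \<phi> g ` U \<inter> U = {}"
        by (elim exE conjE)
      then show "g = h" using sep[of g h U] gh by (auto simp: S_def)
    qed
    define X where "X = (\<lambda>g. \<phi> g y) ` S"
    have "infinite X" unfolding X_def using inf inj finite_imageD by blast
    moreover have "X \<subseteq> closed_cell (m,e')" using y cell_subset[OF e'] by (auto simp: X_def S_def)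
    ultimately obtain w where w: "w \<in> closed_cell (m,e')" "w islimpt X"
      using Heine_Borel_imp_Bolzano_Weierstrass[OF compact_closed_cell[OF e']] by blast
    then have "w \<in> Y" using char_map_into[OF e'] by blast
    from wander[OF this] obtain U where U: "openin (top_of_set Y) U" "w \<in> U" "\<forall>g\<in>carrier J. g \<noteq> \<one>\<^bsub>J\<^esub> \<longrightarrow> \<phi> g ` U \<inter> U = {}"
      by (elim exE conjE)
    obtain T where T: "open T" "U = Y \<inter> T" using U(1) unfolding openin_open by blast
    have wT: "w \<in> T" using U(2) T(2) by simp
    obtain x1 where x1: "x1 \<in> X" "x1 \<in> T" "x1 \<noteq> w" by (rule islimptE[OF w(2) wT T(1)])
    have "w \<in> T - {x1}" "open (T - {x1})" using T(1) wT x1 by auto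
    then obtain x2 where x2: "x2 \<in> X" "x2 \<in> T - {x1}" "x2 \<noteq> w" by (rule islimptE[OF w(2)])
    obtain g h where gh: "g \<in> S" "x1 = \<phi> g y" "h \<in> S" "x2 = \<phi> h y" using x1 x2 by (auto simp: X_def)
    have XY: "X \<subseteq> Y" using element_image yY by (auto simp: X_def S_def)
    have "g = h" by (rule sep[of g h U]) (use gh U T x1 x2 XY in \<open>auto simp: S_def\<close>)
    then show False using gh x2 by simp
  qed
  obtain F V where F: "subcx F" "openin (top_of_set Y) V" "K \<subseteq> V" "V \<subseteq> carrier_of F"
    by (rule compact_in_subcx[OF K])
  have Fi: "finite F" "F \<subseteq> cell_index" using F by (auto simp: subcx_def)
  have "{g \<in> carrier J. \<phi> g ` K \<inter> K \<noteq> {}} \<subseteq> (\<Union>(c,d)\<in>F \<times> F. {g \<in> carrier J. \<phi> g ` snd c = snd d})"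
  proof
    fix g assume "g \<in> {g \<in> carrier J. \<phi> g ` K \<inter> K \<noteq> {}}"
    then obtain x where x: "g \<in> carrier J" "x \<in> K" "\<phi> g x \<in> K" by auto
    then obtain c d where cd: "c \<in> F" "x \<in> snd c" "d \<in> F" "\<phi> g x \<in> snd d"
      using F unfolding carrier_of_def by blast
    have "snd c \<in> E (fst c)" using cd(1) Fi(2) by (auto simp: cell_index_def)
    then have "\<phi> g ` snd c \<in> E (fst c)" using cp x(1) unfolding cell_preserving_def by blast
    then have "(fst c, \<phi> g ` snd c) \<in> cell_index" by (simp add: cell_index_def)
    moreover have "d \<in> cell_index" using cd(3) Fi(2) by blast
    moreover have "snd (fst c, \<phi> g ` snd c) \<inter> snd d \<noteq> {}" using cd(2,4) by auto
    ultimately have "(fst c, \<phi> g ` snd c) = d" by (rule cell_disjoint)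
    then have "\<phi> g ` snd c = snd d" by auto
    then show "g \<in> (\<Union>(c,d)\<in>F \<times> F. {g \<in> carrier J. \<phi> g ` snd c = snd d})" using x(1) cd by blast
  qed
  moreover have "finite (\<Union>(c,d)\<in>F \<times> F. {g \<in> carrier J. \<phi> g ` snd c = snd d})"
  proof (rule finite_UN_I)
    show "finite (F \<times> F)" using Fi by simp
    fix cd assume "cd \<in> F \<times> F"
    then have "(fst (fst cd), snd (fst cd)) \<in> cell_index" "(fst (snd cd), snd (snd cd)) \<in> cell_index"
      using Fi(2) by auto
    from pair[OF this] show "finite (case cd of (c,d) \<Rightarrow> {g \<in> carrier J. \<phi> g ` snd c = snd d})"
      by (simp add: case_prod_unfold)
  qed
  ultimately show ?thesis using finite_subset by blast
qed

locale proper_action = nice_space Y for Y :: "'a::t2_space set" +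
  fixes J :: "('g, 'm) monoid_scheme" (structure) and \<phi> :: "'g \<Rightarrow> 'a \<Rightarrow> 'a"
  assumes act: "group_action J Y \<phi>"
    and homeo: "\<And>g. g \<in> carrier J \<Longrightarrow> homeomorphic_map (top_of_set Y) (top_of_set Y) (\<phi> g)"
    and infinite_group: "infinite (carrier J)"
    and prop_disc: "\<And>K. compact K \<Longrightarrow> K \<subseteq> Y \<Longrightarrow> finite {g \<in> carrier J. \<phi> g ` K \<inter> K \<noteq> {}}"
begin

lemma grp: "group J"
  using act unfolding group_action_def by (rule group_hom.axioms(1))

sublocale J: group J by (rule grp)

lemma act_comp: "g \<in> carrier J \<Longrightarrow> h \<in> carrier J \<Longrightarrow> x \<in> Y \<Longrightarrow> \<phi> (g \<otimes> h) x = \<phi> g (\<phi> h x)"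
  using group_action.composition_rule[OF act] by blast

lemma act_one: "x \<in> Y \<Longrightarrow> \<phi> \<one> x = x"
  using group_action.id_eq_one[OF act] by (metis restrict_apply')

lemma act_in: "g \<in> carrier J \<Longrightarrow> x \<in> Y \<Longrightarrow> \<phi> g x \<in> Y"
  using group_action.element_image[OF act] by blast

lemma act_inv: "g \<in> carrier J \<Longrightarrow> x \<in> Y \<Longrightarrow> \<phi> (inv g) (\<phi> g x) = x"
  using act_comp[of "inv g" g x] act_one by simp

lemma act_inv': "g \<in> carrier J \<Longrightarrow> x \<in> Y \<Longrightarrow> \<phi> g (\<phi> (inv g) x) = x"
  using act_comp[of g "inv g" x] act_one by simp

lemma act_cont: "g \<in> carrier J \<Longrightarrow> continuous_on Y (\<phi> g)"
  using homeomorphic_imp_continuous_map[OF homeo] by simp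

lemma act_sub: "g \<in> carrier J \<Longrightarrow> A \<subseteq> Y \<Longrightarrow> \<phi> g ` A \<subseteq> Y"
  using act_in by blast

lemma act_compact: "g \<in> carrier J \<Longrightarrow> A \<subseteq> Y \<Longrightarrow> compact A \<Longrightarrow> compact (\<phi> g ` A)"
  using act_cont compact_continuous_image continuous_on_subset by blast

lemma act_open: "g \<in> carrier J \<Longrightarrow> openin (top_of_set Y) A \<Longrightarrow> openin (top_of_set Y) (\<phi> g ` A)"
  using homeomorphic_imp_open_map[OF homeo] unfolding open_map_def by blast

lemma act_path:
  assumes g: "g \<in> carrier J" and A: "A \<subseteq> Y" and p: "path_in A p x y"
  shows "path_in (\<phi> g ` A) (\<phi> g \<circ> p) (\<phi> g x) (\<phi> g y)"
proof -
  have im: "path_image p \<subseteq> A" using p by (simp add: path_in_def)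
  then have "continuous_on (path_image p) (\<phi> g)"
    using continuous_on_subset[OF act_cont[OF g]] A by blast
  then have "path (\<phi> g \<circ> p)" using p by (intro path_continuous_image) (simp_all add: path_in_def)
  then show ?thesis using p im by (auto simp: path_in_def path_image_compose pathstart_compose pathfinish_compose)
qed

lemma act_path_connected:
  assumes "g \<in> carrier J" "A \<subseteq> Y" "path_connected A"
  shows "path_connected (\<phi> g ` A)"
  by (rule path_connected_continuous_image[OF continuous_on_subset[OF act_cont[OF assms(1)] assms(2)] assms(3)])

lemma act_hom:
  assumes "g \<in> carrier J" "A \<subseteq> Y" "homotopic_paths A p q"
  shows "homotopic_paths (\<phi> g ` A) (\<phi> g \<circ> p) (\<phi> g \<circ> q)"
  by (rule homotopic_paths_continuous_image[OF assms(3) continuous_on_subset[OF act_cont[OF assms(1)] assms(2)]]) blast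

lemma act_image_comp: "g \<in> carrier J \<Longrightarrow> h \<in> carrier J \<Longrightarrow> A \<subseteq> Y \<Longrightarrow> \<phi> g ` \<phi> h ` A = \<phi> (g \<otimes> h) ` A"
  using act_comp by (auto simp: image_image subset_iff intro!: image_cong)

lemma act_image_one: "A \<subseteq> Y \<Longrightarrow> \<phi> \<one> ` A = A"
  using act_one by (force simp: subset_iff)

lemma meets_finite:
  assumes "compact K" "K \<subseteq> Y" "compact L" "L \<subseteq> Y"
  shows "finite {g \<in> carrier J. \<phi> g ` K \<inter> L \<noteq> {}}"
proof (rule finite_subset)
  show "{g \<in> carrier J. \<phi> g ` K \<inter> L \<noteq> {}} \<subseteq> {g \<in> carrier J. \<phi> g ` (K \<union> L) \<inter> (K \<union> L) \<noteq> {}}" by auto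
  show "finite {g \<in> carrier J. \<phi> g ` (K \<union> L) \<inter> (K \<union> L) \<noteq> {}}" using assms by (intro prop_disc) auto
qed

lemma compact_finite_translates: "finite M \<Longrightarrow> M \<subseteq> carrier J \<Longrightarrow> compact K \<Longrightarrow> K \<subseteq> Y \<Longrightarrow> compact (\<Union>g\<in>M. \<phi> g ` K)"
  by (intro compact_UN act_compact) auto

lemma translates_sub: "A \<subseteq> Y \<Longrightarrow> translates J \<phi> A \<subseteq> Y"
  using act_in by (auto simp: translates_def)

lemma translates_mono: "A \<subseteq> B \<Longrightarrow> translates J \<phi> A \<subseteq> translates J \<phi> B"
  by (auto simp: translates_def)

lemma translates_self: "A \<subseteq> Y \<Longrightarrow> A \<subseteq> translates J \<phi> A"
  using act_image_one[of A] J.one_closed unfolding translates_def by blast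

lemma translates_invariant:
  assumes "g \<in> carrier J" "A \<subseteq> Y" "x \<in> translates J \<phi> A" shows "\<phi> g x \<in> translates J \<phi> A"
proof -
  obtain h a where "h \<in> carrier J" "a \<in> A" "x = \<phi> h a" using assms(3) by (auto simp: translates_def)
  then have "\<phi> g x = \<phi> (g \<otimes> h) a" "g \<otimes> h \<in> carrier J" using act_comp[of g h a] assms by auto
  then show ?thesis using \<open>a \<in> A\<close> by (auto simp: translates_def)
qed

lemma translates_open: "openin (top_of_set Y) A \<Longrightarrow> openin (top_of_set Y) (translates J \<phi> A)"
  unfolding translates_def by (intro openin_Union) (auto intro: act_open)

lemma translates_closed:
  assumes K: "compact K" "K \<subseteq> Y"
  shows "closedin (top_of_set Y) (translates J \<phi> K)"
proof (rule closedin_of_compact_traces[OF translates_sub[OF K(2)]])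
  fix L assume L: "compact L" "L \<subseteq> Y"
  let ?M = "{g \<in> carrier J. \<phi> g ` K \<inter> L \<noteq> {}}"
  have "translates J \<phi> K \<inter> L = (\<Union>g\<in>?M. \<phi> g ` K) \<inter> L" by (auto simp: translates_def)
  moreover have "compact (\<Union>g\<in>?M. \<phi> g ` K)"
    by (rule compact_finite_translates[OF meets_finite[OF K L] _ K]) auto
  then have "compact ((\<Union>g\<in>?M. \<phi> g ` K) \<inter> L)" using compact_imp_closed[OF L(1)] by (rule compact_Int_closed)
  ultimately show "compact (translates J \<phi> K \<inter> L)" by (simp only:)
qed

end

section \<open>Cayley rays and classes of paths to infinity\<close>

text \<open>\<open>Cs\<close> is the compact set that semistability with respect to \<open>C0\<close> provides, enlarged by \<open>C0\<close>.\<close>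

locale cayley_action = proper_action Y J \<phi>
  for Y :: "'a::t2_space set" and J :: "('g, 'm) monoid_scheme" (structure) and \<phi> +
  fixes base :: 'a and S :: "'g set" and z :: "'g \<Rightarrow> 'g \<Rightarrow> real \<Rightarrow> 'a" and C0 Cs :: "'a set"
  assumes base: "base \<in> Y"
    and S: "finite S" "S \<subseteq> carrier J" "generate J S = carrier J"
    and z_path: "\<And>g s. g \<in> carrier J \<Longrightarrow> s \<in> S \<Longrightarrow> path_in Y (z g s) (\<phi> g base) (\<phi> (g \<otimes> s) base)"
    and z_equiv: "\<And>h g s t. h \<in> carrier J \<Longrightarrow> g \<in> carrier J \<Longrightarrow> s \<in> S \<Longrightarrow> t \<in> {0..1} \<Longrightarrow> z (h \<otimes> g) s t = \<phi> h (z g s t)"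
    and C0: "C0 \<subseteq> Cs" and Cs: "compact Cs" "Cs \<subseteq> Y"
    and semi: "\<And>D r s. compact D \<Longrightarrow> D \<subseteq> Y \<Longrightarrow> proper_cayley_ray J S r \<Longrightarrow> proper_cayley_ray J S s \<Longrightarrow>
        cayley_source J (r 0) = cayley_source J (s 0) \<Longrightarrow>
        ray_image z r ` {0..} \<subseteq> Y - Cs \<Longrightarrow> ray_image z s ` {0..} \<subseteq> Y - Cs \<Longrightarrow>
        \<exists>a b \<delta>. 0 \<le> a \<and> 0 \<le> b \<and> path \<delta> \<and> path_image \<delta> \<subseteq> Y - D \<and>
              pathstart \<delta> = ray_image z r a \<and> pathfinish \<delta> = ray_image z s b \<and>
              homotopic_paths (Y - C0)
                (initial_segment (ray_image z r) a +++ \<delta> +++ reversepath (initial_segment (ray_image z s) b))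
                (\<lambda>t. ray_image z r 0)"
begin

abbreviation "src \<equiv> cayley_source J"
abbreviation "tgt \<equiv> cayley_target J"
abbreviation "vtx g \<equiv> \<phi> g base"
abbreviation "edges \<equiv> carrier J \<times> S \<times> (UNIV :: bool set)"
abbreviation "edge_im \<equiv> oriented_edge_image z"
abbreviation "Q \<equiv> Y - C0"

definition cell where "cell = (\<Union>s\<in>S. path_image (z \<one> s))"

lemma S_in: "s \<in> S \<Longrightarrow> s \<in> carrier J" using S by blast

lemma cell: "compact cell" "cell \<subseteq> Y"
  using z_path[OF J.one_closed] S(1) unfolding cell_def path_in_def
  by (auto intro!: compact_UN compact_path_image)

lemma z_cell: "g \<in> carrier J \<Longrightarrow> s \<in> S \<Longrightarrow> path_image (z g s) \<subseteq> \<phi> g ` cell"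
proof -
  assume g: "g \<in> carrier J" and s: "s \<in> S"
  have "z g s t \<in> \<phi> g ` cell" if "t \<in> {0..1}" for t
  proof -
    have "z g s t = \<phi> g (z \<one> s t)" using z_equiv[OF g J.one_closed s that] g by simp
    moreover have "z \<one> s t \<in> cell" using s that unfolding cell_def path_image_def by blast
    ultimately show ?thesis by simp
  qed
  then show ?thesis by (auto simp: path_image_def)
qed

lemma edge_path_in: "e \<in> edges \<Longrightarrow> path_in Y (edge_im e) (vtx (src e)) (vtx (tgt e))"
proof -
  assume "e \<in> edges"
  then obtain g s b where e: "e = (g,s,b)" "g \<in> carrier J" "s \<in> S" by auto
  then show ?thesis using z_path[OF e(2,3)] path_in_rev[OF z_path[OF e(2,3)]] by (cases b) auto
qed

lemma edge_ends: "e \<in> edges \<Longrightarrow> src e \<in> carrier J \<and> tgt e \<in> carrier J"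
  using S_in by (cases e) auto

lemma edge_cell: "e \<in> edges \<Longrightarrow> path_image (edge_im e) \<subseteq> \<phi> (fst e) ` cell"
  using z_cell by (cases e) auto

definition cray :: "(nat \<Rightarrow> 'g \<times> 'g \<times> bool) \<Rightarrow> 'g \<Rightarrow> bool" where
  "cray r g \<longleftrightarrow> proper_cayley_ray J S r \<and> src (r 0) = g"

lemma cray_edges: "cray r g \<Longrightarrow> r i \<in> edges"
  unfolding cray_def proper_cayley_ray_def by blast

lemma cray_match: "cray r g \<Longrightarrow> edge_im (r i) 1 = edge_im (r (Suc i)) 0"
proof -
  assume r: "cray r g"
  then have "tgt (r i) = src (r (Suc i))" by (simp add: cray_def proper_cayley_ray_def)
  then show ?thesis
    using path_cont(4)[OF edge_path_in[OF cray_edges[OF r, of i]]] path_cont(3)[OF edge_path_in[OF cray_edges[OF r, of "Suc i"]]]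
    by simp
qed

lemma cray_cont: "cray r g \<Longrightarrow> continuous_on {0..} (ray_image z r)"
  unfolding ray_image_eq_concat
  by (rule concat_paths_continuous[OF path_cont(1)[OF edge_path_in[OF cray_edges]] cray_match])

lemma cray_image: "cray r g \<Longrightarrow> ray_image z r ` {0..} = (\<Union>i. edge_im (r i) ` {0..1})"
  unfolding ray_image_eq_concat by (rule concat_paths_image[OF cray_match])

lemma cray_in: "cray r g \<Longrightarrow> ray_image z r ` {0..} \<subseteq> Y"
  unfolding cray_image using path_cont(2)[OF edge_path_in[OF cray_edges]] by blast

lemma cray_start: "cray r g \<Longrightarrow> ray_image z r 0 = vtx g"
  using path_cont(3)[OF edge_path_in[OF cray_edges[of r g 0]]]
  by (simp add: ray_image_def cray_def)

lemma cray_eventually: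
  assumes r: "cray r g" and D: "compact D" "D \<subseteq> Y"
  shows "\<exists>T\<ge>0. \<forall>t\<ge>T. ray_image z r t \<in> Y - D"
proof -
  let ?G = "{g \<in> carrier J. \<phi> g ` cell \<inter> D \<noteq> {}}"
  have fG: "finite ?G" by (rule meets_finite[OF cell D])
  let ?V = "?G \<union> (\<lambda>(g,s). g \<otimes> s) ` (?G \<times> S)"
  have fV: "finite ?V" using fG S(1) by simp
  have VJ: "?V \<subseteq> carrier J" using S_in by auto
  have sub: "{i. edge_im (r i) ` {0..1} \<inter> D \<noteq> {}} \<subseteq> (\<Union>v\<in>?V. {i. src (r i) = v})"
  proof
    fix i assume "i \<in> {i. edge_im (r i) ` {0..1} \<inter> D \<noteq> {}}"
    then have ne: "edge_im (r i) ` {0..1} \<inter> D \<noteq> {}" by simp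
    obtain g s b where e: "r i = (g,s,b)" by (cases "r i") auto
    have gs: "g \<in> carrier J" "s \<in> S" using cray_edges[OF r, of i] e by auto
    have "edge_im (r i) ` {0..1} \<subseteq> \<phi> g ` cell" using edge_cell[OF cray_edges[OF r, of i]] e by (simp add: path_image_def)
    then have "\<phi> g ` cell \<inter> D \<noteq> {}" using ne by blast
    then have "g \<in> ?G" using gs by simp
    then have "src (r i) \<in> ?V" using e gs by (auto simp: image_iff)
    then show "i \<in> (\<Union>v\<in>?V. {i. src (r i) = v})" by blast
  qed
  have "finite {i. src (r i) = v}" if "v \<in> ?V" for v
    using r that VJ by (auto simp: cray_def proper_cayley_ray_def)
  then have "finite (\<Union>v\<in>?V. {i. src (r i) = v})" using fV by blast
  then have "finite {i. edge_im (r i) ` {0..1} \<inter> D \<noteq> {}}" using sub finite_subset by blast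
  then obtain T where T: "T \<ge> 0" "\<forall>t\<ge>T. ray_image z r t \<notin> D"
    using concat_paths_eventually[of "\<lambda>i. edge_im (r i)" D] cray_match[OF r] unfolding ray_image_eq_concat by blast
  have "ray_image z r t \<in> Y - D" if "t \<ge> T" for t using T that cray_in[OF r] by auto
  then show ?thesis using T(1) by blast
qed

definition cadj :: "'g \<Rightarrow> 'g \<Rightarrow> bool" where
  "cadj x y \<longleftrightarrow> x \<in> carrier J \<and> y \<in> carrier J \<and> (\<exists>s\<in>S. y = x \<otimes> s \<or> x = y \<otimes> s)"

lemma cadj_sym: "cadj x y \<Longrightarrow> cadj y x"
  unfolding cadj_def by blast

lemma cadj_finite: "finite {y. cadj x y}"
proof (rule finite_subset)
  show "{y. cadj x y} \<subseteq> (\<lambda>s. x \<otimes> s) ` S \<union> (\<lambda>s. x \<otimes> inv s) ` S"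
  proof
    fix y assume "y \<in> {y. cadj x y}"
    then obtain s where s: "x \<in> carrier J" "y \<in> carrier J" "s \<in> S" "y = x \<otimes> s \<or> x = y \<otimes> s" by (auto simp: cadj_def)
    then have "y = x \<otimes> s \<or> y = x \<otimes> inv s" using S_in by (metis J.inv_solve_right)
    then show "y \<in> (\<lambda>s. x \<otimes> s) ` S \<union> (\<lambda>s. x \<otimes> inv s) ` S" using s(3) by blast
  qed
  show "finite ((\<lambda>s. x \<otimes> s) ` S \<union> (\<lambda>s. x \<otimes> inv s) ` S)" using S(1) by simp
qed

lemma cadj_edge: "cadj x y \<Longrightarrow> \<exists>e\<in>edges. src e = x \<and> tgt e = y \<and> (fst e = x \<or> fst e = y)"
proof -
  assume "cadj x y"
  then obtain s where s: "x \<in> carrier J" "y \<in> carrier J" "s \<in> S" "y = x \<otimes> s \<or> x = y \<otimes> s" by (auto simp: cadj_def)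
  show ?thesis
  proof (cases "y = x \<otimes> s")
    case True then show ?thesis using s by (intro bexI[of _ "(x,s,True)"]) auto
  next
    case False then show ?thesis using s by (intro bexI[of _ "(y,s,False)"]) auto
  qed
qed

lemma cadj_right: "h \<in> generate J S \<Longrightarrow> x \<in> carrier J \<Longrightarrow> cadj\<^sup>*\<^sup>* x (x \<otimes> h)"
proof (induction h arbitrary: x rule: generate.induct)
  case one then show ?case by simp
next
  case (incl h)
  then have "cadj x (x \<otimes> h)" using S_in by (auto simp: cadj_def)
  then show ?case by blast
next
  case (inv h)
  have "x = (x \<otimes> inv h) \<otimes> h" using inv S_in by (simp add: J.m_assoc)
  then have "cadj x (x \<otimes> inv h)" using inv S_in by (auto simp: cadj_def)
  then show ?case by blast
next
  case (eng h1 h2)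
  have c: "h1 \<in> carrier J" "h2 \<in> carrier J" using eng S(3) by auto
  have "cadj\<^sup>*\<^sup>* (x \<otimes> h1) ((x \<otimes> h1) \<otimes> h2)" using eng c by simp
  moreover have "cadj\<^sup>*\<^sup>* x (x \<otimes> h1)" using eng by simp
  ultimately show ?case using eng.prems c by (simp add: J.m_assoc)
qed

lemma cadj_connected: "x \<in> carrier J \<Longrightarrow> y \<in> carrier J \<Longrightarrow> cadj\<^sup>*\<^sup>* x y"
  using cadj_right[of "inv x \<otimes> y" x] S(3) by (simp add: J.m_assoc[symmetric])

text \<open>The edges whose images meet \<open>F\<close> start at finitely many vertices. As the Cayley graph is connected and infinite, Koenig's
  lemma gives rays off these vertices.\<close>

lemma cray_avoiding:
  assumes F: "compact F" "F \<subseteq> Y"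
  obtains M where "finite M" "M \<subseteq> carrier J" "\<forall>g\<in>carrier J - M. \<exists>r. cray r g \<and> ray_image z r ` {0..} \<subseteq> Y - F"
proof -
  define B where "B = {g \<in> carrier J. \<phi> g ` cell \<inter> F \<noteq> {}}"
  have "finite B" unfolding B_def by (rule meets_finite[OF cell F])
  from rays_off_finite_set[of cadj B, OF cadj_sym cadj_finite this]
  obtain M where M: "finite M" "B \<subseteq> M" 
     "\<forall>v. infinite {w. cadj\<^sup>*\<^sup>* v w} \<longrightarrow> v \<notin> M \<longrightarrow> infinite {w. (\<lambda>x y. cadj x y \<and> x \<notin> B \<and> y \<notin> B)\<^sup>*\<^sup>* v w}"
    by blast
  let ?adj = "\<lambda>x y. cadj x y \<and> x \<notin> B \<and> y \<notin> B"
  have "\<exists>r. cray r g \<and> ray_image z r ` {0..} \<subseteq> Y - F" if g: "g \<in> carrier J" "g \<notin> M" for g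
  proof -
    have "carrier J \<subseteq> {w. cadj\<^sup>*\<^sup>* g w}" using cadj_connected g by blast
    then have "infinite {w. cadj\<^sup>*\<^sup>* g w}" using infinite_group finite_subset by blast
    then have inf: "infinite {w. ?adj\<^sup>*\<^sup>* g w}" using M(3) g by blast
    have fin: "finite {w. ?adj x w}" for x by (rule finite_subset[OF _ cadj_finite[of x]]) blast
    obtain f where f: "f 0 = g" "\<forall>i. ?adj (f i) (f (Suc i))" "inj f"
      by (rule ray_of_infinite[OF inf fin])
    have "\<forall>i. \<exists>e\<in>edges. src e = f i \<and> tgt e = f (Suc i) \<and> (fst e = f i \<or> fst e = f (Suc i))"
      using cadj_edge f(2) by blast
    then obtain r where r: "\<And>i. r i \<in> edges \<and> src (r i) = f i \<and> tgt (r i) = f (Suc i) \<and> (fst (r i) = f i \<or> fst (r i) = f (Suc i))"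
      by metis
    have "finite {i. f i = v}" for v
    proof (rule finite_subset)
      show "{i. f i = v} \<subseteq> {inv_into UNIV f v}" using f(3) by (auto simp: inv_f_f)
    qed simp
    then have "proper_cayley_ray J S r" unfolding proper_cayley_ray_def using r by (auto simp: image_subset_iff)
    then have c: "cray r g" using r f(1) by (simp add: cray_def)
    have "edge_im (r i) ` {0..1} \<subseteq> Y - F" for i
    proof -
      have "fst (r i) \<notin> B" "fst (r i) \<in> carrier J" using r[of i] f(2)[rule_format, of i] by (auto simp: cadj_def)
      then have "\<phi> (fst (r i)) ` cell \<inter> F = {}" by (simp add: B_def)
      moreover have "edge_im (r i) ` {0..1} \<subseteq> \<phi> (fst (r i)) ` cell"
        using edge_cell[of "r i"] r[of i] by (simp add: path_image_def)
      moreover have "edge_im (r i) ` {0..1} \<subseteq> Y" using path_cont(2)[OF edge_path_in[of "r i"]] r[of i] by simp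
      ultimately show ?thesis by blast
    qed
    then have "ray_image z r ` {0..} \<subseteq> Y - F" unfolding cray_image[OF c] by blast
    then show ?thesis using c by blast
  qed
  then show thesis by (intro that[of "M \<inter> carrier J"]) (use M(1) in auto)
qed

text \<open>Images of finite edge paths; the recursion matches that of \<open>cray_cons\<close>.\<close>

inductive cpath :: "'g \<Rightarrow> (real \<Rightarrow> 'a) \<Rightarrow> 'g \<Rightarrow> bool" where
  nil: "g \<in> carrier J \<Longrightarrow> cpath g (\<lambda>_. vtx g) g"
| cons: "e \<in> edges \<Longrightarrow> cpath (tgt e) p h \<Longrightarrow> cpath (src e) (edge_im e +++ p) h"

lemma cpath_path: "cpath g p h \<Longrightarrow> g \<in> carrier J \<and> h \<in> carrier J \<and> path_in Y p (vtx g) (vtx h)"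
proof (induction rule: cpath.induct)
  case (nil g) then show ?case using act_in[OF _ base] by (simp add: path_in_const)
next
  case (cons e p h)
  then show ?case using edge_ends[OF cons(1)] path_in_join[OF edge_path_in[OF cons(1)], of p "vtx h"] by simp
qed

lemma cpath_exists: "g \<in> carrier J \<Longrightarrow> h \<in> carrier J \<Longrightarrow> \<exists>p. cpath g p h"
proof -
  assume gh: "g \<in> carrier J" "h \<in> carrier J"
  have "cadj\<^sup>*\<^sup>* g h" using cadj_connected gh by blast
  then show ?thesis
  proof (induction rule: converse_rtranclp_induct)
    case base then show ?case using nil gh by blast
  next
    case (step x y)
    obtain e where "e \<in> edges" "src e = x" "tgt e = y" using cadj_edge[OF step(1)] by blast
    then show ?case using step(3) cons by blast
  qed
qed

lemma cpath_translate:
  assumes x: "x \<in> carrier J"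
  shows "cpath g p h \<Longrightarrow> \<exists>p'. cpath (x \<otimes> g) p' (x \<otimes> h) \<and> (\<forall>t\<in>{0..1}. p' t = \<phi> x (p t))"
proof (induction rule: cpath.induct)
  case (nil g)
  then show ?case using cpath.nil[of "x \<otimes> g"] act_comp[OF x nil base] x by auto
next
  case (cons e p h)
  then obtain p' where p': "cpath (x \<otimes> tgt e) p' (x \<otimes> h)" "\<And>t. t \<in> {0..1} \<Longrightarrow> p' t = \<phi> x (p t)" by blast
  obtain g s b where e: "e = (g,s,b)" by (cases e) auto
  have gs: "g \<in> carrier J" "s \<in> S" using cons(1) e by auto
  define e' where "e' = (x \<otimes> g, s, b)"
  have e': "e' \<in> edges" "tgt e' = x \<otimes> tgt e" "src e' = x \<otimes> src e"
    using gs x S_in by (auto simp: e'_def e J.m_assoc)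
  have im: "edge_im e' t = \<phi> x (edge_im e t)" if "t \<in> {0..1}" for t
    using z_equiv[OF x gs, of t] z_equiv[OF x gs, of "1-t"] that by (auto simp: e'_def e reversepath_def)
  have "cpath (src e') (edge_im e' +++ p') (x \<otimes> h)" using cpath.cons[OF e'(1)] p'(1) e'(2) by simp
  moreover have "(edge_im e' +++ p') t = \<phi> x ((edge_im e +++ p) t)" if "t \<in> {0..1}" for t
    using im[of "2*t"] p'(2)[of "2*t-1"] that by (auto simp: joinpaths_def)
  ultimately show ?case using e'(3) by metis
qed

definition avoids :: "(nat \<Rightarrow> 'g \<times> 'g \<times> bool) \<Rightarrow> bool" where
  "avoids r \<longleftrightarrow> ray_image z r ` {0..} \<subseteq> Y - Cs"

lemma avoids_Q: "avoids r \<Longrightarrow> ray_image z r ` {0..} \<subseteq> Q"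
  using C0 by (auto simp: avoids_def)

lemma ray_piece: "cray r g \<Longrightarrow> avoids r \<Longrightarrow> 0 \<le> a \<Longrightarrow> 0 \<le> b \<Longrightarrow>
    path_in Q (piece a b (ray_image z r)) (ray_image z r a) (ray_image z r b)"
  by (rule path_in_piece[OF cray_cont _ _ _ avoids_Q]) auto

lemma cray_cons:
  assumes e: "e \<in> edges" and r: "cray r (tgt e)"
  shows "cray (case_nat e r) (src e)"
    "\<And>t. t \<ge> 0 \<Longrightarrow> ray_image z (case_nat e r) (t + 1) = ray_image z r t"
    "\<And>t. t \<in> {0..1} \<Longrightarrow> ray_image z (case_nat e r) t = edge_im e t"
    "ray_image z (case_nat e r) ` {0..} = path_image (edge_im e) \<union> ray_image z r ` {0..}"
proof -
  let ?r = "case_nat e r"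
  have R: "proper_cayley_ray J S r" "src (r 0) = tgt e" using r by (auto simp: cray_def)
  have "finite {i. src (?r i) = v}" if "v \<in> carrier J" for v
  proof (rule finite_subset)
    show "{i. src (?r i) = v} \<subseteq> insert 0 (Suc ` {i. src (r i) = v})"
    proof
      fix i assume i: "i \<in> {i. src (?r i) = v}"
      show "i \<in> insert 0 (Suc ` {i. src (r i) = v})"
      proof (cases i)
        case (Suc k) then show ?thesis using i by simp
      qed simp
    qed
    show "finite (insert 0 (Suc ` {i. src (r i) = v}))" using R(1) that by (simp add: proper_cayley_ray_def)
  qed
  moreover have "?r i \<in> edges" for i using e cray_edges[OF r] by (cases i) auto
  moreover have "tgt (?r i) = src (?r (Suc i))" for i using R by (cases i) (auto simp: proper_cayley_ray_def)
  ultimately show c: "cray ?r (src e)" unfolding cray_def proper_cayley_ray_def by (auto simp: image_subset_iff)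
  show "ray_image z ?r (t + 1) = ray_image z r t" if "t \<ge> 0" for t
  proof -
    have "nat \<lfloor>t + 1\<rfloor> = Suc (nat \<lfloor>t\<rfloor>)" using that by (simp add: nat_add_distrib)
    moreover have "frac (t + 1) = frac t" by (simp add: frac_def)
    ultimately show ?thesis unfolding ray_image_def by simp
  qed
  show "ray_image z ?r t = edge_im e t" if "t \<in> {0..1}" for t
    unfolding ray_image_eq_concat using concat_paths_eq[of "\<lambda>i. edge_im (?r i)" 0 t, OF cray_match[OF c]] that by simp
  have "(\<Union>i. edge_im (?r i) ` {0..1}) = edge_im (?r 0) ` {0..1} \<union> (\<Union>i. edge_im (?r (Suc i)) ` {0..1})"
    by (subst UNIV_nat_eq) (simp add: image_image)
  then show "ray_image z ?r ` {0..} = path_image (edge_im e) \<union> ray_image z r ` {0..}"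
    unfolding cray_image[OF c] cray_image[OF r] by (simp add: path_image_def)
qed

text \<open>The edge path is put in front of the Cayley ray, which shifts the parameter of the ray by its length \<open>n\<close>.\<close>

lemma cpath_ray:
  "cpath g p h \<Longrightarrow> path_image p \<subseteq> Y - Cs \<Longrightarrow> cray s h \<Longrightarrow> avoids s \<Longrightarrow>
    \<exists>r n. cray r g \<and> avoids r \<and> n \<ge> 0 \<and> (\<forall>t\<ge>0. ray_image z r (t + n) = ray_image z s t) \<and>
      (\<forall>b\<ge>0. homotopic_paths Q (p +++ piece 0 b (ray_image z s)) (piece 0 (b + n) (ray_image z r)))"
proof (induction rule: cpath.induct)
  case (nil g)
  have "homotopic_paths Q ((\<lambda>_. vtx g) +++ piece 0 b (ray_image z s)) (piece 0 (b + 0) (ray_image z s))" if "b \<ge> 0" for b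
    using hom_lid[OF ray_piece[OF nil(3,4), of 0 b]] that cray_start[OF nil(3)] by simp
  then show ?case using nil by (intro exI[of _ s] exI[of _ 0]) simp
next
  case (cons e p h)
  let ?S = "ray_image z s"
  have ep: "path_in Y (edge_im e) (vtx (src e)) (vtx (tgt e))" by (rule edge_path_in[OF cons(1)])
  have pp: "path_in Y p (vtx (tgt e)) (vtx h)" using cpath_path[OF cons(2)] by blast
  have im: "path_image (edge_im e) \<subseteq> Y - Cs" "path_image p \<subseteq> Y - Cs"
    using cons.prems(1) ep pp by (auto simp: path_image_join path_in_def)
  obtain r n where r: "cray r (tgt e)" "avoids r" "n \<ge> 0" "\<forall>t\<ge>0. ray_image z r (t + n) = ?S t"
      "\<forall>b\<ge>0. homotopic_paths Q (p +++ piece 0 b ?S) (piece 0 (b + n) (ray_image z r))"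
    using cons.IH[OF im(2) cons.prems(2,3)] by blast
  let ?r = "case_nat e r" let ?R = "ray_image z ?r"
  note cc = cray_cons[OF cons(1) r(1)]
  have av: "avoids ?r" using im(1) r(2) unfolding avoids_def cc(4) by blast
  have shift: "?R (t + (n+1)) = ?S t" if "t \<ge> 0" for t
    using cc(2)[of "t+n"] r(3,4) that by (simp add: add.assoc)
  have CQ: "Y - Cs \<subseteq> Q" using C0 by blast
  have eQ: "path_in Q (edge_im e) (vtx (src e)) (vtx (tgt e))" using path_in_image[OF ep] im(1) CQ by blast
  have pQ: "path_in Q p (vtx (tgt e)) (vtx h)" using path_in_image[OF pp] im(2) CQ by blast
  have "homotopic_paths Q ((edge_im e +++ p) +++ piece 0 b ?S) (piece 0 (b + (n+1)) ?R)" if b: "b \<ge> 0" for b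
  proof -
    have sb: "path_in Q (piece 0 b ?S) (vtx h) (?S b)" using ray_piece[OF cons.prems(2,3), of 0 b] b cray_start[OF cons.prems(2)] by simp
    have 1: "homotopic_paths Q ((edge_im e +++ p) +++ piece 0 b ?S) (edge_im e +++ (p +++ piece 0 b ?S))"
      by (rule hom_assoc'[OF eQ pQ sb])
    have 2: "homotopic_paths Q (edge_im e +++ (p +++ piece 0 b ?S)) (edge_im e +++ piece 0 (b+n) (ray_image z r))"
      using hom_join_left[OF _ eQ path_in_join[OF pQ sb]] r(5) b by blast
    have p1: "path_in Q (piece 0 1 ?R) (?R 0) (?R 1)" "path_in Q (piece 1 (b+n+1) ?R) (?R 1) (?R (b+n+1))"
      using ray_piece[OF cc(1) av, of 0 1] ray_piece[OF cc(1) av, of 1 "b+n+1"] b r(3) by auto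
    have 3: "homotopic_paths Q (piece 0 1 ?R) (edge_im e)"
      by (rule homotopic_paths_eq) (use p1(1) cc(3) in \<open>auto simp: path_in_def\<close>)
    have 4: "homotopic_paths Q (piece 1 (b+n+1) ?R) (piece 0 (b+n) (ray_image z r))"
    proof (rule homotopic_paths_eq)
      show "path (piece 1 (b+n+1) ?R)" "path_image (piece 1 (b+n+1) ?R) \<subseteq> Q" using p1(2) by (auto simp: path_in_def)
      fix t :: real assume t: "t \<in> {0..1}"
      have "linepath 1 (b+n+1) t = t * (b+n) + 1" by (simp add: linepath_def algebra_simps)
      moreover have "linepath 0 (b+n) t = t * (b+n)" by (simp add: linepath_def)
      ultimately show "piece 1 (b+n+1) ?R t = piece 0 (b+n) (ray_image z r) t"
        using cc(2)[of "t * (b+n)"] t b r(3) by (simp add: piece_def)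
    qed
    have 5: "homotopic_paths Q (piece 0 1 ?R +++ piece 1 (b+n+1) ?R) (edge_im e +++ piece 0 (b+n) (ray_image z r))"
      by (rule hom_join[OF 3 4 p1])
    have 6: "homotopic_paths Q (piece 0 1 ?R +++ piece 1 (b+n+1) ?R) (piece 0 (b+n+1) ?R)"
      by (rule hom_piece_join[OF cray_cont[OF cc(1)] _ _ _ _ avoids_Q[OF av]]) (use b r(3) in auto)
    show ?thesis
      using hom_trans3[OF 1 2 homotopic_paths_sym[OF 5]] 6 homotopic_paths_trans by (simp add: add.assoc) blast
  qed
  then show ?case using cc(1) av r(3) shift by (intro exI[of _ ?r] exI[of _ "n+1"]) simp
qed

section \<open>Paths from a point to infinity\<close>

text \<open>Paths into the complement of \<open>F\<close> up to homotopy off \<open>C0\<close> and continuation outside \<open>F\<close>. As \<open>F\<close> grows, these classes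
  describe the ways to go from a point to infinity.\<close>

definition eqv :: "'a set \<Rightarrow> (real \<Rightarrow> 'a) \<Rightarrow> (real \<Rightarrow> 'a) \<Rightarrow> bool" where
  "eqv F p q \<longleftrightarrow> (\<exists>\<delta>. path_in (Y - F) \<delta> (pathfinish p) (pathfinish q) \<and> homotopic_paths Q (p +++ \<delta>) q)"

definition out :: "'a set \<Rightarrow> (real \<Rightarrow> 'a) \<Rightarrow> 'a \<Rightarrow> bool" where
  "out F p x \<longleftrightarrow> (\<exists>y. path_in Q p x y \<and> y \<in> Y - F)"

lemma pathfinish_in: "path_in A p x y \<Longrightarrow> pathfinish p = y" by (simp add: path_in_def)

lemma out_path: "out F p x \<Longrightarrow> path_in Q p x (pathfinish p) \<and> pathfinish p \<in> Y - F"
  by (auto simp: out_def path_in_def)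

lemma outI: "path_in Q p x y \<Longrightarrow> y \<in> Y - F \<Longrightarrow> out F p x"
  by (auto simp: out_def)

lemma out_join: "path_in Q \<gamma> w x \<Longrightarrow> out F p x \<Longrightarrow> out F (\<gamma> +++ p) w"
  unfolding out_def using path_in_join by blast

lemma out_hom: "homotopic_paths Q p q \<Longrightarrow> out F p x \<Longrightarrow> out F q x"
  unfolding out_def using path_in_hom by blast

context
  fixes F assumes F: "C0 \<subseteq> F"
begin

lemma FQ: "path_in (Y - F) \<delta> x y \<Longrightarrow> path_in Q \<delta> x y"
  using F by (auto intro: path_in_mono)

lemma eqv_ext:
  assumes "path_in Q p x y" "path_in (Y - F) \<delta> y w"
  shows "eqv F p (p +++ \<delta>)"
  unfolding eqv_def using assms path_in_refl[OF path_in_join[OF assms(1) FQ[OF assms(2)]]]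
  by (intro exI[of _ \<delta>]) (auto simp: path_in_def)

lemma eqv_hom: 
  assumes "out F p x" "homotopic_paths Q p q" shows "eqv F p q"
proof -
  have p: "path_in Q p x (pathfinish p)" "pathfinish p \<in> Y - F" using out_path[OF assms(1)] by auto
  have "pathfinish q = pathfinish p" using homotopic_paths_imp_pathfinish[OF assms(2)] by simp
  then show ?thesis unfolding eqv_def
    using path_in_const[OF p(2)] homotopic_paths_trans[OF hom_rid[OF p(1)] assms(2)] by auto
qed

lemma eqv_sym:
  assumes "out F p x" "out F q x" "eqv F p q" shows "eqv F q p"
proof -
  obtain \<delta> where d: "path_in (Y - F) \<delta> (pathfinish p) (pathfinish q)" "homotopic_paths Q (p +++ \<delta>) q"
    using assms(3) unfolding eqv_def by blast
  note p = conjunct1[OF out_path[OF assms(1)]] and q = conjunct1[OF out_path[OF assms(2)]]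
  note r = path_in_rev[OF d(1)]
  have "homotopic_paths Q (q +++ reversepath \<delta>) ((p +++ \<delta>) +++ reversepath \<delta>)"
    by (rule hom_join_right[OF homotopic_paths_sym[OF d(2)] q FQ[OF r]])
  also have "homotopic_paths Q \<dots> p" by (rule hom_cancel_right[OF p FQ[OF d(1)]])
  finally show ?thesis unfolding eqv_def using r by blast
qed

lemma eqv_trans:
  assumes "out F p x" "eqv F p q" "eqv F q r" shows "eqv F p r"
proof -
  obtain \<delta> where d: "path_in (Y - F) \<delta> (pathfinish p) (pathfinish q)" "homotopic_paths Q (p +++ \<delta>) q"
    using assms(2) unfolding eqv_def by blast
  obtain \<epsilon> where e: "path_in (Y - F) \<epsilon> (pathfinish q) (pathfinish r)" "homotopic_paths Q (q +++ \<epsilon>) r"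
    using assms(3) unfolding eqv_def by blast
  note p = conjunct1[OF out_path[OF assms(1)]]
  have "homotopic_paths Q (p +++ (\<delta> +++ \<epsilon>)) ((p +++ \<delta>) +++ \<epsilon>)" by (rule hom_assoc[OF p FQ[OF d(1)] FQ[OF e(1)]])
  also have "homotopic_paths Q \<dots> (q +++ \<epsilon>)"
    by (rule hom_join_right[OF d(2) path_in_join[OF p FQ[OF d(1)]] FQ[OF e(1)]])
  also have "homotopic_paths Q \<dots> r" by (rule e(2))
  finally show ?thesis unfolding eqv_def using path_in_join[OF d(1) e(1)] by blast
qed

lemma eqv_join:
  assumes "path_in Q \<gamma> w x" "out F p x" "eqv F p q"
  shows "eqv F (\<gamma> +++ p) (\<gamma> +++ q)"
proof -
  obtain \<delta> where d: "path_in (Y - F) \<delta> (pathfinish p) (pathfinish q)" "homotopic_paths Q (p +++ \<delta>) q"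
    using assms(3) unfolding eqv_def by blast
  note p = conjunct1[OF out_path[OF assms(2)]]
  have "homotopic_paths Q ((\<gamma> +++ p) +++ \<delta>) (\<gamma> +++ (p +++ \<delta>))" by (rule hom_assoc'[OF assms(1) p FQ[OF d(1)]])
  also have "homotopic_paths Q \<dots> (\<gamma> +++ q)" by (rule hom_join_left[OF d(2) assms(1) path_in_join[OF p FQ[OF d(1)]]])
  finally show ?thesis unfolding eqv_def using d(1) by auto
qed

definition tail :: "(nat \<Rightarrow> 'g \<times> 'g \<times> bool) \<Rightarrow> real \<Rightarrow> bool" where
  "tail r a \<longleftrightarrow> 0 \<le> a \<and> (\<forall>t\<ge>a. ray_image z r t \<in> Y - F)"

lemma tail_piece: "cray r g \<Longrightarrow> tail r a \<Longrightarrow> a \<le> b \<Longrightarrow> path_in (Y - F) (piece a b (ray_image z r)) (ray_image z r a) (ray_image z r b)"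
  by (rule path_in_piece[of "{a..}"])
    (auto simp: tail_def intro: continuous_on_subset[OF cray_cont])

lemma tail_out: "cray r g \<Longrightarrow> avoids r \<Longrightarrow> tail r a \<Longrightarrow> out F (piece 0 a (ray_image z r)) (vtx g)"
  using ray_piece[of r g 0 a] cray_start[of r g] by (auto simp: tail_def intro: outI)

lemma tail_extend:
  assumes "cray r g" "avoids r" "tail r a" "a \<le> b"
  shows "eqv F (piece 0 a (ray_image z r)) (piece 0 b (ray_image z r))"
proof -
  have a: "0 \<le> a" using assms(3) by (simp add: tail_def)
  have h: "homotopic_paths Q (piece 0 a (ray_image z r) +++ piece a b (ray_image z r)) (piece 0 b (ray_image z r))"
    by (rule hom_piece_join[OF cray_cont[OF assms(1)] _ _ _ _ avoids_Q[OF assms(2)]]) (use a assms(4) in auto)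
  have f: "pathfinish (piece 0 a (ray_image z r)) = ray_image z r a" "pathfinish (piece 0 b (ray_image z r)) = ray_image z r b"
    by (simp_all add: piece_def pathfinish_def)
  show ?thesis unfolding eqv_def f using tail_piece[OF assms(1,3,4)] h by blast
qed

text \<open>The compact set in the definition of semistability is taken to contain the initial segments of both rays, so that the
  connecting path starts and ends on the parts outside \<open>F\<close>.\<close>

lemma semi_eqv:
  assumes r: "cray r g" "avoids r" "tail r a" and s: "cray s g" "avoids s" "tail s b" and cF: "compact F" "F \<subseteq> Y"
  shows "eqv F (piece 0 a (ray_image z r)) (piece 0 b (ray_image z s))"
proof -
  let ?R = "ray_image z r" and ?S = "ray_image z s"
  have ab: "0 \<le> a" "0 \<le> b" using r s by (auto simp: tail_def)
  let ?D = "F \<union> ?R ` {0..a} \<union> ?S ` {0..b}"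
  have "compact (?R ` {0..a})" "compact (?S ` {0..b})"
    by (intro compact_continuous_image continuous_on_subset[OF cray_cont[OF r(1)]] continuous_on_subset[OF cray_cont[OF s(1)]]; simp)+
  moreover have "?R ` {0..a} \<subseteq> Y" "?S ` {0..b} \<subseteq> Y" using cray_in[OF r(1)] cray_in[OF s(1)] by auto
  ultimately have D: "compact ?D" "?D \<subseteq> Y" using cF by auto
  have eq: "src (r 0) = src (s 0)" using r(1) s(1) by (simp add: cray_def)
  have pr: "proper_cayley_ray J S r" "proper_cayley_ray J S s" using r(1) s(1) by (auto simp: cray_def)
  obtain a' b' \<delta> where d: "0 \<le> a'" "0 \<le> b'" "path \<delta>" "path_image \<delta> \<subseteq> Y - ?D" "pathstart \<delta> = ?R a'" "pathfinish \<delta> = ?S b'"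
     and h: "homotopic_paths Q (initial_segment ?R a' +++ \<delta> +++ reversepath (initial_segment ?S b')) (\<lambda>t. ?R 0)"
    using semi[OF D pr eq r(2)[unfolded avoids_def] s(2)[unfolded avoids_def]] by blast
  have dp: "path_in (Y - ?D) \<delta> (?R a') (?S b')" using d by (simp add: path_in_def)
  have "?R a' \<notin> ?D" "?S b' \<notin> ?D" using path_in_ends[OF dp] by auto
  then have le: "a \<le> a'" "b \<le> b'" using d(1,2) by (metis UnI1 UnI2 atLeastAtMost_iff image_eqI linear)+
  have dF: "path_in (Y - F) \<delta> (?R a') (?S b')" using path_in_mono[OF dp] by blast
  let ?A = "piece 0 a' ?R" and ?B = "piece 0 b' ?S"
  have A: "path_in Q ?A (vtx g) (?R a')" using ray_piece[OF r(1,2), of 0 a'] d cray_start[OF r(1)] by simp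
  have B: "path_in Q ?B (vtx g) (?S b')" using ray_piece[OF s(1,2), of 0 b'] d cray_start[OF s(1)] by simp
  have "homotopic_paths Q ((?A +++ \<delta>) +++ reversepath ?B) (?A +++ (\<delta> +++ reversepath ?B))"
    by (rule hom_assoc'[OF A FQ[OF dF] path_in_rev[OF B]])
  also have "homotopic_paths Q \<dots> (\<lambda>_. vtx g)" using h unfolding initial_segment_eq_piece cray_start[OF r(1)] .
  finally have "homotopic_paths Q (?A +++ \<delta>) ?B" by (rule hom_of_loop[OF path_in_join[OF A FQ[OF dF]] B])
  then have 1: "eqv F ?A ?B" unfolding eqv_def using dF pathfinish_in[OF A] pathfinish_in[OF B] by auto
  have 2: "eqv F (piece 0 a ?R) ?A" by (rule tail_extend[OF r le(1)])
  have ts: "tail s b'" using s(3) le(2) by (auto simp: tail_def)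
  have 3: "eqv F ?B (piece 0 b ?S)"
    by (rule eqv_sym[OF tail_out[OF s] tail_out[OF s(1,2) ts] tail_extend[OF s le(2)]])
  show ?thesis by (rule eqv_trans[OF tail_out[OF r] eqv_trans[OF tail_out[OF r] 2 1] 3])
qed

end

end

section \<open>Classes at infinity near the orbit\<close>

text \<open>The translates of the connected neighbourhood \<open>P\<close> of the base point form a neighbourhood of the orbit. A point \<open>p\<close> of it is joined
  to the orbit by the path \<open>trk p\<close> in the translate with index \<open>idx p\<close>.\<close>

locale tracks = cayley_action Y J \<phi> base S z C0 Cs
  for Y :: "'a::t2_space set" and J :: "('g, 'm) monoid_scheme" (structure) and \<phi> base S z C0 Cs +
  fixes P LP :: "'a set"
  assumes P: "openin (top_of_set Y) P" "path_connected P" "base \<in> P" "P \<subseteq> LP"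
    and LP: "compact LP" "LP \<subseteq> Y"
begin

abbreviation "JP \<equiv> translates J \<phi> P"

definition idx :: "'a \<Rightarrow> 'g" where
  "idx p = (SOME g. g \<in> carrier J \<and> p \<in> \<phi> g ` P)"

definition trk :: "'a \<Rightarrow> real \<Rightarrow> 'a" where
  "trk p = (SOME \<tau>. path_in (\<phi> (idx p) ` P) \<tau> p (vtx (idx p)))"

lemma PY: "P \<subseteq> Y" using P(4) LP(2) by blast

lemma idx: assumes "p \<in> JP" shows "idx p \<in> carrier J" "p \<in> \<phi> (idx p) ` P"
proof -
  have "\<exists>g. g \<in> carrier J \<and> p \<in> \<phi> g ` P" using assms by (auto simp: translates_def)
  then have "idx p \<in> carrier J \<and> p \<in> \<phi> (idx p) ` P" unfolding idx_def by (rule someI_ex)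
  then show "idx p \<in> carrier J" "p \<in> \<phi> (idx p) ` P" by auto
qed

lemma trk: assumes "p \<in> JP" shows "path_in (\<phi> (idx p) ` P) (trk p) p (vtx (idx p))"
proof -
  have "path_connected (\<phi> (idx p) ` P)" by (rule act_path_connected[OF idx(1)[OF assms] PY P(2)])
  then have "\<exists>\<tau>. path_in (\<phi> (idx p) ` P) \<tau> p (vtx (idx p))"
    by (rule path_connected_path_in[OF _ idx(2)[OF assms]]) (use P(3) in simp)
  then show ?thesis unfolding trk_def by (rule someI_ex)
qed

definition good :: "'a \<Rightarrow> bool" where
  "good p \<longleftrightarrow> p \<in> JP \<and> \<phi> (idx p) ` LP \<inter> Cs = {}"

lemma good_sub: "good p \<Longrightarrow> \<phi> (idx p) ` P \<subseteq> Y - Cs"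
  using act_sub[OF idx(1) PY] P(4) unfolding good_def by blast

lemma trk_Q: "good p \<Longrightarrow> path_in Q (trk p) p (vtx (idx p))"
  using path_in_mono[OF trk, of p Q] good_sub C0 unfolding good_def by blast

text \<open>\<open>\<pi>\<close> represents the class of \<open>p\<close>: that of the track of \<open>p\<close>, continued along a Cayley ray off \<open>Cs\<close> until this ray stays outside \<open>F\<close>.\<close>

definition reach :: "'a set \<Rightarrow> 'a \<Rightarrow> (real \<Rightarrow> 'a) \<Rightarrow> bool" where
  "reach F p \<pi> \<longleftrightarrow> out F \<pi> p \<and> (\<exists>r a. cray r (idx p) \<and> avoids r \<and> tail F r a \<and>
      eqv F (trk p +++ piece 0 a (ray_image z r)) \<pi>)"

text \<open>It suffices to demand this for one representative: by \<open>reach_unique\<close> the class at each end is unique.\<close>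

definition transports :: "'a set \<Rightarrow> (real \<Rightarrow> 'a) \<Rightarrow> 'a \<Rightarrow> 'a \<Rightarrow> bool" where
  "transports F \<gamma> p q \<longleftrightarrow> path_in Q \<gamma> p q \<and> (\<exists>\<pi>. reach F q \<pi> \<and> reach F p (\<gamma> +++ \<pi>))"

lemma reach_out: "reach F p \<pi> \<Longrightarrow> out F \<pi> p" by (simp add: reach_def)

context
  fixes F assumes F: "C0 \<subseteq> F" "compact F" "F \<subseteq> Y"
begin

lemma reach_unique:
  assumes p: "good p" and r: "reach F p \<pi>" "reach F p \<pi>'"
  shows "eqv F \<pi> \<pi>'"
proof -
  obtain r1 a1 where 1: "cray r1 (idx p)" "avoids r1" "tail F r1 a1" "eqv F (trk p +++ piece 0 a1 (ray_image z r1)) \<pi>"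
    using r(1) unfolding reach_def by blast
  obtain r2 a2 where 2: "cray r2 (idx p)" "avoids r2" "tail F r2 a2" "eqv F (trk p +++ piece 0 a2 (ray_image z r2)) \<pi>'"
    using r(2) unfolding reach_def by blast
  have o1: "out F (trk p +++ piece 0 a1 (ray_image z r1)) p" by (rule out_join[OF trk_Q[OF p] tail_out[OF F(1) 1(1-3)]])
  have e: "eqv F (trk p +++ piece 0 a1 (ray_image z r1)) (trk p +++ piece 0 a2 (ray_image z r2))"
    by (rule eqv_join[OF F(1) trk_Q[OF p] tail_out[OF F(1) 1(1-3)] semi_eqv[OF F(1) 1(1-3) 2(1-3) F(2,3)]])
  have s: "eqv F \<pi> (trk p +++ piece 0 a1 (ray_image z r1))" by (rule eqv_sym[OF F(1) o1 reach_out[OF r(1)] 1(4)])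
  show ?thesis
    by (rule eqv_trans[OF F(1) reach_out[OF r(1)] eqv_trans[OF F(1) reach_out[OF r(1)] s e] 2(4)])
qed

lemma reach_eqv:
  assumes p: "good p" and r: "reach F p \<pi>" and e: "eqv F \<pi> \<pi>'" and o: "out F \<pi>' p"
  shows "reach F p \<pi>'"
proof -
  obtain r1 a1 where 1: "cray r1 (idx p)" "avoids r1" "tail F r1 a1" "eqv F (trk p +++ piece 0 a1 (ray_image z r1)) \<pi>"
    using r unfolding reach_def by blast
  have o1: "out F (trk p +++ piece 0 a1 (ray_image z r1)) p" by (rule out_join[OF trk_Q[OF p] tail_out[OF F(1) 1(1-3)]])
  show ?thesis unfolding reach_def using 1(1-3) eqv_trans[OF F(1) o1 1(4) e] o by blast
qed

lemma reach_hom: "good p \<Longrightarrow> reach F p \<pi> \<Longrightarrow> homotopic_paths Q \<pi> \<pi>' \<Longrightarrow> reach F p \<pi>'"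
  using reach_eqv eqv_hom[OF F(1) reach_out] out_hom reach_out by blast

lemma transports_all:
  assumes "good p" "good q" "transports F \<gamma> p q" "reach F q \<pi>"
  shows "reach F p (\<gamma> +++ \<pi>)"
proof -
  obtain \<pi>' where t: "path_in Q \<gamma> p q" "reach F q \<pi>'" "reach F p (\<gamma> +++ \<pi>')" using assms(3) unfolding transports_def by blast
  have "eqv F (\<gamma> +++ \<pi>') (\<gamma> +++ \<pi>)"
    by (rule eqv_join[OF F(1) t(1) reach_out[OF t(2)] reach_unique[OF assms(2) t(2) assms(4)]])
  then show ?thesis by (rule reach_eqv[OF assms(1) t(3) _ out_join[OF t(1) reach_out[OF assms(4)]]])
qed

lemma transports_trans:
  assumes g: "good p" "good q" and 1: "transports F \<gamma> p q" and 2: "transports F \<gamma>' q r"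
  shows "transports F (\<gamma> +++ \<gamma>') p r"
proof -
  obtain \<pi> where t: "path_in Q \<gamma>' q r" "reach F r \<pi>" "reach F q (\<gamma>' +++ \<pi>)" using 2 unfolding transports_def by blast
  have g1: "path_in Q \<gamma> p q" using 1 by (simp add: transports_def)
  have "homotopic_paths Q (\<gamma> +++ (\<gamma>' +++ \<pi>)) ((\<gamma> +++ \<gamma>') +++ \<pi>)"
    using hom_assoc[OF g1 t(1)] out_path[OF reach_out[OF t(2)]] by blast
  then have "reach F p ((\<gamma> +++ \<gamma>') +++ \<pi>)" by (rule reach_hom[OF g(1) transports_all[OF g 1 t(3)]])
  then show ?thesis unfolding transports_def using path_in_join[OF g1 t(1)] t(2) by blast
qed

lemma transports_rev:
  assumes g: "good p" "good q" and 1: "transports F \<gamma> p q"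
  shows "transports F (reversepath \<gamma>) q p"
proof -
  obtain \<pi> where t: "path_in Q \<gamma> p q" "reach F q \<pi>" "reach F p (\<gamma> +++ \<pi>)" using 1 unfolding transports_def by blast
  have p: "path_in Q \<pi> q (pathfinish \<pi>)" using out_path[OF reach_out[OF t(2)]] by blast
  have "homotopic_paths Q \<pi> (reversepath \<gamma> +++ (\<gamma> +++ \<pi>))" by (rule homotopic_paths_sym[OF hom_cancel_left[OF t(1) p]])
  then have "reach F q (reversepath \<gamma> +++ (\<gamma> +++ \<pi>))" by (rule reach_hom[OF g(2) t(2)])
  then show ?thesis unfolding transports_def using path_in_rev[OF t(1)] t(3) by blast
qed

lemma transports_hom:
  assumes g: "good p" and 1: "transports F \<gamma> p q" and h: "homotopic_paths Q \<gamma> \<gamma>'"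
  shows "transports F \<gamma>' p q"
proof -
  obtain \<pi> where t: "path_in Q \<gamma> p q" "reach F q \<pi>" "reach F p (\<gamma> +++ \<pi>)" using 1 unfolding transports_def by blast
  have "homotopic_paths Q (\<gamma> +++ \<pi>) (\<gamma>' +++ \<pi>)" using hom_join_right[OF h t(1)] out_path[OF reach_out[OF t(2)]] by blast
  then have "reach F p (\<gamma>' +++ \<pi>)" by (rule reach_hom[OF g t(3)])
  then show ?thesis unfolding transports_def using path_in_hom[OF h t(1)] t(2) by blast
qed

text \<open>If the classes at both ends are those of the constant paths, a path outside \<open>F\<close> is itself equivalent to a constant path.\<close>

lemma transports_far:
  assumes g: "good p" and c: "reach F p (\<lambda>_. p)" "reach F q (\<lambda>_. q)" and \<gamma>: "path_in (Y - F) \<gamma> p q"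
  shows "transports F \<gamma> p q"
proof -
  have \<gamma>Q: "path_in Q \<gamma> p q" by (rule FQ[OF F(1) \<gamma>])
  have pQ: "path_in Q (\<lambda>_. p) p p" using path_in_ends[OF \<gamma>Q] by (simp add: path_in_const)
  have "eqv F (\<lambda>_. p) ((\<lambda>_. p) +++ \<gamma>)" by (rule eqv_ext[OF F(1) pQ \<gamma>])
  moreover have "out F ((\<lambda>_. p) +++ \<gamma>) p"
    by (rule outI[OF path_in_join[OF pQ \<gamma>Q]]) (use path_in_ends[OF \<gamma>] in blast)
  ultimately have r: "reach F p ((\<lambda>_. p) +++ \<gamma>)" by (rule reach_eqv[OF g c(1)])
  have "homotopic_paths Q ((\<lambda>_. p) +++ \<gamma>) (\<gamma> +++ (\<lambda>_. q))"
    by (rule homotopic_paths_trans[OF hom_lid[OF \<gamma>Q] homotopic_paths_sym[OF hom_rid[OF \<gamma>Q]]])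
  then have "reach F p (\<gamma> +++ (\<lambda>_. q))" by (rule reach_hom[OF g r])
  then show ?thesis unfolding transports_def using \<gamma>Q c(2) by blast
qed

text \<open>If the translate of \<open>P\<close> around \<open>p\<close> and a Cayley ray from its index avoid \<open>F\<close>, then so does the whole representative
  of the class of \<open>p\<close>.\<close>

lemma reach_const_far:
  obtains E where "compact E" "E \<subseteq> Y" "\<forall>p\<in>JP - E. reach F p (\<lambda>_. p)"
proof -
  have FC: "compact (F \<union> Cs)" "F \<union> Cs \<subseteq> Y" using F Cs by auto
  obtain M where M: "finite M" "M \<subseteq> carrier J" "\<forall>g\<in>carrier J - M. \<exists>r. cray r g \<and> ray_image z r ` {0..} \<subseteq> Y - (F \<union> Cs)"
    by (rule cray_avoiding[OF FC])
  let ?N = "{g \<in> carrier J. \<phi> g ` LP \<inter> F \<noteq> {}} \<union> M"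
  have N: "finite ?N" "?N \<subseteq> carrier J" using meets_finite[OF LP F(2,3)] M by auto
  define E where "E = (\<Union>g\<in>?N. \<phi> g ` LP)"
  have E: "compact E" "E \<subseteq> Y" unfolding E_def using compact_finite_translates[OF N LP] N(2) act_sub[OF _ LP(2)] by blast+
  have "reach F p (\<lambda>_. p)" if p: "p \<in> JP - E" for p
  proof -
    have pJ: "p \<in> JP" using p by blast
    have "p \<in> \<phi> (idx p) ` LP" using idx(2)[OF pJ] P(4) by blast
    then have nN: "idx p \<notin> ?N" using p unfolding E_def by blast
    obtain r where r: "cray r (idx p)" "ray_image z r ` {0..} \<subseteq> Y - (F \<union> Cs)" using M(3) idx(1)[OF pJ] nN by blast
    have av: "avoids r" using r(2) by (auto simp: avoids_def)
    have tl: "tail F r 0" using r(2) by (auto simp: tail_def[OF F(1)])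
    have "\<phi> (idx p) ` LP \<inter> F = {}" using nN idx(1)[OF pJ] by blast
    then have "\<phi> (idx p) ` P \<subseteq> Y - F" using act_sub[OF idx(1)[OF pJ] PY] P(4) by blast
    then have tk: "path_in (Y - F) (trk p) p (vtx (idx p))" using trk[OF pJ] path_in_mono by blast
    have rp: "path_in (Y - F) (piece 0 0 (ray_image z r)) (vtx (idx p)) (vtx (idx p))"
      using tail_piece[OF F(1) r(1) tl, of 0] cray_start[OF r(1)] by simp
    have b: "path_in (Y - F) (trk p +++ piece 0 0 (ray_image z r)) p (vtx (idx p))" by (rule path_in_join[OF tk rp])
    have bQ: "path_in Q (trk p +++ piece 0 0 (ray_image z r)) p (vtx (idx p))" by (rule FQ[OF F(1) b])
    have "eqv F (trk p +++ piece 0 0 (ray_image z r)) (\<lambda>_. p)"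
      unfolding eqv_def using path_in_rev[OF b] hom_rinv[OF bQ] pathfinish_in[OF b]
      by (intro exI[of _ "reversepath (trk p +++ piece 0 0 (ray_image z r))"]) (simp add: pathfinish_def)
    moreover have "out F (\<lambda>_. p) p" using path_in_ends[OF tk] F(1) by (intro outI[of _ _ p] path_in_const) blast+
    ultimately show ?thesis unfolding reach_def using r(1) av tl by blast
  qed
  then show thesis using that[of E] E by blast
qed

end

text \<open>A path in one translate of \<open>P\<close>, together with the tracks at its ends, joins two orbit points within a translate of the fixed compact set \<open>P3\<close>.
  It is compared with the image of an edge path: up to translation, there are finitely many pairs of vertices and so finitely
  many edge paths \<open>w\<close>, and the resulting loops contract in the translate of one compact set \<open>L\<close>. The compact set \<open>D\<close> consists of the translates
  for which this contraction meets \<open>Cs\<close>, or from which no Cayley ray avoids \<open>Cs\<close>.\<close>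

lemma transports_near_orbit:
  obtains D where "compact D" "D \<subseteq> Y" "\<forall>p\<in>JP - D. good p"
    "\<forall>F \<gamma> p q. C0 \<subseteq> F \<longrightarrow> compact F \<longrightarrow> F \<subseteq> Y \<longrightarrow> path_in (JP - D) \<gamma> p q \<longrightarrow> transports F \<gamma> p q"
proof -
  define A where "A = {u \<in> carrier J. \<phi> u ` LP \<inter> LP \<noteq> {}}"
  have fA: "finite A" unfolding A_def by (rule meets_finite[OF LP LP])
  have AJ: "A \<subseteq> carrier J" by (auto simp: A_def)
  have bLP: "base \<in> LP" using P by blast
  have oneA: "\<one> \<in> A" using act_image_one[OF LP(2)] bLP by (auto simp: A_def)
  have Amem: "inv g \<otimes> k \<in> A" if gk: "g \<in> carrier J" "k \<in> carrier J" "x \<in> \<phi> g ` LP" "x \<in> \<phi> k ` LP" for g k x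
  proof -
    obtain a b where ab: "a \<in> LP" "x = \<phi> g a" "b \<in> LP" "x = \<phi> k b" using gk by blast
    have "\<phi> (inv g \<otimes> k) b = \<phi> (inv g) (\<phi> k b)" using act_comp gk ab LP(2) by blast
    also have "\<dots> = a" using act_inv[OF gk(1), of a] ab LP(2) by auto
    finally show ?thesis unfolding A_def using gk ab by blast
  qed
  define P3 where "P3 = (\<Union>(u,v)\<in>A \<times> A. \<phi> (u \<otimes> v) ` LP)"
  have P3: "compact P3" "P3 \<subseteq> Y"
  proof -
    have "compact (\<phi> (fst w \<otimes> snd w) ` LP) \<and> \<phi> (fst w \<otimes> snd w) ` LP \<subseteq> Y" if "w \<in> A \<times> A" for w
    proof -
      have "fst w \<in> carrier J" "snd w \<in> carrier J" using that AJ by (auto simp: mem_Times_iff)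
      then have "fst w \<otimes> snd w \<in> carrier J" by simp
      then show ?thesis using act_compact[OF _ LP(2,1)] act_sub[OF _ LP(2)] by blast
    qed
    then show "compact P3" "P3 \<subseteq> Y" unfolding P3_def case_prod_unfold using fA by (blast intro: compact_UN)+
  qed
  define G3 where "G3 = {k \<in> carrier J. vtx k \<in> P3}"
  have fG3: "finite G3"
  proof -
    have "finite {g \<in> carrier J. \<phi> g ` {base} \<inter> P3 \<noteq> {}}" using base by (intro meets_finite P3) auto
    then show ?thesis by (simp add: G3_def)
  qed
  have "\<forall>k\<in>G3. \<exists>p. cpath \<one> p k" using cpath_exists by (auto simp: G3_def)
  then obtain w where w: "\<And>k. k \<in> G3 \<Longrightarrow> cpath \<one> (w k) k" by metis
  define F4 where "F4 = P3 \<union> (\<Union>k\<in>G3. path_image (w k))"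
  have wY: "path_in Y (w k) base (vtx k)" if "k \<in> G3" for k
    using cpath_path[OF w[OF that]] act_one[OF base] by simp
  have F4: "compact F4" "F4 \<subseteq> Y"
  proof -
    have "compact (path_image (w k)) \<and> path_image (w k) \<subseteq> Y" if "k \<in> G3" for k
      using wY[OF that] by (auto simp: path_in_def intro: compact_path_image)
    then show "compact F4" "F4 \<subseteq> Y" unfolding F4_def using P3 fG3 by (blast intro: compact_Un compact_UN)+
  qed
  obtain L where L: "compact L" "L \<subseteq> Y" "\<And>p x. path_in F4 p x x \<Longrightarrow> homotopic_paths L p (\<lambda>_. x)"
    using loops_bounded[OF F4] by metis
  obtain M where M: "finite M" "M \<subseteq> carrier J" "\<forall>g\<in>carrier J - M. \<exists>r. cray r g \<and> ray_image z r ` {0..} \<subseteq> Y - Cs"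
    by (rule cray_avoiding[OF Cs])
  define N where "N = {g \<in> carrier J. \<phi> g ` (L \<union> F4) \<inter> Cs \<noteq> {}} \<union> M"
  have N: "finite N" "N \<subseteq> carrier J"
    using meets_finite[of "L \<union> F4" Cs] L F4 Cs M unfolding N_def by auto
  define D where "D = (\<Union>g\<in>N. \<phi> g ` LP)"
  have D: "compact D" "D \<subseteq> Y" unfolding D_def using compact_finite_translates[OF N LP] N(2) act_sub[OF _ LP(2)] by blast+
  have LP3: "\<phi> (u \<otimes> v) ` LP \<subseteq> P3" if "u \<in> A" "v \<in> A" for u v using that unfolding P3_def by blast
  have LPP3: "LP \<subseteq> P3" using LP3[OF oneA oneA] act_image_one[OF LP(2)] by simp
  have offN: "\<phi> g ` (L \<union> F4) \<subseteq> Y - Cs" if "g \<in> carrier J" "g \<notin> N" for g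
    using that act_sub[OF that(1), of "L \<union> F4"] L F4 unfolding N_def by blast
  have idxN: "idx p \<notin> N" if p: "p \<in> JP - D" for p
  proof
    assume "idx p \<in> N"
    moreover have "p \<in> \<phi> (idx p) ` LP" using idx(2)[of p] P(4) p by blast
    ultimately show False using p unfolding D_def by blast
  qed
  have CQ: "Y - Cs \<subseteq> Q" using C0 by blast
  have goodD: "good p" if p: "p \<in> JP - D" for p
  proof -
    have "\<phi> (idx p) ` LP \<subseteq> \<phi> (idx p) ` (L \<union> F4)" using LPP3 by (auto simp: F4_def)
    then show ?thesis using offN[OF idx(1) idxN[OF p], of] p unfolding good_def by blast
  qed
  have inQ: "JP - D \<subseteq> Q"
  proof
    fix p assume p: "p \<in> JP - D"
    then have "p \<in> \<phi> (idx p) ` P" using idx(2) by blast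
    then show "p \<in> Q" using good_sub[OF goodD[OF p]] CQ by blast
  qed
  \<comment> \<open>Moving a Cayley ray from \<open>h\<close> to \<open>g\<close> along a path in the translate of \<open>P3\<close> gives, up to homotopy, a Cayley ray again: the path is replaced by an edge path.\<close>
  have local1: "\<exists>r n. cray r g \<and> avoids r \<and> n \<ge> 0 \<and> (\<forall>t\<ge>0. ray_image z r (t + n) = ray_image z s t) \<and>
      (\<forall>b\<ge>0. homotopic_paths Q (\<sigma> +++ piece 0 b (ray_image z s)) (piece 0 (b + n) (ray_image z r)))"
    if g: "g \<in> carrier J" "g \<notin> N" and h: "h \<in> carrier J" and \<sigma>: "path_in (\<phi> g ` P3) \<sigma> (vtx g) (vtx h)" and s: "cray s h" "avoids s" for g h \<sigma> s
  proof -
    define k where "k = inv g \<otimes> h"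
    have k: "k \<in> carrier J" "g \<otimes> k = h" using g h by (auto simp: k_def J.m_assoc[symmetric])
    have gi: "inv g \<in> carrier J" using g by simp
    have gP3: "\<phi> g ` P3 \<subseteq> Y" by (rule act_sub[OF g(1) P3(2)])
    have "path_in (\<phi> (inv g) ` \<phi> g ` P3) (\<phi> (inv g) \<circ> \<sigma>) (\<phi> (inv g) (vtx g)) (\<phi> (inv g) (vtx h))"
      by (rule act_path[OF gi gP3 \<sigma>])
    moreover have "\<phi> (inv g) ` \<phi> g ` P3 = P3" using act_image_comp[OF gi g(1) P3(2)] act_image_one[OF P3(2)] g by simp
    moreover have "\<phi> (inv g) (vtx g) = base" using act_inv[OF g(1) base] .
    moreover have "\<phi> (inv g) (vtx h) = vtx k" using act_comp[OF gi h base] by (simp add: k_def)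
    ultimately have s0: "path_in P3 (\<phi> (inv g) \<circ> \<sigma>) base (vtx k)" by simp
    let ?s0 = "\<phi> (inv g) \<circ> \<sigma>"
    have kG: "k \<in> G3" using k path_in_ends[OF s0] by (simp add: G3_def)
    have s4: "path_in F4 ?s0 base (vtx k)" by (rule path_in_mono[OF s0]) (simp add: F4_def)
    have w4: "path_in F4 (w k) base (vtx k)" by (rule path_in_image[OF wY[OF kG]]) (use kG in \<open>auto simp: F4_def\<close>)
    have null: "homotopic_paths L (?s0 +++ reversepath (w k)) (\<lambda>_. base)"
      by (rule L(3)[OF path_in_join[OF s4 path_in_rev[OF w4]]])
    have "path_image (?s0 +++ reversepath (w k)) \<subseteq> L" using homotopic_paths_imp_subset[OF null] by blast
    then have im: "path_image ?s0 \<subseteq> L" "path_image (w k) \<subseteq> L"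
      using s4 w4 by (simp_all add: path_image_join path_in_def)
    have hL: "homotopic_paths L ?s0 (w k)"
      by (rule hom_of_loop[OF path_in_image[OF s4 im(1)] path_in_image[OF w4 im(2)] null])
    obtain p' where p': "cpath (g \<otimes> \<one>) p' (g \<otimes> k)" "\<forall>t\<in>{0..1}. p' t = \<phi> g (w k t)"
      using cpath_translate[OF g(1) w[OF kG]] by blast
    have cp: "cpath g p' h" using p'(1) k(2) g(1) by simp
    have imp: "path_image p' \<subseteq> Y - Cs"
    proof -
      have "path_image p' \<subseteq> \<phi> g ` path_image (w k)" using p'(2) by (auto simp: path_image_def)
      then show ?thesis using im(2) offN[OF g] by blast
    qed
    obtain r n where r: "cray r g" "avoids r" "n \<ge> 0" "\<forall>t\<ge>0. ray_image z r (t + n) = ray_image z s t"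
        "\<forall>b\<ge>0. homotopic_paths Q (p' +++ piece 0 b (ray_image z s)) (piece 0 (b + n) (ray_image z r))"
      using cpath_ray[OF cp imp s] by blast
    have "homotopic_paths (\<phi> g ` L) (\<phi> g \<circ> ?s0) (\<phi> g \<circ> w k)" by (rule act_hom[OF g(1) L(2) hL])
    then have h1: "homotopic_paths Q (\<phi> g \<circ> ?s0) (\<phi> g \<circ> w k)"
      by (rule homotopic_paths_subset) (use offN[OF g] CQ in blast)
    have \<sigma>Q: "path_in Q \<sigma> (vtx g) (vtx h)"
      by (rule path_in_mono[OF \<sigma>]) (use offN[OF g] CQ in \<open>auto simp: F4_def\<close>)
    have h2: "homotopic_paths Q \<sigma> (\<phi> g \<circ> ?s0)"
    proof (rule homotopic_paths_eq)
      show "path \<sigma>" "path_image \<sigma> \<subseteq> Q" using \<sigma>Q by (auto simp: path_in_def)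
      show "\<sigma> t = (\<phi> g \<circ> ?s0) t" if "t \<in> {0..1}" for t
      proof -
        have "\<sigma> t \<in> Y" using path_cont(2)[OF \<sigma>Q] that by blast
        then show ?thesis using act_inv'[OF g(1)] by simp
      qed
    qed
    have h3: "homotopic_paths Q (\<phi> g \<circ> w k) p'"
    proof (rule homotopic_paths_eq)
      show "path (\<phi> g \<circ> w k)" "path_image (\<phi> g \<circ> w k) \<subseteq> Q"
        using homotopic_paths_imp_path[OF h1] homotopic_paths_imp_subset[OF h1] by auto
      show "(\<phi> g \<circ> w k) t = p' t" if "t \<in> {0..1}" for t using p'(2) that by simp
    qed
    have hs: "homotopic_paths Q \<sigma> p'" by (rule hom_trans3[OF h2 h1 h3])
    have "homotopic_paths Q (\<sigma> +++ piece 0 b (ray_image z s)) (piece 0 (b + n) (ray_image z r))" if b: "b \<ge> 0" for b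
    proof -
      have "path_in Q (piece 0 b (ray_image z s)) (vtx h) (ray_image z s b)"
        using ray_piece[OF s, of 0 b] b cray_start[OF s(1)] by simp
      from hom_join_right[OF hs \<sigma>Q this] r(5) b show ?thesis using homotopic_paths_trans by blast
    qed
    then show ?thesis using r(1-4) by blast
  qed
  \<comment> \<open>The class at a point off \<open>D\<close> exists.\<close>
  have reach0: "\<exists>s b. cray s (idx q) \<and> avoids s \<and> tail F s b \<and> reach F q (trk q +++ piece 0 b (ray_image z s))"
    if q: "q \<in> JP - D" and F: "C0 \<subseteq> F" "compact F" "F \<subseteq> Y" for F q
  proof -
    have "idx q \<in> carrier J - M" using idx(1)[of q] idxN[OF q] q by (auto simp: N_def)
    then obtain s where s: "cray s (idx q)" "avoids s" using M(3) unfolding avoids_def by blast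
    obtain b where b: "tail F s b" using cray_eventually[OF s(1) F(2,3)] unfolding tail_def[OF F(1)] by blast
    have o: "out F (trk q +++ piece 0 b (ray_image z s)) q"
      by (rule out_join[OF trk_Q[OF goodD[OF q]] tail_out[OF F(1) s b]])
    have "eqv F (trk q +++ piece 0 b (ray_image z s)) (trk q +++ piece 0 b (ray_image z s))"
      by (rule eqv_hom[OF F(1) o]) (use out_path[OF o] in \<open>auto simp: path_in_def\<close>)
    then have "reach F q (trk q +++ piece 0 b (ray_image z s))" unfolding reach_def using o s b by blast
    then show ?thesis using s b by blast
  qed
  \<comment> \<open>The case of a path in one translate of \<open>P\<close>.\<close>
  have local2: "transports F \<gamma> p q"
    if F: "C0 \<subseteq> F" "compact F" "F \<subseteq> Y" and k: "k \<in> carrier J" and \<gamma>: "path_in (\<phi> k ` P) \<gamma> p q" and pq: "p \<in> JP - D" "q \<in> JP - D" for F \<gamma> p q k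
  proof -
    define g where "g = idx p"
    define h where "h = idx q"
    have gh: "g \<in> carrier J" "h \<in> carrier J" "g \<notin> N" "h \<notin> N"
      using idx(1) idxN pq unfolding g_def h_def by blast+
    note tp = trk[of p, folded g_def] and tq = trk[of q, folded h_def]
    have pin: "p \<in> \<phi> g ` LP" "p \<in> \<phi> k ` LP" "q \<in> \<phi> k ` LP" "q \<in> \<phi> h ` LP"
      using idx(2)[of p] idx(2)[of q] pq path_in_ends[OF \<gamma>] P(4) unfolding g_def h_def by blast+
    define u where "u = inv g \<otimes> k"
    define v where "v = inv k \<otimes> h"
    have u: "u \<in> A" unfolding u_def by (rule Amem[OF gh(1) k pin(1,2)])
    have v: "v \<in> A" unfolding v_def by (rule Amem[OF k gh(2) pin(3,4)])
    have uv: "u \<in> carrier J" "v \<in> carrier J" using u v AJ by auto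
    have ke: "k = g \<otimes> (u \<otimes> \<one>)" using gh k uv by (simp add: u_def J.m_assoc[symmetric])
    have he: "h = g \<otimes> (u \<otimes> v)"
    proof -
      have "g \<otimes> (u \<otimes> v) = (g \<otimes> (u \<otimes> \<one>)) \<otimes> v" using gh uv by (simp add: J.m_assoc)
      also have "\<dots> = k \<otimes> v" using ke by simp
      also have "\<dots> = h" using gh k by (simp add: v_def J.m_assoc[symmetric])
      finally show ?thesis by simp
    qed
    have ge: "g = g \<otimes> (\<one> \<otimes> \<one>)" using gh by simp
    have sub: "\<phi> x ` P \<subseteq> \<phi> g ` P3" if "x = g \<otimes> (a \<otimes> b)" "a \<in> A" "b \<in> A" for x a b
    proof -
      have ab: "a \<in> carrier J" "b \<in> carrier J" using that AJ by auto
      have "\<phi> x ` P \<subseteq> \<phi> x ` LP" using P(4) by blast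
      also have "\<phi> x ` LP = \<phi> g ` \<phi> (a \<otimes> b) ` LP" using act_image_comp[OF gh(1) _ LP(2), of "a \<otimes> b"] ab that(1) by simp
      also have "\<dots> \<subseteq> \<phi> g ` P3" using LP3[OF that(2,3)] by blast
      finally show ?thesis .
    qed
    have tp3: "path_in (\<phi> g ` P3) (trk p) p (vtx g)" using path_in_mono[OF tp sub[OF ge oneA oneA]] pq by blast
    have tq3: "path_in (\<phi> g ` P3) (trk q) q (vtx h)" using path_in_mono[OF tq sub[OF he u v]] pq by blast
    have g3: "path_in (\<phi> g ` P3) \<gamma> p q" by (rule path_in_mono[OF \<gamma> sub[OF ke u oneA]])
    define \<sigma> where "\<sigma> = reversepath (trk p) +++ (\<gamma> +++ trk q)"
    have \<sigma>: "path_in (\<phi> g ` P3) \<sigma> (vtx g) (vtx h)"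
      unfolding \<sigma>_def by (rule path_in_join[OF path_in_rev[OF tp3] path_in_join[OF g3 tq3]])
    have P3Q: "\<phi> g ` P3 \<subseteq> Q" using offN[OF gh(1,3)] CQ by (auto simp: F4_def)
    note tpQ = path_in_mono[OF tp3 P3Q] and tqQ = path_in_mono[OF tq3 P3Q] and gQ = path_in_mono[OF g3 P3Q] and \<sigma>Q = path_in_mono[OF \<sigma> P3Q]
    obtain s b where s: "cray s h" "avoids s" "tail F s b" "reach F q (trk q +++ piece 0 b (ray_image z s))"
      using reach0[OF pq(2) F] unfolding h_def by blast
    have b: "b \<ge> 0" using s(3) by (simp add: tail_def[OF F(1)])
    obtain r n where r: "cray r g" "avoids r" "n \<ge> 0" "\<forall>t\<ge>0. ray_image z r (t + n) = ray_image z s t"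
      "homotopic_paths Q (\<sigma> +++ piece 0 b (ray_image z s)) (piece 0 (b + n) (ray_image z r))"
      using local1[OF gh(1,3,2) \<sigma> s(1,2)] b by blast
    have tr: "tail F r (b + n)"
      unfolding tail_def[OF F(1)]
    proof (intro conjI allI impI)
      show "0 \<le> b + n" using b r(3) by simp
      fix t assume t: "b + n \<le> t"
      then have "ray_image z r t = ray_image z s (t - n)" using r(4)[rule_format, of "t-n"] b by simp
      then show "ray_image z r t \<in> Y - F" using s(3) t unfolding tail_def[OF F(1)] by simp
    qed
    let ?S = "piece 0 b (ray_image z s)" and ?R = "piece 0 (b+n) (ray_image z r)"
    have SQ: "path_in Q ?S (vtx h) (ray_image z s b)" using ray_piece[OF s(1,2), of 0 b] b cray_start[OF s(1)] by simp
    have RQ: "path_in Q ?R (vtx g) (ray_image z r (b+n))" using ray_piece[OF r(1,2), of 0 "b+n"] b r(3) cray_start[OF r(1)] by simp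
    note gt = path_in_join[OF gQ tqQ]
    have 1: "homotopic_paths Q (trk p +++ ?R) (trk p +++ (\<sigma> +++ ?S))"
      by (rule hom_join_left[OF homotopic_paths_sym[OF r(5)] tpQ RQ])
    have a2: "homotopic_paths Q (\<sigma> +++ ?S) (reversepath (trk p) +++ ((\<gamma> +++ trk q) +++ ?S))"
      unfolding \<sigma>_def by (rule hom_assoc'[OF path_in_rev[OF tpQ] gt SQ])
    have 2: "homotopic_paths Q (trk p +++ (\<sigma> +++ ?S)) (trk p +++ (reversepath (trk p) +++ ((\<gamma> +++ trk q) +++ ?S)))"
      by (rule hom_join_left[OF a2 tpQ path_in_join[OF \<sigma>Q SQ]])
    have 3: "homotopic_paths Q (trk p +++ (reversepath (trk p) +++ ((\<gamma> +++ trk q) +++ ?S))) ((\<gamma> +++ trk q) +++ ?S)"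
      by (rule hom_cancel_left'[OF tpQ path_in_join[OF gt SQ]])
    have 4: "homotopic_paths Q ((\<gamma> +++ trk q) +++ ?S) (\<gamma> +++ (trk q +++ ?S))" by (rule hom_assoc'[OF gQ tqQ SQ])
    have h: "homotopic_paths Q (trk p +++ ?R) (\<gamma> +++ (trk q +++ ?S))"
      by (rule homotopic_paths_trans[OF hom_trans3[OF 1 2 3] 4])
    have o: "out F (trk p +++ ?R) p" by (rule out_join[OF tpQ tail_out[OF F(1) r(1,2) tr]])
    have "reach F p (\<gamma> +++ (trk q +++ ?S))"
      unfolding reach_def using out_hom[OF h o] r(1,2) tr eqv_hom[OF F(1) o h] unfolding g_def by blast
    then show ?thesis unfolding transports_def using gQ s(4) by blast
  qed
  have main: "transports F \<gamma> p q" if F: "C0 \<subseteq> F" "compact F" "F \<subseteq> Y" and \<gamma>: "path_in (JP - D) \<gamma> p q" for F \<gamma> p q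
  proof -
    note c = path_cont[OF \<gamma>]
    have JPY: "JP \<subseteq> Y" by (rule translates_sub[OF PY])
    have mem: "\<gamma> t \<in> JP - D" if "t \<in> {0..1}" for t using c(2) that by blast
    have "transports F (piece 0 1 \<gamma>) (\<gamma> 0) (\<gamma> 1)"
    proof (rule Bolzano_path[OF c(1)])
      show "\<gamma> ` {0..1} \<subseteq> Y" using c(2) JPY by blast
      fix x :: real assume x: "x \<in> {0..1}"
      obtain k where k: "k \<in> carrier J" "\<gamma> x \<in> \<phi> k ` P" using mem[OF x] by (auto simp: translates_def)
      have "transports F (piece s t \<gamma>) (\<gamma> s) (\<gamma> t)" if st: "0 \<le> s" "s \<le> t" "t \<le> 1" "\<gamma> ` {s..t} \<subseteq> \<phi> k ` P" for s t
      proof (rule local2[OF F k(1)])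
        show "path_in (\<phi> k ` P) (piece s t \<gamma>) (\<gamma> s) (\<gamma> t)"
          by (rule path_in_piece[of "{s..t}"]) (use st continuous_on_subset[OF c(1), of "{s..t}"] in auto)
        show "\<gamma> s \<in> JP - D" "\<gamma> t \<in> JP - D" using mem[of s] mem[of t] st by auto
      qed
      then show "\<exists>V. openin (top_of_set Y) V \<and> \<gamma> x \<in> V \<and> (\<forall>s t. 0 \<le> s \<longrightarrow> s \<le> t \<longrightarrow> t \<le> 1 \<longrightarrow> \<gamma> ` {s..t} \<subseteq> V \<longrightarrow>
          transports F (piece s t \<gamma>) (\<gamma> s) (\<gamma> t))"
        using k act_open[OF k(1) P(1)] by (intro exI[of _ "\<phi> k ` P"]) simp
    next
      fix s t u :: real assume le: "0 \<le> s" "s \<le> t" "t \<le> u" "u \<le> 1"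
        and h: "transports F (piece s t \<gamma>) (\<gamma> s) (\<gamma> t)" "transports F (piece t u \<gamma>) (\<gamma> t) (\<gamma> u)"
      have g: "good (\<gamma> s)" "good (\<gamma> t)" using goodD[OF mem[of s]] goodD[OF mem[of t]] le by auto
      have "transports F (piece s t \<gamma> +++ piece t u \<gamma>) (\<gamma> s) (\<gamma> u)" by (rule transports_trans[OF F g h])
      then show "transports F (piece s u \<gamma>) (\<gamma> s) (\<gamma> u)"
        by (rule transports_hom[OF F g(1)])
          (rule hom_piece_join[OF c(1)], use le c(2) inQ in auto)
    qed
    then show ?thesis by (simp add: c(3,4))
  qed
  show thesis
    by (rule that[OF D]) (use goodD main in blast)+
qed

end

section \<open>One-ended spaces\<close>

context nice_space
begin

lemma Y_connected: "connected Y"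
proof -
  have "\<exists>p. path_in Y p x y" if xy: "x \<in> Y" "y \<in> Y" for x y
  proof -
    obtain p where "path_in Y p x y" by (rule simply_connected_path[OF simply_conn xy])
    then show ?thesis by blast
  qed
  then show ?thesis by (intro path_connected_imp_connected path_connected_of_paths)
qed

lemma closed_compl_open: "compact K \<Longrightarrow> openin (top_of_set Y) (Y - K)"
  by (rule openin_Diff_closed[OF openin_subtopology_self compact_imp_closed])

lemma component_frontier:
  assumes A: "openin (top_of_set Y) A" "U \<in> components A" and y: "y \<in> Y" "y \<notin> U"
    and lim: "\<And>V. openin (top_of_set Y) V \<Longrightarrow> y \<in> V \<Longrightarrow> V \<inter> U \<noteq> {}"
  shows "y \<notin> A"
proof
  assume "y \<in> A"
  then have "y \<in> \<Union>(components A)" by simp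
  then obtain V where V: "V \<in> components A" "y \<in> V" by blast
  have "openin (top_of_set Y) V" by (rule component_open(1)[OF A(1) V(1)])
  then have "V \<inter> U \<noteq> {}" using lim V(2) by blast
  then have "V = U" using components_nonoverlap[OF V(1) A(2)] by blast
  then show False using V(2) y(2) by simp
qed

lemma connected_clopen_cases:
  assumes "connected C" "openin (top_of_set Y) U" "openin (top_of_set Y) V" "C \<subseteq> U \<union> V" "U \<inter> V \<inter> C = {}"
  shows "C \<subseteq> U \<or> C \<inter> U = {}"
proof (rule ccontr)
  assume n: "\<not> ?thesis"
  obtain T1 where T1: "open T1" "U = Y \<inter> T1" using assms(2) unfolding openin_open by blast
  obtain T2 where T2: "open T2" "V = Y \<inter> T2" using assms(3) unfolding openin_open by blast
  have CY: "C \<subseteq> Y" using assms(2-4) openin_imp_subset by blast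
  have U1: "x \<in> U \<longleftrightarrow> x \<in> T1" and V1: "x \<in> V \<longleftrightarrow> x \<in> T2" if "x \<in> C" for x using T1 T2 CY that by auto
  have "C \<subseteq> T1 \<union> T2" using assms(4) U1 V1 by blast
  moreover have "T1 \<inter> T2 \<inter> C = {}" using assms(5) U1 V1 by blast
  moreover have "T1 \<inter> C \<noteq> {}" "T2 \<inter> C \<noteq> {}" using n assms(4) U1 V1 by blast+
  ultimately show False using connectedD[OF assms(1) T1(1) T2(1)] by blast
qed

text \<open>Otherwise \<open>U\<close> would be open and closed.\<close>

lemma component_meets:
  assumes O: "openin (top_of_set Y) Ob" "Ob \<noteq> {}" and A: "openin (top_of_set Y) A" and cover: "Ob \<union> A = Y"
    and U: "U \<in> components A"
  shows "U \<inter> Ob \<noteq> {}"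
proof
  assume e: "U \<inter> Ob = {}"
  have oU: "openin (top_of_set Y) U" by (rule component_open(1)[OF A U])
  have "openin (top_of_set Y) (Ob \<union> \<Union>(components A - {U}))"
    using O(1) component_open(1)[OF A] by (intro openin_Un openin_Union) auto
  moreover have "Y \<subseteq> U \<union> (Ob \<union> \<Union>(components A - {U}))"
  proof
    fix y assume "y \<in> Y"
    then have "y \<in> Ob \<or> y \<in> \<Union>(components A)" using cover by auto
    then show "y \<in> U \<union> (Ob \<union> \<Union>(components A - {U}))" by blast
  qed
  moreover have "U \<inter> V' = {}" if "V' \<in> components A - {U}" for V'
    using components_nonoverlap[of U A V'] that U by blast
  then have "U \<inter> (Ob \<union> \<Union>(components A - {U})) \<inter> Y = {}" using e by blast
  ultimately have "Y \<subseteq> U \<or> Y \<inter> U = {}" using connected_clopen_cases[OF Y_connected oU] by blast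
  then have "Y \<subseteq> U" using in_components_nonempty[OF U] openin_imp_subset[OF oU] by blast
  then show False using e O(2) openin_imp_subset[OF O(1)] by blast
qed

text \<open>Outside a large compact set, only one component of the complement of \<open>K\<close> is left: all but
  finitely many components lie near \<open>K\<close>.\<close>

lemma outside_one_component:
  assumes one: "one_ended Y" and K: "compact K" "K \<subseteq> Y"
  obtains W K' where "W \<in> components (Y - K)" "compact K'" "K' \<subseteq> Y" "K \<subseteq> K'" "Y - K' \<subseteq> W"
proof -
  obtain W where W: "W \<in> components (Y - K)" 
     "\<And>U. U \<in> components (Y - K) \<Longrightarrow> \<not> (\<exists>K. compact K \<and> K \<subseteq> Y \<and> U \<subseteq> K) \<Longrightarrow> U = W"
    using one K unfolding one_ended_def by metis
  have oYK: "openin (top_of_set Y) (Y - K)" by (rule closed_compl_open[OF K(1)])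
  obtain V L where V: "openin (top_of_set Y) V" "K \<subseteq> V" "V \<subseteq> L" "compact L" "L \<subseteq> Y" using compact_nbhd[OF K] by blast
  have oYL: "openin (top_of_set Y) (Y - L)" by (rule closed_compl_open[OF V(4)])
  show thesis
  proof (cases "K = {}")
    case True
    have "Y \<subseteq> W"
    proof -
      obtain x where x: "x \<in> W" using in_components_nonempty[OF W(1)] by blast
      have "Y \<subseteq> W" by (rule components_maximal[OF W(1) Y_connected]) (use x True in_components_subset[OF W(1)] in auto)
      then show ?thesis .
    qed
    then show thesis using that[OF W(1), of "{}"] True by auto
  next
    case False
    have meets: "U \<inter> (L - V) \<noteq> {}" if U: "U \<in> components (Y - K)" "\<not> U \<subseteq> L" for U
    proof
      assume e: "U \<inter> (L - V) = {}"
      have UY: "U \<subseteq> Y - K" by (rule in_components_subset[OF U(1)])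
      have c: "U \<subseteq> (Y - L) \<or> U \<inter> (Y - L) = {}"
        by (rule connected_clopen_cases[OF in_components_connected[OF U(1)] oYL V(1)]) (use e UY V(3) in blast)+
      then have UL: "U \<inter> L = {}" using U(2) UY by blast
      have oU: "openin (top_of_set Y) U" by (rule component_open(1)[OF oYK U(1)])
      \<comment> \<open>Then \<open>U\<close> would be open and closed.\<close>
      have "openin (top_of_set Y) (Y - U)"
      proof (subst openin_subopen, intro ballI)
        fix y assume y: "y \<in> Y - U"
        show "\<exists>T. openin (top_of_set Y) T \<and> y \<in> T \<and> T \<subseteq> Y - U"
        proof (rule ccontr)
          assume n: "\<nexists>T. openin (top_of_set Y) T \<and> y \<in> T \<and> T \<subseteq> Y - U"
          have lim: "T \<inter> U \<noteq> {}" if "openin (top_of_set Y) T" "y \<in> T" for T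
            using n that openin_imp_subset[OF that(1)] by blast
          have "y \<notin> Y - K" by (rule component_frontier[OF oYK U(1) _ _ lim]) (use y in auto)
          then have "y \<in> V" using y V(2) by blast
          then show False using lim[OF V(1)] UL V(3) by blast
        qed
      qed
      then have oc: "openin (top_of_set Y) (Y - U)" .
      have "Y \<subseteq> U \<or> Y \<inter> U = {}"
        by (rule connected_clopen_cases[OF Y_connected oU oc]) blast+
      then show False using UY False K(2) in_components_nonempty[OF U(1)] by blast
    qed
    let ?C = "{U \<in> components (Y - K). U \<inter> (L - V) \<noteq> {}}"
    have finC: "finite ?C"
    proof -
      have "compact (L - V)"
      proof -
        obtain T where "open T" "V = Y \<inter> T" using V(1) unfolding openin_open by blast
        then have "L - V = L - T" using V(5) by blast
        then show ?thesis using compact_diff[OF V(4) \<open>open T\<close>] by simp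
      qed
      moreover have "L - V \<subseteq> Y" using V(5) by blast
      moreover have "\<exists>U. U \<in> components (Y - K) \<and> y \<in> U" if "y \<in> L - V" for y
      proof -
        have "y \<in> \<Union>(components (Y - K))" using that V(2,5) by auto
        then show ?thesis by blast
      qed
      then obtain cmp where cmp: "\<And>y. y \<in> L - V \<Longrightarrow> cmp y \<in> components (Y - K) \<and> y \<in> cmp y" by metis
      have oc: "openin (top_of_set Y) (cmp y) \<and> y \<in> cmp y" if "y \<in> L - V" for y
        using cmp[OF that] component_open(1)[OF oYK, of "cmp y"] by simp
      ultimately obtain A where A: "finite A" "A \<subseteq> L - V" "L - V \<subseteq> (\<Union>y\<in>A. cmp y)"
        using finite_open_cover[of "L - V" cmp, OF _ _ oc] by metis
      have "?C \<subseteq> cmp ` A"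
      proof
        fix U assume U: "U \<in> ?C"
        then obtain y where y: "y \<in> U" "y \<in> L - V" by blast
        then obtain a where a: "a \<in> A" "y \<in> cmp a" using A(3) by blast
        then have "U = cmp a" using components_nonoverlap[of U "Y - K" "cmp a"] cmp[of a] A(2) U y(1) by blast
        then show "U \<in> cmp ` A" using a(1) by blast
      qed
      then show ?thesis using A(1) finite_surj by blast
    qed
    have "\<forall>U\<in>?C - {W}. \<exists>B. compact B \<and> B \<subseteq> Y \<and> U \<subseteq> B" using W(2) by blast
    from bchoice[OF this] obtain B where B: "\<forall>U\<in>?C - {W}. compact (B U) \<and> B U \<subseteq> Y \<and> U \<subseteq> B U" by (elim exE)
    let ?K' = "L \<union> (\<Union>U\<in>?C - {W}. B U)"
    show thesis
    proof (rule that[OF W(1)])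
      show "compact ?K'" using V(4) B finC by (intro compact_Un compact_UN) auto
      show "?K' \<subseteq> Y" using V(5) B by blast
      show "K \<subseteq> ?K'" using V by blast
      show "Y - ?K' \<subseteq> W"
      proof
        fix y assume y: "y \<in> Y - ?K'"
        then have "y \<in> \<Union>(components (Y - K))" using V(2,3) by auto
        then obtain U where U: "U \<in> components (Y - K)" "y \<in> U" by blast
        have "\<not> U \<subseteq> L" using y U(2) by blast
        then have UC: "U \<in> ?C" using meets[OF U(1)] U(1) by blast
        have "U = W" 
        proof (rule ccontr)
          assume "U \<noteq> W"
          then have "U \<in> ?C - {W}" using UC by blast
          then have "U \<subseteq> B U" "U \<in> ?C - {W}" using B by blast+
          then show False using y U(2) by blast
        qed
        then show "y \<in> W" using U(2) by simp
      qed
    qed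
  qed
qed

end

section \<open>The collar of the orbit\<close>

text \<open>\<open>Oh\<close> is a connected neighbourhood of the orbit, and the components of \<open>Ah\<close> stand for the components of its complement. The
  overlap of both is tiled by translates of the sets \<open>W i\<close>.\<close>

locale collar = tracks Y J \<phi> base S z C0 Cs P LP
  for Y :: "'a::t2_space set" and J :: "('g, 'm) monoid_scheme" (structure) and \<phi> base S z C0 Cs P LP +
  fixes I :: "'i set" and W L :: "'i \<Rightarrow> 'a set" and Oh Ah :: "'a set"
  assumes one: "one_ended Y"
    and I: "finite I"
    and W: "\<And>i. i \<in> I \<Longrightarrow> openin (top_of_set Y) (W i) \<and> path_connected (W i) \<and> W i \<noteq> {} \<and> W i \<subseteq> L i"
    and L: "\<And>i. i \<in> I \<Longrightarrow> compact (L i) \<and> L i \<subseteq> Y"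
    and Oh: "openin (top_of_set Y) Oh" "path_connected Oh" "Oh \<subseteq> translates J \<phi> P" "\<And>g. g \<in> carrier J \<Longrightarrow> \<phi> g base \<in> Oh"
    and Ah: "openin (top_of_set Y) Ah"
    and cover: "Oh \<union> Ah = Y"
    and inter: "Oh \<inter> Ah = (\<Union>g\<in>carrier J. \<Union>i\<in>I. \<phi> g ` W i)"
    and bounded_comp: "\<And>U. U \<in> components Ah \<Longrightarrow> J_bounded J \<phi> Y U \<Longrightarrow> U \<subseteq> translates J \<phi> P"
    and co_semi: "\<And>U r. U \<in> components Ah \<Longrightarrow> \<not> J_bounded J \<phi> Y U \<Longrightarrow> proper_ray Y r \<Longrightarrow> r ` {0..} \<subseteq> U \<Longrightarrow>
        J_bounded J \<phi> Y (r ` {0..}) \<Longrightarrow> co_semistable_wrt_ray Y U r C0"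
begin

definition X where "X = Oh \<inter> Ah"
definition VS :: "'g \<times> 'i \<Rightarrow> 'a set" where "VS v = \<phi> (fst v) ` W (snd v)"
abbreviation "V \<equiv> carrier J \<times> I"
text \<open>The nerve of the tiling.\<close>

definition gadj :: "'g \<times> 'i \<Rightarrow> 'g \<times> 'i \<Rightarrow> bool" where
  "gadj v w \<longleftrightarrow> v \<in> V \<and> w \<in> V \<and> VS v \<inter> VS w \<noteq> {}"

lemma WY: "i \<in> I \<Longrightarrow> W i \<subseteq> Y" using W L by blast

lemma X_eq: "X = (\<Union>v\<in>V. VS v)"
  unfolding X_def inter VS_def by force

lemma VS: assumes "v \<in> V" 
  shows "openin (top_of_set Y) (VS v)" "path_connected (VS v)" "VS v \<noteq> {}" "VS v \<subseteq> X" "VS v \<subseteq> Ah" "VS v \<subseteq> Y" 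
proof -
  have v: "fst v \<in> carrier J" "snd v \<in> I" using assms by auto
  show "openin (top_of_set Y) (VS v)" unfolding VS_def using act_open[OF v(1)] W[OF v(2)] by blast
  show "path_connected (VS v)" unfolding VS_def using act_path_connected[OF v(1) WY[OF v(2)]] W[OF v(2)] by blast
  show "VS v \<noteq> {}" unfolding VS_def using W[OF v(2)] by blast
  show "VS v \<subseteq> X" using assms X_eq by blast
  then show "VS v \<subseteq> Ah" by (auto simp: X_def)
  show "VS v \<subseteq> Y" unfolding VS_def by (rule act_sub[OF v(1) WY[OF v(2)]])
qed

lemma VS_compact: "v \<in> V \<Longrightarrow> VS v \<subseteq> \<phi> (fst v) ` L (snd v) \<and> compact (\<phi> (fst v) ` L (snd v)) \<and> \<phi> (fst v) ` L (snd v) \<subseteq> Y"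
proof -
  assume v: "v \<in> V"
  then have "fst v \<in> carrier J" "snd v \<in> I" by auto
  then show ?thesis unfolding VS_def using W L act_compact act_sub by (simp add: image_mono)
qed

lemma VS_meets_finite:
  assumes "compact D" "D \<subseteq> Y" shows "finite {v \<in> V. VS v \<inter> D \<noteq> {}}"
proof (rule finite_subset)
  show "{v \<in> V. VS v \<inter> D \<noteq> {}} \<subseteq> (\<Union>i\<in>I. (\<lambda>g. (g,i)) ` {g \<in> carrier J. \<phi> g ` L i \<inter> D \<noteq> {}})"
  proof
    fix v assume v: "v \<in> {v \<in> V. VS v \<inter> D \<noteq> {}}"
    then have "fst v \<in> carrier J" "snd v \<in> I" "\<phi> (fst v) ` L (snd v) \<inter> D \<noteq> {}" using VS_compact[of v] by auto
    then show "v \<in> (\<Union>i\<in>I. (\<lambda>g. (g,i)) ` {g \<in> carrier J. \<phi> g ` L i \<inter> D \<noteq> {}})"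
      by (intro UN_I[of "snd v"] image_eqI[of _ _ "fst v"]) auto
  qed
  show "finite (\<Union>i\<in>I. (\<lambda>g. (g,i)) ` {g \<in> carrier J. \<phi> g ` L i \<inter> D \<noteq> {}})"
    using I L meets_finite[OF _ _ assms] by (intro finite_UN_I finite_imageI) auto
qed

lemma gadj_sym: "gadj v w \<Longrightarrow> gadj w v" by (auto simp: gadj_def)

lemma gadj_finite: "finite {w. gadj v w}"
proof (cases "v \<in> V")
  case True
  have "{w. gadj v w} \<subseteq> {w \<in> V. VS w \<inter> \<phi> (fst v) ` L (snd v) \<noteq> {}}" using VS_compact[OF True] by (auto simp: gadj_def)
  then show ?thesis using VS_meets_finite VS_compact[OF True] finite_subset by blast
qed (auto simp: gadj_def)

lemma comp_of: "x \<in> Ah \<Longrightarrow> \<exists>U\<in>components Ah. x \<in> U"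
proof -
  assume "x \<in> Ah"
  then have "x \<in> \<Union>(components Ah)" by simp
  then show ?thesis by blast
qed

lemma connected_in_comp: "U \<in> components Ah \<Longrightarrow> connected C \<Longrightarrow> C \<subseteq> Ah \<Longrightarrow> C \<inter> U \<noteq> {} \<Longrightarrow> C \<subseteq> U"
  using components_maximal[of U Ah C] by blast

lemma VS_in_comp: "U \<in> components Ah \<Longrightarrow> v \<in> V \<Longrightarrow> VS v \<inter> U \<noteq> {} \<Longrightarrow> VS v \<subseteq> U"
  using connected_in_comp[OF _ path_connected_imp_connected[OF VS(2)] VS(5)] by blast

lemma gadj_in_comp: "U \<in> components Ah \<Longrightarrow> gadj v w \<Longrightarrow> VS v \<subseteq> U \<Longrightarrow> VS w \<subseteq> U"
  using VS_in_comp[of U w] by (auto simp: gadj_def)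

lemma comp_meets_Oh: "U \<in> components Ah \<Longrightarrow> U \<inter> Oh \<noteq> {}"
  by (rule component_meets[OF Oh(1) _ Ah cover]) (use Oh(4)[OF J.one_closed] in blast)

text \<open>The part of the collar in one component of \<open>Ah\<close> is connected, by unicoherence of \<open>Y\<close>.\<close>

lemma collar_connected: assumes U: "U \<in> components Ah" shows "connected (U \<inter> X)"
proof -
  let ?B = "Oh \<union> \<Union>(components Ah - {U})"
  have oB: "openin (top_of_set Y) ?B"
    using Oh(1) component_open(1)[OF Ah] by (intro openin_Un openin_Union) auto
  have "connected ?B"
  proof -
    have "?B = \<Union>((\<lambda>C. Oh \<union> C) ` (insert Oh (components Ah - {U})))" by auto
    moreover have "connected (\<Union>((\<lambda>C. Oh \<union> C) ` (insert Oh (components Ah - {U}))))"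
    proof (rule connected_Union)
      fix C assume "C \<in> (\<lambda>C. Oh \<union> C) ` (insert Oh (components Ah - {U}))"
      then obtain D where D: "C = Oh \<union> D" "D = Oh \<or> D \<in> components Ah" by blast
      have cO: "connected Oh" by (rule path_connected_imp_connected[OF Oh(2)])
      show "connected C"
      proof (cases "D = Oh")
        case True then show ?thesis using D cO by simp
      next
        case False
        then have "D \<in> components Ah" using D by blast
        then show ?thesis unfolding D(1)
          using comp_meets_Oh in_components_connected by (intro connected_Un cO) blast+
      qed
    next
      show "\<Inter>((\<lambda>C. Oh \<union> C) ` (insert Oh (components Ah - {U}))) \<noteq> {}"
        using Oh(4)[OF J.one_closed] by blast
    qed
    ultimately show ?thesis by simp
  qed
  then have pB: "path_connected ?B" by (rule open_connected_path_connected[OF oB])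
  have UB: "U \<union> ?B = Y"
  proof
    show "U \<union> ?B \<subseteq> Y" using openin_imp_subset[OF oB] openin_imp_subset[OF component_open(1)[OF Ah U]] by blast
    show "Y \<subseteq> U \<union> ?B"
    proof
      fix y assume "y \<in> Y"
      then have "y \<in> Oh \<or> y \<in> Ah" using cover by blast
      then show "y \<in> U \<union> ?B" using comp_of[of y] by blast
    qed
  qed
  have "connected (U \<inter> ?B)"
    by (rule simply_connected_unicoherent_open[OF simply_conn component_open[OF Ah U] oB pB UB])
  moreover have "U \<inter> ?B = U \<inter> X"
  proof -
    have "U \<inter> V' = {}" if "V' \<in> components Ah - {U}" for V'
      using components_nonoverlap[of U Ah V'] that U by blast
    then show ?thesis using in_components_subset[OF U] unfolding X_def by blast
  qed
  ultimately show ?thesis by simp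
qed

text \<open>Otherwise the tiles that can be reached and those that cannot would disconnect the collar of \<open>U\<close>.\<close>

lemma gadj_connected:
  assumes U: "U \<in> components Ah" and v: "v \<in> V" "VS v \<subseteq> U" and w: "w \<in> V" "VS w \<subseteq> U"
  shows "gadj\<^sup>*\<^sup>* v w"
proof (rule ccontr)
  assume n: "\<not> gadj\<^sup>*\<^sup>* v w"
  let ?R = "\<Union>(VS ` {u \<in> V. gadj\<^sup>*\<^sup>* v u})" and ?N = "\<Union>(VS ` {u \<in> V. \<not> gadj\<^sup>*\<^sup>* v u})"
  have o: "openin (top_of_set Y) ?R" "openin (top_of_set Y) ?N" by (intro openin_Union; use VS(1) in auto)+
  have "U \<inter> X \<subseteq> ?R \<union> ?N" unfolding X_eq by blast
  moreover have "?R \<inter> ?N = {}"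
  proof (rule ccontr)
    assume "?R \<inter> ?N \<noteq> {}"
    then obtain x a b where x: "a \<in> V" "gadj\<^sup>*\<^sup>* v a" "b \<in> V" "\<not> gadj\<^sup>*\<^sup>* v b" "x \<in> VS a" "x \<in> VS b" by blast
    then have "gadj a b" by (auto simp: gadj_def)
    then show False using x by (meson rtranclp.rtrancl_into_rtrancl)
  qed
  ultimately have "U \<inter> X \<subseteq> ?R \<or> (U \<inter> X) \<inter> ?R = {}"
    using connected_clopen_cases[OF collar_connected[OF U] o] by blast
  moreover obtain x where x: "x \<in> VS v" using VS(3)[OF v(1)] by blast
  moreover obtain y where y: "y \<in> VS w" using VS(3)[OF w(1)] by blast
  moreover have "x \<in> (U \<inter> X) \<inter> ?R"
  proof -
    have "x \<in> ?R" by (rule UN_I[of v]) (use v x in auto)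
    then show ?thesis using x v VS(4)[OF v(1)] by blast
  qed
  moreover have "y \<in> ?N" by (rule UN_I[of w]) (use w n y in auto)
  moreover have "y \<in> U \<inter> X" using w VS(4)[OF w(1)] y by blast
  ultimately show False using \<open>?R \<inter> ?N = {}\<close> by (elim disjE) blast+
qed

text \<open>If the collar of \<open>U\<close> were bounded, a compact set would separate \<open>U\<close> from the orbit of the
  base point; both are unbounded, against one-endedness.\<close>

lemma gadj_infinite:
  assumes U: "U \<in> components Ah" "\<not> J_bounded J \<phi> Y U" and v: "v \<in> V" "VS v \<subseteq> U"
  shows "infinite {w. gadj\<^sup>*\<^sup>* v w}"
proof
  assume fin: "finite {w. gadj\<^sup>*\<^sup>* v w}"
  let ?R = "{w \<in> V. gadj\<^sup>*\<^sup>* v w}"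
  define K where "K = (\<Union>w\<in>?R. \<phi> (fst w) ` L (snd w))"
  have fR: "finite ?R" by (rule finite_subset[OF _ fin]) blast
  have K: "compact K" "K \<subseteq> Y" unfolding K_def using fR VS_compact by (blast intro: compact_UN)+
  have UX: "U \<inter> X \<subseteq> K"
  proof
    fix x assume x: "x \<in> U \<inter> X"
    then obtain w where w: "w \<in> V" "x \<in> VS w" unfolding X_eq by blast
    then have "VS w \<subseteq> U" using VS_in_comp[OF U(1) w(1)] x by blast
    then have "w \<in> ?R" using gadj_connected[OF U(1) v w(1)] w(1) by blast
    then show "x \<in> K" unfolding K_def using VS_compact[OF w(1)] w(2) by blast
  qed
  have oU: "openin (top_of_set Y) U" by (rule component_open(1)[OF Ah U(1)])
  have oUK: "openin (top_of_set Y) (U - K)" by (rule openin_Diff_closed[OF oU compact_imp_closed[OF K(1)]])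
  have oN: "openin (top_of_set Y) (Y - K - U)"
  proof (subst openin_subopen, intro ballI)
    fix y assume y: "y \<in> Y - K - U"
    have "y \<in> Oh \<or> y \<in> Ah" using y cover by blast
    then show "\<exists>T. openin (top_of_set Y) T \<and> y \<in> T \<and> T \<subseteq> Y - K - U"
    proof
      assume yO: "y \<in> Oh"
      have "openin (top_of_set Y) (Oh - K)" by (rule openin_Diff_closed[OF Oh(1) compact_imp_closed[OF K(1)]])
      moreover have "Oh - K \<subseteq> Y - K - U"
        using openin_imp_subset[OF Oh(1)] UX in_components_subset[OF U(1)] unfolding X_def by blast
      ultimately show ?thesis using yO y by blast
    next
      assume "y \<in> Ah"
      then obtain V' where V': "V' \<in> components Ah" "y \<in> V'" using comp_of by blast
      have "V' \<inter> U = {}" using components_nonoverlap[OF V'(1) U(1)] V'(2) y by blast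
      moreover have "openin (top_of_set Y) (V' - K)"
        by (rule openin_Diff_closed[OF component_open(1)[OF Ah V'(1)] compact_imp_closed[OF K(1)]])
      moreover have "V' \<subseteq> Y" by (rule openin_imp_subset[OF component_open(1)[OF Ah V'(1)]])
      ultimately show ?thesis using V'(2) y by (intro exI[of _ "V' - K"]) blast
    qed
  qed
  obtain W' K' where W': "W' \<in> components (Y - K)" "compact K'" "K' \<subseteq> Y" "K \<subseteq> K'" "Y - K' \<subseteq> W'"
    by (rule outside_one_component[OF one K])
  have "W' \<subseteq> U - K \<or> W' \<inter> (U - K) = {}"
    by (rule connected_clopen_cases[OF in_components_connected[OF W'(1)] oUK oN]) (use in_components_subset[OF W'(1)] in blast)+
  then show False
  proof
    assume s: "W' \<subseteq> U - K"
    have "vtx g \<in> K'" if g: "g \<in> carrier J" for g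
    proof (rule ccontr)
      assume n: "vtx g \<notin> K'"
      have "vtx g \<in> Y" by (rule act_in[OF g base])
      then have "vtx g \<in> U - K" using n W'(5) s by blast
      then show False using Oh(4)[OF g] UX in_components_subset[OF U(1)] unfolding X_def by blast
    qed
    then have "carrier J \<subseteq> {g \<in> carrier J. \<phi> g ` {base} \<inter> K' \<noteq> {}}" by auto
    moreover have "finite {g \<in> carrier J. \<phi> g ` {base} \<inter> K' \<noteq> {}}" using base W' by (intro meets_finite) auto
    ultimately show False using infinite_group finite_subset by blast
  next
    assume "W' \<inter> (U - K) = {}"
    then have "U \<subseteq> K'" using W'(4,5) openin_imp_subset[OF oU] by blast
    also have "K' \<subseteq> translates J \<phi> K'" by (rule translates_self[OF W'(3)])
    finally show False using U(2) W'(2,3) unfolding J_bounded_def by blast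
  qed
qed

end

section \<open>Paths through the complement of the orbit\<close>

text \<open>Paths near the orbit and off \<open>D1\<close> transport. The set \<open>B\<close> consists of the tiles that meet \<open>D1\<close>, and \<open>M\<close> contains in addition the tiles in infinite
  components of the nerve that \<open>B\<close> cuts off from infinity.\<close>

locale far_collar = collar Y J \<phi> base S z C0 Cs P LP I W L Oh Ah
  for Y :: "'a::t2_space set" and J :: "('g, 'm) monoid_scheme" (structure) and \<phi> base S z C0 Cs P LP
    and I :: "'i set" and W L Oh Ah +
  fixes D1 :: "'a set" and B M :: "('g \<times> 'i) set"
  assumes D1: "compact D1" "D1 \<subseteq> Y"
    and good_far: "\<forall>p\<in>JP - D1. good p"
    and near: "\<forall>F \<gamma> p q. C0 \<subseteq> F \<longrightarrow> compact F \<longrightarrow> F \<subseteq> Y \<longrightarrow> path_in (JP - D1) \<gamma> p q \<longrightarrow> transports F \<gamma> p q"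
    and B_eq: "B = {v \<in> V. VS v \<inter> D1 \<noteq> {}}"
    and M: "finite M" "B \<subseteq> M"
      "\<forall>v. infinite {w. gadj\<^sup>*\<^sup>* v w} \<longrightarrow> v \<notin> M \<longrightarrow> infinite {w. (\<lambda>x y. gadj x y \<and> x \<notin> B \<and> y \<notin> B)\<^sup>*\<^sup>* v w}"
begin

abbreviation "gadjB \<equiv> \<lambda>x y. gadj x y \<and> x \<notin> B \<and> y \<notin> B"

lemma XJP: "X \<subseteq> JP" using Oh(3) by (auto simp: X_def)

lemma VS_far: "v \<in> V \<Longrightarrow> v \<notin> B \<Longrightarrow> VS v \<subseteq> X - D1"
  using VS(4)[of v] B_eq by blast

lemma VS_JP: "v \<in> V \<Longrightarrow> v \<notin> B \<Longrightarrow> VS v \<subseteq> JP - D1"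
  using VS_far XJP by blast

lemma gadjB_sym: "gadjB\<^sup>*\<^sup>* v w \<Longrightarrow> gadjB\<^sup>*\<^sup>* w v"
proof (induction rule: rtranclp_induct)
  case (step y w)
  have "gadjB w y" using step(2) gadj_sym by blast
  then show ?case using step(3) by (rule converse_rtranclp_into_rtranclp)
qed simp

lemma gadjB_path:
  assumes U: "U \<in> components Ah" and vw: "gadjB\<^sup>*\<^sup>* v w" and v: "v \<in> V" "v \<notin> B" "VS v \<subseteq> U" and p: "p \<in> VS v"
  shows "w \<in> V \<and> w \<notin> B \<and> VS w \<subseteq> U \<and> (\<forall>q\<in>VS w. \<exists>\<gamma>. path_in ((X - D1) \<inter> U) \<gamma> p q)"
  using vw
proof (induction rule: rtranclp_induct)
  case base
  have "VS v \<subseteq> (X - D1) \<inter> U" using VS_far[OF v(1,2)] v(3) by blast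
  then have "\<exists>\<gamma>. path_in ((X - D1) \<inter> U) \<gamma> p q" if "q \<in> VS v" for q
    using path_connected_path_in[OF VS(2)[OF v(1)] p that] path_in_mono by blast
  then show ?case using v by blast
next
  case (step y w)
  have w: "w \<in> V" "w \<notin> B" using step(2) by (auto simp: gadj_def)
  have g: "gadj y w" using step(2) by blast
  have wU: "VS w \<subseteq> U" by (rule gadj_in_comp[OF U g]) (use step.IH in blast)
  obtain x where x: "x \<in> VS y" "x \<in> VS w" using g by (auto simp: gadj_def)
  obtain \<gamma> where \<gamma>: "path_in ((X - D1) \<inter> U) \<gamma> p x" using step.IH x(1) by blast
  have s: "VS w \<subseteq> (X - D1) \<inter> U" using VS_far[OF w] wU by blast
  have "\<exists>\<gamma>. path_in ((X - D1) \<inter> U) \<gamma> p q" if q: "q \<in> VS w" for q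
  proof -
    obtain \<gamma>' where "path_in (VS w) \<gamma>' x q" using path_connected_path_in[OF VS(2)[OF w(1)] x(2) q] by blast
    then show ?thesis using path_in_join[OF \<gamma> path_in_mono[OF _ s]] by blast
  qed
  then show ?case using w wU by blast
qed

lemma transports_collar_path: 
  assumes F: "C0 \<subseteq> F" "compact F" "F \<subseteq> Y" and \<gamma>: "path_in ((X - D1) \<inter> U) \<gamma> p q"
  shows "transports F \<gamma> p q"
proof -
  have "path_in (JP - D1) \<gamma> p q" by (rule path_in_mono[OF \<gamma>]) (use XJP in blast)
  then show ?thesis using near F by blast
qed

text \<open>A ray in the nerve that avoids \<open>B\<close> is realized by paths through its tiles.\<close>

lemma bounded_ray:
  assumes U: "U \<in> components Ah" "\<not> J_bounded J \<phi> Y U" and v: "v \<in> V" "v \<notin> M" "VS v \<subseteq> U" and p: "p \<in> VS v"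
  shows "\<exists>\<rho>. proper_ray Y \<rho> \<and> \<rho> 0 = p \<and> \<rho> ` {0..} \<subseteq> (X - D1) \<inter> U \<and> J_bounded J \<phi> Y (\<rho> ` {0..})"
proof -
  have "infinite {w. gadj\<^sup>*\<^sup>* v w}" by (rule gadj_infinite[OF U v(1,3)])
  then have inf: "infinite {w. gadjB\<^sup>*\<^sup>* v w}" using M(3) v(2) by blast
  have fin: "finite {w. gadjB x w}" for x by (rule finite_subset[OF _ gadj_finite[of x]]) blast
  obtain f where f: "f 0 = v" "\<forall>i. gadjB (f i) (f (Suc i))" "inj f"
    by (rule ray_of_infinite[OF inf fin])
  have fV: "f i \<in> V" "f i \<notin> B" for i using f(2)[rule_format, of i] by (auto simp: gadj_def)
  have fU: "VS (f i) \<subseteq> U" for i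
  proof (induction i)
    case 0 then show ?case using f(1) v(3) by simp
  next
    case (Suc i)
    have "gadj (f i) (f (Suc i))" using f(2) by blast
    then show ?case using gadj_in_comp[OF U(1)] Suc by blast
  qed
  have "\<forall>i. \<exists>x. x \<in> VS (f i) \<and> x \<in> VS (f (Suc i))" using f(2) by (auto simp: gadj_def)
  then obtain x' where x': "\<And>i. x' i \<in> VS (f i) \<and> x' i \<in> VS (f (Suc i))" by metis
  define x where "x = case_nat p x'"
  have x: "x i \<in> VS (f i)" for i
  proof (cases i)
    case 0 then show ?thesis using p f(1) by (simp add: x_def)
  next
    case (Suc k) then show ?thesis using x'[of k] by (simp add: x_def)
  qed
  have xS: "x (Suc i) \<in> VS (f i)" for i using x'[of i] by (simp add: x_def)
  have "\<forall>i. \<exists>e. path_in (VS (f i)) e (x i) (x (Suc i))"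
    using path_connected_path_in[OF VS(2)[OF fV(1)] x xS] by blast
  then obtain e where e: "\<And>i. path_in (VS (f i)) (e i) (x i) (x (Suc i))" by metis
  have m: "e i 1 = e (Suc i) 0" for i using path_cont(4)[OF e[of i]] path_cont(3)[OF e[of "Suc i"]] by simp
  define \<rho> where "\<rho> = concat_paths e"
  have im: "\<rho> ` {0..} = (\<Union>i. e i ` {0..1})" unfolding \<rho>_def by (rule concat_paths_image) (rule m)
  have ei: "e i ` {0..1} \<subseteq> VS (f i)" for i by (rule path_cont(2)[OF e])
  have imV: "\<rho> ` {0..} \<subseteq> (\<Union>i. VS (f i))" unfolding im using ei by blast
  have "VS (f i) \<subseteq> (X - D1) \<inter> U" for i using VS_far[OF fV] fU by blast
  then have imU: "\<rho> ` {0..} \<subseteq> (X - D1) \<inter> U" using imV by blast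
  have "\<rho> 0 = e 0 0" unfolding \<rho>_def using concat_paths_eq[of e 0 0] m by simp
  then have "\<rho> 0 = p" using path_cont(3)[OF e[of 0]] by (simp add: x_def)
  moreover have "proper_ray Y \<rho>"
  proof (rule proper_rayI)
    show "continuous_on {0..} \<rho>" unfolding \<rho>_def by (rule concat_paths_continuous[OF path_cont(1)[OF e]]) (rule m)
    show "\<rho> ` {0..} \<subseteq> Y" using imV VS(6)[OF fV(1)] by blast
    fix D assume D: "compact D" "D \<subseteq> Y"
    have "{i. e i ` {0..1} \<inter> D \<noteq> {}} \<subseteq> f -` {v \<in> V. VS v \<inter> D \<noteq> {}}" using ei fV(1) by blast
    then have "finite {i. e i ` {0..1} \<inter> D \<noteq> {}}"
      using finite_vimageI[OF VS_meets_finite[OF D] f(3)] finite_subset by blast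
    then show "\<exists>T. \<forall>t\<ge>T. \<rho> t \<notin> D" using concat_paths_eventually[of e D] m unfolding \<rho>_def by blast
  qed
  moreover have "J_bounded J \<phi> Y (\<rho> ` {0..})"
    unfolding J_bounded_def
  proof (intro exI conjI)
    show "compact (\<Union>i\<in>I. L i)" "(\<Union>i\<in>I. L i) \<subseteq> Y" using I L by (blast intro: compact_UN)+
    have "VS (f i) \<subseteq> translates J \<phi> (\<Union>i\<in>I. L i)" for i
    proof -
      have "fst (f i) \<in> carrier J" "snd (f i) \<in> I" using fV(1)[of i] by auto
      then show ?thesis using VS_compact[OF fV(1)[of i]] unfolding translates_def by blast
    qed
    then show "\<rho> ` {0..} \<subseteq> translates J \<phi> (\<Union>i\<in>I. L i)" using imV by blast
  qed
  ultimately show ?thesis using imU by blast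
qed

text \<open>Co-semistability along a bounded ray \<open>\<rho>\<close> moves the loop out of \<open>F\<close>, and out of the set near which classes need not be constant; so the
  moved loop transports. It is conjugate to the given loop by a segment of \<open>\<rho>\<close>, which transports because it stays
  in the collar.\<close>

lemma loop_transports:
  assumes F: "C0 \<subseteq> F" "compact F" "F \<subseteq> Y" 
    and U: "U \<in> components Ah" "\<not> J_bounded J \<phi> Y U" and v: "v \<in> V" "v \<notin> M" "VS v \<subseteq> U" and p: "p \<in> VS v"
    and l: "path_in U lp p p"
  shows "transports F lp p p"
proof -
  obtain \<rho> where \<rho>: "proper_ray Y \<rho>" "\<rho> 0 = p" "\<rho> ` {0..} \<subseteq> (X - D1) \<inter> U" "J_bounded J \<phi> Y (\<rho> ` {0..})"
    using bounded_ray[OF U v p] by blast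
  obtain E where E: "compact E" "E \<subseteq> Y" "\<forall>p\<in>JP - E. reach F p (\<lambda>_. p)" by (rule reach_const_far[OF F])
  have FE: "compact (F \<union> E)" "F \<union> E \<subseteq> Y" using F E by auto
  have "\<rho> ` {0..} \<subseteq> U" using \<rho>(3) by blast
  from co_semi[OF U \<rho>(1) this \<rho>(4)] obtain n H where n: "n \<ge> (0::real)"
    and H: "continuous_on ({0..1} \<times> {0..n}) H" "H ` ({0..1} \<times> {0..n}) \<subseteq> Q"
      "\<forall>t\<in>{0..1::real}. H (t,0) = lp t" "\<forall>s\<in>{0..n}. H (0,s) = \<rho> s \<and> H (1,s) = \<rho> s"
      "\<forall>t\<in>{0..1}. H (t,n) \<in> Y - (F \<union> E)"
    unfolding co_semistable_wrt_ray_def using FE l \<rho>(2) unfolding path_in_def by metis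
  let ?\<sigma> = "piece 0 n \<rho>" and ?\<tau> = "\<lambda>t. H (t,n)"
  have cr: "continuous_on {0..} \<rho>" by (rule proper_rayD(1)[OF \<rho>(1)])
  have \<sigma>: "path_in ((X - D1) \<inter> U) ?\<sigma> p (\<rho> n)"
    using path_in_piece[OF cr convex_real_interval(1), of 0 n "(X - D1) \<inter> U"] \<rho>(2,3) n by simp
  have H0n: "H (0,n) = \<rho> n" "H (1,n) = \<rho> n" using H(4) n by auto
  have ct: "continuous_on {0..1} ?\<tau>"
    by (rule continuous_on_compose2[OF H(1)]) (use n in \<open>auto intro!: continuous_intros\<close>)
  have \<tau>: "path_in (Y - F) ?\<tau> (\<rho> n) (\<rho> n)" by (rule path_inI[OF ct]) (use H(5) H0n in auto)
  have qE: "\<rho> n \<in> JP - E" "\<rho> n \<in> JP - D1"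
  proof -
    have "\<rho> n \<in> X - D1" using \<rho>(3) n by auto
    moreover have "\<rho> n \<notin> E" using H(5) H0n(1) by (metis DiffD2 UnI2 atLeastAtMost_iff zero_le_one order_refl)
    ultimately show "\<rho> n \<in> JP - E" "\<rho> n \<in> JP - D1" using XJP by blast+
  qed
  have pg: "good p" "good (\<rho> n)" using good_far qE(2) VS_JP[OF v(1) _] v(2) M(2) p by blast+
  have t\<sigma>: "transports F ?\<sigma> p (\<rho> n)" by (rule transports_collar_path[OF F \<sigma>])
  have rc: "reach F (\<rho> n) (\<lambda>_. \<rho> n)" using E(3) qE(1) by blast
  have t\<tau>: "transports F ?\<tau> (\<rho> n) (\<rho> n)" by (rule transports_far[OF F pg(2) rc rc \<tau>])
  have tt: "transports F ((?\<sigma> +++ ?\<tau>) +++ reversepath ?\<sigma>) p p"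
    by (rule transports_trans[OF F pg(1,2) transports_trans[OF F pg t\<sigma> t\<tau>] transports_rev[OF F pg t\<sigma>]])
  have \<sigma>Q: "path_in Q ?\<sigma> p (\<rho> n)" and \<tau>Q: "path_in Q ?\<tau> (\<rho> n) (\<rho> n)" 
    using t\<sigma> t\<tau> by (auto simp: transports_def)
  have lQ: "path_in Q lp p p"
  proof (rule path_in_image[OF l])
    show "path_image lp \<subseteq> Q"
    proof (clarsimp simp: path_image_def image_subset_iff)
      fix t :: real assume t: "0 \<le> t" "t \<le> 1"
      then have "(t,0) \<in> {0..1} \<times> {0..n}" using n by simp
      then have "H (t,0) \<in> Q" using H(2) by blast
      then show "lp t \<in> Y \<and> lp t \<notin> C0" using H(3) t by auto
    qed
  qed
  have rect: "homotopic_paths Q (piece 0 1 (\<lambda>t. H (t,0)) +++ piece 0 n (\<lambda>u. H (1,u))) (piece 0 n (\<lambda>u. H (0,u)) +++ piece 0 1 ?\<tau>)"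
    by (rule hom_rectangle[OF H(1,2) _ n]) simp
  have pc: "piece 0 n (\<lambda>u. H (1,u)) t = ?\<sigma> t" "piece 0 n (\<lambda>u. H (0,u)) t = ?\<sigma> t" if "t \<in> {0..1}" for t
  proof -
    have "linepath 0 n t \<in> {0..n}" using that n by (auto simp: linepath_def intro: mult_left_le_one_le)
    then show "piece 0 n (\<lambda>u. H (1,u)) t = ?\<sigma> t" "piece 0 n (\<lambda>u. H (0,u)) t = ?\<sigma> t" using H(4) by (auto simp: piece_def)
  qed
  have l\<sigma>: "path_in Q (lp +++ ?\<sigma>) p (\<rho> n)" by (rule path_in_join[OF lQ \<sigma>Q])
  have \<sigma>\<tau>: "path_in Q (?\<sigma> +++ ?\<tau>) p (\<rho> n)" by (rule path_in_join[OF \<sigma>Q \<tau>Q])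
  have e1: "homotopic_paths Q (lp +++ ?\<sigma>) (piece 0 1 (\<lambda>t. H (t,0)) +++ piece 0 n (\<lambda>u. H (1,u)))"
    by (rule homotopic_paths_eq) (use l\<sigma> H(3) pc(1) in \<open>auto simp: path_in_def joinpaths_def\<close>)
  have e2: "homotopic_paths Q (?\<sigma> +++ ?\<tau>) (piece 0 n (\<lambda>u. H (0,u)) +++ piece 0 1 ?\<tau>)"
    by (rule homotopic_paths_eq) (use \<sigma>\<tau> pc(2) in \<open>auto simp: path_in_def joinpaths_def\<close>)
  have h: "homotopic_paths Q (?\<sigma> +++ ?\<tau>) (lp +++ ?\<sigma>)"
    by (rule hom_trans3[OF e2 homotopic_paths_sym[OF rect] homotopic_paths_sym[OF e1]])
  have "homotopic_paths Q ((?\<sigma> +++ ?\<tau>) +++ reversepath ?\<sigma>) ((lp +++ ?\<sigma>) +++ reversepath ?\<sigma>)"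
    by (rule hom_join_right[OF h \<sigma>\<tau> path_in_rev[OF \<sigma>Q]])
  then have "homotopic_paths Q ((?\<sigma> +++ ?\<tau>) +++ reversepath ?\<sigma>) lp"
    using hom_cancel_right[OF lQ \<sigma>Q] by (rule homotopic_paths_trans)
  then show ?thesis by (rule transports_hom[OF F pg(1) tt])
qed

lemma transports_of_loop:
  assumes F: "C0 \<subseteq> F" "compact F" "F \<subseteq> Y" and g: "good p"
    and \<alpha>: "path_in Q \<alpha> p q" and l: "transports F (\<alpha> +++ reversepath \<kappa>) p p" and k: "transports F \<kappa> p q"
  shows "transports F \<alpha> p q"
proof -
  have "path_in Q \<kappa> p q" using k by (simp add: transports_def)
  then have "homotopic_paths Q ((\<alpha> +++ reversepath \<kappa>) +++ \<kappa>) \<alpha>" by (rule hom_cancel_right'[OF \<alpha>])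
  then show ?thesis by (rule transports_hom[OF F g transports_trans[OF F g g l k]])
qed

text \<open>A path in the nerve either avoids \<open>B\<close> or has a last vertex before it enters \<open>B\<close>.\<close>

lemma gadjB_or_neighbour:
  assumes "gadj\<^sup>*\<^sup>* v w" "v \<notin> B"
  shows "gadjB\<^sup>*\<^sup>* v w \<or> (\<exists>u. gadjB\<^sup>*\<^sup>* v u \<and> (\<exists>b\<in>B. gadj b u))"
  using assms(1)
proof (induction rule: rtranclp_induct)
  case (step y w)
  show ?case
  proof (cases "gadjB\<^sup>*\<^sup>* v y")
    case True
    have y: "y \<notin> B" using True assms(2) by (cases rule: rtranclp.cases) auto
    show ?thesis
    proof (cases "w \<in> B")
      case False
      then have "gadjB y w" using step(2) y by blast
      with True have "gadjB\<^sup>*\<^sup>* v w" by (rule rtranclp.rtrancl_into_rtrancl)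
      then show ?thesis by blast
    next
      case w: True
      then show ?thesis using True gadj_sym[OF step(2)] by blast
    qed
  next
    case False then show ?thesis using step.IH by blast
  qed
qed simp

text \<open>The parts of the collar at \<open>u\<close> and at \<open>u'\<close>, as cut by \<open>B\<close>, are joined by a path in \<open>Ah\<close> that avoids \<open>K\<close>.\<close>

definition linked :: "'g \<times> 'i \<Rightarrow> 'g \<times> 'i \<Rightarrow> 'a set \<Rightarrow> bool" where
  "linked u u' K \<longleftrightarrow> (\<exists>v w p q \<beta>. gadjB\<^sup>*\<^sup>* u v \<and> gadjB\<^sup>*\<^sup>* u' w \<and> p \<in> VS v \<and> q \<in> VS w \<and> path_in (Ah - K) \<beta> p q)"

text \<open>By \<open>loop_transports\<close> a path in \<open>U\<close> transports if some path in \<open>U\<close> with the same end points does. If the ends are not in the same part of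
  the collar, then their parts contain neighbours \<open>u\<close> and \<open>u'\<close> of \<open>B\<close>, so that finitely many pairs of parts matter.
  The path itself shows that the parts are linked off \<open>D\<close>, so by the choice of \<open>D\<close> they are linked off any
  compact set.\<close>

lemma crossing_transports:
  obtains D where "compact D" "D \<subseteq> Y"
    "\<forall>F U v w p q \<beta>. C0 \<subseteq> F \<longrightarrow> compact F \<longrightarrow> F \<subseteq> Y \<longrightarrow> U \<in> components Ah \<longrightarrow> \<not> J_bounded J \<phi> Y U \<longrightarrow>
       v \<in> V - M \<longrightarrow> w \<in> V - M \<longrightarrow> VS v \<subseteq> U \<longrightarrow> VS w \<subseteq> U \<longrightarrow> p \<in> VS v \<longrightarrow> q \<in> VS w \<longrightarrow>
       path_in (U - D) \<beta> p q \<longrightarrow> transports F \<beta> p q"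
proof -
  define NB where "NB = (\<Union>b\<in>B. {u. gadj b u})"
  have fB: "finite B" by (rule finite_subset[OF M(2,1)])
  have fNB: "finite NB" unfolding NB_def using fB gadj_finite by blast
  \<comment> \<open>For neighbours \<open>u\<close>, \<open>u'\<close> of \<open>B\<close> that are linked off some but not all compact sets, a compact
      set off which they are not linked is put into \<open>D\<close>.\<close>
  have "\<exists>K. compact K \<and> K \<subseteq> Y \<and> (linked u u' K \<longrightarrow> (\<forall>K. compact K \<longrightarrow> K \<subseteq> Y \<longrightarrow> linked u u' K))" for u u'
  proof (cases "\<exists>K. compact K \<and> K \<subseteq> Y \<and> \<not> linked u u' K")
    case True then show ?thesis by blast
  next
    case False
    then show ?thesis by (intro exI[of _ "{}"] conjI) auto
  qed
  then obtain blk0 where blk0: "\<And>u u'. compact (blk0 u u') \<and> blk0 u u' \<subseteq> Y \<and>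
      (linked u u' (blk0 u u') \<longrightarrow> (\<forall>K. compact K \<longrightarrow> K \<subseteq> Y \<longrightarrow> linked u u' K))" by metis
  define blk where "blk uu = blk0 (fst uu) (snd uu)" for uu
  have blk: "compact (blk uu) \<and> blk uu \<subseteq> Y" for uu using blk0 by (simp add: blk_def)
  let ?BL = "\<Union>uu\<in>NB \<times> NB. blk uu"
  let ?D = "Cs \<union> ?BL"
  have D: "compact ?D" "?D \<subseteq> Y"
  proof -
    have "compact ?BL" "?BL \<subseteq> Y" using fNB blk by (blast intro: compact_UN finite_cartesian_product)+
    then show "compact ?D" "?D \<subseteq> Y" using Cs by auto
  qed
  have "transports F \<beta> p q" if F: "C0 \<subseteq> F" "compact F" "F \<subseteq> Y" and U: "U \<in> components Ah" "\<not> J_bounded J \<phi> Y U"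
    and v: "v \<in> V - M" and w: "w \<in> V - M" and vU: "VS v \<subseteq> U" and wU: "VS w \<subseteq> U" and p: "p \<in> VS v" and q: "q \<in> VS w"
    and \<beta>: "path_in (U - ?D) \<beta> p q" for F U v w p q \<beta>
  proof -
    have vB: "v \<in> V" "v \<notin> M" "v \<notin> B" and wB: "w \<in> V" "w \<notin> M" "w \<notin> B" using v w M(2) by blast+
    have gp: "good p" using good_far VS_JP[OF vB(1,3)] p by blast
    have gq: "good q" using good_far VS_JP[OF wB(1,3)] q by blast
    have UAh: "U \<subseteq> Ah" by (rule in_components_subset[OF U(1)])
    have UY: "U \<subseteq> Y" using UAh openin_imp_subset[OF Ah] by blast
    have \<beta>Q: "path_in Q \<beta> p q" by (rule path_in_mono[OF \<beta>]) (use UY C0 in blast)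
    have \<beta>U: "path_in U \<beta> p q" by (rule path_in_mono[OF \<beta>]) blast
    note loop = loop_transports[OF F U vB(1,2) vU p]
    show ?thesis
    proof (cases "gadjB\<^sup>*\<^sup>* v w")
      case True
      obtain \<gamma> where \<gamma>: "path_in ((X - D1) \<inter> U) \<gamma> p q" using gadjB_path[OF U(1) True vB(1,3) vU p] q by blast
      have \<gamma>U: "path_in U \<gamma> p q" by (rule path_in_mono[OF \<gamma>]) blast
      show ?thesis
        by (rule transports_of_loop[OF F gp \<beta>Q loop[OF path_in_join[OF \<beta>U path_in_rev[OF \<gamma>U]]] transports_collar_path[OF F \<gamma>]])
    next
      case False
      have c: "gadj\<^sup>*\<^sup>* v w" "gadj\<^sup>*\<^sup>* w v" using gadj_connected[OF U(1)] vB(1) wB(1) vU wU by blast+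
      have F': "\<not> gadjB\<^sup>*\<^sup>* w v" using False gadjB_sym by blast
      obtain u where u: "gadjB\<^sup>*\<^sup>* v u" "u \<in> NB" using gadjB_or_neighbour[OF c(1) vB(3)] False unfolding NB_def by blast
      obtain u' where u': "gadjB\<^sup>*\<^sup>* w u'" "u' \<in> NB" using gadjB_or_neighbour[OF c(2) wB(3)] F' unfolding NB_def by blast
      have uu: "(u,u') \<in> NB \<times> NB" using u u' by blast
      have "path_in (Ah - blk (u,u')) \<beta> p q" by (rule path_in_mono[OF \<beta>]) (use uu UAh in blast)
      then have "linked u u' (blk (u,u'))" unfolding linked_def using gadjB_sym[OF u(1)] gadjB_sym[OF u'(1)] p q by blast
      then have all: "\<forall>K. compact K \<longrightarrow> K \<subseteq> Y \<longrightarrow> linked u u' K" using blk0[of u u'] by (simp add: blk_def)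
      obtain E where E: "compact E" "E \<subseteq> Y" "\<forall>p\<in>JP - E. reach F p (\<lambda>_. p)" by (rule reach_const_far[OF F])
      have FE: "compact (F \<union> E)" "F \<union> E \<subseteq> Y" using F E by auto
      have "linked u u' (F \<union> E)" using all FE by blast
      then obtain v' w' p' q' \<beta>' where l: "gadjB\<^sup>*\<^sup>* u v'" "gadjB\<^sup>*\<^sup>* u' w'" "p' \<in> VS v'" "q' \<in> VS w'" "path_in (Ah - (F \<union> E)) \<beta>' p' q'"
        unfolding linked_def by blast
      have vv: "gadjB\<^sup>*\<^sup>* v v'" "gadjB\<^sup>*\<^sup>* w w'" by (rule rtranclp_trans[OF u(1) l(1)], rule rtranclp_trans[OF u'(1) l(2)])
      note P1 = gadjB_path[OF U(1) vv(1) vB(1,3) vU p] and P2 = gadjB_path[OF U(1) vv(2) wB(1,3) wU q]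
      obtain \<gamma>1 where \<gamma>1: "path_in ((X - D1) \<inter> U) \<gamma>1 p p'" using P1 l(3) by blast
      obtain \<gamma>2 where \<gamma>2: "path_in ((X - D1) \<inter> U) \<gamma>2 q q'" using P2 l(4) by blast
      have p': "p' \<in> JP - D1" "q' \<in> JP - D1" using VS_JP P1 P2 l(3,4) by blast+
      have e: "p' \<notin> E" "q' \<notin> E" using path_in_ends[OF l(5)] by blast+
      have gp': "good p'" "good q'" using good_far p' by blast+
      have r: "reach F p' (\<lambda>_. p')" "reach F q' (\<lambda>_. q')" using E(3) e p' by blast+
      have \<beta>'F: "path_in (Y - F) \<beta>' p' q'" by (rule path_in_mono[OF l(5)]) (use openin_imp_subset[OF Ah] in blast)
      have t\<beta>': "transports F \<beta>' p' q'" by (rule transports_far[OF F gp'(1) r \<beta>'F])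
      have "path_image \<beta>' \<subseteq> U"
      proof (rule connected_in_comp[OF U(1)])
        have "path \<beta>'" "path_image \<beta>' \<subseteq> Ah - (F \<union> E)" "pathstart \<beta>' = p'" using l(5) by (auto simp: path_in_def)
        then show "connected (path_image \<beta>')" "path_image \<beta>' \<subseteq> Ah" "path_image \<beta>' \<inter> U \<noteq> {}"
          using connected_path_image pathstart_in_path_image[of \<beta>'] path_in_ends[OF \<gamma>1] by blast+
      qed
      then have \<beta>'U: "path_in U \<beta>' p' q'" by (rule path_in_image[OF l(5)])
      have \<gamma>U: "path_in U \<gamma>1 p p'" "path_in U \<gamma>2 q q'" using path_in_mono[OF \<gamma>1] path_in_mono[OF \<gamma>2] by blast+
      note t1 = transports_collar_path[OF F \<gamma>1] and t2 = transports_collar_path[OF F \<gamma>2]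
      have \<gamma>2Q: "path_in Q \<gamma>2 q q'" using t2 by (simp add: transports_def)
      \<comment> \<open>The path followed by \<open>\<gamma>2\<close> is compared with the far path \<open>\<beta>'\<close> preceded by \<open>\<gamma>1\<close>.\<close>
      have lpt: "transports F ((\<beta> +++ \<gamma>2) +++ reversepath (\<gamma>1 +++ \<beta>')) p p"
        by (rule loop[OF path_in_join[OF path_in_join[OF \<beta>U \<gamma>U(2)] path_in_rev[OF path_in_join[OF \<gamma>U(1) \<beta>'U]]]])
      have "transports F (\<beta> +++ \<gamma>2) p q'"
        by (rule transports_of_loop[OF F gp path_in_join[OF \<beta>Q \<gamma>2Q] lpt transports_trans[OF F gp gp'(1) t1 t\<beta>']])
      then have "transports F ((\<beta> +++ \<gamma>2) +++ reversepath \<gamma>2) p q"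
        by (rule transports_trans[OF F gp gp'(2) _ transports_rev[OF F gq gp'(2) t2]])
      then show ?thesis by (rule transports_hom[OF F gp _ hom_cancel_right[OF \<beta>Q \<gamma>2Q]])
    qed
  qed
  then show thesis by (intro that[OF D]) blast
qed

text \<open>The path is cut at points of \<open>Oh\<close> into pieces in \<open>Oh\<close>, which are near the orbit, and pieces in \<open>Ah\<close>. The latter lie in single
  components of \<open>Ah\<close>. The tiles in \<open>M\<close> are put into \<open>D\<close>, as the results on unbounded components exclude them.\<close>

lemma transports_outside:
  obtains D where "compact D" "D \<subseteq> Y" "D1 \<subseteq> D" "Cs \<subseteq> D"
    "\<forall>F p q \<gamma>. C0 \<subseteq> F \<longrightarrow> compact F \<longrightarrow> F \<subseteq> Y \<longrightarrow> p \<in> Oh \<longrightarrow> q \<in> Oh \<longrightarrow> path_in (Y - D) \<gamma> p q \<longrightarrow> transports F \<gamma> p q"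
proof -
  obtain Dc where Dc: "compact Dc" "Dc \<subseteq> Y"
    "\<forall>F U v w p q \<beta>. C0 \<subseteq> F \<longrightarrow> compact F \<longrightarrow> F \<subseteq> Y \<longrightarrow> U \<in> components Ah \<longrightarrow> \<not> J_bounded J \<phi> Y U \<longrightarrow>
       v \<in> V - M \<longrightarrow> w \<in> V - M \<longrightarrow> VS v \<subseteq> U \<longrightarrow> VS w \<subseteq> U \<longrightarrow> p \<in> VS v \<longrightarrow> q \<in> VS w \<longrightarrow>
       path_in (U - Dc) \<beta> p q \<longrightarrow> transports F \<beta> p q" by (rule crossing_transports)
  let ?DM = "\<Union>v\<in>M \<inter> V. \<phi> (fst v) ` L (snd v)"
  let ?D = "D1 \<union> Cs \<union> Dc \<union> ?DM"
  have "compact ?DM" "?DM \<subseteq> Y" using M(1) VS_compact by (blast intro: compact_UN)+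
  then have D: "compact ?D" "?D \<subseteq> Y" using D1 Cs Dc by auto
  have "transports F \<gamma> p q" if F: "C0 \<subseteq> F" "compact F" "F \<subseteq> Y" and p: "p \<in> Oh" and q: "q \<in> Oh" and \<gamma>: "path_in (Y - ?D) \<gamma> p q" for F p q \<gamma>
  proof -
    note c = path_cont[OF \<gamma>]
    have D1D: "Y - ?D \<subseteq> Y - D1" by blast
    have goodO: "good x" if "x \<in> Oh" "x \<in> Y - ?D" for x using good_far Oh(3) that by blast
    have piece_path: "path_in (A \<inter> (Y - ?D)) (piece s t \<gamma>) (\<gamma> s) (\<gamma> t)" if "0 \<le> s" "s \<le> t" "t \<le> 1" "\<gamma> ` {s..t} \<subseteq> A" for s t A
    proof (rule path_in_piece[of "{s..t}"])
      have sub: "{s..t} \<subseteq> {0..1}" using that by auto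
      show "continuous_on {s..t} \<gamma>" by (rule continuous_on_subset[OF c(1) sub])
      show "\<gamma> ` {s..t} \<subseteq> A \<inter> (Y - ?D)" using that(4) c(2) sub by blast
    qed (use that in auto)
    have "transports F (piece 0 1 \<gamma>) (\<gamma> 0) (\<gamma> 1)"
    proof (rule two_cover_chain[OF c(1) _ Oh(1) Ah])
      show "\<gamma> ` {0..1} \<subseteq> Y" using c(2) by blast
      show "Y \<subseteq> Oh \<union> Ah" using cover by blast
      show "\<gamma> 0 \<in> Oh" "\<gamma> 1 \<in> Oh" using c(3,4) p q by auto
    next
      fix s t u :: real assume le: "0 \<le> s" "s \<le> t" "t \<le> u" "u \<le> 1" and O: "\<gamma> s \<in> Oh" "\<gamma> t \<in> Oh" "\<gamma> u \<in> Oh"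
        and h: "transports F (piece s t \<gamma>) (\<gamma> s) (\<gamma> t)" "transports F (piece t u \<gamma>) (\<gamma> t) (\<gamma> u)"
      have "s \<in> {0..1}" "t \<in> {0..1}" using le by auto
      then have mem: "\<gamma> s \<in> Y - ?D" "\<gamma> t \<in> Y - ?D" using c(2) by blast+
      have g: "good (\<gamma> s)" "good (\<gamma> t)" by (rule goodO[OF O(1) mem(1)], rule goodO[OF O(2) mem(2)])
      have "transports F (piece s t \<gamma> +++ piece t u \<gamma>) (\<gamma> s) (\<gamma> u)" by (rule transports_trans[OF F g h])
      moreover have "homotopic_paths Q (piece s t \<gamma> +++ piece t u \<gamma>) (piece s u \<gamma>)"
        by (rule hom_piece_join[OF c(1)]) (use le c(2) C0 in auto)
      ultimately show "transports F (piece s u \<gamma>) (\<gamma> s) (\<gamma> u)" by (rule transports_hom[OF F g(1)])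
    next
      fix s t :: real assume le: "0 \<le> s" "s \<le> t" "t \<le> 1" and O: "\<gamma> ` {s..t} \<subseteq> Oh"
      have "path_in (JP - D1) (piece s t \<gamma>) (\<gamma> s) (\<gamma> t)"
        by (rule path_in_mono[OF piece_path[OF le O]]) (use Oh(3) in blast)
      then show "transports F (piece s t \<gamma>) (\<gamma> s) (\<gamma> t)" using near F by blast
    next
      fix s t :: real assume le: "0 \<le> s" "s \<le> t" "t \<le> 1" and A: "\<gamma> ` {s..t} \<subseteq> Ah" and O: "\<gamma> s \<in> Oh" "\<gamma> t \<in> Oh"
      have st: "\<gamma> s \<in> Ah" "\<gamma> t \<in> Ah" using A le by auto
      obtain U where U: "U \<in> components Ah" "\<gamma> s \<in> U" using comp_of[OF st(1)] by blast
      have "\<gamma> ` {s..t} \<subseteq> U"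
      proof (rule connected_in_comp[OF U(1) _ A])
        show "connected (\<gamma> ` {s..t})"
          by (rule connected_continuous_image[OF continuous_on_subset[OF c(1)]]) (use le in auto)
        have "s \<in> {s..t}" using le by simp
        then show "\<gamma> ` {s..t} \<inter> U \<noteq> {}" using U(2) by blast
      qed
      note pU = piece_path[OF le this]
      show "transports F (piece s t \<gamma>) (\<gamma> s) (\<gamma> t)"
      proof (cases "J_bounded J \<phi> Y U")
        case True
        have "path_in (JP - D1) (piece s t \<gamma>) (\<gamma> s) (\<gamma> t)"
          by (rule path_in_mono[OF pU]) (use bounded_comp[OF U(1) True] in blast)
        then show ?thesis using near F by blast
      next
        case False
        have "\<gamma> s \<in> X" "\<gamma> t \<in> X" using O st by (auto simp: X_def)
        then obtain v w where vw: "v \<in> V" "\<gamma> s \<in> VS v" "w \<in> V" "\<gamma> t \<in> VS w" unfolding X_eq by blast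
        have e: "\<gamma> s \<in> U" "\<gamma> s \<notin> ?D" "\<gamma> t \<in> U" "\<gamma> t \<notin> ?D" using path_in_ends[OF pU] by blast+
        have vM: "v \<in> V - M" "w \<in> V - M" using e(2,4) vw VS_compact[OF vw(1)] VS_compact[OF vw(3)] by blast+
        have vU: "VS v \<subseteq> U" "VS w \<subseteq> U" using VS_in_comp[OF U(1) vw(1)] VS_in_comp[OF U(1) vw(3)] vw e by blast+
        have "path_in (U - Dc) (piece s t \<gamma>) (\<gamma> s) (\<gamma> t)" by (rule path_in_mono[OF pU]) blast
        then show ?thesis using Dc(3) F U(1) False vM vU vw by blast
      qed
    qed
    then show ?thesis by (simp add: c(3,4))
  qed
  then show thesis by (intro that[OF D]) blast+
qed

end

section \<open>Pushing a path along two rays\<close>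

text \<open>The homotopy at the end bounds a square with the sides \<open>\<alpha>\<close>, \<open>\<delta>\<close> and segments of the two rays.\<close>

definition pushes :: "'a::t2_space set \<Rightarrow> 'a set \<Rightarrow> 'a set \<Rightarrow> bool" where
  "pushes Y C D \<longleftrightarrow> (\<forall>r s \<alpha> F T. proper_ray Y r \<longrightarrow> proper_ray Y s \<longrightarrow> r ` {0..} \<subseteq> Y - D \<longrightarrow> s ` {0..} \<subseteq> Y - D \<longrightarrow>
     path_in (Y - D) \<alpha> (r 0) (s 0) \<longrightarrow> compact F \<longrightarrow> F \<subseteq> Y \<longrightarrow>
     (\<exists>n\<ge>T. n \<ge> 0 \<and> (\<exists>\<delta>. path_in (Y - F) \<delta> (r n) (s n) \<and>
        homotopic_paths (Y - C) (\<alpha> +++ piece 0 n s) (piece 0 n r +++ \<delta>))))"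

context far_collar
begin

text \<open>Far out, both rays are joined to an orbit point \<open>p\<close> whose class is constant, by paths outside \<open>F\<close> and \<open>D\<close>; this uses that there is one end. The loop at \<open>p\<close>
  that runs back along the first ray, through \<open>\<alpha>\<close>, and out along the second ray avoids \<open>D\<close>, so it transports. It is therefore
  homotopic to a loop \<open>\<delta>0\<close> outside \<open>F\<close>.\<close>

lemma far_collar_pushes: obtains D where "compact D" "D \<subseteq> Y" "pushes Y C0 D"
proof -
  obtain D where D: "compact D" "D \<subseteq> Y" "D1 \<subseteq> D" "Cs \<subseteq> D" and
    main: "\<forall>F p q \<gamma>. C0 \<subseteq> F \<longrightarrow> compact F \<longrightarrow> F \<subseteq> Y \<longrightarrow> p \<in> Oh \<longrightarrow> q \<in> Oh \<longrightarrow> path_in (Y - D) \<gamma> p q \<longrightarrow> transports F \<gamma> p q"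
    by (rule transports_outside)
  have DQ: "Y - D \<subseteq> Q" using C0 D(4) by blast
  have "\<exists>n\<ge>T. n \<ge> 0 \<and> (\<exists>\<delta>. path_in (Y - F0) \<delta> (r n) (s n) \<and>
        homotopic_paths Q (\<alpha> +++ piece 0 n s) (piece 0 n r +++ \<delta>))"
    if rs: "proper_ray Y r" "proper_ray Y s" "r ` {0..} \<subseteq> Y - D" "s ` {0..} \<subseteq> Y - D"
      and \<alpha>: "path_in (Y - D) \<alpha> (r 0) (s 0)" and F0: "compact F0" "F0 \<subseteq> Y" for r s \<alpha> F0 T
  proof -
    define F where "F = F0 \<union> Cs"
    have F: "C0 \<subseteq> F" "compact F" "F \<subseteq> Y" using F0 C0 Cs by (auto simp: F_def)
    obtain E where E: "compact E" "E \<subseteq> Y" "\<forall>p\<in>JP - E. reach F p (\<lambda>_. p)" by (rule reach_const_far[OF F])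
    let ?K = "D \<union> F \<union> E"
    have K: "compact ?K" "?K \<subseteq> Y" using D F E by auto
    obtain W' K' where W': "W' \<in> components (Y - ?K)" "compact K'" "K' \<subseteq> Y" "?K \<subseteq> K'" "Y - K' \<subseteq> W'"
      by (rule outside_one_component[OF one K])
    have pW: "path_connected W'" by (rule component_open(2)[OF closed_compl_open[OF K(1)] W'(1)])
    have WK: "W' \<subseteq> Y - ?K" by (rule in_components_subset[OF W'(1)])
    have "finite {g \<in> carrier J. \<phi> g ` {base} \<inter> K' \<noteq> {}}" using base W' by (intro meets_finite) auto
    then have "\<not> carrier J \<subseteq> {g \<in> carrier J. \<phi> g ` {base} \<inter> K' \<noteq> {}}" using infinite_group finite_subset by blast
    then obtain g where g: "g \<in> carrier J" "vtx g \<notin> K'" by auto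
    let ?p = "vtx g"
    have pY: "?p \<in> Y" by (rule act_in[OF g(1) base])
    have pK: "?p \<in> W'" using g(2) W'(5) pY by blast
    have pO: "?p \<in> Oh" by (rule Oh(4)[OF g(1)])
    have pE: "?p \<in> JP - E" "?p \<in> JP - D1" using Oh(3) pO g(2) W'(4) D(3) by blast+
    have gp: "good ?p" using good_far pE(2) by blast
    have rc: "reach F ?p (\<lambda>_. ?p)" using E(3) pE(1) by blast
    obtain Tr where Tr: "Tr \<ge> 0" "\<forall>t\<ge>Tr. r t \<in> Y - K'" using proper_rayD(3)[OF rs(1) W'(2,3)] by blast
    obtain Ts where Ts: "Ts \<ge> 0" "\<forall>t\<ge>Ts. s t \<in> Y - K'" using proper_rayD(3)[OF rs(2) W'(2,3)] by blast
    define n where "n = max T (max Tr Ts)"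
    have n: "n \<ge> T" "n \<ge> 0" "n \<ge> Tr" "n \<ge> Ts" using Tr(1) by (auto simp: n_def)
    have "r n \<in> W'" "s n \<in> W'" using Tr(2) Ts(2) n W'(5) by blast+
    then obtain \<epsilon> \<epsilon>' where \<epsilon>: "path_in W' \<epsilon> (r n) ?p" "path_in W' \<epsilon>' (s n) ?p"
      using path_connected_path_in[OF pW _ pK] by meson
    let ?R = "piece 0 n r" and ?S = "piece 0 n s"
    have R: "path_in (Y - D) ?R (r 0) (r n)"
      by (rule path_in_piece[OF proper_rayD(1)[OF rs(1)]]) (use n rs(3) in auto)
    have S: "path_in (Y - D) ?S (s 0) (s n)"
      by (rule path_in_piece[OF proper_rayD(1)[OF rs(2)]]) (use n rs(4) in auto)
    have WD: "W' \<subseteq> Y - D" using WK by blast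
    note \<epsilon>D = path_in_mono[OF \<epsilon>(1) WD] path_in_mono[OF \<epsilon>(2) WD]
    have WF: "W' \<subseteq> Y - F" using WK by blast
    note \<epsilon>F = path_in_mono[OF \<epsilon>(1) WF] path_in_mono[OF \<epsilon>(2) WF]
    let ?X = "?R +++ \<epsilon>" and ?Z = "\<alpha> +++ ?S"
    have X: "path_in (Y - D) ?X (r 0) ?p" by (rule path_in_join[OF R \<epsilon>D(1)])
    have Z: "path_in (Y - D) ?Z (r 0) (s n)" by (rule path_in_join[OF \<alpha> S])
    have Z': "path_in (Y - D) (?Z +++ \<epsilon>') (r 0) ?p" by (rule path_in_join[OF Z \<epsilon>D(2)])
    let ?l = "reversepath ?X +++ (?Z +++ \<epsilon>')"
    have l: "path_in (Y - D) ?l ?p ?p" by (rule path_in_join[OF path_in_rev[OF X] Z'])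
    have "transports F ?l ?p ?p" using main F pO l by blast
    then have "reach F ?p (?l +++ (\<lambda>_. ?p))" by (rule transports_all[OF F gp gp _ rc])
    then have "eqv F (\<lambda>_. ?p) (?l +++ (\<lambda>_. ?p))" by (rule reach_unique[OF F gp rc])
    then obtain \<delta>0 where \<delta>0: "path_in (Y - F) \<delta>0 ?p ?p" "homotopic_paths Q ((\<lambda>_. ?p) +++ \<delta>0) (?l +++ (\<lambda>_. ?p))"
      unfolding eqv_def by (auto simp: pathfinish_def joinpaths_def)
    note lQ = path_in_mono[OF l DQ] and XQ = path_in_mono[OF X DQ] and ZQ = path_in_mono[OF Z DQ] and Z'Q = path_in_mono[OF Z' DQ]
      and RQ = path_in_mono[OF R DQ] and \<epsilon>Q = path_in_mono[OF \<epsilon>D(1) DQ] path_in_mono[OF \<epsilon>D(2) DQ] and \<delta>0Q = FQ[OF F(1) \<delta>0(1)]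
    have h0: "homotopic_paths Q \<delta>0 ?l"
      by (rule hom_trans3[OF homotopic_paths_sym[OF hom_lid[OF \<delta>0Q]] \<delta>0(2) hom_rid[OF lQ]])
    have h1: "homotopic_paths Q (?X +++ \<delta>0) (?Z +++ \<epsilon>')"
      by (rule homotopic_paths_trans[OF hom_join_left[OF h0 XQ \<delta>0Q] hom_cancel_left'[OF XQ Z'Q]])
    have X\<delta>: "path_in Q (?X +++ \<delta>0) (r 0) ?p" by (rule path_in_join[OF XQ \<delta>0Q])
    have h2: "homotopic_paths Q ((?X +++ \<delta>0) +++ reversepath \<epsilon>') ?Z"
      by (rule homotopic_paths_trans[OF hom_join_right[OF h1 X\<delta> path_in_rev[OF \<epsilon>Q(2)]] hom_cancel_right[OF ZQ \<epsilon>Q(2)]])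
    have e\<delta>: "path_in Q (\<epsilon> +++ \<delta>0) (r n) ?p" by (rule path_in_join[OF \<epsilon>Q(1) \<delta>0Q])
    have h3: "homotopic_paths Q ((?X +++ \<delta>0) +++ reversepath \<epsilon>') ((?R +++ (\<epsilon> +++ \<delta>0)) +++ reversepath \<epsilon>')"
      by (rule hom_join_right[OF hom_assoc'[OF RQ \<epsilon>Q(1) \<delta>0Q] X\<delta> path_in_rev[OF \<epsilon>Q(2)]])
    have h4: "homotopic_paths Q ((?R +++ (\<epsilon> +++ \<delta>0)) +++ reversepath \<epsilon>') (?R +++ ((\<epsilon> +++ \<delta>0) +++ reversepath \<epsilon>'))"
      by (rule hom_assoc'[OF RQ e\<delta> path_in_rev[OF \<epsilon>Q(2)]])
    have h: "homotopic_paths Q ?Z (?R +++ ((\<epsilon> +++ \<delta>0) +++ reversepath \<epsilon>'))"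
      by (rule hom_trans3[OF homotopic_paths_sym[OF h2] h3 h4])
    have "path_in (Y - F) ((\<epsilon> +++ \<delta>0) +++ reversepath \<epsilon>') (r n) (s n)"
      by (rule path_in_join[OF path_in_join[OF \<epsilon>F(1) \<delta>0(1)] path_in_rev[OF \<epsilon>F(2)]])
    then have "path_in (Y - F0) ((\<epsilon> +++ \<delta>0) +++ reversepath \<epsilon>') (r n) (s n)"
      by (rule path_in_mono) (auto simp: F_def)
    then show ?thesis using h n by blast
  qed
  then show thesis by (intro that[OF D(1,2)]) (simp add: pushes_def)
qed

end

lemma (in collar) collar_pushes: obtains D where "compact D" "D \<subseteq> Y" "pushes Y C0 D"
proof -
  obtain D1 where D1: "compact D1" "D1 \<subseteq> Y" "\<forall>p\<in>JP - D1. good p"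
    "\<forall>F \<gamma> p q. C0 \<subseteq> F \<longrightarrow> compact F \<longrightarrow> F \<subseteq> Y \<longrightarrow> path_in (JP - D1) \<gamma> p q \<longrightarrow> transports F \<gamma> p q"
    by (rule transports_near_orbit)
  define B where "B = {v \<in> V. VS v \<inter> D1 \<noteq> {}}"
  have fB: "finite B" unfolding B_def by (rule VS_meets_finite[OF D1(1,2)])
  obtain M where M: "finite M" "B \<subseteq> M"
      "\<forall>v. infinite {w. gadj\<^sup>*\<^sup>* v w} \<longrightarrow> v \<notin> M \<longrightarrow> infinite {w. (\<lambda>x y. gadj x y \<and> x \<notin> B \<and> y \<notin> B)\<^sup>*\<^sup>* v w}"
    by (rule rays_off_finite_set[of gadj B, OF gadj_sym gadj_finite fB])
  interpret far_collar Y J \<phi> base S z C0 Cs P LP I W L Oh Ah D1 B M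
    by unfold_locales (use D1 M B_def in blast)+
  show thesis by (rule far_collar_pushes[OF that])
qed

section \<open>Construction of the collar\<close>

context cayley_action
begin

lemma cpath_in_cells: "cpath g p h \<Longrightarrow> path_image p \<subseteq> translates J \<phi> (insert base cell)"
proof (induction rule: cpath.induct)
  case (nil g) then show ?case by (auto simp: path_image_def translates_def)
next
  case (cons e p h)
  have "fst e \<in> carrier J" using cons(1) by auto
  then have "path_image (edge_im e) \<subseteq> translates J \<phi> (insert base cell)"
    using edge_cell[OF cons(1)] unfolding translates_def by blast
  then show ?case using cons.IH path_image_join_subset by blast
qed

text \<open>Each point is joined to the orbit of the base point in its translate, and orbit points are joined by images of edge paths.\<close>

lemma translates_path_connected:
  assumes A: "A \<subseteq> Y" "path_connected A" "insert base cell \<subseteq> A"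
  shows "path_connected (translates J \<phi> A)"
proof (rule path_connected_of_paths)
  fix x y assume "x \<in> translates J \<phi> A" "y \<in> translates J \<phi> A"
  then obtain g h where gh: "g \<in> carrier J" "x \<in> \<phi> g ` A" "h \<in> carrier J" "y \<in> \<phi> h ` A" by (auto simp: translates_def)
  have sub: "\<phi> k ` A \<subseteq> translates J \<phi> A" if "k \<in> carrier J" for k using that by (auto simp: translates_def)
  have v: "vtx k \<in> \<phi> k ` A" for k using A(3) by blast
  obtain p1 where p1: "path_in (\<phi> g ` A) p1 x (vtx g)"
    using path_connected_path_in[OF act_path_connected[OF gh(1) A(1,2)] gh(2) v] by blast
  obtain p2 where p2: "path_in (\<phi> h ` A) p2 (vtx h) y"
    using path_connected_path_in[OF act_path_connected[OF gh(3) A(1,2)] v gh(4)] by blast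
  obtain p where p: "cpath g p h" using cpath_exists[OF gh(1,3)] by blast
  have "path_in (translates J \<phi> A) p (vtx g) (vtx h)"
    by (rule path_in_image) (use cpath_path[OF p] cpath_in_cells[OF p] translates_mono[OF A(3)] in blast)+
  then have "path_in (translates J \<phi> A) (p1 +++ (p +++ p2)) x y"
    by (rule path_in_join[OF path_in_mono[OF p1 sub[OF gh(1)]] path_in_join[OF _ path_in_mono[OF p2 sub[OF gh(3)]]]])
  then show "\<exists>p. path_in (translates J \<phi> A) p x y" by blast
qed

lemma translates_disjoint:
  assumes "A \<subseteq> Y" "C \<subseteq> Y" "A \<inter> translates J \<phi> C = {}" "g \<in> carrier J"
  shows "\<phi> g ` A \<inter> translates J \<phi> C = {}"
proof (rule ccontr)
  assume "\<phi> g ` A \<inter> translates J \<phi> C \<noteq> {}"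
  then obtain a where a: "a \<in> A" "\<phi> g a \<in> translates J \<phi> C" by blast
  have "\<phi> (inv g) (\<phi> g a) \<in> translates J \<phi> C" by (rule translates_invariant[OF _ assms(2) a(2)]) (use assms(4) in simp)
  moreover have "\<phi> (inv g) (\<phi> g a) = a" by (rule act_inv[OF assms(4)]) (use a(1) assms(1) in blast)
  ultimately show False using a(1) assms(3) by auto
qed

text \<open>\<open>Ob\<close> is the orbit of a connected neighbourhood \<open>O1\<close> of \<open>Cc\<close> with compact closure. Modulo \<open>J\<close>, the frontier of \<open>Ob\<close> is covered by
  the compact set \<open>Zf\<close>, hence by finitely many small connected sets \<open>W i\<close> off the orbit of \<open>Cc\<close>. The collar is the orbit of their union.
  Components of \<open>Ah\<close> are contained in components of the complement of the orbit of \<open>Cc\<close>, and co-semistability is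
  inherited. Up to translation, finitely many components of \<open>Ah\<close> occur, since each contains a tile; so a
  single compact set has an orbit that contains all the bounded ones.\<close>

lemma co_semistable_pushes:
  assumes one: "one_ended Y" and Cc: "compact Cc" "Cc \<subseteq> Y"
    and co: "\<And>U r. U \<in> components (Y - translates J \<phi> Cc) \<Longrightarrow> \<not> J_bounded J \<phi> Y U \<Longrightarrow> proper_ray Y r \<Longrightarrow>
        r ` {0..} \<subseteq> U \<Longrightarrow> J_bounded J \<phi> Y (r ` {0..}) \<Longrightarrow> co_semistable_wrt_ray Y U r C0"
  obtains D where "compact D" "D \<subseteq> Y" "pushes Y C0 D"
proof -
  let ?TC = "translates J \<phi> Cc"
  have "compact (Cc \<union> cell)" "Cc \<union> cell \<subseteq> Y" using Cc cell by auto
  then obtain O1 L1 where O1: "openin (top_of_set Y) O1" "path_connected O1" "Cc \<union> cell \<subseteq> O1" "base \<in> O1" "O1 \<subseteq> L1" "compact L1" "L1 \<subseteq> Y"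
    using connected_nbhd[OF _ _ base] by metis
  define Ob where "Ob = translates J \<phi> O1"
  have O1Y: "O1 \<subseteq> Y" using O1 by blast
  have Obo: "openin (top_of_set Y) Ob" unfolding Ob_def by (rule translates_open[OF O1(1)])
  have Obc: "path_connected Ob" unfolding Ob_def by (rule translates_path_connected[OF O1Y O1(2)]) (use O1(3,4) in blast)
  have ObY: "Ob \<subseteq> Y" by (rule openin_imp_subset[OF Obo])
  define K1 where "K1 = closure O1"
  have K1: "compact K1" "K1 \<subseteq> Y" "O1 \<subseteq> K1"
  proof -
    have "K1 \<subseteq> L1" unfolding K1_def using O1(5) compact_imp_closed[OF O1(6)] by (rule closure_minimal)
    moreover from this have "K1 = L1 \<inter> closure O1" unfolding K1_def by blast
    ultimately show "compact K1" "K1 \<subseteq> Y" using O1(6,7) compact_Int_closed[OF O1(6) closed_closure] by auto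
    show "O1 \<subseteq> K1" unfolding K1_def by (rule closure_subset)
  qed
  define Zf where "Zf = K1 - Ob"
  have Zf: "compact Zf" "Zf \<subseteq> Y"
  proof -
    obtain T where T: "open T" "Ob = Y \<inter> T" using Obo unfolding openin_open by blast
    have "Zf = K1 - T" using T K1(2) unfolding Zf_def by blast
    then show "compact Zf" using compact_diff[OF K1(1) T(1)] by simp
    show "Zf \<subseteq> Y" using K1 by (auto simp: Zf_def)
  qed
  have TCo: "openin (top_of_set Y) (Y - ?TC)" using translates_closed[OF Cc] by (simp add: closedin_def)
  have TCO: "?TC \<subseteq> Ob" unfolding Ob_def by (rule translates_mono) (use O1(3) in blast)
  have "\<exists>V L. openin (top_of_set Y) V \<and> path_connected V \<and> y \<in> V \<and> V \<subseteq> Y - ?TC \<and> V \<subseteq> L \<and> compact L \<and> L \<subseteq> Y" if y: "y \<in> Zf" for y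
  proof -
    have "y \<in> Y - ?TC" using y TCO Zf(2) unfolding Zf_def by blast
    from small_nbhd[OF TCo this] show ?thesis by metis
  qed
  then obtain W L where WL: "\<And>y. y \<in> Zf \<Longrightarrow> openin (top_of_set Y) (W y) \<and> path_connected (W y) \<and> y \<in> W y \<and> W y \<subseteq> Y - ?TC \<and> W y \<subseteq> L y \<and> compact (L y) \<and> L y \<subseteq> Y"
    by metis
  have Wo: "openin (top_of_set Y) (W y) \<and> y \<in> W y" if "y \<in> Zf" for y using WL[OF that] by blast
  obtain I where I: "finite I" "I \<subseteq> Zf" "Zf \<subseteq> (\<Union>y\<in>I. W y)"
    by (rule finite_open_cover[OF Zf Wo])
  have WI: "openin (top_of_set Y) (W i)" "path_connected (W i)" "W i \<noteq> {}" "W i \<subseteq> Y" "W i \<inter> ?TC = {}" "W i \<subseteq> L i" "compact (L i)" "L i \<subseteq> Y" if "i \<in> I" for i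
    using WL[of i] I(2) that by blast+
  have meetO: "W i \<inter> O1 \<noteq> {}" if i: "i \<in> I" for i
  proof -
    have "i \<in> W i" "i \<in> K1" using WL[of i] I(2) i by (auto simp: Zf_def)
    moreover obtain T where T: "open T" "W i = Y \<inter> T" using WI(1)[OF i] unfolding openin_open by blast
    ultimately have "T \<inter> O1 \<noteq> {}" using open_Int_closure_eq_empty[OF T(1), of O1] unfolding K1_def by blast
    then show ?thesis using T O1Y by blast
  qed
  define XX where "XX = (\<Union>g\<in>carrier J. \<Union>i\<in>I. \<phi> g ` W i)"
  have XXo: "openin (top_of_set Y) XX" unfolding XX_def by (intro openin_Union) (auto intro!: act_open WI(1))
  have XXinv: "\<phi> g x \<in> XX" if g: "g \<in> carrier J" and x: "x \<in> XX" for g x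
  proof -
    obtain h i w where h: "h \<in> carrier J" "i \<in> I" "w \<in> W i" "x = \<phi> h w" using x unfolding XX_def by blast
    have "\<phi> g x = \<phi> (g \<otimes> h) w" using act_comp[OF g h(1), of w] WI(4)[OF h(2)] h(3,4) by auto
    then show ?thesis unfolding XX_def using h g by (intro UN_I[of "g \<otimes> h"] UN_I[of i]) auto
  qed
  have XXC: "XX \<inter> ?TC = {}" unfolding XX_def using translates_disjoint[OF WI(4) Cc(2) WI(5)] by blast
  define Oh where "Oh = Ob \<union> XX"
  define Ah where "Ah = (Y - translates J \<phi> K1) \<union> XX"
  have K1o: "openin (top_of_set Y) (Y - translates J \<phi> K1)" using translates_closed[OF K1(1,2)] by (simp add: closedin_def)
  have Oho: "openin (top_of_set Y) Oh" unfolding Oh_def by (rule openin_Un[OF Obo XXo])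
  have Aho: "openin (top_of_set Y) Ah" unfolding Ah_def by (rule openin_Un[OF K1o XXo])
  have ObK: "Ob \<subseteq> translates J \<phi> K1" unfolding Ob_def by (rule translates_mono[OF K1(3)])
  have bO: "vtx g \<in> Ob" if "g \<in> carrier J" for g using that O1(4) by (auto simp: Ob_def translates_def)
  have cover: "Oh \<union> Ah = Y"
  proof
    show "Oh \<union> Ah \<subseteq> Y" using openin_imp_subset[OF Oho] openin_imp_subset[OF Aho] by blast
    show "Y \<subseteq> Oh \<union> Ah"
    proof
      fix y assume y: "y \<in> Y"
      show "y \<in> Oh \<union> Ah"
      proof (cases "y \<in> translates J \<phi> K1")
        case True
        then obtain g k where g: "g \<in> carrier J" "k \<in> K1" "y = \<phi> g k" by (auto simp: translates_def)
        show ?thesis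
        proof (cases "k \<in> Ob")
          case True
          then have "\<phi> g k \<in> Ob" unfolding Ob_def by (rule translates_invariant[OF g(1) O1Y])
          then show ?thesis using g by (simp add: Oh_def)
        next
          case False
          then obtain i where "i \<in> I" "k \<in> W i" using g(2) I(3) unfolding Zf_def by blast
          then have "y \<in> XX" using g unfolding XX_def by blast
          then show ?thesis by (simp add: Oh_def)
        qed
      qed (use y in \<open>simp add: Ah_def\<close>)
    qed
  qed
  have inter: "Oh \<inter> Ah = XX" unfolding Oh_def Ah_def using ObK by blast
  have Ohc: "path_connected Oh"
  proof (rule open_connected_path_connected[OF Oho])
    let ?\<C> = "insert Ob ((\<lambda>(g,i). Ob \<union> \<phi> g ` W i) ` (carrier J \<times> I))"
    have cO: "connected Ob" by (rule path_connected_imp_connected[OF Obc])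
    have "Oh = \<Union>?\<C>" unfolding Oh_def XX_def by force
    moreover have "connected (\<Union>?\<C>)"
    proof (rule connected_Union)
      fix C assume "C \<in> ?\<C>"
      then consider "C = Ob" | g i where "C = Ob \<union> \<phi> g ` W i" "g \<in> carrier J" "i \<in> I" by auto
      then show "connected C"
      proof cases
        case 1 then show ?thesis using cO by simp
      next
        case 2
        have "\<phi> g ` W i \<inter> Ob \<noteq> {}" using meetO[OF 2(3)] 2(2) unfolding Ob_def translates_def by blast
        then show ?thesis unfolding 2(1)
          using cO path_connected_imp_connected[OF act_path_connected[OF 2(2) WI(4,2)[OF 2(3)]]] by (intro connected_Un) blast+
      qed
    next
      show "\<Inter>?\<C> \<noteq> {}" using bO[OF J.one_closed] by auto
    qed
    ultimately show "connected Oh" by simp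
  qed
  have Ahinv: "\<phi> g x \<in> Ah" if g: "g \<in> carrier J" and x: "x \<in> Ah" for g x
  proof (cases "x \<in> XX")
    case True then show ?thesis using XXinv[OF g] by (simp add: Ah_def)
  next
    case False
    then have x: "x \<in> Y" "x \<notin> translates J \<phi> K1" using x by (auto simp: Ah_def)
    have "\<phi> g ` {x} \<inter> translates J \<phi> K1 = {}" by (rule translates_disjoint[OF _ K1(2) _ g]) (use x in auto)
    then show ?thesis using act_in[OF g x(1)] by (auto simp: Ah_def)
  qed
  have AhC: "Ah \<subseteq> Y - ?TC"
  proof -
    have "?TC \<subseteq> translates J \<phi> K1" using TCO ObK by blast
    then show ?thesis using XXC openin_imp_subset[OF XXo] unfolding Ah_def by blast
  qed
  have WA: "\<phi> g ` W i \<subseteq> Ah" if "g \<in> carrier J" "i \<in> I" for g i using that unfolding Ah_def XX_def by blast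
  have WA1: "W i \<subseteq> Ah" if "i \<in> I" for i using WA[OF J.one_closed that] act_image_one[OF WI(4)[OF that]] by simp
  have "\<exists>U. U \<in> components Ah \<and> W i \<subseteq> U" if i: "i \<in> I" for i
  proof -
    obtain w where w: "w \<in> W i" using WI(3)[OF i] by blast
    then have "w \<in> \<Union>(components Ah)" using WA1[OF i] by auto
    then obtain U where U: "U \<in> components Ah" "w \<in> U" by blast
    have "W i \<subseteq> U" by (rule components_maximal[OF U(1) path_connected_imp_connected[OF WI(2)[OF i]] WA1[OF i]]) (use w U(2) in blast)
    then show ?thesis using U(1) by blast
  qed
  then obtain Uf where Uf: "\<And>i. i \<in> I \<Longrightarrow> Uf i \<in> components Ah \<and> W i \<subseteq> Uf i" by metis
  have "\<exists>F. compact F \<and> F \<subseteq> Y \<and> (J_bounded J \<phi> Y (Uf i) \<longrightarrow> Uf i \<subseteq> translates J \<phi> F)" for i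
  proof (cases "J_bounded J \<phi> Y (Uf i)")
    case True then show ?thesis unfolding J_bounded_def by blast
  next
    case False then show ?thesis by (intro exI[of _ "{}"]) simp
  qed
  then obtain Ff where Ff: "\<And>i. compact (Ff i) \<and> Ff i \<subseteq> Y \<and> (J_bounded J \<phi> Y (Uf i) \<longrightarrow> Uf i \<subseteq> translates J \<phi> (Ff i))" by metis
  let ?PK = "L1 \<union> (\<Union>i\<in>I. L i) \<union> (\<Union>i\<in>I. Ff i)"
  have "compact (\<Union>i\<in>I. L i)" "compact (\<Union>i\<in>I. Ff i)" using I(1) WI(7) Ff by (blast intro: compact_UN)+
  then have PK1: "compact ?PK" using O1(6) by (intro compact_Un)
  have "(\<Union>i\<in>I. L i) \<subseteq> Y" "(\<Union>i\<in>I. Ff i) \<subseteq> Y" using WI(8) Ff by blast+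
  then have PK: "compact ?PK" "?PK \<subseteq> Y" using PK1 O1(7) by blast+
  obtain P LP where P: "openin (top_of_set Y) P" "path_connected P" "?PK \<subseteq> P" "base \<in> P" "P \<subseteq> LP" "compact LP" "LP \<subseteq> Y"
    by (rule connected_nbhd[OF PK base])
  have OhP: "Oh \<subseteq> translates J \<phi> P"
  proof -
    have "Ob \<subseteq> translates J \<phi> P" unfolding Ob_def by (rule translates_mono) (use O1(5) P(3) in blast)
    moreover have "\<phi> g ` W i \<subseteq> translates J \<phi> P" if "g \<in> carrier J" "i \<in> I" for g i
    proof -
      have "W i \<subseteq> P" using WI(6)[OF that(2)] P(3) that(2) by blast
      then show ?thesis using that(1) unfolding translates_def by blast
    qed
    ultimately show ?thesis unfolding Oh_def XX_def by blast
  qed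
  have move: "\<phi> g ` C \<subseteq> U'" if g: "g \<in> carrier J" and C: "connected C" "C \<subseteq> Ah" and U': "U' \<in> components Ah" "\<phi> g ` C \<inter> U' \<noteq> {}" for g C U'
  proof (rule components_maximal[OF U'(1) _ _ _])
    have "C \<subseteq> Y" using C(2) openin_imp_subset[OF Aho] by blast
    then show "connected (\<phi> g ` C)" by (intro connected_continuous_image[OF continuous_on_subset[OF act_cont[OF g]] C(1)])
    show "\<phi> g ` C \<subseteq> Ah" using Ahinv[OF g] C(2) by blast
    show "U' \<inter> \<phi> g ` C \<noteq> {}" using U'(2) by blast
  qed
  have bounded_comp: "U \<subseteq> translates J \<phi> P" if U: "U \<in> components Ah" and b: "J_bounded J \<phi> Y U" for U
  proof -
    have "Oh \<noteq> {}" using bO[OF J.one_closed] by (auto simp: Oh_def)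
    then have "U \<inter> Oh \<noteq> {}" by (rule component_meets[OF Oho _ Aho cover U])
    then obtain x where "x \<in> U" "x \<in> XX" using inter in_components_subset[OF U] by blast
    then obtain g i w where g: "g \<in> carrier J" "i \<in> I" "w \<in> W i" "\<phi> g w \<in> U" unfolding XX_def by blast
    note Ui = Uf[OF g(2), THEN conjunct1] and Wi = Uf[OF g(2), THEN conjunct2]
    have UiY: "Uf i \<subseteq> Y" using in_components_subset[OF Ui] openin_imp_subset[OF Aho] by blast
    have UY: "U \<subseteq> Y" using in_components_subset[OF U] openin_imp_subset[OF Aho] by blast
    have gi: "inv g \<in> carrier J" using g(1) by simp
    have s1: "\<phi> g ` Uf i \<subseteq> U"
      by (rule move[OF g(1) in_components_connected[OF Ui] in_components_subset[OF Ui] U]) (use g Wi in blast)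
    have wY: "w \<in> Y" using g(3) WI(4)[OF g(2)] by blast
    have "\<phi> (inv g) (\<phi> g w) = w" by (rule act_inv[OF g(1) wY])
    then have "w \<in> \<phi> (inv g) ` U" using g(4) by (metis imageI)
    then have s2: "\<phi> (inv g) ` U \<subseteq> Uf i"
      by (intro move[OF gi in_components_connected[OF U] in_components_subset[OF U] Ui]) (use g(3) Wi in blast)
    have "J_bounded J \<phi> Y (Uf i)"
    proof -
      obtain DU where DU: "compact DU" "DU \<subseteq> Y" "U \<subseteq> translates J \<phi> DU" using b unfolding J_bounded_def by blast
      have "Uf i \<subseteq> translates J \<phi> DU"
      proof
        fix x assume x: "x \<in> Uf i"
        then have "\<phi> g x \<in> translates J \<phi> DU" using s1 DU(3) by blast
        then have "\<phi> (inv g) (\<phi> g x) \<in> translates J \<phi> DU" by (rule translates_invariant[OF gi DU(2)])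
        moreover have "\<phi> (inv g) (\<phi> g x) = x" using act_inv[OF g(1)] UiY x by blast
        ultimately show "x \<in> translates J \<phi> DU" by simp
      qed
      then show ?thesis using DU unfolding J_bounded_def by blast
    qed
    then have UF: "Uf i \<subseteq> translates J \<phi> (Ff i)" using Ff by blast
    have FP: "translates J \<phi> (Ff i) \<subseteq> translates J \<phi> P" by (rule translates_mono) (use P(3) g(2) in blast)
    have PY: "P \<subseteq> Y" using P by blast
    show ?thesis
    proof
      fix x assume x: "x \<in> U"
      then have "\<phi> (inv g) x \<in> translates J \<phi> P" using s2 UF FP by blast
      then have "\<phi> g (\<phi> (inv g) x) \<in> translates J \<phi> P" by (rule translates_invariant[OF g(1) PY])
      moreover have "\<phi> g (\<phi> (inv g) x) = x" using act_inv'[OF g(1)] UY x by blast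
      ultimately show "x \<in> translates J \<phi> P" by simp
    qed
  qed
  have co_semi: "co_semistable_wrt_ray Y U r C0"
    if U: "U \<in> components Ah" "\<not> J_bounded J \<phi> Y U" and r: "proper_ray Y r" "r ` {0..} \<subseteq> U" "J_bounded J \<phi> Y (r ` {0..})" for U r
  proof -
    have "U \<subseteq> Y - ?TC" using in_components_subset[OF U(1)] AhC by blast
    then obtain U' where U': "U' \<in> components (Y - ?TC)" "U \<subseteq> U'"
      using exists_component_superset[OF _ _ in_components_connected[OF U(1)]] in_components_nonempty[OF U(1)] by blast
    have "\<not> J_bounded J \<phi> Y U'" using U(2) U'(2) unfolding J_bounded_def by blast
    then have "co_semistable_wrt_ray Y U' r C0" using co[OF U'(1) _ r(1) _ r(3)] r(2) U'(2) by blast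
    note cU = this[unfolded co_semistable_wrt_ray_def, rule_format]
    show ?thesis
      unfolding co_semistable_wrt_ray_def
    proof (intro allI impI, elim conjE)
      fix D \<alpha>
      assume h: "compact D" "D \<subseteq> Y" "path \<alpha>" "path_image \<alpha> \<subseteq> U" "pathstart \<alpha> = r 0" "pathfinish \<alpha> = r 0"
      have "path_image \<alpha> \<subseteq> U'" using h(4) U'(2) by blast
      with h show "\<exists>n\<ge>0. \<exists>H. continuous_on ({0..1} \<times> {0..n}) H \<and> H ` ({0..1} \<times> {0..n}) \<subseteq> Q \<and>
           (\<forall>t\<in>{0..1}. H (t, 0) = \<alpha> t) \<and> (\<forall>s\<in>{0..n}. H (0, s) = r s \<and> H (1, s) = r s) \<and>
           (\<forall>t\<in>{0..1}. H (t, n) \<in> Y - D)"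
        by (intro cU conjI)
    qed
  qed
  interpret collar Y J \<phi> base S z C0 Cs P LP I W L Oh Ah
  proof unfold_locales
    show "openin (top_of_set Y) P" "path_connected P" "base \<in> P" "P \<subseteq> LP" "compact LP" "LP \<subseteq> Y" using P by auto
    show "one_ended Y" by (rule one)
    show "finite I" by (rule I(1))
    show "openin (top_of_set Y) (W i) \<and> path_connected (W i) \<and> W i \<noteq> {} \<and> W i \<subseteq> L i" if "i \<in> I" for i
      using WI[OF that] by blast
    show "compact (L i) \<and> L i \<subseteq> Y" if "i \<in> I" for i using WI[OF that] by blast
    show "openin (top_of_set Y) Oh" by (rule Oho)
    show "path_connected Oh" by (rule Ohc)
    show "Oh \<subseteq> translates J \<phi> P" by (rule OhP)
    show "vtx g \<in> Oh" if "g \<in> carrier J" for g using bO[OF that] by (simp add: Oh_def)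
    show "openin (top_of_set Y) Ah" by (rule Aho)
    show "Oh \<union> Ah = Y" by (rule cover)
    show "Oh \<inter> Ah = (\<Union>g\<in>carrier J. \<Union>i\<in>I. \<phi> g ` W i)" unfolding inter XX_def ..
  qed (rule bounded_comp co_semi; assumption)+
  show thesis by (rule collar_pushes[OF that])
qed

end

section \<open>Assembling the proper homotopy\<close>

context nice_space
begin

lemma properly_homotopic_of_squares:
  fixes \<tau> :: "nat \<Rightarrow> real" and G :: "nat \<Rightarrow> real \<times> real \<Rightarrow> 'a"
  assumes \<tau>: "\<tau> 0 = 0" "\<And>j. \<tau> j + 1 \<le> \<tau> (Suc j)"
    and G: "\<And>j. continuous_on ({0..1} \<times> {0..1}) (G j)" "\<And>j. G j ` ({0..1} \<times> {0..1}) \<subseteq> Y"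
    and bottom: "\<And>j t. t \<in> {0..1} \<Longrightarrow> G j (t,0) = piece (\<tau> j) (\<tau> (Suc j)) r t"
    and top: "\<And>j t. t \<in> {0..1} \<Longrightarrow> G j (t,1) = piece (\<tau> j) (\<tau> (Suc j)) s t"
    and match: "\<And>j u. u \<in> {0..1} \<Longrightarrow> G j (1,u) = G (Suc j) (0,u)"
    and escape: "\<And>D. compact D \<Longrightarrow> D \<subseteq> Y \<Longrightarrow> \<exists>m. \<forall>j\<ge>m. G j ` ({0..1} \<times> {0..1}) \<inter> D = {}"
  shows "properly_homotopic_rays Y r s"
proof -
  have mono: "\<tau> i \<le> \<tau> j" if "i \<le> j" for i j
    by (rule lift_Suc_mono_le[OF _ that]) (use \<tau>(2) order_trans[of _ "\<tau> _ + 1"] in \<open>smt (verit)\<close>)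
  have large: "real j \<le> \<tau> j" for j
  proof (induction j)
    case (Suc j) then show ?case using \<tau>(2)[of j] by simp
  qed (use \<tau>(1) in simp)
  define q where "q j x = (x - \<tau> j) / (\<tau> (Suc j) - \<tau> j)" for j x
  have pos: "0 < \<tau> (Suc j) - \<tau> j" for j using \<tau>(2)[of j] by simp
  have q01: "q j x \<in> {0..1}" if "\<tau> j \<le> x" "x \<le> \<tau> (Suc j)" for j x
    using that pos[of j] by (simp add: q_def divide_simps)
  have q0: "q j (\<tau> j) = 0" and q1: "q j (\<tau> (Suc j)) = 1" for j using pos[of j] by (auto simp: q_def)
  have lq: "linepath (\<tau> j) (\<tau> (Suc j)) (q j x) = x" for j x
  proof -
    have "linepath (\<tau> j) (\<tau> (Suc j)) (q j x) = \<tau> j + q j x * (\<tau> (Suc j) - \<tau> j)" by (simp add: linepath_def algebra_simps)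
    also have "\<dots> = x" using pos[of j] by (simp add: q_def)
    finally show ?thesis .
  qed
  \<comment> \<open>At a common boundary of two squares, \<open>ix\<close> selects the left one.\<close>
  define ix where "ix x = (LEAST j. x \<le> \<tau> (Suc j))" for x
  define H where "H xu = G (ix (fst xu)) (q (ix (fst xu)) (fst xu), snd xu)" for xu :: "real \<times> real"
  have ix: "x \<le> \<tau> (Suc (ix x))" "\<tau> (ix x) \<le> x" if x: "x \<ge> 0" for x
  proof -
    obtain n where "x \<le> real n" using real_arch_simple by blast
    then have "x \<le> \<tau> (Suc n)" using large[of n] mono[of n "Suc n"] by linarith
    then show "x \<le> \<tau> (Suc (ix x))" unfolding ix_def by (rule LeastI)
    show "\<tau> (ix x) \<le> x"
    proof (cases "ix x")
      case 0 then show ?thesis using \<tau>(1) x by simp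
    next
      case (Suc k)
      then have "\<not> x \<le> \<tau> (Suc k)" using not_less_Least[of k "\<lambda>j. x \<le> \<tau> (Suc j)"] unfolding ix_def by simp
      then show ?thesis using Suc by simp
    qed
  qed
  have H: "H (x,u) = G j (q j x, u)" if x: "\<tau> j \<le> x" "x \<le> \<tau> (Suc j)" and u: "u \<in> {0..1}" for j x u
  proof -
    have x0: "x \<ge> 0" using x(1) mono[of 0 j] \<tau>(1) by simp
    have le: "ix x \<le> j" unfolding ix_def by (rule Least_le) (rule x(2))
    show ?thesis
    proof (cases "ix x = j")
      case True then show ?thesis by (simp add: H_def)
    next
      case False
      then obtain k where k: "j = Suc k" "ix x \<le> k" using le by (cases j) auto
      have "x \<le> \<tau> (Suc k)" using ix(1)[OF x0] mono[of "Suc (ix x)" "Suc k"] k(2) by simp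
      then have xe: "x = \<tau> (Suc k)" using x(1) k(1) by simp
      have "\<not> ix x < k"
      proof
        assume "ix x < k"
        then have "x \<le> \<tau> k" using ix(1)[OF x0] mono[of "Suc (ix x)" k] by simp
        then show False using xe pos[of k] by simp
      qed
      then have "ix x = k" using k(2) by simp
      then have "H (x,u) = G k (1,u)" using q1[of k] xe by (simp add: H_def)
      also have "\<dots> = G j (0,u)" using match[OF u] k(1) by simp
      also have "\<dots> = G j (q j x, u)" using q0[of j] xe k(1) by simp
      finally show ?thesis .
    qed
  qed
  let ?Q = "{0::real..} \<times> {0..1::real}" and ?I = "{0..1::real} \<times> {0..1::real}"
  have cont: "continuous_on ?Q H"
  proof -
    have "continuous_map (top_of_set ?Q) euclidean H"
    proof (rule pasting_lemma_locally_finite[where I = UNIV and T = "\<lambda>j. {\<tau> j..\<tau> (Suc j)} \<times> {0..1}" and f = "\<lambda>j xu. G j (q j (fst xu), snd xu)"])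
      fix xu :: "real \<times> real" assume "xu \<in> topspace (top_of_set ?Q)"
      then obtain x u where xu: "xu = (x,u)" "x \<ge> 0" "u \<in> {0..1}" by auto
      obtain n where n: "x + 1 \<le> real n" using real_arch_simple by blast
      let ?V = "?Q \<inter> ({..<x+1} \<times> UNIV)"
      have "{i \<in> UNIV. {\<tau> i..\<tau> (Suc i)} \<times> {0..1} \<inter> ?V \<noteq> {}} \<subseteq> {..n}"
      proof
        fix i assume "i \<in> {i \<in> UNIV. {\<tau> i..\<tau> (Suc i)} \<times> {0..1} \<inter> ?V \<noteq> {}}"
        then obtain y where "\<tau> i \<le> y" "y < x + 1" by auto
        then have "real i < real n" using large[of i] n by linarith
        then show "i \<in> {..n}" by simp
      qed
      then have "finite {i \<in> UNIV. {\<tau> i..\<tau> (Suc i)} \<times> {0..1} \<inter> ?V \<noteq> {}}" using finite_subset by blast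
      moreover have "openin (top_of_set ?Q) ?V" by (intro openin_open_Int open_Times) simp_all
      ultimately show "\<exists>V. openin (top_of_set ?Q) V \<and> xu \<in> V \<and> finite {i \<in> UNIV. {\<tau> i..\<tau> (Suc i)} \<times> {0..1} \<inter> V \<noteq> {}}"
        using xu by (intro exI[of _ ?V]) simp
      show "\<exists>j. j \<in> UNIV \<and> xu \<in> {\<tau> j..\<tau> (Suc j)} \<times> {0..1} \<and> H xu = G j (q j (fst xu), snd xu)"
        using xu ix[OF xu(2)] H[OF ix(2,1)[OF xu(2)] xu(3)] by (intro exI[of _ "ix x"]) simp
    next
      fix j
      have "0 \<le> \<tau> j" using mono[of 0 j] \<tau>(1) by simp
      then have sub: "{\<tau> j..\<tau> (Suc j)} \<times> {0..1} \<subseteq> ?Q" by auto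
      show "closedin (top_of_set ?Q) ({\<tau> j..\<tau> (Suc j)} \<times> {0..1})"
        by (rule closed_subset[OF sub]) (simp add: closed_Times)
      have "continuous_on ({\<tau> j..\<tau> (Suc j)} \<times> {0..1}) (\<lambda>xu. G j (q j (fst xu), snd xu))"
      proof (rule continuous_on_compose2[OF G(1)])
        show "continuous_on ({\<tau> j..\<tau> (Suc j)} \<times> {0..1}) (\<lambda>xu. (q j (fst xu), snd xu))"
          unfolding q_def using pos[of j] by (auto intro!: continuous_intros)
        show "(\<lambda>xu. (q j (fst xu), snd xu)) ` ({\<tau> j..\<tau> (Suc j)} \<times> {0..1}) \<subseteq> ?I" using q01[of j] by auto
      qed
      moreover have "?Q \<inter> ({\<tau> j..\<tau> (Suc j)} \<times> {0..1}) = {\<tau> j..\<tau> (Suc j)} \<times> {0..1}" using sub by blast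
      ultimately show "continuous_map (subtopology (top_of_set ?Q) ({\<tau> j..\<tau> (Suc j)} \<times> {0..1})) euclidean (\<lambda>xu. G j (q j (fst xu), snd xu))"
        by (simp add: subtopology_subtopology)
    next
      fix i j xu assume "xu \<in> topspace (top_of_set ?Q) \<inter> {\<tau> i..\<tau> (Suc i)} \<times> {0..1} \<inter> {\<tau> j..\<tau> (Suc j)} \<times> {0..1}"
      then obtain x u where "xu = (x,u)" "\<tau> i \<le> x" "x \<le> \<tau> (Suc i)" "\<tau> j \<le> x" "x \<le> \<tau> (Suc j)" "u \<in> {0..1}" by auto
      then show "G i (q i (fst xu), snd xu) = G j (q j (fst xu), snd xu)" using H[of i x u] H[of j x u] by simp
    qed
    then show ?thesis by simp
  qed
  have HG: "H xu \<in> G (ix (fst xu)) ` ?I" if "xu \<in> ?Q" for xu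
  proof -
    have "(q (ix (fst xu)) (fst xu), snd xu) \<in> ?I" using that q01[OF ix(2,1), of "fst xu"] by auto
    then show ?thesis unfolding H_def by blast
  qed
  have im: "H ` ?Q \<subseteq> Y" using HG G(2) by blast
  have "proper_map (top_of_set ?Q) (top_of_set Y) H"
  proof (rule proper_mapI[OF _ cont im])
    show "closed ?Q" by (intro closed_Times closed_atLeast closed_atLeastAtMost)
    fix D assume D: "compact D" "D \<subseteq> Y"
    obtain m where m: "\<forall>j\<ge>m. G j ` ?I \<inter> D = {}" using escape[OF D] by blast
    have "{xu \<in> ?Q. H xu \<in> D} \<subseteq> {0..\<tau> m} \<times> {0..1}"
    proof
      fix xu assume xu: "xu \<in> {xu \<in> ?Q. H xu \<in> D}"
      then have "\<not> m \<le> ix (fst xu)" using HG[of xu] m by blast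
      then have "\<tau> (Suc (ix (fst xu))) \<le> \<tau> m" by (intro mono) simp
      moreover have "fst xu \<le> \<tau> (Suc (ix (fst xu)))" by (rule ix(1)) (use xu in auto)
      ultimately show "xu \<in> {0..\<tau> m} \<times> {0..1}" using xu by auto
    qed
    then show "bounded {xu \<in> ?Q. H xu \<in> D}" using bounded_Times[OF bounded_closed_interval bounded_closed_interval] bounded_subset by blast
  qed
  moreover have "continuous_map (top_of_set ?Q) (top_of_set Y) H" using cont im by (simp add: image_subset_iff_funcset)
  moreover have "H (t,0) = r t \<and> H (t,1) = s t" if t: "t \<ge> 0" for t
  proof -
    have qt: "q (ix t) t \<in> {0..1}" by (rule q01[OF ix(2,1)[OF t]])
    have "H (t,0) = r t" using bottom[OF qt, of "ix t"] lq[of "ix t" t] by (simp add: H_def piece_def)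
    moreover have "H (t,1) = s t" using top[OF qt, of "ix t"] lq[of "ix t" t] by (simp add: H_def piece_def)
    ultimately show ?thesis ..
  qed
  ultimately show ?thesis unfolding properly_homotopic_rays_def by blast
qed

lemma proper_ray_shift: 
  assumes "proper_ray Y r" "a \<ge> 0" shows "proper_ray Y (\<lambda>t. r (a + t))"
proof (rule proper_rayI)
  show "continuous_on {0..} (\<lambda>t. r (a + t))"
    by (rule continuous_on_compose2[OF proper_rayD(1)[OF assms(1)]]) (use assms(2) in \<open>auto intro!: continuous_intros\<close>)
  show "(\<lambda>t. r (a + t)) ` {0..} \<subseteq> Y" using proper_rayD(2)[OF assms(1)] assms(2) by auto
  fix D assume D: "compact D" "D \<subseteq> Y"
  obtain T where "T \<ge> 0" "\<forall>t\<ge>T. r t \<in> Y - D" using proper_rayD(3)[OF assms(1) D] by blast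
  then show "\<exists>T. \<forall>t\<ge>T. r (a + t) \<notin> D" using assms(2) by (intro exI[of _ T]) auto
qed

lemma piece_shift: "piece 0 n (\<lambda>t. r (a + t)) = piece a (a + n) r"
  by (auto simp: piece_def linepath_def fun_eq_iff algebra_simps)

text \<open>The rung number \<open>i\<close> and the rays beyond it lie outside a set \<open>D i\<close> that allows pushing off \<open>K i\<close>. Pushing the rung out of
  \<open>D (Suc i)\<close> gives the next rung and a square off \<open>K i\<close>. The first rung exists because there is one end, and it is joined to the
  start of the rays by a square because \<open>Y\<close> is simply connected.\<close>

lemma semistable_of_pushes:
  assumes one: "one_ended Y"
    and pushes: "\<And>C. compact C \<Longrightarrow> C \<noteq> {} \<Longrightarrow> C \<subseteq> Y \<Longrightarrow> \<exists>D. compact D \<and> D \<subseteq> Y \<and> pushes Y C D"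
  shows "semistable_fundamental_group_at_infinity Y"
  unfolding semistable_fundamental_group_at_infinity_def
proof (intro allI impI, elim conjE)
  fix r s assume r: "proper_ray Y r" and s: "proper_ray Y s"
  have rY: "r t \<in> Y" and sY: "s t \<in> Y" if "t \<ge> 0" for t using proper_rayD(2)[OF r] proper_rayD(2)[OF s] that by auto
  then have "Y \<noteq> {}" by (metis empty_iff order_refl)
  then obtain K :: "nat \<Rightarrow> 'a set" where K: "\<forall>n. compact (K n) \<and> K n \<noteq> {} \<and> K n \<subseteq> Y \<and>
          (\<exists>V. openin (top_of_set Y) V \<and> K n \<subseteq> V \<and> V \<subseteq> K (Suc n))" "(\<Union>n. K n) = Y"
    using exhaustion by blast
  have Kmono: "K i \<subseteq> K j" if "i \<le> j" for i j by (rule lift_Suc_mono_le[OF _ that]) (use K(1) in blast)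
  have exh: "\<exists>m. \<forall>j\<ge>m. D \<subseteq> K j" if D: "compact D" "D \<subseteq> Y" for D
  proof -
    have "\<exists>V n. openin (top_of_set Y) V \<and> y \<in> V \<and> V \<subseteq> K n" if y: "y \<in> D" for y
    proof -
      obtain n where "y \<in> K n" using K(2) D(2) y by blast
      then show ?thesis using K(1) by (meson subsetD)
    qed
    then obtain V N where V: "\<And>y. y \<in> D \<Longrightarrow> openin (top_of_set Y) (V y) \<and> y \<in> V y \<and> V y \<subseteq> K (N y)" by metis
    have Vo: "openin (top_of_set Y) (V y) \<and> y \<in> V y" if "y \<in> D" for y using V[OF that] by blast
    obtain A where A: "finite A" "A \<subseteq> D" "D \<subseteq> (\<Union>y\<in>A. V y)" by (rule finite_open_cover[OF D Vo])
    have "D \<subseteq> K j" if j: "j \<ge> Max (insert 0 (N ` A))" for j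
    proof
      fix x assume "x \<in> D"
      then obtain y where y: "y \<in> A" "x \<in> V y" using A(3) by blast
      then have "N y \<le> j" using j A(1) by (meson Max_ge finite_imageI finite_insert imageI insertI2 order_trans)
      then show "x \<in> K j" using V[of y] A(2) y Kmono[of "N y" j] by blast
    qed
    then show ?thesis by blast
  qed
  have "\<exists>D. compact D \<and> D \<subseteq> Y \<and> pushes Y (K n) D" for n by (rule pushes) (use K(1) in auto)
  then obtain D where D: "\<And>n. compact (D n) \<and> D n \<subseteq> Y \<and> pushes Y (K n) (D n)" by metis
  have far: "\<exists>T\<ge>0. \<forall>t\<ge>T. r t \<in> Y - C \<and> s t \<in> Y - C" if C: "compact C" "C \<subseteq> Y" for C
  proof -
    obtain T1 where T1: "T1 \<ge> 0" "\<forall>t\<ge>T1. r t \<in> Y - C" using proper_rayD(3)[OF r C] by blast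
    obtain T2 where T2: "T2 \<ge> 0" "\<forall>t\<ge>T2. s t \<in> Y - C" using proper_rayD(3)[OF s C] by blast
    show ?thesis by (rule exI[of _ "max T1 T2"]) (use T1 T2 in auto)
  qed
  define st :: "nat \<Rightarrow> real \<times> (real \<Rightarrow> 'a) \<Rightarrow> bool" where
    "st i x \<longleftrightarrow> 1 \<le> fst x \<and> (\<forall>t\<ge>fst x. r t \<in> Y - D i \<and> s t \<in> Y - D i) \<and> path_in (Y - D i) (snd x) (r (fst x)) (s (fst x))" for i x
  define lk :: "nat \<Rightarrow> real \<times> (real \<Rightarrow> 'a) \<Rightarrow> real \<times> (real \<Rightarrow> 'a) \<Rightarrow> bool" where
    "lk i x y \<longleftrightarrow> fst x + 1 \<le> fst y \<and> homotopic_paths (Y - K i) (snd x +++ piece (fst x) (fst y) s) (piece (fst x) (fst y) r +++ snd y)" for i x y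
  have ex0: "\<exists>x. st 0 x"
  proof -
    have D0: "compact (D 0)" "D 0 \<subseteq> Y" using D by auto
    obtain W K' where W: "W \<in> components (Y - D 0)" "compact K'" "K' \<subseteq> Y" "D 0 \<subseteq> K'" "Y - K' \<subseteq> W"
      by (rule outside_one_component[OF one D0])
    have pW: "path_connected W" by (rule component_open(2)[OF closed_compl_open[OF D0(1)] W(1)])
    have WD: "W \<subseteq> Y - D 0" by (rule in_components_subset[OF W(1)])
    obtain T where T: "T \<ge> 0" "\<forall>t\<ge>T. r t \<in> Y - K' \<and> s t \<in> Y - K'" using far[OF W(2,3)] by blast
    let ?n = "max 1 T"
    have "r ?n \<in> W" "s ?n \<in> W" using T(2)[rule_format, of ?n] W(5) by auto
    then obtain \<delta> where "path_in W \<delta> (r ?n) (s ?n)" using path_connected_path_in[OF pW] by blast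
    then have "path_in (Y - D 0) \<delta> (r ?n) (s ?n)" using path_in_mono WD by blast
    moreover have "r t \<in> Y - D 0 \<and> s t \<in> Y - D 0" if "t \<ge> ?n" for t using T(2)[rule_format, of t] W(4) that by auto
    ultimately have "st 0 (?n, \<delta>)" by (simp add: st_def)
    then show ?thesis by blast
  qed
  have exS: "\<exists>y. st (Suc i) y \<and> lk i x y" if x: "st i x" for x i
  proof -
    obtain a \<delta> where a: "x = (a,\<delta>)" by (cases x)
    have h: "1 \<le> a" "\<forall>t\<ge>a. r t \<in> Y - D i \<and> s t \<in> Y - D i" "path_in (Y - D i) \<delta> (r a) (s a)" using x by (auto simp: st_def a)
    have DS: "compact (D (Suc i))" "D (Suc i) \<subseteq> Y" using D by auto
    obtain T where T: "T \<ge> 0" "\<forall>t\<ge>T. r t \<in> Y - D (Suc i) \<and> s t \<in> Y - D (Suc i)" using far[OF DS] by blast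
    let ?r = "\<lambda>t. r (a + t)" and ?s = "\<lambda>t. s (a + t)"
    have "proper_ray Y ?r" "proper_ray Y ?s" using proper_ray_shift r s h(1) by auto
    moreover have "?r ` {0..} \<subseteq> Y - D i" "?s ` {0..} \<subseteq> Y - D i" using h(2) by auto
    moreover have "path_in (Y - D i) \<delta> (?r 0) (?s 0)" using h(3) by simp
    moreover have "pushes Y (K i) (D i)" using D by blast
    ultimately obtain n \<delta>' where n: "n \<ge> max 1 T" "path_in (Y - D (Suc i)) \<delta>' (?r n) (?s n)"
        "homotopic_paths (Y - K i) (\<delta> +++ piece 0 n ?s) (piece 0 n ?r +++ \<delta>')"
      using DS unfolding pushes_def by meson
    have "st (Suc i) (a + n, \<delta>')" using n(1,2) h(1) T by (simp add: st_def)
    moreover have "lk i x (a + n, \<delta>')" using n(1,3) unfolding lk_def a piece_shift by simp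
    ultimately show ?thesis by blast
  qed
  obtain X where X: "\<And>i. st i (X i)" "\<And>i. lk i (X i) (X (Suc i))"
    using dependent_nat_choice[of st lk, OF ex0 exS] by metis
  define \<tau> where "\<tau> = case_nat 0 (\<lambda>i. fst (X i))"
  have \<tau>0: "\<tau> 0 = 0" and \<tau>S: "\<tau> (Suc i) = fst (X i)" for i by (simp_all add: \<tau>_def)
  have step: "\<tau> j + 1 \<le> \<tau> (Suc j)" for j
  proof (cases j)
    case 0 then show ?thesis using X(1)[of 0] by (simp add: \<tau>0 \<tau>S st_def)
  next
    case (Suc k) then show ?thesis using X(2)[of k] by (simp add: \<tau>S lk_def)
  qed
  obtain \<alpha> where \<alpha>: "path_in Y \<alpha> (r 0) (s 0)" by (rule simply_connected_path[OF simply_conn rY[OF order_refl] sY[OF order_refl]])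
  define \<delta> where "\<delta> = case_nat \<alpha> (\<lambda>i. snd (X i))"
  define K' where "K' = case_nat {} K"
  have pr: "path_in Y (piece a b r) (r a) (r b)" "path_in Y (piece a b s) (s a) (s b)" if "0 \<le> a" "a \<le> b" for a b
    by (rule path_in_piece[of "{0..}"]; use that proper_rayD(1,2)[OF r] proper_rayD(1,2)[OF s] in auto)+
  have tpos: "0 \<le> \<tau> j" for j
  proof (induction j)
    case (Suc j) then show ?case using step[of j] by simp
  qed (simp add: \<tau>0)
  have \<delta>p: "path_in Y (\<delta> j) (r (\<tau> j)) (s (\<tau> j))" for j
  proof (cases j)
    case 0 then show ?thesis using \<alpha> by (simp add: \<tau>0 \<delta>_def)
  next
    case (Suc k)
    have "path_in (Y - D k) (snd (X k)) (r (fst (X k))) (s (fst (X k)))" using X(1)[of k] by (simp add: st_def)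
    then show ?thesis using Suc path_in_mono by (simp add: \<tau>S \<delta>_def) blast
  qed
  have hom: "homotopic_paths (Y - K' j) (\<delta> j +++ piece (\<tau> j) (\<tau> (Suc j)) s) (piece (\<tau> j) (\<tau> (Suc j)) r +++ \<delta> (Suc j))" for j
  proof (cases j)
    case 0
    have le: "0 \<le> \<tau> 0" "\<tau> 0 \<le> \<tau> 1" using step[of 0] \<tau>0 by auto
    have 1: "path_in Y (\<delta> 0 +++ piece (\<tau> 0) (\<tau> 1) s) (r (\<tau> 0)) (s (\<tau> 1))" by (rule path_in_join[OF \<delta>p pr(2)[OF le]])
    have 2: "path_in Y (piece (\<tau> 0) (\<tau> 1) r +++ \<delta> 1) (r (\<tau> 0)) (s (\<tau> 1))" by (rule path_in_join[OF pr(1)[OF le] \<delta>p])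
    have "homotopic_paths Y (\<delta> 0 +++ piece (\<tau> 0) (\<tau> 1) s) (piece (\<tau> 0) (\<tau> 1) r +++ \<delta> 1)"
      by (rule hom_of_loop[OF 1 2 simply_connected_null[OF simply_conn path_in_join[OF 1 path_in_rev[OF 2]]]])
    then show ?thesis using 0 by (simp add: K'_def)
  next
    case (Suc k)
    then show ?thesis using X(2)[of k] by (simp add: \<tau>S \<delta>_def K'_def lk_def)
  qed
  have "\<exists>G. continuous_on ({0..1} \<times> {0..1}) G \<and> G ` ({0..1} \<times> {0..1}) \<subseteq> Y - K' j \<and>
      (\<forall>t\<in>{0..1}. G (t,0) = piece (\<tau> j) (\<tau> (Suc j)) r t \<and> G (t,1) = piece (\<tau> j) (\<tau> (Suc j)) s t) \<and>
      (\<forall>u\<in>{0..1}. G (0,u) = \<delta> j u \<and> G (1,u) = \<delta> (Suc j) u)" for j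
  proof -
    have le: "0 \<le> \<tau> j" "\<tau> j \<le> \<tau> (Suc j)" using tpos[of j] step[of j] by auto
    have 1: "pathfinish (\<delta> j) = pathstart (piece (\<tau> j) (\<tau> (Suc j)) s)" using \<delta>p[of j] pr(2)[OF le] by (simp add: path_in_def)
    have 2: "pathfinish (piece (\<tau> j) (\<tau> (Suc j)) r) = pathstart (\<delta> (Suc j))" using \<delta>p[of "Suc j"] pr(1)[OF le] by (simp add: path_in_def)
    show ?thesis by (rule square_of_hom[OF hom 1 2]) blast
  qed
  then obtain G where G: "\<And>j. continuous_on ({0..1} \<times> {0..1}) (G j) \<and> G j ` ({0..1} \<times> {0..1}) \<subseteq> Y - K' j \<and>
      (\<forall>t\<in>{0..1}. G j (t,0) = piece (\<tau> j) (\<tau> (Suc j)) r t \<and> G j (t,1) = piece (\<tau> j) (\<tau> (Suc j)) s t) \<and>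
      (\<forall>u\<in>{0..1}. G j (0,u) = \<delta> j u \<and> G j (1,u) = \<delta> (Suc j) u)" by metis
  show "properly_homotopic_rays Y r s"
  proof (rule properly_homotopic_of_squares[OF \<tau>0 step, of G])
    show "G j ` ({0..1} \<times> {0..1}) \<subseteq> Y" for j using G[of j] by blast
    fix D' assume "compact D'" "D' \<subseteq> Y"
    then obtain m where m: "\<forall>j\<ge>m. D' \<subseteq> K j" using exh by blast
    have "G j ` ({0..1} \<times> {0..1}) \<inter> D' = {}" if j: "j \<ge> Suc m" for j
    proof -
      obtain k where "j = Suc k" "k \<ge> m" using j by (cases j) auto
      then have "D' \<subseteq> K' j" using m by (simp add: K'_def)
      moreover have "G j ` ({0..1} \<times> {0..1}) \<subseteq> Y - K' j" using G[of j] by blast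
      ultimately show ?thesis by blast
    qed
    then show "\<exists>m. \<forall>j\<ge>m. G j ` ({0..1} \<times> {0..1}) \<inter> D' = {}" by blast
  qed (use G in auto)
qed

end

section \<open>Group actions on CW complexes\<close>

context CW
begin

lemma vertices_sub: "vertices E \<subseteq> Y"
  unfolding vertices_def Y_eq cell_index_def by force

lemma edge_path_path: "edge_path E k p \<Longrightarrow> path p \<and> path_image p \<subseteq> Y"
proof (induction rule: edge_path.induct)
  case (trivial v) then show ?case using vertices_sub by (auto simp: path_image_def path_def)
next
  case (edge p)
  then have p: "path p" "p 0 \<in> Y" "p 1 \<in> Y" using vertices_sub unfolding edge_traversal_def pathstart_def pathfinish_def by blast+
  obtain e where e: "e \<in> E 1" "homeomorphic_map (top_of_set {0<..<1}) (top_of_set e) p" using edge unfolding edge_traversal_def by blast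
  have "p ` {0<..<1} = e" using homeomorphic_imp_surjective_map[OF e(2)] by simp
  moreover have "e \<subseteq> Y" using e(1) unfolding Y_eq cell_index_def by force
  ultimately have "p ` {0<..<1} \<subseteq> Y" by simp
  moreover have "{0..1} = insert 0 (insert 1 {0<..<1::real})" by auto
  ultimately show ?case using p by (simp add: path_image_def)
next
  case (join k p l q) then show ?case using path_image_join_subset[of p q] by (auto intro: path_join_imp)
qed

lemma compact_finite_subcomplex: "finite_subcomplex E C \<Longrightarrow> compact C \<and> C \<subseteq> Y"
proof -
  assume "finite_subcomplex E C"
  then obtain F where F: "finite F" "F \<subseteq> cells E" "C = \<Union>F" "\<forall>e\<in>F. closure e \<subseteq> C" unfolding finite_subcomplex_def by blast
  have "C = (\<Union>e\<in>F. closure e)" using F(3,4) closure_subset by blast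
  moreover have "compact (closure e)" if e: "e \<in> F" for e
  proof -
    obtain n where n: "(n,e) \<in> cell_index" using e F(2) unfolding cells_def cell_index_def by auto
    have "closure e = closed_cell (n,e) \<inter> closure e" using closure_cell[OF n] by auto
    then show ?thesis using compact_Int_closed[OF compact_closed_cell[OF n] closed_closure, of e] by simp
  qed
  ultimately have "compact C" using F(1) by (simp add: compact_UN)
  moreover have "C \<subseteq> Y" using F(2,3) unfolding Y_eq cells_def cell_index_def by force
  ultimately show ?thesis by blast
qed

lemma pushes_of_group_action:
  assumes sc: "simply_connected Y" and one: "one_ended Y" and C0: "compact C0" "C0 \<subseteq> Y"
    and J: "infinite_fg_group J" "acts_by_covering_transformations J \<phi> Y" "cell_preserving J \<phi> E"
    and ss: "semistable_in J \<phi> Y E C0" and cs: "co_semistable_in J \<phi> Y E C0"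
  shows "\<exists>D. compact D \<and> D \<subseteq> Y \<and> pushes Y C0 D"
proof -
  obtain base S z C where b: "base \<in> vertices E" "finite_generating_set J S" "cayley_map J \<phi> E S base z" "compact C" "C \<subseteq> Y"
    and semi: "\<And>D r s. compact D \<Longrightarrow> D \<subseteq> Y \<Longrightarrow>
           proper_cayley_ray J S r \<Longrightarrow> proper_cayley_ray J S s \<Longrightarrow>
           cayley_source J (r 0) = cayley_source J (s 0) \<Longrightarrow>
           ray_image z r ` {0..} \<subseteq> Y - C \<Longrightarrow> ray_image z s ` {0..} \<subseteq> Y - C \<Longrightarrow>
           \<exists>a b \<delta>.
              0 \<le> a \<and> 0 \<le> b \<and> path \<delta> \<and> path_image \<delta> \<subseteq> Y - D \<and>
              pathstart \<delta> = ray_image z r a \<and> pathfinish \<delta> = ray_image z s b \<and>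
              homotopic_paths (Y - C0)
                (initial_segment (ray_image z r) a +++ \<delta> +++
                   reversepath (initial_segment (ray_image z s) b))
                (\<lambda>t. ray_image z r 0)"
    using ss unfolding semistable_in_def by metis
  obtain Cc where Cc: "finite_subcomplex E Cc" and co: "\<And>U r. U \<in> components (Y - translates J \<phi> Cc) \<and> \<not> J_bounded J \<phi> Y U \<and>
           proper_ray Y r \<and> r ` {0..} \<subseteq> U \<and> J_bounded J \<phi> Y (r ` {0..}) \<Longrightarrow> co_semistable_wrt_ray Y U r C0"
    using cs unfolding co_semistable_in_def by metis
  interpret nice_space Y by (rule nice[OF sc])
  interpret cayley_action Y J \<phi> base S z C0 "C \<union> C0"
  proof (intro cayley_action.intro proper_action.intro proper_action_axioms.intro cayley_action_axioms.intro)
    show "nice_space Y" by (rule nice[OF sc])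
    show "group_action J Y \<phi>" using J(2) by (simp add: acts_by_covering_transformations_def)
    show "homeomorphic_map (top_of_set Y) (top_of_set Y) (\<phi> g)" if "g \<in> carrier J" for g
      using J(2) that by (simp add: acts_by_covering_transformations_def)
    show "infinite (carrier J)" using J(1) by (simp add: infinite_fg_group_def)
    show "finite {g \<in> carrier J. \<phi> g ` K \<inter> K \<noteq> {}}" if "compact K" "K \<subseteq> Y" for K
      by (rule covering_action_properly_discontinuous[OF J(2,3) that])
    show "base \<in> Y" using b(1) vertices_sub by blast
    show "finite S" "S \<subseteq> carrier J" "generate J S = carrier J" using b(2) by (auto simp: finite_generating_set_def)
    show "path_in Y (z g s) (\<phi> g base) (\<phi> (g \<otimes>\<^bsub>J\<^esub> s) base)" if "g \<in> carrier J" "s \<in> S" for g s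
    proof -
      have "\<exists>K. \<forall>g\<in>carrier J. \<forall>s\<in>S. \<exists>k\<le>K. edge_path E k (z g s)" using b(3) by (simp add: cayley_map_def)
      with that have "\<exists>k. edge_path E k (z g s)" by blast
      then obtain k where "edge_path E k (z g s)" ..
      then have "path (z g s) \<and> path_image (z g s) \<subseteq> Y" by (rule edge_path_path)
      then show ?thesis using b(3) that unfolding cayley_map_def path_in_def by blast
    qed
    show "z (h \<otimes>\<^bsub>J\<^esub> g) s t = \<phi> h (z g s t)" if "h \<in> carrier J" "g \<in> carrier J" "s \<in> S" "t \<in> {0..1}" for h g s t
      using b(3) that unfolding cayley_map_def by blast
    show "C0 \<subseteq> C \<union> C0" by blast
    show "compact (C \<union> C0)" "C \<union> C0 \<subseteq> Y" using b C0 by auto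
    fix D r s
    assume h: "compact D" "D \<subseteq> Y" "proper_cayley_ray J S r" "proper_cayley_ray J S s"
           "cayley_source J (r 0) = cayley_source J (s 0)"
           "ray_image z r ` {0..} \<subseteq> Y - (C \<union> C0)" "ray_image z s ` {0..} \<subseteq> Y - (C \<union> C0)"
    have "ray_image z r ` {0..} \<subseteq> Y - C" "ray_image z s ` {0..} \<subseteq> Y - C" using h(6,7) by blast+
    from semi[OF h(1-5) this] show "\<exists>a b \<delta>.
              0 \<le> a \<and> 0 \<le> b \<and> path \<delta> \<and> path_image \<delta> \<subseteq> Y - D \<and>
              pathstart \<delta> = ray_image z r a \<and> pathfinish \<delta> = ray_image z s b \<and>
              homotopic_paths (Y - C0)
                (initial_segment (ray_image z r) a +++ \<delta> +++
                   reversepath (initial_segment (ray_image z s) b))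
                (\<lambda>t. ray_image z r 0)" .
  qed
  have Ccc: "compact Cc" "Cc \<subseteq> Y" using compact_finite_subcomplex[OF Cc] by auto
  have co': "co_semistable_wrt_ray Y U r C0" if "U \<in> components (Y - translates J \<phi> Cc)" "\<not> J_bounded J \<phi> Y U"
      "proper_ray Y r" "r ` {0..} \<subseteq> U" "J_bounded J \<phi> Y (r ` {0..})" for U r
    by (rule co) (intro conjI that)
  obtain D where "compact D" "D \<subseteq> Y" "pushes Y C0 D"
    by (rule co_semistable_pushes[OF one Ccc co'])
  then show ?thesis by blast
qed

end

theorem theorem3p1:
  fixes Y :: "'a::t2_space set"
  assumes "locally_finite_CW_complex Y"
    and "simply_connected Y"
    and "one_ended Y"
    and "\<And>C\<^sub>0. compact C\<^sub>0 \<Longrightarrow> C\<^sub>0 \<noteq> {} \<Longrightarrow> C\<^sub>0 \<subseteq> Y \<Longrightarrow>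
           \<exists>(J :: 'g monoid) \<phi> E.
             locally_finite_CW_structure Y E \<and>
             infinite_fg_group J \<and>
             acts_by_covering_transformations J \<phi> Y \<and>
             cell_preserving J \<phi> E \<and>
             semistable_in J \<phi> Y E C\<^sub>0 \<and>
             co_semistable_in J \<phi> Y E C\<^sub>0"
  shows "semistable_fundamental_group_at_infinity Y"
proof -
  obtain E where "locally_finite_CW_structure Y E" using assms(1) unfolding locally_finite_CW_complex_def by blast
  then interpret CW Y E by (rule CW.intro)
  interpret nice_space Y by (rule nice[OF assms(2)])
  show ?thesis
  proof (rule semistable_of_pushes[OF assms(3)])
    fix C assume C: "compact C" "C \<noteq> {}" "C \<subseteq> Y"
    from assms(4)[OF this] obtain J :: "'g monoid" and \<phi> E' where E': "locally_finite_CW_structure Y E'"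
      and J: "infinite_fg_group J" "acts_by_covering_transformations J \<phi> Y" "cell_preserving J \<phi> E'"
        "semistable_in J \<phi> Y E' C" "co_semistable_in J \<phi> Y E' C" by blast
    show "\<exists>D. compact D \<and> D \<subseteq> Y \<and> pushes Y C D"
      by (rule CW.pushes_of_group_action[OF CW.intro[OF E'] assms(2,3) C(1,3) J])
  qed
qed

end
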